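(* Let $n\ge 2$ and let $s,t,\kappa,\Lambda\in\mathbb R$ satisfy $s>\frac n2$, $t\ge 0$, $\kappa>-\frac{1}{2(n-1)}$ and $\Lambda>0$. Then for every $e\in H^{s+2,t}(\mathbb R^n,\mathcal S_2)$ close to zero there exists $h$ close to zero in $H^{s+2,t}(\mathbb R^n,\mathcal S_2)$ such that $$\operatorname{Ein}(\delta+h)=\operatorname{Ein}(\delta)+e,$$ and moreover the map $e\mapsto h$ is smooth near zero between the corresponding Hilbert spaces. Precisely: for every neighbourhood $V$ of $0$ in $H^{s+2,t}(\mathbb R^n,\mathcal S_2)$ there exist a neighbourhood $U$ of $0$ in $H^{s+2,t}(\mathbb R^n,\mathcal S_2)$ and a smooth map $U\to V$, $e\mapsto h_e$, such that for every $e\in U$ the tensor $\delta+h_e$ is a Riemannian metric on $\mathbb R^n$ and $\operatorname{Ein}(\delta+h_e)=\operatorname{Ein}(\delta)+e$.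
   Context: $\delta$ is the Euclidean metric on $\mathbb R^n$ and $\mathcal S_2$ denotes the symmetric covariant 2-tensors on $\mathbb R^n$. For a Riemannian metric $g$, $\operatorname{Ric}(g)$ is its Ricci curvature (in coordinates $\operatorname{Ric}(g)_{jk}=\partial_l\Gamma^l_{jk}-\partial_k\Gamma^l_{jl}+\Gamma^p_{jk}\Gamma^l_{pl}-\Gamma^p_{jl}\Gamma^l_{pk}$, with $\Gamma$ the Christoffel symbols), $R(g)$ its scalar curvature, and $$\operatorname{Ein}(g):=\operatorname{Ric}(g)+\kappa R(g)g+\Lambda g ,$$ where $\kappa,\Lambda$ are real constants; in particular $\operatorname{Ein}(\delta)=\Lambda\delta$. For $s\in\mathbb R$, $H^s(\mathbb R^n)=\{u\in\mathcal S'(\mathbb R^n): \langle\xi\rangle^s\hat u\in L^2(\mathbb R^n)\}$ with norm $\|u\|_s=\|\langle\xi\rangle^s\hat u\|_{L^2}$, where $\langle x\rangle=(1+|x|^2)^{1/2}$, $\mathcal S'(\mathbb R^n)$ is the space of tempered distributions and $\hat u$ is the Fourier transform. For $s,t\in\mathbb R$, $H^{s,t}(\mathbb R^n)=\{u\in\mathcal S'(\mathbb R^n): \langle x\rangle^t u\in H^s(\mathbb R^n)\}$ with norm $\|u\|_{s,t}=\|\langle x\rangle^t u\|_s$. $H^{s,t}(\mathbb R^n,\mathcal S_2)$ is the space of (real) symmetric 2-tensor fields whose components in the standard coordinates lie in $H^{s,t}(\mathbb R^n)$. *)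

theory Defs
  imports "HOL-Analysis.Analysis"
begin

definition pderivative :: "'n::finite \<Rightarrow> (real^'n \<Rightarrow> 'b::real_normed_vector) \<Rightarrow> real^'n \<Rightarrow> 'b" where
  "pderivative i f = (\<lambda>x. frechet_derivative f (at x) (axis i 1))"

definition pderivatives :: "'n::finite list \<Rightarrow> (real^'n \<Rightarrow> 'b::real_normed_vector) \<Rightarrow> real^'n \<Rightarrow> 'b" where
  "pderivatives is f = foldr pderivative is f"

definition class_C :: "nat \<Rightarrow> (real^'n::finite \<Rightarrow> 'b::real_normed_vector) \<Rightarrow> bool" where
  "class_C k f \<longleftrightarrow>
     (\<forall>is. length is \<le> k \<longrightarrow> continuous_on UNIV (pderivatives is f)) \<and>
     (\<forall>is x. length is < k \<longrightarrow> pderivatives is f differentiable (at x))"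

definition schwartz :: "(real^'n::finite \<Rightarrow> complex) \<Rightarrow> bool" where
  "schwartz \<phi> \<longleftrightarrow> (\<forall>k. class_C k \<phi>) \<and>
     (\<forall>is N. bdd_above (range (\<lambda>x. (1 + norm x) ^ N * norm (pderivatives is \<phi> x))))"

definition schwartz_seminorm :: "nat \<Rightarrow> (real^'n::finite \<Rightarrow> complex) \<Rightarrow> real" where
  "schwartz_seminorm N \<phi> =
     (SUP (is, x) \<in> {is. length is \<le> N} \<times> UNIV. (1 + norm x) ^ N * norm (pderivatives is \<phi> x))"

text \<open>A tempered distribution is a functional on the Schwartz space; it is made total by the
  value 0 outside that space, so that distributions are equal iff they are equal as functions.\<close>

definition tempered :: "((real^'n::finite \<Rightarrow> complex) \<Rightarrow> complex) \<Rightarrow> bool" where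
  "tempered T \<longleftrightarrow>
     (\<forall>\<phi>. \<not> schwartz \<phi> \<longrightarrow> T \<phi> = 0) \<and>
     (\<forall>\<phi> \<psi>. schwartz \<phi> \<longrightarrow> schwartz \<psi> \<longrightarrow> T (\<lambda>x. \<phi> x + \<psi> x) = T \<phi> + T \<psi>) \<and>
     (\<forall>c \<phi>. schwartz \<phi> \<longrightarrow> T (\<lambda>x. c * \<phi> x) = c * T \<phi>) \<and>
     (\<exists>C N. \<forall>\<phi>. schwartz \<phi> \<longrightarrow> norm (T \<phi>) \<le> C * schwartz_seminorm N \<phi>)"

lemma bdd_above_schwartz_seminorm:
  fixes \<phi> :: "real^'n::finite \<Rightarrow> complex"
  assumes "schwartz \<phi>"
  shows "bdd_above ((\<lambda>(is, x). (1 + norm x) ^ N * norm (pderivatives is \<phi> x)) `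
                      ({is. length is \<le> N} \<times> UNIV))"
proof -
  have "finite {is :: 'n list. length is \<le> N}"
    using finite_lists_length_le[of "UNIV :: 'n set" N] by simp
  moreover have "((\<lambda>(is, x). (1 + norm x) ^ N * norm (pderivatives is \<phi> x)) `
                      ({is. length is \<le> N} \<times> UNIV)) =
      (\<Union>is \<in> {is. length is \<le> N}. range (\<lambda>x. (1 + norm x) ^ N * norm (pderivatives is \<phi> x)))"
    by auto
  ultimately show ?thesis
    using assms by (simp add: schwartz_def)
qed

lemma schwartz_seminorm_nonneg:
  assumes "schwartz \<phi>"
  shows "0 \<le> schwartz_seminorm N \<phi>"
proof -
  have "(\<lambda>(is, x). (1 + norm x) ^ N * norm (pderivatives is \<phi> x)) ([], 0) \<le> schwartz_seminorm N \<phi>"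
    unfolding schwartz_seminorm_def
    by (rule cSUP_upper[OF _ bdd_above_schwartz_seminorm[OF assms]]) simp
  then show ?thesis
    by (simp add: order_trans[OF norm_ge_zero])
qed

lemma schwartz_seminorm_mono:
  assumes "schwartz \<phi>" "M \<le> N"
  shows "schwartz_seminorm M \<phi> \<le> schwartz_seminorm N \<phi>"
  unfolding schwartz_seminorm_def
proof (rule cSUP_mono[OF _ bdd_above_schwartz_seminorm[OF assms(1)]])
  show "{is. length is \<le> M} \<times> UNIV \<noteq> ({} :: ('a list \<times> (real^'a)) set)"
    by (auto intro: exI[of _ "[]"])
  fix p :: "'a list \<times> (real^'a)"
  assume "p \<in> {is. length is \<le> M} \<times> UNIV"
  then show "\<exists>q\<in>{is. length is \<le> N} \<times> UNIV.
      (case p of (is, x) \<Rightarrow> (1 + norm x) ^ M * norm (pderivatives is \<phi> x))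
      \<le> (case q of (is, x) \<Rightarrow> (1 + norm x) ^ N * norm (pderivatives is \<phi> x))"
    using assms(2) by (intro bexI[of _ p]) (auto intro!: mult_right_mono power_increasing)
qed

lemma tempered_zero: "tempered (\<lambda>_. 0)"
  unfolding tempered_def by (auto intro!: exI[of _ 0])

lemma tempered_add:
  assumes "tempered S" "tempered T"
  shows "tempered (\<lambda>\<phi>. S \<phi> + T \<phi>)"
proof -
  obtain C M where S: "\<And>\<phi>. schwartz \<phi> \<Longrightarrow> norm (S \<phi>) \<le> C * schwartz_seminorm M \<phi>"
    using assms(1) unfolding tempered_def by blast
  obtain D N where T: "\<And>\<phi>. schwartz \<phi> \<Longrightarrow> norm (T \<phi>) \<le> D * schwartz_seminorm N \<phi>"
    using assms(2) unfolding tempered_def by blast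
  have "norm (S \<phi> + T \<phi>) \<le> (\<bar>C\<bar> + \<bar>D\<bar>) * schwartz_seminorm (max M N) \<phi>" if \<phi>: "schwartz \<phi>" for \<phi>
  proof -
    have *: "K * schwartz_seminorm L \<phi> \<le> \<bar>K\<bar> * schwartz_seminorm (max M N) \<phi>"
      if "L \<le> max M N" for K L
      by (rule mult_mono)
         (auto simp: schwartz_seminorm_nonneg[OF \<phi>] schwartz_seminorm_mono[OF \<phi> that])
    have "norm (S \<phi> + T \<phi>) \<le> C * schwartz_seminorm M \<phi> + D * schwartz_seminorm N \<phi>"
      using S[OF \<phi>] T[OF \<phi>] norm_triangle_ineq[of "S \<phi>" "T \<phi>"] by linarith
    also have "\<dots> \<le> (\<bar>C\<bar> + \<bar>D\<bar>) * schwartz_seminorm (max M N) \<phi>"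
      using *[of M C] *[of N D] by (simp add: distrib_right)
    finally show ?thesis .
  qed
  then have "\<exists>C N. \<forall>\<phi>. schwartz \<phi> \<longrightarrow> norm (S \<phi> + T \<phi>) \<le> C * schwartz_seminorm N \<phi>"
    by blast
  then show ?thesis
    using assms unfolding tempered_def by (simp add: algebra_simps)
qed

lemma tempered_scaleR:
  assumes "tempered T"
  shows "tempered (\<lambda>\<phi>. r *\<^sub>R T \<phi>)"
proof -
  obtain D N where T: "\<And>\<phi>. schwartz \<phi> \<Longrightarrow> norm (T \<phi>) \<le> D * schwartz_seminorm N \<phi>"
    using assms unfolding tempered_def by blast
  have "norm (r *\<^sub>R T \<phi>) \<le> (\<bar>r\<bar> * D) * schwartz_seminorm N \<phi>" if "schwartz \<phi>" for \<phi>
    using mult_left_mono[OF T[OF that], of "\<bar>r\<bar>"] by (simp add: mult.assoc)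
  then have "\<exists>C N. \<forall>\<phi>. schwartz \<phi> \<longrightarrow> norm (r *\<^sub>R T \<phi>) \<le> C * schwartz_seminorm N \<phi>"
    by blast
  then show ?thesis
    using assms unfolding tempered_def by (simp add: scaleR_add_right)
qed

typedef (overloaded) ('n::finite) tdist =
    "{T :: (real^'n \<Rightarrow> complex) \<Rightarrow> complex. tempered T}"
  morphisms pairing Abs_tdist
  using tempered_zero by blast

setup_lifting type_definition_tdist

instantiation tdist :: (finite) real_vector
begin

lift_definition zero_tdist :: "'a tdist" is "\<lambda>_. 0"
  by (rule tempered_zero)

lift_definition plus_tdist :: "'a tdist \<Rightarrow> 'a tdist \<Rightarrow> 'a tdist" is "\<lambda>S T \<phi>. S \<phi> + T \<phi>"
  by (rule tempered_add)

lift_definition scaleR_tdist :: "real \<Rightarrow> 'a tdist \<Rightarrow> 'a tdist" is "\<lambda>r T \<phi>. r *\<^sub>R T \<phi>"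
  by (rule tempered_scaleR)

definition uminus_tdist :: "'a tdist \<Rightarrow> 'a tdist" where
  "uminus_tdist T = (-1) *\<^sub>R T"

definition minus_tdist :: "'a tdist \<Rightarrow> 'a tdist \<Rightarrow> 'a tdist" where
  "minus_tdist S T = S + (-1) *\<^sub>R T"

instance
  by standard
     (unfold uminus_tdist_def minus_tdist_def, (transfer, simp add: algebra_simps fun_eq_iff)+)

end

text \<open>The distribution associated with a function, \<open>\<phi> \<mapsto> \<integral> f \<phi>\<close>. The stated integrability is
  needed because the integral of a non-integrable function is 0 by convention.\<close>

definition represents :: "(real^'n::finite \<Rightarrow> complex) \<Rightarrow> ((real^'n \<Rightarrow> complex) \<Rightarrow> complex) \<Rightarrow> bool" where
  "represents f T \<longleftrightarrow> (\<forall>\<phi>. schwartz \<phi> \<longrightarrow>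
     integrable lborel (\<lambda>x. f x * \<phi> x) \<and> T \<phi> = (LINT x|lborel. f x * \<phi> x))"

definition real_distribution :: "((real^'n::finite \<Rightarrow> complex) \<Rightarrow> complex) \<Rightarrow> bool" where
  "real_distribution T \<longleftrightarrow> (\<forall>\<phi>. schwartz \<phi> \<longrightarrow> range \<phi> \<subseteq> \<real> \<longrightarrow> T \<phi> \<in> \<real>)"

definition bracket :: "real^'n::finite \<Rightarrow> real" where
  "bracket x = sqrt (1 + (norm x)\<^sup>2)"

text \<open>Without the factor \<open>(2 * pi) powr (- n / 2)\<close>: this changes the Sobolev norms below by a constant factor only.\<close>

definition fourier :: "(real^'n::finite \<Rightarrow> complex) \<Rightarrow> real^'n \<Rightarrow> complex" where
  "fourier \<phi> \<xi> = (LINT x|lborel. exp (- \<i> * complex_of_real (x \<bullet> \<xi>)) * \<phi> x)"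

text \<open>The Fourier transform and the multiplication by \<open>\<langle>x\<rangle>\<^sup>t\<close> are transposed to functionals; for a
  Schwartz function \<open>\<phi>\<close> the arguments passed to \<open>T\<close> are again Schwartz functions.\<close>

definition dist_fourier :: "((real^'n::finite \<Rightarrow> complex) \<Rightarrow> complex) \<Rightarrow> (real^'n \<Rightarrow> complex) \<Rightarrow> complex" where
  "dist_fourier T = (\<lambda>\<phi>. if schwartz \<phi> then T (fourier \<phi>) else 0)"

definition dist_weight :: "real \<Rightarrow> ((real^'n::finite \<Rightarrow> complex) \<Rightarrow> complex) \<Rightarrow> (real^'n \<Rightarrow> complex) \<Rightarrow> complex" where
  "dist_weight t T =
     (\<lambda>\<phi>. if schwartz \<phi> then T (\<lambda>x. complex_of_real (bracket x powr t) * \<phi> x) else 0)"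

definition square_integrable :: "(real^'n::finite \<Rightarrow> complex) \<Rightarrow> bool" where
  "square_integrable g \<longleftrightarrow>
     g \<in> borel_measurable lborel \<and> integrable lborel (\<lambda>x. (norm (g x))\<^sup>2)"

definition L2_representative ::
    "(real^'n::finite \<Rightarrow> complex) \<Rightarrow> ((real^'n \<Rightarrow> complex) \<Rightarrow> complex) \<Rightarrow> bool" where
  "L2_representative g T \<longleftrightarrow> square_integrable g \<and> represents g T"

definition sobolev :: "real \<Rightarrow> ((real^'n::finite \<Rightarrow> complex) \<Rightarrow> complex) set" where
  "sobolev s = {u. tempered u \<and> (\<exists>g. L2_representative g (dist_weight s (dist_fourier u)))}"

text \<open>The representative is unique up to a null set, so the choice does not affect the norm.\<close>

definition sobolev_norm :: "real \<Rightarrow> ((real^'n::finite \<Rightarrow> complex) \<Rightarrow> complex) \<Rightarrow> real" where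
  "sobolev_norm s u =
     (let g = (SOME g. L2_representative g (dist_weight s (dist_fourier u)))
      in sqrt (LINT \<xi>|lborel. (norm (g \<xi>))\<^sup>2))"

definition wsobolev :: "real \<Rightarrow> real \<Rightarrow> 'n::finite tdist set" where
  "wsobolev s t = {u. dist_weight t (pairing u) \<in> sobolev s}"

definition wsobolev_norm :: "real \<Rightarrow> real \<Rightarrow> 'n::finite tdist \<Rightarrow> real" where
  "wsobolev_norm s t u = sobolev_norm s (dist_weight t (pairing u))"

type_synonym 'n dist_tensor = "'n tdist ^ 'n ^ 'n"

definition wsobolev_sym2 :: "real \<Rightarrow> real \<Rightarrow> 'n::finite dist_tensor set" where
  "wsobolev_sym2 s t =
     {h. \<forall>i j. h $ i $ j = h $ j $ i \<and> h $ i $ j \<in> wsobolev s t \<and>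
               real_distribution (pairing (h $ i $ j))}"

definition wsobolev_sym2_norm :: "real \<Rightarrow> real \<Rightarrow> 'n::finite dist_tensor \<Rightarrow> real" where
  "wsobolev_sym2_norm s t h = sqrt (\<Sum>i\<in>UNIV. \<Sum>j\<in>UNIV. (wsobolev_norm s t (h $ i $ j))\<^sup>2)"

definition tensor_represents :: "(real^'n::finite \<Rightarrow> real^'n^'n) \<Rightarrow> 'n dist_tensor \<Rightarrow> bool" where
  "tensor_represents f h \<longleftrightarrow>
     (\<forall>i j. represents (\<lambda>x. complex_of_real (f x $ i $ j)) (pairing (h $ i $ j)))"

definition nhd_on :: "'a::real_vector set \<Rightarrow> ('a \<Rightarrow> real) \<Rightarrow> 'a \<Rightarrow> 'a set \<Rightarrow> bool" where
  "nhd_on E N x V \<longleftrightarrow> x \<in> V \<and> V \<subseteq> E \<and> (\<exists>r>0. \<forall>y\<in>E. N (y - x) < r \<longrightarrow> y \<in> V)"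

definition open_on :: "'a::real_vector set \<Rightarrow> ('a \<Rightarrow> real) \<Rightarrow> 'a set \<Rightarrow> bool" where
  "open_on E N U \<longleftrightarrow> (\<forall>x\<in>U. nhd_on E N x U)"

definition bounded_multilinear_on ::
    "'a::real_vector set \<Rightarrow> ('a \<Rightarrow> real) \<Rightarrow> 'b::real_vector set \<Rightarrow> ('b \<Rightarrow> real) \<Rightarrow>
     nat \<Rightarrow> ('a list \<Rightarrow> 'b) \<Rightarrow> bool" where
  "bounded_multilinear_on E N F M k A \<longleftrightarrow>
     (\<forall>vs \<in> lists E. length vs = k \<longrightarrow> A vs \<in> F) \<and>
     (\<forall>xs \<in> lists E. \<forall>ys \<in> lists E. \<forall>v \<in> E. \<forall>w \<in> E. \<forall>a b. Suc (length xs + length ys) = k \<longrightarrow>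
        A (xs @ (a *\<^sub>R v + b *\<^sub>R w) # ys) = a *\<^sub>R A (xs @ v # ys) + b *\<^sub>R A (xs @ w # ys)) \<and>
     (\<exists>C. \<forall>vs \<in> lists E. length vs = k \<longrightarrow> M (A vs) \<le> C * prod_list (map N vs))"

text \<open>\<open>D u [v\<^sub>1, \<dots>, v\<^sub>k]\<close> is the \<open>k\<close>-th Frechet derivative at \<open>u\<close>: the derivative of order \<open>k + 1\<close>
  is the Frechet derivative of the one of order \<open>k\<close> with respect to the operator norm of
  \<open>k\<close>-linear maps. The domain \<open>U\<close> is meant to be open.\<close>

definition smooth_map_on ::
    "'a::real_vector set \<Rightarrow> ('a \<Rightarrow> real) \<Rightarrow> 'b::real_vector set \<Rightarrow> ('b \<Rightarrow> real) \<Rightarrow>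
     'a set \<Rightarrow> ('a \<Rightarrow> 'b) \<Rightarrow> bool" where
  "smooth_map_on E N F M U f \<longleftrightarrow> (\<exists>D.
     (\<forall>u\<in>U. D u [] = f u) \<and>
     (\<forall>u\<in>U. \<forall>k. bounded_multilinear_on E N F M k (D u)) \<and>
     (\<forall>u\<in>U. \<forall>k. \<forall>\<epsilon>>0. \<exists>d>0. \<forall>v\<in>E. N v < d \<and> u + v \<in> U \<longrightarrow>
        (\<forall>vs \<in> lists E. length vs = k \<longrightarrow>
           M (D (u + v) vs - D u vs - D u (v # vs)) \<le> \<epsilon> * N v * prod_list (map N vs))))"

definition riemannian_metric :: "(real^'n::finite \<Rightarrow> real^'n^'n) \<Rightarrow> bool" where
  "riemannian_metric g \<longleftrightarrow> class_C 2 g \<and>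
     (\<forall>x. transpose (g x) = g x \<and> (\<forall>v. v \<noteq> 0 \<longrightarrow> 0 < v \<bullet> (g x *v v)))"

definition christoffel :: "(real^'n::finite \<Rightarrow> real^'n^'n) \<Rightarrow> 'n \<Rightarrow> 'n \<Rightarrow> 'n \<Rightarrow> real^'n \<Rightarrow> real" where
  "christoffel g l j k x = (1/2) * (\<Sum>m\<in>UNIV. matrix_inv (g x) $ l $ m *
     (pderivative j (\<lambda>y. g y $ k $ m) x + pderivative k (\<lambda>y. g y $ j $ m) x
      - pderivative m (\<lambda>y. g y $ j $ k) x))"

definition ricci :: "(real^'n::finite \<Rightarrow> real^'n^'n) \<Rightarrow> real^'n \<Rightarrow> real^'n^'n" where
  "ricci g x = (\<chi> j k. \<Sum>l\<in>UNIV.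
     pderivative l (christoffel g l j k) x - pderivative k (christoffel g l j l) x
     + (\<Sum>p\<in>UNIV. christoffel g p j k x * christoffel g l p l x
                  - christoffel g p j l x * christoffel g l p k x))"

definition scalar_curvature :: "(real^'n::finite \<Rightarrow> real^'n^'n) \<Rightarrow> real^'n \<Rightarrow> real" where
  "scalar_curvature g x = (\<Sum>j\<in>UNIV. \<Sum>k\<in>UNIV. matrix_inv (g x) $ j $ k * ricci g x $ j $ k)"

definition Ein :: "real \<Rightarrow> real \<Rightarrow> (real^'n::finite \<Rightarrow> real^'n^'n) \<Rightarrow> real^'n \<Rightarrow> real^'n^'n" where
  "Ein \<kappa> \<Lambda> g x = ricci g x + (\<kappa> * scalar_curvature g x) *\<^sub>R g x + \<Lambda> *\<^sub>R g x"

definition flat_metric :: "real^'n::finite \<Rightarrow> real^'n^'n" where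
  "flat_metric x = mat 1"

end

theory Submission imports Defs begin

text \<open>Adding the symmetrized derivative of a one-form \<open>w\<close> makes the equation elliptic. Written for the
 perturbation \<open>h\<close>, the inverse metric, the Christoffel symbols, the source with a raised index and \<open>w\<close> as separate
 unknowns, the gauged system is a quadratic fixed point equation in weighted Sobolev spaces, whose small
 solution is analytic in \<open>e\<close>. If the solution has one derivative more than required, the contracted Bianchi
 identity shows that \<open>w\<close> solves a homogeneous linear elliptic equation with a small perturbation, so \<open>w = 0\<close>.
 For band-limited \<open>e\<close> this applies to all tiny multiples of \<open>e\<close>, hence \<open>w = 0\<close> for \<open>e\<close> itself by analyticity, and then
 for all small \<open>e\<close> by density. Uniqueness without weights transfers this to the weighted spaces.\<close>

text \<open>The field \<open>w\<close> is not a coordinate condition imposed on \<open>h\<close>. It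
  is the combination of derivatives of the raised source that the Bianchi identity forces to vanish.
  To first order its part in \<open>h\<close> is - \<Lambda> times a divergence, so division by
  \<Lambda> cancels exactly the divergence terms of the linearized Ricci tensor. What remains is a
  Laplacian on every component plus trace terms, and the bound on \<kappa> makes the leading
  coefficient \<beta> of the scalar equation for the trace positive. The obstacle is a loss of
  derivatives: the Bianchi identity differentiates the curvature, hence takes three derivatives of
  \<open>h\<close>, while \<open>h\<close> has only order s + 2 with s > n/2. Smallness in the space
  with one more derivative depends on the source, so only tiny multiples of a regular source are
  reached directly; this is why analyticity is needed. All Sobolev spaces are parametrized by one
  Hilbert space of frequency densities, so that all operators act on a single type. Conjugating the
  Laplacian by <x>^t is no small perturbation, but conjugating by <ep x>^t is, and the two weights
  give equivalent norms.\<close>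

notation scaleR (infixr "*R" 75)

abbreviation pd :: "'n::finite => (real^'n => 'b::real_normed_vector) => real^'n => 'b" where "pd == pderivative"

abbreviation cor :: "real => complex" where "cor == complex_of_real"

section \<open>The Hilbert space of Hermitian square-integrable functions\<close>

lemma lborel_nn_integral_affine:
 fixes f :: "'a::euclidean_space => ennreal"
 assumes [measurable]: "f \<in> borel_measurable borel" and c: "c ~= 0"
 shows "(\<integral>\<^sup>+x. f x \<partial>lborel) = ennreal (\<bar>c\<bar>^DIM('a)) * (\<integral>\<^sup>+x. f (t + c *R x) \<partial>lborel)"
 by (subst lborel_affine[OF c, of t])
   (simp add: nn_integral_density nn_integral_distr nn_integral_cmult ennreal_power)

lemma lborel_integrable_affine:
 fixes f :: "'a::euclidean_space => 'b :: {banach, second_countable_topology}"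
 assumes f: "integrable lborel f" and c: "c ~= 0"
 shows "integrable lborel (%x. f (t + c *R x))"
proof -
 have [measurable]: "f \<in> borel_measurable borel" using borel_measurable_integrable[OF f] by simp
 have "(\<integral>\<^sup>+x. ennreal (norm (f x)) \<partial>lborel) < \<infinity>" using f by (simp add: integrable_iff_bounded)
 then have "ennreal (\<bar>c\<bar>^DIM('a)) * (\<integral>\<^sup>+x. ennreal (norm (f (t + c *R x))) \<partial>lborel) < \<infinity>"
  by (subst (asm) lborel_nn_integral_affine[OF _ c, of _ t]) (auto simp: ennreal_power)
 then have "(\<integral>\<^sup>+x. ennreal (norm (f (t + c *R x))) \<partial>lborel) < \<infinity>"
  using c by (auto simp: ennreal_mult_less_top)
 then show ?thesis by (simp add: integrable_iff_bounded)
qed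

lemma lborel_integrable_affine_iff:
 fixes f :: "'a::euclidean_space => 'b :: {banach, second_countable_topology}"
 assumes c: "c ~= 0"
 shows "integrable lborel (%x. f (t + c *R x)) \<longleftrightarrow> integrable lborel f"
 using lborel_integrable_affine[of f c t] c
  lborel_integrable_affine[of "%x. f (t + c *R x)" "1/c" "- (1/c) *R t"]
 by (auto simp: algebra_simps)

lemma lborel_integral_affine:
 fixes f :: "'a::euclidean_space => 'b :: {banach, second_countable_topology}"
 assumes c: "c ~= 0"
 shows "(\<integral>x. f x \<partial>lborel) = \<bar>c\<bar>^DIM('a) *R (\<integral>x. f (t + c *R x) \<partial>lborel)"
proof cases
 assume f: "integrable lborel f"
 then have [measurable]: "f \<in> borel_measurable borel" using borel_measurable_integrable by force
 show ?thesis using f lborel_integrable_affine[OF f c]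
  by (subst lborel_affine[OF c, of t]) (simp add: integral_density integral_distr)
next
 assume "\<not> integrable lborel f"
 with lborel_integrable_affine_iff[OF c, of f t] show ?thesis by (simp add: not_integrable_integral_eq)
qed

lemma lborel_integral_translate:
 fixes f :: "'a::euclidean_space => 'b :: {banach, second_countable_topology}"
 shows "(\<integral>x. f (x + a) \<partial>lborel) = (\<integral>x. f x \<partial>lborel)"
 using lborel_integral_affine[of 1 f a] by (simp add: add.commute)

lemma lborel_integrable_translate_iff:
 fixes f :: "'a::euclidean_space => 'b :: {banach, second_countable_topology}"
 shows "integrable lborel (%x. f (x + a)) \<longleftrightarrow> integrable lborel f"
 using lborel_integrable_affine_iff[of 1 f a] by (simp add: add.commute)

lemma lborel_nn_integral_translate:
 fixes f :: "'a::euclidean_space => ennreal"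
 assumes "f \<in> borel_measurable borel"
 shows "(\<integral>\<^sup>+x. f (x + a) \<partial>lborel) = (\<integral>\<^sup>+x. f x \<partial>lborel)"
 using lborel_nn_integral_affine[OF assms, of 1 a] by (simp add: add.commute)

lemma lborel_integral_reflect:
 fixes f :: "'a::euclidean_space => 'b :: {banach, second_countable_topology}"
 shows "(\<integral>x. f (- x) \<partial>lborel) = (\<integral>x. f x \<partial>lborel)"
 using lborel_integral_affine[of "-1" f 0] by simp

lemma lborel_integrable_reflect_iff:
 fixes f :: "'a::euclidean_space => 'b :: {banach, second_countable_topology}"
 shows "integrable lborel (%x. f (- x)) \<longleftrightarrow> integrable lborel f"
 using lborel_integrable_affine_iff[of "-1" f 0] by simp

text \<open>Hermitian densities are the Fourier transforms of real functions, so this real vector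
  space models real fields. The symmetry is demanded at every point and not just almost everywhere,
  so representatives must be modified symmetrically.\<close>

definition L2H :: "(real^'n::finite => complex) set" where
 "L2H = {f. f \<in> borel_measurable borel & integrable lborel (%x. (norm (f x))^2) &
   (\<forall>x. f (- x) = cnj (f x))}"

lemma cnj_borel [measurable]: "cnj \<in> borel_measurable borel"
 by (intro borel_measurable_continuous_onI continuous_intros)

lemma norm_add_sq_le: "(norm (a + b))^2 <= 2 * (norm a)^2 + 2 * (norm b)^2" for a b :: "'a::real_normed_vector"
proof -
 have "(norm (a + b))^2 <= (norm a + norm b)^2" by (simp add: norm_triangle_ineq power_mono)
 also have "... <= 2 * (norm a)^2 + 2 * (norm b)^2"
  using sum_squares_bound[of "norm a" "norm b"] by (simp add: power2_sum)
 finally show ?thesis .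
qed

lemma square_integrable_add:
 fixes f g :: "'a => 'b::{banach, second_countable_topology}"
 assumes [measurable]: "f \<in> borel_measurable M" "g \<in> borel_measurable M"
  and "integrable M (%x. (norm (f x))^2)" "integrable M (%x. (norm (g x))^2)"
 shows "integrable M (%x. (norm (f x + g x))^2)"
 by (rule Bochner_Integration.integrable_bound[of _ "%x. 2 * (norm (f x))^2 + 2 * (norm (g x))^2"])
   (use assms norm_add_sq_le in auto)

lemma L2H_add: "f \<in> L2H ==> g \<in> L2H ==> (%x. f x + g x) \<in> L2H"
 by (auto simp: L2H_def square_integrable_add)

lemma L2H_scaleR: "f \<in> L2H ==> (%x. r *R f x) \<in> L2H"
 by (auto simp: L2H_def power_mult_distrib)

lemma L2H_zero: "(%_. 0) \<in> L2H"
 by (auto simp: L2H_def)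

text \<open>The choice depends only on the almost-everywhere class (\<open>canon_cong\<close>), so
  the fixed points of \<open>canon\<close> in \<open>L2H\<close> contain exactly one member of each
  class. The space modulo null sets thus becomes a set of functions.\<close>

definition canon :: "(real^'n::finite => complex) => real^'n => complex" where
 "canon f = (SOME g. g \<in> L2H & (AE x in lborel. g x = f x))"

lemma canon: "f \<in> L2H ==> canon f \<in> L2H & (AE x in lborel. canon f x = f x)"
 unfolding canon_def by (rule someI[of _ f]) auto

lemma canon_cong: "AE x in lborel. f x = g x ==> canon f = canon g"
proof -
 assume "AE x in lborel. f x = g x"
 then have "(AE x in lborel. h x = f x) \<longleftrightarrow> (AE x in lborel. h x = g x)" for h
  by (auto elim: AE_mp)
 then show ?thesis unfolding canon_def by simp
qed

typedef ('n::finite) l2 = "{f :: real^'n => complex. f \<in> L2H & canon f = f}"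
 morphisms rp Abs_l2
 using canon[OF L2H_zero] canon_cong[of "canon (%_. 0)" "%_. 0"] by (intro exI[of _ "canon (%_. 0)"]) auto

definition mk :: "(real^'n::finite => complex) => 'n l2" where "mk f = Abs_l2 (canon f)"

lemma rp_L2H: "rp F \<in> L2H" using rp[of F] by auto

lemma rp_meas [measurable]: "rp F \<in> borel_measurable borel" using rp_L2H[of F] by (simp add: L2H_def)

lemma rp_sq: "integrable lborel (%x. (norm (rp F x))^2)" using rp_L2H[of F] by (simp add: L2H_def)

lemma rp_herm: "rp F (- x) = cnj (rp F x)" using rp_L2H[of F] by (simp add: L2H_def)

lemma rp_mk: "f \<in> L2H ==> AE x in lborel. rp (mk f) x = f x"
 unfolding mk_def using canon[of f] canon_cong[of "canon f" f] by (subst Abs_l2_inverse) auto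

lemma l2_eqI: "AE x in lborel. rp F x = rp G x ==> F = G"
 using canon_cong[of "rp F" "rp G"] rp[of F] rp[of G] by (auto simp: rp_inject)

lemma sq_integrable_product:
 fixes f g :: "'a => complex"
 assumes [measurable]: "f \<in> borel_measurable M" "g \<in> borel_measurable M"
  and "integrable M (%x. (norm (f x))^2)" "integrable M (%x. (norm (g x))^2)"
 shows "integrable M (%x. f x * g x)"
proof (rule Bochner_Integration.integrable_bound[of _ "%x. (norm (f x))^2 + (norm (g x))^2"])
 show "AE x in M. norm (f x * g x) <= norm ((norm (f x))^2 + (norm (g x))^2)"
 proof (rule AE_I2)
  fix x
  have "2 * (norm (f x) * norm (g x)) <= (norm (f x))^2 + (norm (g x))^2"
   using sum_squares_bound[of "norm (f x)" "norm (g x)"] by simp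
  moreover have "0 <= norm (f x) * norm (g x)" by simp
  ultimately have "norm (f x) * norm (g x) <= (norm (f x))^2 + (norm (g x))^2"
   by linarith
  then show "norm (f x * g x) <= norm ((norm (f x))^2 + (norm (g x))^2)"
   by (simp add: norm_mult)
 qed
qed (use assms in auto)

lemma rp_inner_integrable: "integrable lborel (%x. rp F x \<bullet> rp G x)"
proof -
 have "integrable lborel (%x. cnj (rp F x) * rp G x)"
  by (rule sq_integrable_product) (auto simp: rp_sq)
 then have "integrable lborel (%x. Re (cnj (rp F x) * rp G x))" by (rule integrable_Re)
 then show ?thesis by (simp add: inner_complex_def)
qed

instantiation l2 :: (finite) real_vector
begin

definition zero_l2 :: "'a l2" where "zero_l2 = mk (%_. 0)"
definition plus_l2 :: "'a l2 => 'a l2 => 'a l2" where "plus_l2 F G = mk (%x. rp F x + rp G x)"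
definition scaleR_l2 :: "real => 'a l2 => 'a l2" where "scaleR_l2 r F = mk (%x. r *R rp F x)"
definition uminus_l2 :: "'a l2 => 'a l2" where "uminus_l2 F = (-1) *R F"
definition minus_l2 :: "'a l2 => 'a l2 => 'a l2" where "minus_l2 F G = F + (-1) *R G"

lemma rp_add: "AE x in lborel. rp (F + G) x = rp F x + rp G x"
 unfolding plus_l2_def by (rule rp_mk[OF L2H_add[OF rp_L2H rp_L2H]])

lemma rp_scaleR: "AE x in lborel. rp (r *R F) x = r *R rp F x"
 unfolding scaleR_l2_def by (rule rp_mk[OF L2H_scaleR[OF rp_L2H]])

lemma rp_zero: "AE x in lborel. rp 0 x = 0"
 unfolding zero_l2_def by (rule rp_mk[OF L2H_zero])

instance
proof
 fix F G H :: "'a l2" and r q :: real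
 show "F + G + H = F + (G + H)"
  using rp_add[of F G] rp_add[of "F + G" H] rp_add[of G H] rp_add[of F "G + H"]
  by (intro l2_eqI) (auto elim!: AE_mp)
 show "F + G = G + F" by (simp add: plus_l2_def add.commute)
 show "0 + F = F"
  using rp_add[of 0 F] rp_zero by (intro l2_eqI) (auto elim!: AE_mp)
 show "- F + F = 0"
  using rp_add[of "-F" F] rp_scaleR[of "-1" F] rp_zero
  unfolding uminus_l2_def by (intro l2_eqI) (auto elim!: AE_mp)
 show "F - G = F + - G" by (simp add: minus_l2_def uminus_l2_def)
 show "r *R (F + G) = r *R F + r *R G"
  using rp_add[of F G] rp_add[of "r *R F" "r *R G"] rp_scaleR[of r F] rp_scaleR[of r G] rp_scaleR[of r "F + G"]
  by (intro l2_eqI) (auto elim!: AE_mp simp: scaleR_add_right)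
 show "(r + q) *R F = r *R F + q *R F"
  using rp_add[of "r *R F" "q *R F"] rp_scaleR[of r F] rp_scaleR[of q F] rp_scaleR[of "r + q" F]
  by (intro l2_eqI) (auto elim!: AE_mp simp: scaleR_add_left)
 show "r *R q *R F = (r * q) *R F"
  using rp_scaleR[of r "q *R F"] rp_scaleR[of q F] rp_scaleR[of "r * q" F]
  by (intro l2_eqI) (auto elim!: AE_mp)
 show "1 *R F = F" using rp_scaleR[of 1 F] by (intro l2_eqI) auto
qed

end

instantiation l2 :: (finite) real_inner
begin

definition inner_l2 :: "'a l2 => 'a l2 => real" where "inner_l2 F G = (LINT x|lborel. rp F x \<bullet> rp G x)"
definition norm_l2 :: "'a l2 => real" where "norm_l2 F = sqrt (inner F F)"
definition sgn_l2 :: "'a l2 => 'a l2" where "sgn_l2 F = F /\<^sub>R norm F"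
definition dist_l2 :: "'a l2 => 'a l2 => real" where "dist_l2 F G = norm (F - G)"
definition uniformity_l2 :: "('a l2 \<times> 'a l2) filter" where
 "uniformity_l2 = (INF e\<in>{0 <..}. principal {(x, y). dist x y < e})"
definition open_l2 :: "'a l2 set => bool" where
 "open_l2 U = (\<forall>x\<in>U. \<forall>\<^sub>F (x', y) in uniformity. x' = x --> y \<in> U)"

instance
proof
 fix F G H :: "'a l2" and r q :: real
 show "dist F G = norm (F - G)" by (simp add: dist_l2_def)
 show "sgn F = F /\<^sub>R norm F" by (simp add: sgn_l2_def)
 show "(uniformity :: ('a l2 \<times> 'a l2) filter) = (INF e\<in>{0 <..}. principal {(x, y). dist x y < e})"
  by (rule uniformity_l2_def)
 show "open U = (\<forall>x\<in>U. \<forall>\<^sub>F (x', y) in uniformity. x' = x --> y \<in> U)" for U :: "'a l2 set"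
  by (rule open_l2_def)
 show "inner F G = inner G F" by (simp add: inner_l2_def inner_commute)
 have "inner (F + G) H = (LINT x|lborel. rp F x \<bullet> rp H x + rp G x \<bullet> rp H x)"
  unfolding inner_l2_def using rp_add[of F G]
  by (intro integral_cong_AE) (auto elim!: AE_mp simp: inner_add_left)
 then show "inner (F + G) H = inner F H + inner G H"
  by (simp add: inner_l2_def rp_inner_integrable)
 have "inner (r *R F) G = (LINT x|lborel. r * (rp F x \<bullet> rp G x))"
  unfolding inner_l2_def using rp_scaleR[of r F]
  by (intro integral_cong_AE) (auto elim!: AE_mp)
 then show "inner (r *R F) G = r * inner F G" by (simp add: inner_l2_def)
 show "0 <= inner F F" by (simp add: inner_l2_def)
 have "inner F F = 0 \<longleftrightarrow> (AE x in lborel. rp F x \<bullet> rp F x = 0)"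
  unfolding inner_l2_def
  by (intro integral_nonneg_eq_0_iff_AE rp_inner_integrable) auto
 also have "... \<longleftrightarrow> F = 0"
  using rp_zero by (auto elim!: AE_mp intro!: l2_eqI)
 finally show "inner F F = 0 \<longleftrightarrow> F = 0" .
 show "norm F = sqrt (inner F F)" by (simp add: norm_l2_def)
qed

end

lemma norm_l2: "norm (F :: 'n::finite l2) = sqrt (LINT x|lborel. (norm (rp F x))^2)"
 by (simp add: norm_l2_def inner_l2_def power2_norm_eq_inner)

lemma norm_l2_sq: "(norm (F :: 'n::finite l2))^2 = (LINT x|lborel. (norm (rp F x))^2)"
 by (simp add: norm_l2)

lemma norm_mk:
 assumes "f \<in> L2H" shows "norm (mk f) = sqrt (LINT x|lborel. (norm (f x))^2)"
proof -
 have [measurable]: "f \<in> borel_measurable borel" using assms by (simp add: L2H_def)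
 show ?thesis unfolding norm_l2 using rp_mk[OF assms]
  by (intro arg_cong[where f=sqrt] integral_cong_AE) (auto elim!: AE_mp)
qed

lemma norm_l2_nn: "ennreal ((norm (F :: 'n::finite l2))^2) = (\<integral>\<^sup>+x. ennreal ((norm (rp F x))^2) \<partial>lborel)"
 unfolding norm_l2_sq by (subst nn_integral_eq_integral[OF rp_sq]) auto

lemma L2H_norm_leI:
 assumes [measurable]: "f \<in> borel_measurable borel" and "!!x. f (- x) = cnj (f x)"
  and le: "(\<integral>\<^sup>+x. ennreal ((norm (f x))^2) \<partial>lborel) <= ennreal (c^2)" and c: "0 <= c"
 shows "f \<in> L2H & norm (mk f) <= c"
proof -
 have i: "integrable lborel (%x. (norm (f x))^2)"
  using le by (auto simp: integrable_iff_bounded intro: le_less_trans)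
 then have L: "f \<in> L2H" using assms by (simp add: L2H_def)
 have "ennreal (LINT x|lborel. (norm (f x))^2) <= ennreal (c^2)"
  using le by (subst (asm) nn_integral_eq_integral[OF i]) auto
 then have "(LINT x|lborel. (norm (f x))^2) <= c^2" by (simp add: ennreal_le_iff)
 then have "sqrt (LINT x|lborel. (norm (f x))^2) <= c" using c real_le_lsqrt by fastforce
 then show ?thesis using L norm_mk by metis
qed

lemma rp_sum: "AE x in lborel. rp (sum F I) x = (\<Sum>i\<in>I. rp (F i :: 'n::finite l2) x)"
proof (induction I rule: infinite_finite_induct)
 case (insert i I)
 then show ?case using rp_add[of "F i" "sum F I"] by (auto elim!: AE_mp)
qed (use rp_zero in auto)

lemma rp_diff: "AE x in lborel. rp (F - G :: 'n::finite l2) x = rp F x - rp G x"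
proof -
 have "F - G = F + (-1) *R G" by simp
 then show ?thesis using rp_add[of F "(-1) *R G"] rp_scaleR[of "-1" G]
  by (auto elim!: AE_mp)
qed

text \<open>The Riesz-Fischer argument: the partial sums of the absolute increments are bounded in
  L2, so by monotone convergence their supremum is finite almost everywhere, and there the
  telescoping series converges absolutely.\<close>

lemma l2_fast_Cauchy_AE_convergent:
 fixes Y :: "nat => 'n::finite l2"
 assumes Y: "!!k. norm (Y (Suc k) - Y k) <= (1/2)^k"
 shows "AE x in lborel. convergent (%k. rp (Y k) x)"
proof -
 \<comment> \<open>The moduli of the increments are real and even, hence again Hermitian, so the
   triangle inequality of \<open>l2\<close> applies to their sums.\<close>
 define d where "d k x = cor (norm (rp (Y (Suc k)) x - rp (Y k) x))" for k x
 have dL: "d k \<in> L2H" for k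
 proof -
  have "rp (Y (Suc k) - Y k) \<in> L2H" by (rule rp_L2H)
  moreover have "AE x in lborel. (norm (rp (Y (Suc k) - Y k) x))^2 = (norm (rp (Y (Suc k)) x - rp (Y k) x))^2"
   using rp_diff[of "Y (Suc k)" "Y k"] by (auto elim!: AE_mp)
  moreover have "(%x. (norm (rp (Y (Suc k)) x - rp (Y k) x))^2) \<in> borel_measurable lborel" by measurable
  ultimately have "integrable lborel (%x. (norm (rp (Y (Suc k)) x - rp (Y k) x))^2)"
   by (subst integrable_cong_AE[where g="%x. (norm (rp (Y (Suc k) - Y k) x))^2"]) (auto simp: L2H_def)
  moreover have "d k \<in> borel_measurable borel" unfolding d_def by measurable
  ultimately show ?thesis by (simp add: L2H_def d_def rp_herm flip: complex_cnj_diff)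
 qed
 have nd: "norm (mk (d k)) <= (1/2)^k" for k
 proof -
  have "norm (mk (d k)) = norm (Y (Suc k) - Y k)"
   unfolding norm_mk[OF dL] norm_l2[of "Y (Suc k) - Y k"] using rp_diff[of "Y (Suc k)" "Y k"]
   by (intro arg_cong[where f=sqrt] integral_cong_AE) (auto elim!: AE_mp simp: d_def)
  then show ?thesis using Y[of k] by simp
 qed
 define S where "S K x = (\<Sum>k<K. norm (rp (Y (Suc k)) x - rp (Y k) x))" for K x
 have [measurable]: "S K \<in> borel_measurable lborel" for K unfolding S_def by measurable
 \<comment> \<open>The 4 is the square of the bound 2 for the geometric sum.\<close>
 have bound: "(\<integral>\<^sup>+x. ennreal ((S K x)^2) \<partial>lborel) <= 4" for K
 proof -
  have "norm (\<Sum>k<K. mk (d k)) <= (\<Sum>k<K. (1/2)^k)"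
   by (rule sum_norm_le) (use nd in auto)
  also have "... <= 2"
   by (subst sum_gp_strict) (auto simp: field_simps)
  finally have n: "(norm (\<Sum>k<K. mk (d k)))^2 <= 2^2" by (rule power_mono) simp
  have "AE x in lborel. \<forall>k<K. rp (mk (d k)) x = d k x"
   using rp_mk[OF dL] by (simp add: AE_all_countable)
  then have "AE x in lborel. rp (\<Sum>k<K. mk (d k)) x = cor (S K x)"
   using rp_sum[of "%k. mk (d k)" "{..<K}"]
  proof eventually_elim
   case (elim x)
   then show ?case by (simp add: S_def d_def)
  qed
  then have "(\<integral>\<^sup>+x. ennreal ((S K x)^2) \<partial>lborel) = (\<integral>\<^sup>+x. ennreal ((norm (rp (\<Sum>k<K. mk (d k)) x))^2) \<partial>lborel)"
   by (intro nn_integral_cong_AE) (auto elim!: AE_mp)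
  also have "... = ennreal ((norm (\<Sum>k<K. mk (d k)))^2)" by (simp add: norm_l2_nn)
  also have "... <= ennreal 4" using n by (intro ennreal_leI) simp
  finally show ?thesis by simp
 qed
 define T where "T x = (SUP K. ennreal ((S K x)^2))" for x
 have mono: "S K x <= S L x" if "K <= L" for K L x
  unfolding S_def using that by (intro sum_mono2) auto
 have S0: "0 <= S K x" for K x unfolding S_def by (simp add: sum_nonneg)
 have "(\<integral>\<^sup>+x. T x \<partial>lborel) = (SUP K. \<integral>\<^sup>+x. ennreal ((S K x)^2) \<partial>lborel)"
  unfolding T_def
  by (rule nn_integral_monotone_convergence_SUP)
    (auto simp: incseq_def le_fun_def intro!: ennreal_leI power_mono mono S0)
 also have "... <= 4" by (rule SUP_least) (rule bound)
 finally have fin: "(\<integral>\<^sup>+x. T x \<partial>lborel) ~= \<infinity>" by (auto simp: top_unique)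
 have [measurable]: "T \<in> borel_measurable lborel" unfolding T_def by measurable
 have "AE x in lborel. T x ~= \<infinity>"
  by (rule nn_integral_PInf_AE[OF _ fin]) simp
 then show ?thesis
 proof (rule AE_mp, intro AE_I2 impI)
  fix x assume "T x ~= \<infinity>"
  then obtain c where c: "T x = ennreal c" "0 <= c" by (cases "T x") auto
  have "S K x <= sqrt c" for K
  proof -
   have "ennreal ((S K x)^2) <= ennreal c" unfolding c(1)[symmetric] T_def by (rule SUP_upper) simp
   then have "(S K x)^2 <= c" using c by (simp add: ennreal_le_iff)
   then show ?thesis by (rule real_le_rsqrt)
  qed
  then have "summable (%k. norm (rp (Y (Suc k)) x - rp (Y k) x))"
   by (intro summableI_nonneg_bounded[of _ "sqrt c"]) (auto simp: S_def)
  then have "summable (%k. rp (Y (Suc k)) x - rp (Y k) x)" by (rule summable_norm_cancel)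
  then have "convergent (%K. \<Sum>k<K. rp (Y (Suc k)) x - rp (Y k) x)"
   by (simp add: summable_iff_convergent)
  then have "convergent (%K. rp (Y K) x - rp (Y 0) x)"
   unfolding sum_lessThan_telescope[of "%k. rp (Y k) x"] .
  then have "convergent (%K. (rp (Y K) x - rp (Y 0) x) + rp (Y 0) x)"
   by (intro convergent_add convergent_const)
  then show "convergent (%K. rp (Y K) x)" by simp
 qed
qed

instance l2 :: (finite) banach
proof
 fix X :: "nat => 'a l2"
 assume X: "Cauchy X"
 \<comment> \<open>Dependent choice of a subsequence whose increments are below (1/2)^k.\<close>
 have "\<exists>r. \<forall>k. (ALL m>=r k. ALL n>=r k. norm (X m - X n) < (1/2)^k) & r k < r (Suc k)"
 proof (rule dependent_nat_choice)
  show "\<exists>r. ALL m>=r. ALL n>=r. norm (X m - X n) < (1/2)^0" using CauchyD[OF X, of 1] by simp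
  fix r k
  assume "ALL m>=r. ALL n>=r. norm (X m - X n) < (1/2)^k"
  obtain M where M: "ALL m>=M. ALL n>=M. norm (X m - X n) < (1/2)^Suc k" using CauchyD[OF X, of "(1/2)^Suc k"] by auto
  show "\<exists>q. (ALL m>=q. ALL n>=q. norm (X m - X n) < (1/2)^Suc k) & r < q"
   using M by (intro exI[of _ "max M (Suc r)"]) auto
 qed
 then obtain r where r: "!!k m n. m >= r k ==> n >= r k ==> norm (X m - X n) < (1/2)^k"
  and mono: "!!k. r k < r (Suc k)" by blast
 have rS: "strict_mono r" using mono by (simp add: strict_mono_Suc_iff)
 define Y where "Y = X \<circ> r"
 have "norm (Y (Suc k) - Y k) <= (1/2)^k" for k
  using r[where k=k and m="r (Suc k)" and n="r k"] mono[of k] by (simp add: Y_def less_imp_le)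
 then have conv: "AE x in lborel. convergent (%k. rp (Y k) x)" by (rule l2_fast_Cauchy_AE_convergent)
 \<comment> \<open>The set of convergence is invariant under reflection, so the value 0 off this set
   keeps the limit Hermitian at every point.\<close>
 define f where "f x = (if convergent (%k. rp (Y k) x) then lim (%k. rp (Y k) x) else 0)" for x
 have Cc: "{x. convergent (%k. rp (Y k) x)} \<in> sets borel"
 proof -
  have "{x. convergent (%k. rp (Y k) x)} = {x. Cauchy (%k. rp (Y k) x)}"
   by (simp add: Cauchy_convergent_iff)
  moreover have "{x\<in>space borel. Cauchy (%k. rp (Y k) x)} \<in> sets borel"
   by (rule sets_Collect_Cauchy) simp
  ultimately show ?thesis by simp
 qed
 have fm [measurable]: "f \<in> borel_measurable borel"
  unfolding f_def by (rule measurable_If) (use Cc in "auto intro!: borel_measurable_lim_metric")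
 have fh: "f (- x) = cnj (f x)" for x
 proof -
  have e: "(%k. rp (Y k) (- x)) = (%k. cnj (rp (Y k) x))" by (simp add: rp_herm)
  have c: "convergent (%k. cnj (rp (Y k) x)) \<longleftrightarrow> convergent (%k. rp (Y k) x)"
   using tendsto_cnj[of "%k. rp (Y k) x" _ sequentially] tendsto_cnj[of "%k. cnj (rp (Y k) x)" _ sequentially]
   unfolding convergent_def complex_cnj_cnj by blast
  show ?thesis
  proof (cases "convergent (%k. rp (Y k) x)")
   case True
   then have "(%k. rp (Y k) x) \<longlonglongrightarrow> lim (%k. rp (Y k) x)" by (simp add: convergent_LIMSEQ_iff)
   then have "(%k. cnj (rp (Y k) x)) \<longlonglongrightarrow> cnj (lim (%k. rp (Y k) x))" by (rule tendsto_cnj)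
   then show ?thesis using True c by (simp add: f_def e limI)
  qed (use c in "simp add: f_def e")
 qed
 have lim: "AE x in lborel. (%k. rp (Y k) x) \<longlonglongrightarrow> f x"
  using conv by (rule AE_mp) (auto simp: f_def convergent_LIMSEQ_iff)
 \<comment> \<open>Fatou's lemma in the second index passes the Cauchy estimate to the pointwise
   limit.\<close>
 have Ytail: "(\<integral>\<^sup>+x. ennreal ((norm (rp (Y k) x - f x))^2) \<partial>lborel) <= ennreal (((1/2)^k)^2)" for k
 proof -
  have "(\<integral>\<^sup>+x. ennreal ((norm (rp (Y k) x - f x))^2) \<partial>lborel)
    = (\<integral>\<^sup>+x. liminf (%j. ennreal ((norm (rp (Y k) x - rp (Y j) x))^2)) \<partial>lborel)"
  proof (rule nn_integral_cong_AE, use lim in eventually_elim)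
   case (elim x)
   then have "(%j. ennreal ((norm (rp (Y k) x - rp (Y j) x))^2)) \<longlonglongrightarrow> ennreal ((norm (rp (Y k) x - f x))^2)"
    by (intro tendsto_intros)
   then show ?case by (metis lim_imp_Liminf trivial_limit_sequentially)
  qed
  also have "... <= liminf (%j. \<integral>\<^sup>+x. ennreal ((norm (rp (Y k) x - rp (Y j) x))^2) \<partial>lborel)"
   by (rule nn_integral_liminf) simp
  also have "... = liminf (%j. ennreal ((norm (Y k - Y j))^2))"
  proof -
   have "(\<integral>\<^sup>+x. ennreal ((norm (rp (Y k) x - rp (Y j) x))^2) \<partial>lborel) = ennreal ((norm (Y k - Y j))^2)" for j
    unfolding norm_l2_nn using rp_diff[of "Y k" "Y j"] by (intro nn_integral_cong_AE) (auto elim!: AE_mp)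
   then show ?thesis by simp
  qed
  also have "... <= ennreal (((1/2)^k)^2)"
  proof -
   have "ennreal ((norm (Y k - Y j))^2) <= ennreal (((1/2)^k)^2)" if "k <= j" for j
    using r[where k=k and m="r k" and n="r j"] that strict_mono_less_eq[OF rS, of k j]
    by (intro ennreal_leI power_mono) (auto simp: Y_def)
   then have "liminf (%j. ennreal ((norm (Y k - Y j))^2)) <= liminf (%j::nat. ennreal (((1/2)^k)^2))"
    by (intro Liminf_mono) (auto simp: eventually_sequentially)
   then show ?thesis by (simp add: Liminf_const)
  qed
  finally show ?thesis .
 qed
 have D: "(%x. rp (Y k) x - f x) \<in> L2H & norm (mk (%x. rp (Y k) x - f x)) <= (1/2)^k" for k
  by (rule L2H_norm_leI) (use Ytail in "auto simp: fh rp_herm")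
 have fL: "f \<in> L2H"
  using L2H_add[OF rp_L2H[of "Y 0"] L2H_scaleR[of _ "-1"], OF conjunct1[OF D[of 0]]] by simp
 have "norm (Y k - mk f) <= (1/2)^k" for k
 proof -
  have "Y k - mk f = mk (%x. rp (Y k) x - f x)"
   using rp_diff[of "Y k" "mk f"] rp_mk[OF fL] rp_mk[OF conjunct1[OF D[of k]]]
   by (intro l2_eqI) (auto elim!: AE_mp)
  then show ?thesis using D[of k] by simp
 qed
 then have "(%k. Y k - mk f) \<longlonglongrightarrow> 0"
  by (rule Lim_null_comparison[OF always_eventually[rule_format] LIMSEQ_realpow_zero]) auto
 then have "Y \<longlonglongrightarrow> mk f" using LIM_zero_iff by blast
 then have "X \<longlonglongrightarrow> mk f" using Cauchy_converges_subseq[OF X rS] by (auto simp: Y_def)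
 then show "convergent X" by (auto simp: convergent_def)
qed

section \<open>Schwartz functions\<close>

lemma pderivative_eqI: "(f has_derivative f') (at x) ==> pd i f x = f' (axis i 1)"
 unfolding pderivative_def using frechet_derivative_at by metis

lemma has_derivative_pderivative:
 fixes f :: "real^'n::finite => 'b::real_normed_vector"
 assumes "f differentiable (at x)"
 shows "(f has_derivative (%v. \<Sum>i\<in>UNIV. (v $ i) *R pd i f x)) (at x)"
proof -
 let ?D = "frechet_derivative f (at x)"
 have D: "(f has_derivative ?D) (at x)" using assms frechet_derivative_works by blast
 interpret bounded_linear ?D using D by (rule has_derivative_bounded_linear)
 have "?D v = (\<Sum>i\<in>UNIV. (v $ i) *R pd i f x)" for v
 proof -
  have "?D v = ?D (\<Sum>i\<in>UNIV. (v $ i) *R axis i 1)"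
   using basis_expansion[of v] by (simp add: scalar_mult_eq_scaleR)
  then show ?thesis by (simp add: sum scaleR pderivative_def)
 qed
 then show ?thesis using D by presburger
qed

lemma sum_axis_scaleR [simp]: "(\<Sum>j\<in>UNIV. (axis i 1 $ j) *R X j) = (X i :: 'b::real_vector)"
 by (simp add: axis_def if_distrib[of "%u. u *R _"] cong: if_cong)

lemma pderivatives_Nil [simp]: "pderivatives [] f = f"
 and pderivatives_Cons [simp]: "pderivatives (i # is) f = pd i (pderivatives is f)"
 and pderivatives_append: "pderivatives (is @ js) f = pderivatives is (pderivatives js f)"
 by (simp_all add: pderivatives_def)

lemma differentiable_imp_continuous_on_UNIV:
 "(!!x. f differentiable (at x)) ==> continuous_on UNIV f"
 by (simp add: continuous_at_imp_continuous_on differentiable_imp_continuous_within)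

text \<open>All iterated derivatives stay in \<open>F\<close>, so smoothness and decay of every
  derivative follow from a single differentiation and the decay of the members of \<open>F\<close>.
  The closure proofs below only have to find a family stable under \<open>pd\<close>.\<close>

lemma schwartz_coinduct:
 assumes f: "f \<in> F"
  and step: "!!g. g \<in> F ==> (\<forall>x. g differentiable (at x)) & (\<forall>i. pd i g \<in> F) &
   (\<forall>N. \<exists>C. \<forall>x. (1 + norm x) ^ N * norm (g x) <= C)"
 shows "schwartz f"
proof -
 have p: "pderivatives is f \<in> F" for "is" by (induction "is") (use f step in auto)
 then have "!!is x. pderivatives is f differentiable (at x)" using step by blast
 then have "\<forall>k. class_C k f" unfolding class_C_def by (auto intro: differentiable_imp_continuous_on_UNIV)
 moreover have "bdd_above (range (%x. (1 + norm x) ^ N * norm (pderivatives is f x)))" for "is" N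
 proof -
  obtain C where "\<forall>x. (1 + norm x) ^ N * norm (pderivatives is f x) <= C" using step[OF p[of "is"]] by blast
  then show ?thesis by (intro bdd_aboveI2[where M=C]) auto
 qed
 ultimately show ?thesis by (simp add: schwartz_def)
qed

lemma schwartz_differentiable: "schwartz ph ==> ph differentiable (at x)"
proof -
 assume "schwartz ph"
 then have "class_C 1 ph" by (simp add: schwartz_def)
 then have "pderivatives [] ph differentiable (at x)" unfolding class_C_def by (metis list.size(3) zero_less_one)
 then show ?thesis by simp
qed

lemma schwartz_pderivative:
 assumes "schwartz ph" shows "schwartz (pd i ph)"
proof -
 have e: "pderivatives is (pd i ph) = pderivatives (is @ [i]) ph" for "is"
  by (simp add: pderivatives_append)
 have C: "class_C (Suc k) ph" for k using assms by (simp add: schwartz_def)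
 have "class_C k (pd i ph)" for k
  using C[of k] unfolding class_C_def e by auto
 moreover have "bdd_above (range (%x. (1 + norm x) ^ N * norm (pderivatives is ph x)))" for N "is"
  using assms unfolding schwartz_def by meson
 ultimately show ?thesis unfolding schwartz_def e by simp
qed

lemma schwartz_bounded: "schwartz ph ==> EX C>=0. \<forall>x. (1 + norm x) ^ N * norm (ph x) <= C"
proof -
 assume "schwartz ph"
 then have "bdd_above (range (%x. (1 + norm x) ^ N * norm (pderivatives [] ph x)))" unfolding schwartz_def by meson
 then obtain C where C: "!!x. (1 + norm x) ^ N * norm (ph x) <= C" by (auto simp: bdd_above_def)
 have "0 <= C" using order_trans[OF _ C[of 0]] by simp
 then show ?thesis using C by blast
qed

lemma schwartz_continuous: "schwartz ph ==> continuous_on UNIV ph"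
 by (simp add: differentiable_imp_continuous_on_UNIV schwartz_differentiable)

lemma schwartz_measurable: "schwartz ph ==> ph \<in> borel_measurable borel"
 by (intro borel_measurable_continuous_onI schwartz_continuous)

lemma schwartz_seminorm_upper:
 assumes "schwartz ph" shows "(1 + norm x) ^ N * norm (ph x) <= schwartz_seminorm N ph"
proof -
 have "(%(is, x). (1 + norm x) ^ N * norm (pderivatives is ph x)) ([], x) <= schwartz_seminorm N ph"
  unfolding schwartz_seminorm_def
  by (rule cSUP_upper[OF _ bdd_above_schwartz_seminorm[OF assms]]) simp
 then show ?thesis by simp
qed

lemma bound_add:
 fixes f g :: "'a => 'b::real_normed_vector"
 assumes "\<exists>C. \<forall>x. w x * norm (f x) <= C" "\<exists>C. \<forall>x. w x * norm (g x) <= C" "!!x. 0 <= (w x :: real)"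
 shows "\<exists>C. \<forall>x. w x * norm (f x + g x) <= C"
proof -
 obtain C D where "!!x. w x * norm (f x) <= C" "!!x. w x * norm (g x) <= D" using assms by blast
 then have "w x * norm (f x + g x) <= C + D" for x
  using mult_left_mono[OF norm_triangle_ineq[of "f x" "g x"] assms(3)[of x]]
  by (smt (verit) distrib_left)
 then show ?thesis by blast
qed

lemma pderivative_add:
 "f differentiable (at x) ==> g differentiable (at x) ==>
  pd i (%y. f y + g y) x = pd i f x + pd i g x"
 using pderivative_eqI[OF has_derivative_add[OF has_derivative_pderivative has_derivative_pderivative], of f x g i]
 by simp

lemma pderivative_cmult:
 fixes f :: "real^'n::finite => 'b::real_normed_algebra"
 assumes "f differentiable (at x)"
 shows "pd i (%y. c * f y) x = c * pd i f x"
 using pderivative_eqI[OF has_derivative_mult_right[OF has_derivative_pderivative[OF assms]], of i c]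
 by simp

lemma pderivative_mult:
 fixes f g :: "real^'n::finite => 'b::real_normed_algebra"
 assumes "f differentiable (at x)" "g differentiable (at x)"
 shows "pd i (%y. f y * g y) x = f x * pd i g x + pd i f x * g x"
 using pderivative_eqI[OF has_derivative_mult[OF has_derivative_pderivative[OF assms(1)] has_derivative_pderivative[OF assms(2)]], of i]
 by simp

lemma schwartz_add:
 assumes "schwartz ph" "schwartz psi" shows "schwartz (%x. ph x + psi x)"
proof (rule schwartz_coinduct[of _ "{%x. ph x + psi x |ph psi. schwartz ph & schwartz psi}"])
 show "(%x. ph x + psi x) \<in> {%x. ph x + psi x |ph psi. schwartz ph & schwartz psi}" using assms by blast
 fix g :: "real^'a => complex" assume "g \<in> {%x. ph x + psi x |ph psi. schwartz ph & schwartz psi}"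
 then obtain ph psi where g: "g = (%x. ph x + psi x)" and S: "schwartz ph" "schwartz psi" by blast
 have "pd i g = (%x. pd i ph x + pd i psi x)" for i
  unfolding g by (rule ext, rule pderivative_add) (use S schwartz_differentiable in blast)+
 then have "pd i g \<in> {%x. ph x + psi x |ph psi. schwartz ph & schwartz psi}" for i
  using S schwartz_pderivative by blast
 moreover have "\<exists>C. \<forall>x. (1 + norm x) ^ N * norm (g x) <= C" for N
  unfolding g by (rule bound_add) (use schwartz_bounded[OF S(1)] schwartz_bounded[OF S(2)] in "blast, blast, simp")
 ultimately show "(\<forall>x. g differentiable (at x)) & (\<forall>i. pd i g \<in> {%x. ph x + psi x |ph psi. schwartz ph & schwartz psi}) &
   (\<forall>N. \<exists>C. \<forall>x. (1 + norm x) ^ N * norm (g x) <= C)"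
  using S schwartz_differentiable unfolding g by (auto intro!: differentiable_add)
qed

lemma schwartz_cmult:
 assumes "schwartz ph" shows "schwartz (%x. c * ph x)"
proof (rule schwartz_coinduct[of _ "{%x. c * ph x |ph. schwartz ph}"])
 show "(%x. c * ph x) \<in> {%x. c * ph x |ph. schwartz ph}" using assms by blast
 fix g :: "real^'a => complex" assume "g \<in> {%x. c * ph x |ph. schwartz ph}"
 then obtain ph where g: "g = (%x. c * ph x)" and S: "schwartz ph" by blast
 have "pd i g = (%x. c * pd i ph x)" for i
  unfolding g by (rule ext, rule pderivative_cmult) (use S schwartz_differentiable in blast)
 then have "pd i g \<in> {%x. c * ph x |ph. schwartz ph}" for i
  using S schwartz_pderivative by blast
 moreover have "\<exists>C. \<forall>x. (1 + norm x) ^ N * norm (g x) <= C" for N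
 proof -
  obtain C where "!!x. (1 + norm x) ^ N * norm (ph x) <= C" using schwartz_bounded[OF S] by blast
  then have "(1 + norm x) ^ N * norm (g x) <= norm c * C" for x
   using mult_left_mono[of "(1 + norm x) ^ N * norm (ph x)" C "norm c"] by (simp add: g norm_mult mult_ac)
  then show ?thesis by blast
 qed
 ultimately show "(\<forall>x. g differentiable (at x)) & (\<forall>i. pd i g \<in> {%x. c * ph x |ph. schwartz ph}) &
   (\<forall>N. \<exists>C. \<forall>x. (1 + norm x) ^ N * norm (g x) <= C)"
  using S schwartz_differentiable unfolding g by (auto intro!: differentiable_mult)
qed

lemma has_derivative_coord: "((%x. cor (x $ i)) has_derivative (%v. cor (v $ i))) (at x)"
 by (rule bounded_linear_imp_has_derivative, rule bounded_linear_compose[OF bounded_linear_of_real bounded_linear_vec_nth])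

lemma differentiable_coord: "(%x. cor (x $ i)) differentiable (at x)"
 using has_derivative_coord by (rule differentiableI)

lemma pderivative_coord: "pd j (%x. cor (x $ i)) x = (if i = j then 1 else 0)"
 by (simp add: pderivative_eqI[OF has_derivative_coord] axis_def)

lemma coord_bound:
 assumes "\<exists>C. \<forall>x. (1 + norm x) ^ Suc N * norm (ph x) <= C"
 shows "\<exists>C. \<forall>x. (1 + norm x) ^ N * norm (cor (x $ i) * ph x) <= C"
proof -
 obtain C where C: "!!x. (1 + norm x) ^ Suc N * norm (ph x) <= C" using assms by blast
 have "(1 + norm x) ^ N * norm (cor (x $ i) * ph x) <= C" for x
 proof -
  have "\<bar>x $ i\<bar> <= 1 + norm x" using component_le_norm_cart[of x i] by simp
  then have "(1 + norm x) ^ N * norm (cor (x $ i) * ph x) <= (1 + norm x) ^ N * ((1 + norm x) * norm (ph x))"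
   by (intro mult_left_mono) (auto simp: norm_mult intro: mult_right_mono)
  also have "... <= C" using C[of x] by (simp add: mult_ac)
  finally show ?thesis .
 qed
 then show ?thesis by blast
qed

text \<open>The summand \<open>psi\<close> in the family absorbs the term in which the coordinate is
  differentiated.\<close>

lemma schwartz_coord:
 assumes "schwartz ph" shows "schwartz (%x. cor (x $ i) * ph x)"
proof -
 let ?F = "{%x. cor (x $ i) * ph x + psi x |ph psi. schwartz ph & schwartz psi}"
 have z: "schwartz (%x::real^'a. 0)" using schwartz_cmult[OF assms, of 0] by simp
 show ?thesis
 proof (rule schwartz_coinduct[of _ ?F])
  show "(%x. cor (x $ i) * ph x) \<in> ?F"
   by (rule CollectI, rule exI[of _ ph], rule exI[of _ "%_. 0"]) (simp add: assms z)
  fix g assume "g \<in> ?F"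
  then obtain ph psi where g: "g = (%x. cor (x $ i) * ph x + psi x)" and S: "schwartz ph" "schwartz psi" by blast
  note d = schwartz_differentiable[OF S(1)] schwartz_differentiable[OF S(2)]
  have "pd j g = (%x. cor (x $ i) * pd j ph x + ((if i = j then 1 else 0) * ph x + pd j psi x))" for j
   unfolding g by (rule ext, subst pderivative_add)
    (auto simp: pderivative_mult differentiable_coord pderivative_coord d intro!: differentiable_mult)
  moreover have "schwartz (%x. (if i = j then 1 else 0) * ph x + pd j psi x)" for j
   by (intro schwartz_add schwartz_cmult schwartz_pderivative S)
  ultimately have "pd j g \<in> ?F" for j
   by (intro CollectI exI[of _ "pd j ph"] exI[of _ "%x. (if i = j then 1 else 0) * ph x + pd j psi x"])
     (simp add: schwartz_pderivative S)
  moreover have "\<exists>C. \<forall>x. (1 + norm x) ^ N * norm (g x) <= C" for N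
   unfolding g by (rule bound_add, rule coord_bound)
     (use schwartz_bounded[OF S(1), of "Suc N"] schwartz_bounded[OF S(2), of N] in auto)
  ultimately show "(\<forall>x. g differentiable (at x)) & (\<forall>i. pd i g \<in> ?F) &
    (\<forall>N. \<exists>C. \<forall>x. (1 + norm x) ^ N * norm (g x) <= C)"
   using d unfolding g by (auto intro!: differentiable_add differentiable_mult differentiable_coord)
 qed
qed

lemma bracket_pos: "0 < bracket x" and bracket_ge1: "1 <= bracket x"
 by (auto simp: bracket_def add_pos_nonneg)

lemma bracket_le: "bracket x <= 1 + norm x"
 unfolding bracket_def by (rule real_le_lsqrt) (auto simp: power2_sum)

lemma norm_le_bracket: "norm x <= bracket x"
 unfolding bracket_def by (rule real_le_rsqrt) auto

lemma le_bracket: "1 + norm x <= 2 * bracket x"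
 using norm_le_bracket[of x] bracket_ge1[of x] by simp

lemma bracket_continuous [continuous_intros]: "continuous_on S bracket"
 unfolding bracket_def by (intro continuous_intros)

lemma bracket_measurable [measurable]: "bracket \<in> borel_measurable borel"
 by (intro borel_measurable_continuous_onI continuous_intros)

lemma bracket_uminus [simp]: "bracket (- x) = bracket x"
 by (simp add: bracket_def)

lemma bracket_powr: "bracket x powr p = (1 + x \<bullet> x) powr (p / 2)"
 unfolding bracket_def power2_norm_eq_inner
 by (subst powr_half_sqrt[symmetric]) (auto simp: powr_powr add_nonneg_nonneg)

lemma has_derivative_bracket_powr:
 "((%x. bracket x powr p) has_derivative (%v. p * bracket x powr (p - 2) * (x \<bullet> v))) (at x)"
proof -
 have pos: "0 < 1 + x \<bullet> x" for x :: "real^'a" by (simp add: add_pos_nonneg)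
 have "((%x. (1 + x \<bullet> x) powr (p / 2)) has_derivative
   (%v. (1 + x \<bullet> x) powr (p / 2) * (0 * ln (1 + x \<bullet> x) + (0 + (x \<bullet> v + v \<bullet> x)) * (p / 2) / (1 + x \<bullet> x)))) (at x)"
  by (intro derivative_intros) (use pos in auto)
 moreover have "(1 + x \<bullet> x) powr (p / 2) / (1 + x \<bullet> x) = bracket x powr (p - 2)"
  using pos[of x] by (simp add: bracket_powr diff_divide_distrib powr_diff)
 moreover have "(%v. (1 + x \<bullet> x) powr (p / 2) * (0 * ln (1 + x \<bullet> x) + (0 + (x \<bullet> v + v \<bullet> x)) * (p / 2) / (1 + x \<bullet> x)))
   = (%v. p * ((1 + x \<bullet> x) powr (p / 2) / (1 + x \<bullet> x)) * (x \<bullet> v))"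
  by (simp add: fun_eq_iff inner_commute)
 ultimately show ?thesis by (simp add: bracket_powr)
qed

lemma bracket_powr_bound: "bracket x powr p <= (1 + norm x) ^ nat \<lceil>\<bar>p\<bar>\<rceil>"
proof -
 have "bracket x powr p <= bracket x powr real (nat \<lceil>\<bar>p\<bar>\<rceil>)"
  using bracket_ge1 by (intro powr_mono) (auto, linarith)
 also have "... = bracket x ^ nat \<lceil>\<bar>p\<bar>\<rceil>" by (rule powr_realpow[OF bracket_pos])
 also have "... <= (1 + norm x) ^ nat \<lceil>\<bar>p\<bar>\<rceil>"
  by (intro power_mono bracket_le) (use bracket_pos less_imp_le in auto)
 finally show ?thesis .
qed

text \<open>The exponent has to vary, because differentiating the weight lowers it by 2, and sums
  are included because the product rule yields two terms.\<close>

inductive_set weighted_schwartz :: "(real^'n::finite => complex) set" where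
 base: "schwartz ph ==> (%x. cor (bracket x powr p) * ph x) \<in> weighted_schwartz"
| add: "f \<in> weighted_schwartz ==> g \<in> weighted_schwartz ==> (%x. f x + g x) \<in> weighted_schwartz"

lemma schwartz_bracket_powr:
 assumes "schwartz (ph :: real^'n::finite => complex)" shows "schwartz (%x. cor (bracket x powr p) * ph x)"
proof (rule schwartz_coinduct[OF weighted_schwartz.base[OF assms]])
 fix g :: "real^'n => complex" assume "g \<in> weighted_schwartz"
 then show "(\<forall>x. g differentiable (at x)) & (\<forall>i. pd i g \<in> weighted_schwartz) &
    (\<forall>N. \<exists>C. \<forall>x. (1 + norm x) ^ N * norm (g x) <= C)"
 proof induction
  case (base ph p)
  have d: "((%x. cor (bracket x powr p)) has_derivative (%v. cor (p * bracket x powr (p - 2) * (x \<bullet> v)))) (at x)" for x :: "real^'n"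
   by (intro has_derivative_of_real has_derivative_bracket_powr)
  note dd = differentiableI[OF d] schwartz_differentiable[OF base]
  have "pd i (%x. cor (bracket x powr p) * ph x) =
    (%x. cor (bracket x powr p) * pd i ph x
     + cor (bracket x powr (p - 2)) * (cor p * (cor (x $ i) * ph x)))" for i
   by (rule ext, subst pderivative_mult[OF dd]) (simp add: pderivative_eqI[OF d] inner_axis mult_ac)
  then have "pd i (%x. cor (bracket x powr p) * ph x) \<in> weighted_schwartz" for i
   by (simp only:) (intro weighted_schwartz.intros schwartz_cmult schwartz_coord schwartz_pderivative base)
  moreover have "\<exists>C. \<forall>x. (1 + norm x) ^ N * norm (cor (bracket x powr p) * ph x) <= C" for N
  proof -
   obtain C where C: "!!x. (1 + norm x) ^ (N + nat \<lceil>\<bar>p\<bar>\<rceil>) * norm (ph x) <= C" using schwartz_bounded[OF base] by blast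
   have "(1 + norm x) ^ N * norm (cor (bracket x powr p) * ph x) <= C" for x
   proof -
    have "(1 + norm x) ^ N * norm (cor (bracket x powr p) * ph x)
     <= (1 + norm x) ^ N * ((1 + norm x) ^ nat \<lceil>\<bar>p\<bar>\<rceil> * norm (ph x))"
     using bracket_powr_bound[of x p] by (intro mult_left_mono) (auto simp: norm_mult intro: mult_right_mono)
    also have "... <= C" using C[of x] by (simp add: power_add mult_ac)
    finally show ?thesis .
   qed
   then show ?thesis by blast
  qed
  ultimately show ?case using dd by (auto intro!: differentiable_mult)
 next
  case (add f g)
  then have "pd i (%x. f x + g x) = (%x. pd i f x + pd i g x)" for i
   by (intro ext pderivative_add) auto
  then show ?case using add by (auto intro!: differentiable_add weighted_schwartz.add bound_add)
 qed
qed

lemma schwartz_affine: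
 assumes "schwartz (ph :: real^'n::finite => complex)" and a: "a ~= 0"
 shows "schwartz (%x. ph (b + a *R x))"
proof -
 let ?F = "{%x. c * ph (b + a *R x) |ph c. schwartz ph}"
 show ?thesis
 proof (rule schwartz_coinduct[of _ ?F])
  show "(%x. ph (b + a *R x)) \<in> ?F" using assms by (auto intro!: exI[of _ ph] exI[of _ 1])
  fix g assume "g \<in> ?F"
  then obtain ph c where g: "g = (%x. c * ph (b + a *R x))" and S: "schwartz ph" by blast
  have d: "(g has_derivative (%v. c * (\<Sum>i\<in>UNIV. ((a *R v) $ i) *R pd i ph (b + a *R x)))) (at x)" for x
   unfolding g
   by (rule has_derivative_mult_right)
     (rule has_derivative_compose[OF _ has_derivative_pderivative[OF schwartz_differentiable[OF S]], of "%x. b + a *R x" "%v. a *R v"],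
     auto intro!: derivative_eq_intros)
  have "pd i g = (%x. (c * cor a) * pd i ph (b + a *R x))" for i
  proof
   fix x
   have "(\<Sum>j\<in>UNIV. ((a *R axis i 1) $ j) *R pd j ph (b + a *R x)) = a *R pd i ph (b + a *R x)"
    by (simp add: axis_def if_distrib[of "%u. u *R _"] if_distrib[of "(*) _"] cong: if_cong)
   then show "pd i g x = (c * cor a) * pd i ph (b + a *R x)"
    using pderivative_eqI[OF d] by (simp add: scaleR_conv_of_real)
  qed
  then have "pd i g \<in> ?F" for i using schwartz_pderivative[OF S] by blast
  moreover have "\<exists>C. \<forall>x. (1 + norm x) ^ N * norm (g x) <= C" for N
  proof -
   obtain C where C: "!!x. (1 + norm x) ^ N * norm (ph x) <= C" "0 <= C" using schwartz_bounded[OF S] by blast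
   \<comment> \<open>The factor in \<open>1 + norm x <= M * (1 + norm (b + a *R x))\<close>, which
     converts decay in the image point into decay in \<open>x\<close>.\<close>
   define M where "M = 1 + norm b / \<bar>a\<bar> + 1 / \<bar>a\<bar>"
   have M0: "0 <= M" by (simp add: M_def)
   have "(1 + norm x) ^ N * norm (g x) <= M ^ N * norm c * C" for x
   proof -
    have "\<bar>a\<bar> * norm x <= norm (b + a *R x) + norm b"
     using norm_triangle_ineq4[of "b + a *R x" b] by simp
    then have "norm x <= norm (b + a *R x) / \<bar>a\<bar> + norm b / \<bar>a\<bar>" using a by (simp add: field_simps)
    moreover have "norm (b + a *R x) / \<bar>a\<bar> <= (1 / \<bar>a\<bar>) * norm (b + a *R x)" by simp
    moreover have "M * (1 + norm (b + a *R x)) = M + (1 + norm b / \<bar>a\<bar>) * norm (b + a *R x) + (1 / \<bar>a\<bar>) * norm (b + a *R x)"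
     by (simp add: M_def algebra_simps add_divide_distrib)
    moreover have "0 <= (1 + norm b / \<bar>a\<bar>) * norm (b + a *R x)" "0 <= 1 / \<bar>a\<bar>" by simp_all
    ultimately have "1 + norm x <= M * (1 + norm (b + a *R x))" unfolding M_def by linarith
    then have "(1 + norm x) ^ N <= M ^ N * (1 + norm (b + a *R x)) ^ N"
     by (simp flip: power_mult_distrib) (rule power_mono, auto)
    then have "(1 + norm x) ^ N * norm (g x) <= (M ^ N * (1 + norm (b + a *R x)) ^ N) * (norm c * norm (ph (b + a *R x)))"
     by (simp add: g norm_mult mult_right_mono)
    also have "... = M ^ N * norm c * ((1 + norm (b + a *R x)) ^ N * norm (ph (b + a *R x)))" by simp
    also have "... <= M ^ N * norm c * C" using C M0 by (intro mult_left_mono) auto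
    finally show ?thesis .
   qed
   then show ?thesis by blast
  qed
  ultimately show "(\<forall>x. g differentiable (at x)) & (\<forall>i. pd i g \<in> ?F) &
    (\<forall>N. \<exists>C. \<forall>x. (1 + norm x) ^ N * norm (g x) <= C)"
   using d by (auto intro!: differentiableI)
 qed
qed

inductive_set schwartz_products :: "(real^'n::finite => complex) set" where
 base: "schwartz ph ==> schwartz psi ==> (%x. ph x * psi x) \<in> schwartz_products"
| add: "f \<in> schwartz_products ==> g \<in> schwartz_products ==> (%x. f x + g x) \<in> schwartz_products"

lemma schwartz_mult:
 assumes "schwartz (ph :: real^'n::finite => complex)" "schwartz psi" shows "schwartz (%x. ph x * psi x)"
proof (rule schwartz_coinduct[OF schwartz_products.base[OF assms]])
 fix g :: "real^'n => complex" assume "g \<in> schwartz_products"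
 then show "(\<forall>x. g differentiable (at x)) & (\<forall>i. pd i g \<in> schwartz_products) &
    (\<forall>N. \<exists>C. \<forall>x. (1 + norm x) ^ N * norm (g x) <= C)"
 proof induction
  case (base ph psi)
  note dd = schwartz_differentiable[OF base(1)] schwartz_differentiable[OF base(2)]
  have "pd i (%x. ph x * psi x) =
    (%x. ph x * pd i psi x + pd i ph x * psi x)" for i
   by (rule ext, rule pderivative_mult[OF dd])
  then have "pd i (%x. ph x * psi x) \<in> schwartz_products" for i
   by (simp only:) (intro schwartz_products.intros schwartz_pderivative base)
  moreover have "\<exists>C. \<forall>x. (1 + norm x) ^ N * norm (ph x * psi x) <= C" for N
  proof -
   obtain C where C: "!!x. (1 + norm x) ^ N * norm (ph x) <= C" "0 <= C" using schwartz_bounded[OF base(1)] by blast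
   obtain D where D: "!!x. (1 + norm x) ^ 0 * norm (psi x) <= D" using schwartz_bounded[OF base(2)] by blast
   have "(1 + norm x) ^ N * norm (ph x * psi x) <= C * D" for x
    using mult_mono[OF C(1)[of x] D[of x] C(2)] by (simp add: norm_mult mult_ac)
   then show ?thesis by blast
  qed
  ultimately show ?case using dd by (auto intro!: differentiable_mult)
 next
  case (add f g)
  then have "pd i (%x. f x + g x) = (%x. pd i f x + pd i g x)" for i
   by (intro ext pderivative_add) auto
  then show ?case using add by (auto intro!: differentiable_add schwartz_products.add bound_add)
 qed
qed

lemma has_derivative_osc:
 "((%x. exp (\<i> * cor (x \<bullet> et))) has_derivative
   (%v. \<i> * cor (v \<bullet> et) * exp (\<i> * cor (x \<bullet> et)))) (at x)"
proof -
 have "((%x. \<i> * cor (x \<bullet> et)) has_derivative (%v. \<i> * cor (v \<bullet> et))) (at x)"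
  by (intro has_derivative_mult_right has_derivative_of_real has_derivative_inner_left has_derivative_ident)
 from has_derivative_compose[OF this DERIV_exp[unfolded has_field_derivative_def]]
 show ?thesis by (simp add: mult.commute)
qed

lemma schwartz_modulate:
 assumes "schwartz (ph :: real^'n::finite => complex)"
 shows "schwartz (%x. exp (\<i> * cor (x \<bullet> et)) * ph x)"
proof -
 let ?e = "%x. exp (\<i> * cor (x \<bullet> et))"
 let ?F = "{%x. ?e x * ph x |ph. schwartz ph}"
 show ?thesis
 proof (rule schwartz_coinduct[of _ ?F])
  show "(%x. ?e x * ph x) \<in> ?F" using assms by blast
  fix g assume "g \<in> ?F"
  then obtain ph where g: "g = (%x. ?e x * ph x)" and S: "schwartz ph" by blast
  note dd = differentiableI[OF has_derivative_osc] schwartz_differentiable[OF S]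
  have "pd i g = (%x. ?e x * (pd i ph x + (\<i> * cor (et $ i)) * ph x))" for i
   unfolding g by (rule ext, subst pderivative_mult[OF dd])
    (simp add: pderivative_eqI[OF has_derivative_osc] inner_axis' algebra_simps)
  moreover have "schwartz (%x. pd i ph x + (\<i> * cor (et $ i)) * ph x)" for i
   by (intro schwartz_add schwartz_cmult schwartz_pderivative S)
  ultimately have "pd i g \<in> ?F" for i
   by (intro CollectI exI[of _ "%x. pd i ph x + (\<i> * cor (et $ i)) * ph x"]) simp
  moreover have "\<exists>C. \<forall>x. (1 + norm x) ^ N * norm (g x) <= C" for N
   using schwartz_bounded[OF S, of N] by (auto simp: g norm_mult)
  ultimately show "(\<forall>x. g differentiable (at x)) & (\<forall>i. pd i g \<in> ?F) &
    (\<forall>N. \<exists>C. \<forall>x. (1 + norm x) ^ N * norm (g x) <= C)"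
   using dd unfolding g by (auto intro!: differentiable_mult)
 qed
qed

definition gauss :: "real^'n::finite => complex" where
 "gauss x = cor (exp (- (x \<bullet> x) / 2))"

lemma has_derivative_gauss: "(gauss has_derivative (%v. cor (- (x \<bullet> v)) * gauss x)) (at x)"
 unfolding gauss_def of_real_mult[symmetric]
 by (rule has_derivative_of_real) (auto intro!: derivative_eq_intros simp: fun_eq_iff inner_commute)

inductive_set gauss_polys :: "(real^'n::finite => complex) set" where
 base: "gauss \<in> gauss_polys"
| coord: "f \<in> gauss_polys ==> (%x. cor (x $ i) * f x) \<in> gauss_polys"
| add: "f \<in> gauss_polys ==> g \<in> gauss_polys ==> (%x. f x + g x) \<in> gauss_polys"
| cmult: "f \<in> gauss_polys ==> (%x. c * f x) \<in> gauss_polys"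

text \<open>One term of the exponential series bounds the polynomial by N! exp (1 + |x|), and (|x| -
  1)^2 \<ge> 0 bounds the Gaussian by exp (1/2 - |x|); the exponents add up to 3/2.\<close>

lemma gauss_bounded: "\<exists>C. \<forall>x::real^'n::finite. (1 + norm x) ^ N * norm (gauss x) <= C"
proof -
 have "(1 + norm x) ^ N * norm (gauss x) <= fact N * exp (3/2)" for x :: "real^'n"
 proof -
  have "(1 + norm x) ^ N /\<^sub>R fact N <= exp (1 + norm x)"
   unfolding exp_def by (rule sum_le_suminf[of _ "{N}", simplified]) (auto simp: summable_exp)
  then have a: "(1 + norm x) ^ N <= fact N * exp (1 + norm x)" by (simp add: field_simps)
  have "0 <= (norm x - 1)^2" by simp
  then have "- (x \<bullet> x) / 2 <= 1/2 - norm x" by (simp add: power2_eq_square norm_eq_sqrt_inner algebra_simps)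
  then have b: "norm (gauss x) <= exp (1/2 - norm x)" by (simp add: gauss_def)
  have "(1 + norm x) ^ N * norm (gauss x) <= fact N * exp (1 + norm x) * exp (1/2 - norm x)"
   by (rule mult_mono[OF a b]) auto
  also have "... = fact N * exp (3/2)" by (simp add: mult.assoc flip: exp_add)
  finally show ?thesis .
 qed
 then show ?thesis by blast
qed

lemma schwartz_gauss: "schwartz (gauss :: real^'n::finite => complex)"
proof (rule schwartz_coinduct[OF gauss_polys.base])
 fix g :: "real^'n => complex" assume "g \<in> gauss_polys"
 then show "(\<forall>x. g differentiable (at x)) & (\<forall>i. pd i g \<in> gauss_polys) &
    (\<forall>N. \<exists>C. \<forall>x. (1 + norm x) ^ N * norm (g x) <= C)"
 proof induction
  case base
  have "pd i (gauss :: real^'n => complex) = (%x. (-1) * (cor (x $ i) * gauss x))" for i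
   by (rule ext) (simp add: pderivative_eqI[OF has_derivative_gauss] inner_axis)
  then show ?case using gauss_bounded differentiableI[OF has_derivative_gauss]
   by (auto simp only: intro!: gauss_polys.intros)
 next
  case (coord f j)
  have "pd i (%x. cor (x $ j) * f x) =
    (%x. cor (x $ j) * pd i f x + (if j = i then 1 else 0) * f x)" for i
   by (rule ext, subst pderivative_mult[OF differentiable_coord]) (use coord in "auto simp: pderivative_coord")
  then have "pd i (%x. cor (x $ j) * f x) \<in> gauss_polys" for i
   using coord by (simp only:) (intro gauss_polys.intros, auto)
  then show ?case using coord by (auto intro!: differentiable_mult differentiable_coord coord_bound simp del: power_Suc)
 next
  case (add f g)
  then have "pd i (%x. f x + g x) = (%x. pd i f x + pd i g x)" for i
   by (intro ext pderivative_add) auto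
  then show ?case using add by (auto intro!: differentiable_add gauss_polys.add bound_add)
 next
  case (cmult f c)
  then have "pd i (%x. c * f x) = (%x. c * pd i f x)" for i
   by (intro ext pderivative_cmult) auto
  moreover have "\<exists>C. \<forall>x. (1 + norm x) ^ N * norm (c * f x) <= C" for N
  proof -
   obtain C where "!!x. (1 + norm x) ^ N * norm (f x) <= C" using cmult by blast
   then have "(1 + norm x) ^ N * norm (c * f x) <= norm c * C" for x
    using mult_left_mono[of "(1 + norm x) ^ N * norm (f x)" C "norm c"] by (simp add: norm_mult mult_ac)
   then show ?thesis by blast
  qed
  ultimately show ?case using cmult by (auto intro!: differentiable_mult gauss_polys.cmult)
 qed
qed

section \<open>The Fourier transform on Schwartz functions\<close>

text \<open>Dyadic comparison: if 2^k \<le> 1 + |x| < 2^(k+1), the integrand is at most 2^(-pk) and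
  x lies in a ball of radius 2^(k+1). The volumes leave a geometric series with ratio
  2^(n-p).\<close>

lemma integrable_one_plus_norm_powr:
 fixes p :: real
 assumes p: "p > real DIM('a::euclidean_space)"
 shows "integrable lborel (%x::'a. (1 + norm x) powr (- p))"
proof (rule integrableI_bounded)
 let ?n = "DIM('a)"
 let ?V = "unit_ball_vol (real ?n)"
 let ?f = "%k x::'a. ennreal (2 powr (- (p * real k))) * indicator (cball 0 (2 ^ Suc k)) x"
 have V: "0 <= ?V" by (simp add: unit_ball_vol_nonneg)
 have le: "(\<integral>\<^sup>+x. ennreal (norm ((1 + norm (x::'a)) powr (- p))) \<partial>lborel) <= (\<integral>\<^sup>+x. (\<Sum>k. ?f k x) \<partial>lborel)"
 proof (rule nn_integral_mono)
  fix x :: 'a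
  define k where "k = nat \<lfloor>log 2 (1 + norm x)\<rfloor>"
  have l0: "0 <= log 2 (1 + norm x)" by (subst zero_le_log_cancel_iff) (auto simp: add_pos_nonneg)
  have k1: "real k <= log 2 (1 + norm x)" "log 2 (1 + norm x) < real k + 1"
   using l0 by (simp_all add: k_def)
  have a: "2 powr real k <= 1 + norm x"
   using k1(1) by (simp add: le_log_iff add_pos_nonneg)
  have "1 + norm x < 2 powr (real k + 1)"
   using k1(2) by (simp add: log_less_iff add_pos_nonneg)
  also have "2 powr (real k + 1) = (2::real) ^ Suc k"
   using powr_realpow[of 2 "Suc k"] by (simp add: add.commute)
  finally have b: "x \<in> cball 0 (2 ^ Suc k)" by simp
  have "(1 + norm x) powr (- p) <= (2 powr real k) powr (- p)"
   by (rule powr_mono2') (use a p in auto)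
  then have "ennreal (norm ((1 + norm x) powr (- p))) <= ?f k x"
   using b by (simp add: powr_powr mult.commute ennreal_leI)
  also have "... = (\<Sum>i\<in>{k}. ?f i x)"
   by (simp only: sum.insert[OF finite.emptyI] empty_iff not_False_eq_True sum.empty add_0_right)
  also have "... <= (\<Sum>k. ?f k x)" by (rule sum_le_suminf) auto
  finally show "ennreal (norm ((1 + norm x) powr (- p))) <= (\<Sum>k. ?f k x)" .
 qed
 have sum: "(\<integral>\<^sup>+x. (\<Sum>k. ?f k x) \<partial>lborel) = (\<Sum>k. \<integral>\<^sup>+x. ?f k x \<partial>lborel)"
  by (rule nn_integral_suminf) (intro borel_measurable_times_ennreal borel_measurable_const borel_measurable_indicator, simp)
 have int: "(\<integral>\<^sup>+x. ?f k x \<partial>lborel) = ennreal (?V * 2 ^ ?n * (2 powr (real ?n - p)) ^ k)" for k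
 proof -
  have "(\<integral>\<^sup>+x. ?f k x \<partial>lborel) = ennreal (2 powr (- (p * real k))) * ennreal (?V * (2 ^ Suc k) ^ ?n)"
   by (subst nn_integral_cmult_indicator) (auto simp: emeasure_cball)
  also have "... = ennreal (2 powr (- (p * real k)) * (?V * (2 ^ Suc k) ^ ?n))"
   by (rule ennreal_mult[symmetric]) (use V in auto)
  also have "2 powr (- (p * real k)) * (?V * (2 ^ Suc k) ^ ?n) = ?V * 2 ^ ?n * (2 powr (real ?n - p)) ^ k"
  proof -
   have "(2 powr (real ?n - p)) ^ k = 2 powr ((real ?n - p) * real k)"
    by (subst powr_realpow[symmetric]) (auto simp: powr_powr)
   also have "... = 2 powr (real ?n * real k) * 2 powr (- (p * real k))"
    by (simp add: left_diff_distrib powr_diff powr_minus divide_inverse)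
   also have "2 powr (real ?n * real k) = (2::real) ^ (?n * k)"
    using powr_realpow[of 2 "?n * k"] by simp
   finally show ?thesis by (simp add: power_mult_distrib power_mult[symmetric] mult_ac)
  qed
  finally show "(\<integral>\<^sup>+x. ?f k x \<partial>lborel) = ennreal (?V * 2 ^ ?n * (2 powr (real ?n - p)) ^ k)" .
 qed
 have geo: "(\<Sum>k. ennreal (?V * 2 ^ ?n * (2 powr (real ?n - p)) ^ k)) = ennreal (\<Sum>k. ?V * 2 ^ ?n * (2 powr (real ?n - p)) ^ k)"
 proof (rule suminf_ennreal2)
  have "2 powr (real ?n - p) < 2 powr 0" using p by (intro powr_less_mono) auto
  then show "summable (%k. ?V * 2 ^ ?n * (2 powr (real ?n - p)) ^ k)"
   by (intro summable_mult summable_geometric) simp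
 qed (use V in auto)
 show "(\<integral>\<^sup>+x. ennreal (norm ((1 + norm (x::'a)) powr (- p))) \<partial>lborel) < \<infinity>"
  by (rule le_less_trans[OF le]) (simp only: sum int geo ennreal_less_top infinity_ennreal_def)
qed simp

lemma integrable_inverse_power:
 assumes "N > DIM('a::euclidean_space)"
 shows "integrable lborel (%x::'a. inverse ((1 + norm x) ^ N))"
proof -
 have "inverse ((1 + norm x) ^ N) = (1 + norm x) powr (- real N)" for x :: 'a
  by (simp add: powr_minus powr_realpow add_pos_nonneg)
 then show ?thesis using integrable_one_plus_norm_powr[of "real N"] assms by simp
qed

lemma integrable_decay:
 fixes f :: "real^'n::finite => 'b::{banach, second_countable_topology}"
 assumes [measurable]: "f \<in> borel_measurable borel"
  and C: "!!x. (1 + norm x) ^ Suc CARD('n) * norm (f x) <= C"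
 shows "integrable lborel f"
  and "(LINT x|lborel. norm (f x)) <= C * (LINT x::real^'n|lborel. inverse ((1 + norm x) ^ Suc CARD('n)))"
proof -
 have b: "norm (f x) <= C * inverse ((1 + norm x) ^ Suc CARD('n))" for x
  using C[of x] by (simp add: field_simps add_pos_nonneg)
 have i: "integrable lborel (%x::real^'n. inverse ((1 + norm x) ^ Suc CARD('n)))"
  by (rule integrable_inverse_power) simp
 show f: "integrable lborel f"
  by (rule Bochner_Integration.integrable_bound[of _ "%x. C * inverse ((1 + norm x) ^ Suc CARD('n))"])
    (use i b abs_ge_self order_trans in "auto simp del: power_Suc, blast?")
 have "(LINT x|lborel. norm (f x)) <= (LINT x::real^'n|lborel. C * inverse ((1 + norm x) ^ Suc CARD('n)))"
  by (rule integral_mono) (use f i b in auto)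
 then show "(LINT x|lborel. norm (f x)) <= C * (LINT x::real^'n|lborel. inverse ((1 + norm x) ^ Suc CARD('n)))" by simp
qed

lemma schwartz_integrable: "schwartz (ph :: real^'n::finite => complex) ==> integrable lborel ph"
 using schwartz_bounded[of ph "Suc CARD('n)"] integrable_decay(1)[of ph] schwartz_measurable by blast

text \<open>Synthesis of a field from its frequency density, hence the positive sign in the
  exponent; \<open>fourier\<close> is the reflection of it.\<close>

definition osc :: "(real^'n::finite => complex) => real^'n => complex" where
 "osc f x = (LINT xi|lborel. exp (\<i> * cor (xi \<bullet> x)) * f xi)"

lemma fourier_osc: "fourier f xi = osc f (- xi)"
 by (simp add: fourier_def osc_def)

lemma norm_exp_i [simp]: "norm (exp (\<i> * cor r)) = 1"
 by simp

lemma exp_i_meas [measurable]: "(%xi::real^'n::finite. exp (\<i> * cor (xi \<bullet> x))) \<in> borel_measurable borel"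
 by (intro borel_measurable_continuous_onI continuous_intros)

lemma osc_integrable: "integrable lborel f ==> integrable lborel (%xi. exp (\<i> * cor (xi \<bullet> x)) * f xi)"
 by (rule Bochner_Integration.integrable_bound[of _ f]) (auto simp: norm_mult borel_measurable_integrable)

lemma osc_bound: "integrable lborel f ==> norm (osc f x) <= (LINT xi|lborel. norm (f xi))"
 unfolding osc_def
 by (rule order_trans[OF integral_norm_bound]) (simp add: norm_mult)

lemma norm_exp_i_sub_one: "norm (exp (\<i> * cor y) - 1) <= \<bar>y\<bar>"
 using Taylor_exp[of "\<i> * cor y" 0] by (simp add: norm_mult)

lemma norm_exp_i_taylor: "norm (exp (\<i> * cor y) - 1 - \<i> * cor y) <= y^2"
 using Taylor_exp[of "\<i> * cor y" 1]
 by (simp add: norm_mult power2_eq_square algebra_simps abs_mult_self_eq flip: diff_diff_eq)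

text \<open>Dominated convergence along an arbitrary sequence of increments: the remainder of the
  exponential, divided by the length of the increment, is at most \<open>2 * norm xi\<close>, and at
  fixed \<open>xi\<close> it is at most \<open>(norm xi)^2\<close> times that length.\<close>

lemma has_derivative_osc_integral:
 assumes f: "integrable lborel f" and g: "integrable lborel (%xi. norm xi * norm (f xi))"
 shows "(osc f has_derivative (%v. osc (%xi. \<i> * cor (xi \<bullet> v) * f xi) x)) (at x)"
proof -
 let ?D = "%v. osc (%xi. \<i> * cor (xi \<bullet> v) * f xi) x"
 have [measurable]: "f \<in> borel_measurable borel" using f borel_measurable_integrable by force
 have i: "integrable lborel (%xi. \<i> * cor (xi \<bullet> v) * f xi)" for v
 proof (rule Bochner_Integration.integrable_bound[of _ "%xi. norm v * (norm xi * norm (f xi))"])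
  show "integrable lborel (%xi. norm v * (norm xi * norm (f xi)))" using g by simp
  show "AE xi in lborel. norm (\<i> * cor (xi \<bullet> v) * f xi) <= norm (norm v * (norm xi * norm (f xi)))"
  proof (rule AE_I2)
   fix xi
   have "\<bar>xi \<bullet> v\<bar> * norm (f xi) <= (norm xi * norm v) * norm (f xi)"
    by (rule mult_right_mono[OF Cauchy_Schwarz_ineq2]) simp
   then show "norm (\<i> * cor (xi \<bullet> v) * f xi) <= norm (norm v * (norm xi * norm (f xi)))"
    by (simp add: norm_mult mult_ac)
  qed
 qed measurable
 note iD = osc_integrable[OF i] and i0 = osc_integrable[OF f]
 have Dle: "norm (?D v) <= norm v * (LINT xi|lborel. norm xi * norm (f xi))" for v
 proof -
  have "norm (?D v) <= (LINT xi|lborel. norm (\<i> * cor (xi \<bullet> v) * f xi))" by (rule osc_bound[OF i])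
  also have "... <= (LINT xi|lborel. norm v * (norm xi * norm (f xi)))"
  proof (rule integral_mono)
   fix xi
   have "\<bar>xi \<bullet> v\<bar> * norm (f xi) <= (norm xi * norm v) * norm (f xi)"
    by (rule mult_right_mono[OF Cauchy_Schwarz_ineq2]) simp
   then show "norm (\<i> * cor (xi \<bullet> v) * f xi) <= norm v * (norm xi * norm (f xi))"
    by (simp add: norm_mult mult_ac)
  qed (use i[of v] g in auto)
  finally show ?thesis by simp
 qed
 have lin: "bounded_linear ?D"
 proof (rule bounded_linear_intro)
  show "?D (v + w) = ?D v + ?D w" for v w
   unfolding osc_def by (subst Bochner_Integration.integral_add[symmetric, OF iD iD])
    (simp add: inner_add_right algebra_simps)
  show "?D (r *R v) = r *R ?D v" for r v
  proof -
   have "exp (\<i> * cor (xi \<bullet> x)) * (\<i> * cor (xi \<bullet> (r *R v)) * f xi)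
    = r *R (exp (\<i> * cor (xi \<bullet> x)) * (\<i> * cor (xi \<bullet> v) * f xi))" for xi
    by (simp add: scaleR_conv_of_real[of r "_ :: complex"] mult_ac)
   then show ?thesis unfolding osc_def by (simp only: integral_scaleR_right)
  qed
  show "norm (?D v) <= norm v * (LINT xi|lborel. norm xi * norm (f xi))" for v by (rule Dle)
 qed
 have "((%v. norm (osc f (x + v) - osc f x - ?D v) / norm v) \<longlongrightarrow> 0) (at 0)"
 proof (rule Lim_at_zero[THEN iffD2] tendsto_at_iff_sequentially[THEN iffD2], intro allI impI)
  fix V :: "nat => real^'a" assume V: "\<forall>i. V i \<in> UNIV - {0}" and V0: "V \<longlonglongrightarrow> 0"
  let ?R = "%k xi. norm (exp (\<i> * cor (xi \<bullet> V k)) - 1 - \<i> * cor (xi \<bullet> V k)) / norm (V k) * norm (f xi)"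
  have Vp: "0 < norm (V k)" for k using V by auto
  have R1: "?R k xi <= 2 * (norm xi * norm (f xi))" for k xi
  proof -
   have "norm (exp (\<i> * cor (xi \<bullet> V k)) - 1 - \<i> * cor (xi \<bullet> V k))
    <= \<bar>xi \<bullet> V k\<bar> + \<bar>xi \<bullet> V k\<bar>"
    by (rule order_trans[OF norm_triangle_ineq4 add_mono[OF norm_exp_i_sub_one]]) (simp add: norm_mult)
   also have "... <= 2 * norm xi * norm (V k)" using Cauchy_Schwarz_ineq2[of xi "V k"] by simp
   finally have "norm (exp (\<i> * cor (xi \<bullet> V k)) - 1 - \<i> * cor (xi \<bullet> V k)) / norm (V k) <= 2 * norm xi"
    using Vp[of k] by (simp add: field_simps)
   from mult_right_mono[OF this norm_ge_zero[of "f xi"]] show ?thesis by simp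
  qed
  have R2: "(%k. ?R k xi) \<longlonglongrightarrow> 0" for xi
  proof (rule Lim_null_comparison[of _ "%k. (norm xi)^2 * norm (V k) * norm (f xi)"])
   have "?R k xi <= (norm xi)^2 * norm (V k) * norm (f xi)" for k
   proof -
    have "norm (exp (\<i> * cor (xi \<bullet> V k)) - 1 - \<i> * cor (xi \<bullet> V k)) <= \<bar>xi \<bullet> V k\<bar>^2"
     using norm_exp_i_taylor by simp
    also have "... <= (norm xi * norm (V k))^2" by (rule power_mono[OF Cauchy_Schwarz_ineq2]) simp
    finally have "norm (exp (\<i> * cor (xi \<bullet> V k)) - 1 - \<i> * cor (xi \<bullet> V k)) / norm (V k) <= (norm xi)^2 * norm (V k)"
     using Vp[of k] by (simp add: field_simps power2_eq_square)
    from mult_right_mono[OF this norm_ge_zero[of "f xi"]] show ?thesis by simp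
   qed
   then show "\<forall>\<^sub>F k in sequentially. norm (?R k xi) <= (norm xi)^2 * norm (V k) * norm (f xi)" by simp
   show "(%k. (norm xi)^2 * norm (V k) * norm (f xi)) \<longlonglongrightarrow> 0"
    using tendsto_norm_zero[OF V0] by (intro tendsto_mult_left_zero tendsto_mult_right_zero)
  qed
  have lim: "(%k. LINT xi|lborel. ?R k xi) \<longlonglongrightarrow> (LINT xi::real^'a|lborel. 0)"
  proof (rule integral_dominated_convergence[where w="%xi. 2 * (norm xi * norm (f xi))"])
   show "integrable lborel (%xi. 2 * (norm xi * norm (f xi)))" using g by simp
   show "AE xi in lborel. (%k. ?R k xi) \<longlonglongrightarrow> 0" using R2 by simp
   show "AE xi in lborel. norm (?R k xi) <= 2 * (norm xi * norm (f xi))" for k using R1 by simp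
  qed measurable
  have le: "norm (osc f (x + V k) - osc f x - ?D (V k)) / norm (V k) <= (LINT xi|lborel. ?R k xi)" for k
  proof -
   let ?T = "%xi. exp (\<i> * cor (xi \<bullet> (x + V k))) * f xi
     - exp (\<i> * cor (xi \<bullet> x)) * f xi - exp (\<i> * cor (xi \<bullet> x)) * (\<i> * cor (xi \<bullet> V k) * f xi)"
   have e: "osc f (x + V k) - osc f x - ?D (V k) = (LINT xi|lborel. ?T xi)"
    unfolding osc_def by (simp add: i0 iD)
   have "norm (osc f (x + V k) - osc f x - ?D (V k)) <= (LINT xi|lborel. norm (?T xi))"
    unfolding e by (rule integral_norm_bound)
   also have "... = (LINT xi|lborel. norm (V k) * ?R k xi)"
   proof (rule Bochner_Integration.integral_cong[OF refl])
    fix xi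
    have "exp (\<i> * cor (xi \<bullet> (x + V k))) * f xi
     - exp (\<i> * cor (xi \<bullet> x)) * f xi - exp (\<i> * cor (xi \<bullet> x)) * (\<i> * cor (xi \<bullet> V k) * f xi)
     = exp (\<i> * cor (xi \<bullet> x)) * ((exp (\<i> * cor (xi \<bullet> V k)) - 1 - \<i> * cor (xi \<bullet> V k)) * f xi)"
    proof -
     have "exp (\<i> * cor (xi \<bullet> (x + V k))) = exp (\<i> * cor (xi \<bullet> x)) * exp (\<i> * cor (xi \<bullet> V k))"
      by (simp only: inner_add_right of_real_add distrib_left exp_add)
     then show ?thesis by (simp only: left_diff_distrib right_diff_distrib mult_1_left mult.assoc)
    qed
    then show "norm (exp (\<i> * cor (xi \<bullet> (x + V k))) * f xi
     - exp (\<i> * cor (xi \<bullet> x)) * f xi - exp (\<i> * cor (xi \<bullet> x)) * (\<i> * cor (xi \<bullet> V k) * f xi))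
     = norm (V k) * ?R k xi" using Vp[of k] by (simp add: norm_mult)
   qed
   also have "... = norm (V k) * (LINT xi|lborel. ?R k xi)" by simp
   finally show ?thesis using Vp[of k] by (simp add: field_simps)
  qed
  show "((%v. norm (osc f (x + v) - osc f x - ?D v) / norm v) \<circ> V) \<longlonglongrightarrow> 0"
   by (rule Lim_null_comparison[OF always_eventually[rule_format] lim[simplified]]) (use le in auto)
 qed
 then show ?thesis
  unfolding has_derivative_at using lin by blast
qed

lemma schwartz_norm_integrable:
 assumes "schwartz (ph :: real^'n::finite => complex)"
 shows "integrable lborel (%x. norm x * norm (ph x))"
proof -
 obtain C where C: "!!x. (1 + norm x) ^ Suc (Suc CARD('n)) * norm (ph x) <= C" using schwartz_bounded[OF assms] by blast
 have [measurable]: "ph \<in> borel_measurable borel" by (rule schwartz_measurable[OF assms])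
 have "(1 + norm x) ^ Suc CARD('n) * norm (norm x * norm (ph x)) <= C" for x
 proof -
  have "(1 + norm x) ^ Suc CARD('n) * (norm x * norm (ph x)) <= (1 + norm x) ^ Suc CARD('n) * ((1 + norm x) * norm (ph x))"
   by (intro mult_left_mono mult_right_mono) auto
  also have "... <= C" using C[of x] by (simp add: mult_ac)
  finally show ?thesis by simp
 qed
 then show ?thesis by (intro integrable_decay(1)) auto
qed

lemma osc_cmult: "osc (%xi. c * f xi) x = c * osc f x"
 unfolding osc_def by (simp add: mult.left_commute[of _ c])

lemma pderivative_osc:
 assumes "integrable lborel f" "integrable lborel (%xi. norm xi * norm (f xi))"
 shows "pd j (osc f) x = osc (%xi. \<i> * (cor (xi $ j) * f xi)) x"
 using pderivative_eqI[OF has_derivative_osc_integral[OF assms], of j] by (simp add: inner_axis mult.assoc)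

text \<open>The difference quotients of a Schwartz function are dominated by an integrable function,
 and by translation invariance their integrals vanish.\<close>

lemma integral_pderivative_schwartz:
 assumes S: "schwartz (psi :: real^'n::finite => complex)"
 shows "(LINT x|lborel. pd j psi x) = 0"
proof -
 let ?e = "axis j 1 :: real^'n"
 obtain C where C: "!!x. (1 + norm x) ^ Suc CARD('n) * norm (pd j psi x) <= C" "0 <= C"
  using schwartz_bounded[OF schwartz_pderivative[OF S]] by blast
 have [measurable]: "psi \<in> borel_measurable borel" "pd j psi \<in> borel_measurable borel"
  using S schwartz_pderivative schwartz_measurable by blast+
 define w where "w x = C * 2 ^ Suc CARD('n) * inverse ((1 + norm x) ^ Suc CARD('n))" for x :: "real^'n"
 have wi: "integrable lborel w" unfolding w_def by (intro integrable_mult_right integrable_inverse_power) simp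
 have line: "((%tu. psi (x + tu *R ?e)) has_vector_derivative pd j psi (x + tu *R ?e)) (at tu within T)" for x tu T
 proof -
  have "((%tu. x + tu *R ?e) has_derivative (%h. h *R ?e)) (at tu within T)"
   by (auto intro!: derivative_eq_intros)
  from has_derivative_compose[OF this has_derivative_pderivative[OF schwartz_differentiable[OF S]]]
  show ?thesis by (simp add: has_vector_derivative_def scaleR_sum_right[symmetric] scaleR_scaleR[symmetric] del: scaleR_scaleR)
 qed
 define h where "h k = 1 / real (Suc k)" for k
 have h: "0 < h k" "h k <= 1" for k by (simp_all add: h_def)
 let ?q = "%k x. (psi (x + h k *R ?e) - psi x) /\<^sub>R h k"
 have dom: "norm (?q k x) <= w x" for k x
 proof -
  have ar: "1 + a <= 2 * (1 + N)" if "a <= N + t" "t <= 1" "0 <= N" for a N t :: real using that by simp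
  have d: "norm (pd j psi (x + tu *R ?e)) <= w x" if "tu \<in> {0..1}" for tu
  proof -
   have "norm x <= norm (x + tu *R ?e) + norm (tu *R ?e)" using norm_triangle_ineq4[of "x + tu *R ?e" "tu *R ?e"] by simp
   moreover have "norm (tu *R ?e) <= 1" using that by (simp add: norm_axis_1)
   ultimately have "1 + norm x <= 2 * (1 + norm (x + tu *R ?e))" using ar[of "norm x" "norm (x + tu *R ?e)" "norm (tu *R ?e)"] by simp
   then have "(1 + norm x) ^ Suc CARD('n) <= 2 ^ Suc CARD('n) * (1 + norm (x + tu *R ?e)) ^ Suc CARD('n)"
    unfolding power_mult_distrib[symmetric] by (rule power_mono) auto
   then have "(1 + norm x) ^ Suc CARD('n) * norm (pd j psi (x + tu *R ?e))
     <= 2 ^ Suc CARD('n) * (1 + norm (x + tu *R ?e)) ^ Suc CARD('n) * norm (pd j psi (x + tu *R ?e))"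
    by (rule mult_right_mono) simp
   also have "... <= 2 ^ Suc CARD('n) * C" using C(1)[of "x + tu *R ?e"] by (simp add: mult.assoc)
   finally have "(1 + norm x) ^ Suc CARD('n) * norm (pd j psi (x + tu *R ?e)) <= 2 ^ Suc CARD('n) * C" .
   moreover have "0 < (1 + norm x) ^ Suc CARD('n)" by (simp add: add_pos_nonneg)
   ultimately show ?thesis unfolding w_def divide_inverse[symmetric] by (simp add: pos_le_divide_eq mult_ac del: power_Suc)
  qed
  have "norm (psi (x + h k *R ?e) - psi (x + 0 *R ?e)) <= w x * norm (h k - 0)"
  proof (rule differentiable_bound[where S="{0..1}" and f="%tu. psi (x + tu *R ?e)" and f'="%tu u. u *R pd j psi (x + tu *R ?e)"])
   show "((%tu. psi (x + tu *R ?e)) has_derivative (%u. u *R pd j psi (x + tu *R ?e))) (at tu within {0..1})" for tu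
    using line[unfolded has_vector_derivative_def] .
   show "onorm (%u. u *R pd j psi (x + tu *R ?e)) <= w x" if "tu \<in> {0..1}" for tu
    using d[OF that] by (intro onorm_le) (simp add: mult.commute mult_left_mono)
  qed (use h[of k] in auto)
  then have "norm (psi (x + h k *R ?e) - psi x) / h k <= w x" using h[of k] by (simp add: pos_divide_le_eq)
  moreover have "norm (?q k x) = norm (psi (x + h k *R ?e) - psi x) / h k"
   using h[of k] by (simp only: norm_scaleR divide_inverse abs_inverse abs_of_pos mult.commute)
  ultimately show ?thesis by simp
 qed
 have lim: "(%k. ?q k x) \<longlonglongrightarrow> pd j psi x" for x
 proof -
  have "((%tu. psi (x + tu *R ?e)) has_vector_derivative pd j psi x) (at 0)" using line[of x 0 UNIV] by simp
  then have t: "((%t. norm (psi (x + t *R ?e) - psi x - t *R pd j psi x) / norm t) \<longlongrightarrow> 0) (at 0)"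
   unfolding has_vector_derivative_def has_derivative_at by simp
  have "filterlim h (at 0) sequentially"
   unfolding h_def by (rule filterlim_atI[OF lim_1_over_n[THEN LIMSEQ_Suc]]) simp
  from filterlim_compose[OF t this]
  have "(%k. norm (psi (x + h k *R ?e) - psi x - h k *R pd j psi x) / norm (h k)) \<longlonglongrightarrow> 0" .
  moreover have "norm (psi (x + h k *R ?e) - psi x - h k *R pd j psi x) / norm (h k) = norm (?q k x - pd j psi x)" for k
  proof -
   have "?q k x - pd j psi x = (psi (x + h k *R ?e) - psi x - h k *R pd j psi x) /\<^sub>R h k"
    using h[of k] by (simp add: scaleR_diff_right)
   then show ?thesis by (simp add: divide_inverse mult.commute)
  qed
  ultimately have "(%k. norm (?q k x - pd j psi x)) \<longlonglongrightarrow> 0" by simp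
  then show ?thesis by (rule LIM_zero_cancel[OF tendsto_norm_zero_cancel])
 qed
 have z: "(LINT x|lborel. ?q k x) = 0" for k
 proof -
  have "(LINT x|lborel. psi (x + h k *R ?e) - psi x) = 0"
   using schwartz_integrable[OF S] by (simp add: lborel_integrable_translate_iff lborel_integral_translate)
  then show ?thesis by simp
 qed
 have "(%k. LINT x|lborel. ?q k x) \<longlonglongrightarrow> (LINT x|lborel. pd j psi x)"
  by (rule integral_dominated_convergence[where w=w]) (use lim dom wi in auto)
 then show ?thesis unfolding z by (simp add: LIMSEQ_const_iff)
qed

lemma osc_schwartz_has_derivative:
 "schwartz ph ==> (osc ph has_derivative (%v. osc (%xi. \<i> * cor (xi \<bullet> v) * ph xi) x)) (at x)"
 by (rule has_derivative_osc_integral[OF schwartz_integrable schwartz_norm_integrable])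

lemma pderivative_osc_schwartz:
 "schwartz ph ==> pd j (osc ph) = osc (%xi. \<i> * (cor (xi $ j) * ph xi))"
 by (rule ext, rule pderivative_osc[OF schwartz_integrable schwartz_norm_integrable])

text \<open>Integration by parts: the derivative of the modulated function has integral 0.\<close>

lemma osc_pderivative_schwartz:
 assumes "schwartz ph"
 shows "osc (pd j ph) x = - \<i> * cor (x $ j) * osc ph x"
proof -
 let ?e = "%xi. exp (\<i> * cor (xi \<bullet> x))"
 note dd = differentiableI[OF has_derivative_osc] schwartz_differentiable[OF assms]
 have "pd j (%xi. ?e xi * ph xi) xi = ?e xi * pd j ph xi + \<i> * cor (x $ j) * (?e xi * ph xi)" for xi
  by (subst pderivative_mult[OF dd]) (simp add: pderivative_eqI[OF has_derivative_osc] inner_axis' mult_ac)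
 then have "(LINT xi|lborel. ?e xi * pd j ph xi + \<i> * cor (x $ j) * (?e xi * ph xi)) = 0"
  using integral_pderivative_schwartz[OF schwartz_modulate[OF assms, of x], of j] by simp
 then have "osc (pd j ph) x + \<i> * cor (x $ j) * osc ph x = 0"
  unfolding osc_def
  by (subst (asm) Bochner_Integration.integral_add)
    (simp_all add: osc_integrable schwartz_integrable schwartz_pderivative assms)
 then show ?thesis by (simp add: eq_neg_iff_add_eq_0)
qed

text \<open>A power of |x| is traded for a derivative of \<open>ph\<close>: |x| is at most the sum
  of the |x_j|, and x_j times the transform is, up to a unit factor, the transform of a
  derivative.\<close>

lemma osc_schwartz_bounded:
 "schwartz ph ==> \<exists>C. \<forall>x. (1 + norm x) ^ N * norm (osc ph x) <= C"
proof (induction N arbitrary: ph)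
 case 0
 then show ?case using osc_bound[OF schwartz_integrable[OF 0]] by auto
next
 case (Suc N)
 have "\<exists>C. \<forall>x. (1 + norm x) ^ N * norm (osc (pd j ph) x) <= C" for j
  using Suc.IH[OF schwartz_pderivative[OF Suc.prems]] .
 then obtain C where C: "!!j x. (1 + norm x) ^ N * norm (osc (pd j ph) x) <= C j" by metis
 obtain D where D: "!!x. (1 + norm x) ^ N * norm (osc ph x) <= D" using Suc.IH[OF Suc.prems] by blast
 have "(1 + norm x) ^ Suc N * norm (osc ph x) <= D + (\<Sum>j\<in>UNIV. C j)" for x
 proof -
  have "norm x * norm (osc ph x) <= (\<Sum>j\<in>UNIV. \<bar>x $ j\<bar>) * norm (osc ph x)"
   by (rule mult_right_mono[OF norm_le_l1_cart]) simp
  also have "... = (\<Sum>j\<in>UNIV. norm (osc (pd j ph) x))"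
   by (simp add: osc_pderivative_schwartz[OF Suc.prems] norm_mult sum_distrib_right)
  finally have "(1 + norm x) ^ N * (norm x * norm (osc ph x)) <= (1 + norm x) ^ N * (\<Sum>j\<in>UNIV. norm (osc (pd j ph) x))"
   by (rule mult_left_mono) simp
  also have "... <= (\<Sum>j\<in>UNIV. C j)" unfolding sum_distrib_left by (rule sum_mono) (rule C)
  finally show ?thesis using D[of x] by (simp add: algebra_simps)
 qed
 then show ?case by blast
qed

lemma schwartz_osc:
 assumes "schwartz (ph :: real^'n::finite => complex)" shows "schwartz (osc ph)"
proof (rule schwartz_coinduct[of _ "{osc ph |ph. schwartz ph}"])
 show "osc ph \<in> {osc ph |ph. schwartz ph}" using assms by blast
 fix g :: "real^'n => complex" assume "g \<in> {osc ph |ph. schwartz ph}"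
 then obtain ph where g: "g = osc ph" and S: "schwartz ph" by blast
 have "pd i g \<in> {osc ph |ph. schwartz ph}" for i
  unfolding g pderivative_osc_schwartz[OF S] using schwartz_cmult[OF schwartz_coord[OF S]] by blast
 then show "(\<forall>x. g differentiable (at x)) & (\<forall>i. pd i g \<in> {osc ph |ph. schwartz ph}) &
   (\<forall>N. \<exists>C. \<forall>x. (1 + norm x) ^ N * norm (g x) <= C)"
  using osc_schwartz_bounded[OF S] differentiableI[OF osc_schwartz_has_derivative[OF S]] g by blast
qed

lemma schwartz_reflect: "schwartz ph ==> schwartz (%x. ph (- x))"
 using schwartz_affine[of ph "-1" 0] by simp

lemma schwartz_fourier: "schwartz ph ==> schwartz (fourier ph)"
 using schwartz_reflect[OF schwartz_osc] by (simp add: fourier_osc[abs_def])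

text \<open>The number (2 pi)^(n/2). Its square is the constant of the inversion formula
  \<open>osc_osc\<close> and returns as the ratio of \<open>wsobolev_norm\<close> to the norm of
  \<open>l2\<close>.\<close>

definition gauss_int :: "'n::finite itself => real" where
 "gauss_int _ = (LINT x::real^'n|lborel. exp (- (x \<bullet> x) / 2))"

lemma gauss_int: "(LINT x::real^'n::finite|lborel. gauss x) = cor (gauss_int TYPE('n))"
 unfolding gauss_def gauss_int_def by (rule integral_complex_of_real)

lemma gauss_integrable: "integrable lborel (%x::real^'n::finite. exp (- (x \<bullet> x) / 2))"
 using schwartz_integrable[OF schwartz_gauss] unfolding gauss_def complex_of_real_integrable_eq .

lemma gauss_int_pos: "0 < gauss_int TYPE('n::finite)"
proof -
 have "gauss_int TYPE('n) ~= 0"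
 proof
  assume "gauss_int TYPE('n) = 0"
  then have "AE x::real^'n in lborel. exp (- (x \<bullet> x) / 2) = 0"
   unfolding gauss_int_def by (subst (asm) integral_nonneg_eq_0_iff_AE[OF gauss_integrable]) auto
  then have "AE x::real^'n in lborel. x \<notin> UNIV" by simp
  then have "(UNIV :: (real^'n) set) \<in> null_sets lborel" by (subst AE_iff_null_sets) auto
  then show False by (simp add: null_sets_def)
 qed
 moreover have "0 <= gauss_int TYPE('n)" unfolding gauss_int_def by (rule integral_nonneg_AE) simp
 ultimately show ?thesis by simp
qed

text \<open>Both \<open>gauss\<close> and its transform solve \<open>\<nabla>u = - x u\<close>, so their quotient is constant.\<close>

lemma osc_gauss: "osc (gauss :: real^'n::finite => complex) x = cor (gauss_int TYPE('n)) * gauss x"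
proof -
 let ?q = "%x::real^'n. osc gauss x * cor (exp ((x \<bullet> x) / 2))"
 have pg: "\<i> * (cor (xi $ j) * gauss xi) = (- \<i>) * pd j gauss xi" for j and xi :: "real^'n"
  by (simp add: pderivative_eqI[OF has_derivative_gauss] inner_axis)
 have "pd j (osc gauss) x = - cor (x $ j) * osc gauss x" for j and x :: "real^'n"
  unfolding pderivative_osc_schwartz[OF schwartz_gauss] pg osc_cmult osc_pderivative_schwartz[OF schwartz_gauss] by (simp flip: mult.assoc)
 then have D: "(osc gauss has_derivative (%v. \<Sum>i\<in>UNIV. (v $ i) *R (- cor (x $ i) * osc gauss x))) (at x)" for x :: "real^'n"
  using has_derivative_pderivative[OF differentiableI[OF osc_schwartz_has_derivative[OF schwartz_gauss]], of x] by simp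
 have e: "(\<Sum>i\<in>UNIV. (v $ i) *R (- cor (x $ i) * c)) = - cor (x \<bullet> v) * c" for v x :: "real^'n" and c
  by (simp add: inner_vec_def scaleR_conv_of_real sum_distrib_left sum_negf mult_ac)
 have E: "((%x. cor (exp ((x \<bullet> x) / 2))) has_derivative (%v. cor ((x \<bullet> v) * exp ((x \<bullet> x) / 2)))) (at x)" for x :: "real^'n"
  by (rule has_derivative_of_real) (auto intro!: derivative_eq_intros simp: fun_eq_iff inner_commute)
 have "(?q has_derivative (%v. 0)) (at x)" for x
  using has_derivative_mult[OF D[of x, unfolded e] E[of x]] by (simp add: mult_ac)
 then have "?q x = ?q 0" by (intro has_derivative_zero_unique[of UNIV]) auto
 then have "osc gauss x * cor (exp ((x \<bullet> x) / 2)) = cor (gauss_int TYPE('n))"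
  by (simp add: osc_def gauss_int)
 then have "osc gauss x * (cor (exp ((x \<bullet> x) / 2)) * gauss x) = cor (gauss_int TYPE('n)) * gauss x"
  by (simp flip: mult.assoc)
 then show ?thesis unfolding gauss_def by (simp flip: of_real_mult exp_add)
qed

section \<open>Fourier inversion for Schwartz functions\<close>

lemma osc_swap_integrable:
 fixes f g :: "real^'n::finite => complex"
 assumes f: "integrable lborel f" and g: "integrable lborel g"
 shows "integrable (lborel \<Otimes>\<^sub>M lborel) (%(x, y). exp (\<i> * cor (x \<bullet> y)) * (f x * g y) :: complex)"
proof -
 have [measurable]: "f \<in> borel_measurable borel" "g \<in> borel_measurable borel" using f g borel_measurable_integrable by force+
 have em: "(%p::(real^'n) \<times> (real^'n). exp (\<i> * cor (fst p \<bullet> snd p))) \<in> borel_measurable (borel \<Otimes>\<^sub>M borel)"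
  unfolding borel_prod by (intro borel_measurable_continuous_onI continuous_intros)
 have "integrable (lborel \<Otimes>\<^sub>M lborel) (%(x, y). f x * g y)"
 proof (rule lborel_pair.Fubini_integrable)
  show "(%(x, y). f x * g y) \<in> borel_measurable (lborel \<Otimes>\<^sub>M lborel)" by measurable
  show "integrable lborel (%x. LINT y|lborel. norm (case (x, y) of (x, y) => f x * g y))"
   using f g by (simp add: norm_mult)
  show "AE x in lborel. integrable lborel (%y. case (x, y) of (x, y) => f x * g y)"
   using g by simp
 qed
 then show ?thesis
 proof (rule Bochner_Integration.integrable_bound)
  show "(%(x, y). exp (\<i> * cor (x \<bullet> y)) * (f x * g y)) \<in> borel_measurable (lborel \<Otimes>\<^sub>M lborel)"
   using em by (simp add: split_beta') measurable
 qed (auto simp: norm_mult)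
qed

text \<open>Fubini for the symmetric kernel exp (i x.y). This multiplication formula later carries
  all dualities between functions and densities.\<close>

lemma osc_swap:
 assumes f: "integrable lborel f" and g: "integrable lborel g"
 shows "(LINT x|lborel. osc f x * g x) = (LINT x|lborel. f x * osc g x)"
proof -
 have "(LINT y|lborel. LINT x|lborel. exp (\<i> * cor (x \<bullet> y)) * (f x * g y))
   = (LINT x|lborel. LINT y|lborel. exp (\<i> * cor (x \<bullet> y)) * (f x * g y))"
  by (rule lborel_pair.Fubini_integral[OF osc_swap_integrable[OF f g]])
 moreover have "(LINT x|lborel. exp (\<i> * cor (x \<bullet> y)) * (f x * g y)) = osc f y * g y" for y
  unfolding osc_def by (simp flip: mult.assoc)
 moreover have "(LINT y|lborel. exp (\<i> * cor (x \<bullet> y)) * (f x * g y)) = f x * osc g x" for x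
  unfolding osc_def by (simp add: mult.left_commute[of _ "f x"] inner_commute[of x])
 ultimately show ?thesis by simp
qed

lemma gauss_uminus [simp]: "gauss (- x) = gauss x" by (simp add: gauss_def)

lemma norm_gauss_le: "norm (gauss x) <= 1" by (simp add: gauss_def)

lemma gauss_continuous: "continuous_on UNIV gauss"
 by (rule schwartz_continuous[OF schwartz_gauss])

lemma gauss_measurable [measurable]: "gauss \<in> borel_measurable borel"
 by (rule schwartz_measurable[OF schwartz_gauss])

lemma osc_scale:
 assumes "a > 0"
 shows "osc (%x. f (a *R x)) (y :: real^'n::finite) = (1 / a ^ CARD('n)) *R osc f (y /\<^sub>R a)"
proof -
 have "osc f (y /\<^sub>R a) = a ^ CARD('n) *R osc (%x. f (a *R x)) y"
  unfolding osc_def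
  by (subst lborel_integral_affine[of a _ 0]) (use assms in "simp_all add: field_simps")
 then show ?thesis using assms by simp
qed

lemma gauss_average_tendsto:
 fixes f :: "real^'n::finite => complex"
 assumes c: "continuous_on UNIV f" and b: "!!x. norm (f x) <= B"
 shows "(%k. LINT z|lborel. f (x + (1 / real (Suc k)) *R z) * gauss z)
  \<longlonglongrightarrow> f x * cor (gauss_int TYPE('n))"
proof -
 have [measurable]: "f \<in> borel_measurable borel" using c by (rule borel_measurable_continuous_onI)
 have "(%k. LINT z|lborel. f (x + (1 / real (Suc k)) *R z) * gauss z) \<longlonglongrightarrow> (LINT z|lborel. f x * gauss (z :: real^'n))"
 proof (rule integral_dominated_convergence[where w="%z::real^'n. B * norm (gauss z)"])
  show "integrable lborel (%z::real^'n. B * norm (gauss z))"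
   by (intro integrable_mult_right integrable_norm schwartz_integrable schwartz_gauss)
  show "AE z in lborel. norm (f (x + (1 / real (Suc k)) *R z) * gauss z) <= B * norm (gauss z)" for k
   using b by (simp add: norm_mult mult_right_mono)
  show "AE z in lborel. (%k. f (x + (1 / real (Suc k)) *R z) * gauss z) \<longlonglongrightarrow> f x * gauss z"
  proof (rule AE_I2)
   fix z
   have "(%k. x + (1 / real (Suc k)) *R z) \<longlonglongrightarrow> x + 0 *R z"
    by (intro tendsto_intros lim_1_over_n[THEN LIMSEQ_Suc])
   then have "(%k. f (x + (1 / real (Suc k)) *R z)) \<longlonglongrightarrow> f x"
    using c continuous_on_tendsto_compose[OF c, of "%k. x + (1 / real (Suc k)) *R z" x] by simp
   then show "(%k. f (x + (1 / real (Suc k)) *R z) * gauss z) \<longlonglongrightarrow> f x * gauss z" by (intro tendsto_intros)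
  qed
 qed measurable
 then show ?thesis by (simp add: gauss_int)
qed

text \<open>Inversion at the origin. The factor \<open>gauss (h *R x)\<close> replaces the
  non-integrable constant 1 and permits the swap, which turns it into a Gaussian average of
  \<open>ph\<close> of width \<open>h\<close>; both sides converge as \<open>h\<close> tends to
  0.\<close>

lemma integral_osc_schwartz:
 assumes S: "schwartz (ph :: real^'n::finite => complex)"
 shows "(LINT x|lborel. osc ph x) = cor ((gauss_int TYPE('n))^2) * ph 0"
proof -
 let ?c = "cor (gauss_int TYPE('n))"
 let ?h = "%k. 1 / real (Suc k)"
 have eq: "(LINT x|lborel. osc ph x * gauss (h *R x)) = ?c * (LINT z|lborel. ph (0 + h *R z) * gauss z)" if h: "0 < h" for h :: real
 proof -
  have "(LINT x|lborel. osc ph x * gauss (h *R x)) = (LINT x|lborel. ph x * osc (%x. gauss (h *R x)) x)"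
   by (rule osc_swap[OF schwartz_integrable[OF S] schwartz_integrable])
     (use schwartz_affine[OF schwartz_gauss, of h 0] h in simp)
  also have "... = (LINT x|lborel. (1 / h ^ CARD('n)) *R (?c * (ph x * gauss (x /\<^sub>R h))))"
   unfolding osc_scale[OF h] osc_gauss by (intro Bochner_Integration.integral_cong refl) (simp add: scaleR_conv_of_real mult_ac)
  also have "... = (1 / h ^ CARD('n)) *R (?c * (LINT x|lborel. ph x * gauss (x /\<^sub>R h)))" by simp
  also have "(LINT x|lborel. ph x * gauss (x /\<^sub>R h)) = h ^ CARD('n) *R (LINT z|lborel. ph (0 + h *R z) * gauss z)"
   by (subst lborel_integral_affine[of h _ 0]) (use h in simp_all)
  finally show ?thesis using h by (simp add: scaleR_conv_of_real)
 qed
 obtain B where B: "!!x. norm (ph x) <= B" using schwartz_bounded[OF S, of 0] by auto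
 have R: "(%k. ?c * (LINT z|lborel. ph (0 + ?h k *R z) * gauss z)) \<longlonglongrightarrow> ?c * (ph 0 * ?c)"
  by (intro tendsto_mult_left gauss_average_tendsto[where B=B] schwartz_continuous S B)
 have [measurable]: "osc ph \<in> borel_measurable borel" by (rule schwartz_measurable[OF schwartz_osc[OF S]])
 have L: "(%k. LINT x|lborel. osc ph x * gauss (?h k *R x)) \<longlonglongrightarrow> (LINT x|lborel. osc ph x * 1)"
 proof (rule integral_dominated_convergence[where w="%x::real^'n. norm (osc ph x)"])
  show "integrable lborel (%x. norm (osc ph x))" using schwartz_integrable[OF schwartz_osc[OF S]] by simp
  show "AE x in lborel. (%k. osc ph x * gauss (?h k *R x)) \<longlonglongrightarrow> osc ph x * 1"
  proof (rule AE_I2, rule tendsto_mult_left)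
   fix x :: "real^'n"
   have "(%k. ?h k *R x) \<longlonglongrightarrow> 0 *R x" by (intro tendsto_intros lim_1_over_n[THEN LIMSEQ_Suc])
   then have "(%k. gauss (?h k *R x)) \<longlonglongrightarrow> gauss (0 *R x)"
    by (rule isCont_tendsto_compose[OF differentiable_imp_continuous_within[OF schwartz_differentiable[OF schwartz_gauss]]])
   then show "(%k. gauss (?h k *R x)) \<longlonglongrightarrow> 1" by (simp add: gauss_def)
  qed
  show "AE x in lborel. norm (osc ph x * gauss (?h k *R x)) <= norm (osc ph x)" for k
   by (intro AE_I2) (simp add: norm_mult mult_left_le norm_gauss_le)
 qed measurable
 have "(%k. LINT x|lborel. osc ph x * gauss (?h k *R x)) = (%k. ?c * (LINT z|lborel. ph (0 + ?h k *R z) * gauss z))"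
  by (intro ext eq) simp
 from LIMSEQ_unique[OF L[unfolded this] R] show ?thesis by (simp add: power2_eq_square mult_ac)
qed

text \<open>A translation of \<open>ph\<close> multiplies its transform by a phase, so inversion at
  a point is inversion at the origin for a translate.\<close>

lemma osc_osc:
 assumes S: "schwartz (ph :: real^'n::finite => complex)"
 shows "osc (osc ph) x = cor ((gauss_int TYPE('n))^2) * ph (- x)"
proof -
 have "osc (%y. ph (y - x)) xi = exp (\<i> * cor (xi \<bullet> x)) * osc ph xi" for xi
 proof -
  have "osc (%y. ph (y - x)) xi = (LINT y|lborel. exp (\<i> * cor ((y + x) \<bullet> xi)) * ph y)"
   unfolding osc_def by (subst lborel_integral_translate[of _ x, symmetric]) simp
  also have "... = (LINT y|lborel. exp (\<i> * cor (xi \<bullet> x)) * (exp (\<i> * cor (y \<bullet> xi)) * ph y))"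
  proof (intro Bochner_Integration.integral_cong refl)
   fix y
   have "(y + x) \<bullet> xi = xi \<bullet> x + y \<bullet> xi" by (metis inner_add_left inner_commute add.commute)
   then show "exp (\<i> * cor ((y + x) \<bullet> xi)) * ph y = exp (\<i> * cor (xi \<bullet> x)) * (exp (\<i> * cor (y \<bullet> xi)) * ph y)"
    by (simp only: of_real_add distrib_left exp_add mult.assoc)
  qed
  finally show ?thesis by (simp add: osc_def)
 qed
 then have "osc (osc ph) x = (LINT xi|lborel. osc (%y. ph (y - x)) xi)"
  by (simp add: osc_def[of "osc ph"])
 also have "... = cor ((gauss_int TYPE('n))^2) * ph (- x)"
  using integral_osc_schwartz[of "%y. ph (y - x)"] schwartz_affine[OF S, of 1 "-x"] by (simp add: add.commute)
 finally show ?thesis .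
qed

section \<open>Functions annihilated by all test functions; injectivity of the transform\<close>

lemma lborel_integrable_split:
 fixes f g :: "'a::euclidean_space => complex"
 assumes f: "integrable lborel f" and g: "integrable lborel g"
 shows "integrable (lborel \<Otimes>\<^sub>M lborel) (%(x, y). f x * g (y - x))"
proof (rule lborel_pair.Fubini_integrable)
 have [measurable]: "f \<in> borel_measurable borel" "g \<in> borel_measurable borel" using f g borel_measurable_integrable by force+
 show "(%(x, y). f x * g (y - x)) \<in> borel_measurable (lborel \<Otimes>\<^sub>M lborel)" by measurable
 have i: "integrable lborel (%y. g (y - x))" for x using lborel_integrable_translate_iff[of g "-x"] g by simp
 have "(LINT y|lborel. norm (g (y - x))) = (LINT y|lborel. norm (g y))" for x
  using lborel_integral_translate[of "%y. norm (g y)" "-x"] by simp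
 then show "integrable lborel (%x. LINT y|lborel. norm (case (x, y) of (x, y) => f x * g (y - x)))"
  using f by (simp add: norm_mult)
 show "AE x in lborel. integrable lborel (%y. case (x, y) of (x, y) => f x * g (y - x))"
  using i by simp
qed

text \<open>Bounded continuous functions are limits of their averages against shrinking Gaussians.\<close>

lemma gauss_annihilator:
 fixes h :: "real^'n::finite => complex"
 assumes h: "integrable lborel h"
  and z: "!!a y. a > 0 ==> (LINT x|lborel. h x * gauss (a *R (y - x))) = 0"
  and c: "continuous_on UNIV zt" and b: "!!x. norm (zt x :: complex) <= B"
 shows "(LINT x|lborel. h x * zt x) = 0"
proof -
 have [measurable]: "h \<in> borel_measurable borel" using h borel_measurable_integrable by force
 have [measurable]: "zt \<in> borel_measurable borel" using c by (rule borel_measurable_continuous_onI)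
 have B: "0 <= B" using b[of 0] norm_ge_zero order_trans by blast
 \<comment> \<open>The hypothesis is integrated against \<open>zt\<close>; exchanging the integrals
   moves the Gaussian average onto \<open>zt\<close>.\<close>
 have zero: "(LINT x|lborel. h x * (LINT z|lborel. zt (x + a *R z) * gauss z)) = 0" if a: "a > 0" for a
 proof -
  have g: "integrable lborel (%y::real^'n. gauss (y /\<^sub>R a))"
   using schwartz_integrable[OF schwartz_affine[OF schwartz_gauss, of "inverse a" 0]] a by simp
  have "integrable (lborel \<Otimes>\<^sub>M lborel) (%(x, y). h x * gauss ((y - x) /\<^sub>R a))"
   using lborel_integrable_split[OF h g] .
  then have "integrable (lborel \<Otimes>\<^sub>M lborel) (%p. B *R norm (case p of (x, y) => h x * gauss ((y - x) /\<^sub>R a)))" by simp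
  then have i: "integrable (lborel \<Otimes>\<^sub>M lborel) (%(x, y). h x * (zt y * gauss ((y - x) /\<^sub>R a)))"
  proof (rule Bochner_Integration.integrable_bound)
   have "norm (h x * (zt y * gauss ((y - x) /\<^sub>R a))) <= B * norm (h x * gauss ((y - x) /\<^sub>R a))" for x y
    using mult_right_mono[OF b[of y], of "norm (h x) * norm (gauss ((y - x) /\<^sub>R a))"] by (simp add: norm_mult mult_ac)
   then show "AE p in lborel \<Otimes>\<^sub>M lborel. norm (case p of (x, y) => h x * (zt y * gauss ((y - x) /\<^sub>R a)))
     <= norm (B *R norm (case p of (x, y) => h x * gauss ((y - x) /\<^sub>R a)))"
    using B by (simp add: split_beta')
  qed measurable
  have "0 = (LINT y|lborel. zt y * (LINT x|lborel. h x * gauss (inverse a *R (y - x))))"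
   using z[of "inverse a"] a by simp
  also have "... = (LINT y|lborel. LINT x|lborel. h x * (zt y * gauss ((y - x) /\<^sub>R a)))"
   by (subst integral_mult_right_zero[symmetric]) (simp add: mult_ac)
  also have "... = (LINT x|lborel. LINT y|lborel. h x * (zt y * gauss ((y - x) /\<^sub>R a)))"
   by (rule lborel_pair.Fubini_integral[OF i])
  also have "... = (LINT x|lborel. h x * (a ^ CARD('n) *R (LINT z|lborel. zt (x + a *R z) * gauss z)))"
  proof (intro Bochner_Integration.integral_cong refl)
   fix x
   have "(LINT y|lborel. zt y * gauss ((y - x) /\<^sub>R a)) = a ^ CARD('n) *R (LINT z|lborel. zt (x + a *R z) * gauss z)"
    using lborel_integral_affine[of a "%y. zt y * gauss ((y - x) /\<^sub>R a)" x] a by simp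
   then show "(LINT y|lborel. h x * (zt y * gauss ((y - x) /\<^sub>R a))) = h x * (a ^ CARD('n) *R (LINT z|lborel. zt (x + a *R z) * gauss z))" by simp
  qed
  finally show ?thesis using a by (simp add: scaleR_conv_of_real mult.left_commute[of _ "_ ^ _"])
 qed
 let ?A = "%k x. LINT z|lborel. zt (x + (1 / real (Suc k)) *R z) * gauss z"
 have "(%k. LINT x|lborel. h x * ?A k x) \<longlonglongrightarrow> (LINT x|lborel. h x * (zt x * cor (gauss_int TYPE('n))))"
 proof (rule integral_dominated_convergence[where w="%x. norm (h x) * (B * gauss_int TYPE('n))"])
  show "integrable lborel (%x. norm (h x) * (B * gauss_int TYPE('n)))" using h by simp
  show "AE x in lborel. (%k. h x * ?A k x) \<longlonglongrightarrow> h x * (zt x * cor (gauss_int TYPE('n)))"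
   by (intro AE_I2 tendsto_mult_left gauss_average_tendsto[OF c b])
  have "norm (?A k x) <= B * gauss_int TYPE('n)" for k x
  proof -
   have "norm (?A k x) <= (LINT z|lborel. norm (zt (x + (1 / real (Suc k)) *R z) * gauss z))" by (rule integral_norm_bound)
   also have "... <= (LINT z::real^'n|lborel. B * exp (- (z \<bullet> z) / 2))"
   proof (rule integral_mono_AE')
    show "integrable lborel (%z::real^'n. B * exp (- (z \<bullet> z) / 2))" by (intro integrable_mult_right gauss_integrable)
    show "AE z in lborel. norm (zt (x + (1 / real (Suc k)) *R z) * gauss z) <= B * exp (- (z \<bullet> z) / 2)"
     using b by (simp add: norm_mult gauss_def mult_right_mono)
   qed (use B in simp)
   finally show ?thesis by (simp add: gauss_int_def)
  qed
  then show "AE x in lborel. norm (h x * ?A k x) <= norm (h x) * (B * gauss_int TYPE('n))" for k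
   by (simp add: norm_mult mult_left_mono)
 qed measurable
 then have "(LINT x|lborel. h x * (zt x * cor (gauss_int TYPE('n)))) = 0"
  using zero[of "1 / real (Suc _)"] by (simp add: LIMSEQ_const_iff)
 then show ?thesis using gauss_int_pos[where 'n='n] by (simp flip: mult.assoc)
qed

text \<open>The functions \<open>min 1 (k * infdist x (- A))\<close> converge to the indicator of an
  open set \<open>A\<close>. Open sets are stable under intersection and generate the Borel sets, so
  the integral of \<open>h\<close> vanishes over every Borel set.\<close>

lemma continuous_annihilator_AE_zero:
 fixes h :: "'a::euclidean_space => complex"
 assumes h: "integrable lborel h"
  and z: "!!zt :: 'a => complex. continuous_on UNIV zt ==> (!!x. norm (zt x) <= 1) ==> (LINT x|lborel. h x * zt x) = 0"
 shows "AE x in lborel. h x = 0"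
proof (rule sigma_finite_measure.density_zero[OF sigma_finite_lborel h])
 have [measurable]: "h \<in> borel_measurable borel" using h borel_measurable_integrable by force
 have UN: "(LINT x|lborel. h x) = 0" using z[of "%_. 1"] by (simp add: continuous_on_const)
 have op: "(LINT x:A|lborel. h x) = 0" if A: "open A" for A
 \<comment> \<open>The distance to the empty complement is 0 by convention, so for the whole space
   the constant test function is taken instead.\<close>
 proof (cases "A = UNIV")
  case True then show ?thesis using UN by (simp add: set_lebesgue_integral_def)
 next
  case False
  have Am [measurable]: "A \<in> sets borel" using A by simp
  let ?z = "%k x. cor (min 1 (real k * infdist x (- A)))"
  have "(%k. LINT x|lborel. h x * ?z k x) \<longlonglongrightarrow> (LINT x|lborel. indicator A x *R h x)"
  proof (rule integral_dominated_convergence[where w="%x. norm (h x)"])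
   show "integrable lborel (%x. norm (h x))" using h by simp
   show "(%x. indicator A x *R h x) \<in> borel_measurable lborel" by measurable
   have "?z k \<in> borel_measurable borel" for k
    by (intro borel_measurable_continuous_onI continuous_intros)
   then show "(%x. h x * ?z k x) \<in> borel_measurable lborel" for k by measurable
   show "AE x in lborel. (%k. h x * ?z k x) \<longlonglongrightarrow> indicator A x *R h x"
   proof (rule AE_I2)
    fix x
    show "(%k. h x * ?z k x) \<longlonglongrightarrow> indicator A x *R h x"
    proof (cases "x \<in> A")
     case True
     have "closed (- A)" "- A ~= {}" using A False by auto
     then have d: "0 < infdist x (- A)" using True in_closed_iff_infdist_zero[of "- A" x] infdist_nonneg[of x "- A"] by (auto simp: less_le)
     obtain K where K: "1 < real K * infdist x (- A)" using reals_Archimedean3[OF d] by blast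
     have "min 1 (real k * infdist x (- A)) = 1" if "K <= k" for k
     proof -
      have "real K * infdist x (- A) <= real k * infdist x (- A)" using that d by (intro mult_right_mono) auto
      then show ?thesis using K by (simp add: min_def)
     qed
     then have "\<forall>\<^sub>F k in sequentially. h x * ?z k x = h x" by (auto simp: eventually_sequentially intro!: exI[of _ K])
     then show ?thesis using True by (simp add: tendsto_eventually)
    qed (simp add: infdist_zero)
   qed
   have "0 <= min 1 (real k * infdist x (- A))" for k x by (simp add: infdist_nonneg)
   then show "AE x in lborel. norm (h x * ?z k x) <= norm (h x)" for k
    by (simp add: norm_mult mult_left_le)
  qed
  moreover have "(LINT x|lborel. h x * ?z k x) = 0" for k
  proof (rule z)
   have "0 <= min 1 (real k * infdist x (- A))" for k x by (simp add: infdist_nonneg)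
   then show "norm (?z k x) <= 1" for x by simp
  qed (intro continuous_intros)
  ultimately show ?thesis by (simp add: set_lebesgue_integral_def LIMSEQ_const_iff)
 qed
 fix A :: "'a set" assume "A \<in> sets lborel"
 then have A: "A \<in> sigma_sets UNIV {S. open S}" by (simp add: borel_def)
 have "Int_stable {S :: 'a set. open S}" by (auto simp: Int_stable_def)
 moreover have "{S :: 'a set. open S} \<subseteq> Pow UNIV" by simp
 moreover note A
 ultimately show "(LINT x:A|lborel. h x) = 0"
 proof (induction rule: sigma_sets_induct_disjoint)
  case (basic A) then show ?case using op by simp
 next
  case empty then show ?case by (simp add: set_lebesgue_integral_def)
 next
  case (compl A)
  have Am: "A \<in> sets lborel" using compl(1) by (simp add: borel_def)
  have "(LINT x:A|lborel. h x) + (LINT x:UNIV - A|lborel. h x) = (LINT x:A \<union> (UNIV - A)|lborel. h x)"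
   by (rule set_integral_Un[symmetric]) (use Am h in "auto simp: set_integrable_def intro!: integrable_mult_indicator")
  then show ?case using compl(2) UN by (simp add: set_lebesgue_integral_def)
 next
  case (union A)
  have Am: "A i \<in> sets lborel" for i using union(2) by (auto simp: borel_def)
  have "(LINT x:(\<Union>i. A i)|lborel. h x) = (\<Sum>i. (LINT x:(A i)|lborel. h x))"
   by (rule lebesgue_integral_countable_add)
     (use Am h union(1) in "auto simp: set_integrable_def disjoint_family_on_def intro!: integrable_mult_indicator")
  then show ?case using union(3) by simp
 qed
qed

text \<open>A Gaussian factor makes \<open>f\<close> integrable and never vanishes. Its product with
  a dilated and translated Gaussian is still a Schwartz function, so the hypothesis supplies what
  \<open>gauss_annihilator\<close> asks for.\<close>

lemma schwartz_annihilator_AE_zero: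
 fixes f :: "real^'n::finite => complex"
 assumes f [measurable]: "f \<in> borel_measurable borel"
  and i: "!!ph. schwartz ph ==> integrable lborel (%x. f x * ph x)"
  and z: "!!ph. schwartz ph ==> (LINT x|lborel. f x * ph x) = 0"
 shows "AE x in lborel. f x = 0"
proof -
 have h: "integrable lborel (%x. f x * gauss x)" by (rule i[OF schwartz_gauss])
 have "(LINT x|lborel. (f x * gauss x) * gauss (a *R (y - x))) = 0" if "a > 0" for a y
 proof -
  have "schwartz (%x::real^'n. gauss x * gauss (a *R y + (- a) *R x))"
   by (intro schwartz_mult schwartz_affine schwartz_gauss) (use that in auto)
  from z[OF this] show ?thesis by (simp add: scaleR_diff_right mult.assoc)
 qed
 note ga = gauss_annihilator[OF h this, where B=1]
 have "AE x in lborel. f x * gauss x = 0"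
  by (rule continuous_annihilator_AE_zero[OF h]) (rule ga)
 then show ?thesis by (rule AE_mp) (auto simp: gauss_def)
qed

text \<open>By inversion every Schwartz function is a multiple of a transform, so
  \<open>osc_swap\<close> shows that \<open>f\<close> annihilates all of them.\<close>

lemma osc_injective:
 fixes f :: "real^'n::finite => complex"
 assumes f: "integrable lborel f" and z: "!!x. osc f x = 0"
 shows "AE x in lborel. f x = 0"
proof (rule schwartz_annihilator_AE_zero)
 show fm: "f \<in> borel_measurable borel" using f borel_measurable_integrable by force
 fix ph :: "real^'n => complex" assume S: "schwartz ph"
 obtain B where B: "!!x. norm (ph x) <= B" using schwartz_bounded[OF S, of 0] by auto
 have [measurable]: "ph \<in> borel_measurable borel" by (rule schwartz_measurable[OF S])
 show "integrable lborel (%x. f x * ph x)"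
 proof (rule Bochner_Integration.integrable_bound[of _ "%x. B * norm (f x)"])
  show "AE x in lborel. norm (f x * ph x) <= norm (B * norm (f x))"
   using mult_right_mono[OF B norm_ge_zero, of _ "f _"] order_trans[OF norm_ge_zero B] by (simp add: norm_mult mult.commute[of "norm (f _)"])
 qed (use f fm in auto)
 let ?psi = "%x. osc ph (- x)"
 have "(LINT x|lborel. osc f x * ?psi x) = (LINT x|lborel. f x * osc ?psi x)"
  by (rule osc_swap[OF f schwartz_integrable[OF schwartz_reflect[OF schwartz_osc[OF S]]]])
 moreover have "osc ?psi x = cor ((gauss_int TYPE('n))^2) * ph x" for x
 proof -
  have "osc ?psi x = osc (osc ph) (- x)"
   unfolding osc_def[of ?psi] osc_def[of "osc ph"] by (subst lborel_integral_reflect[symmetric]) simp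
  then show ?thesis using osc_osc[OF S] by simp
 qed
 ultimately have "(LINT x|lborel. cor ((gauss_int TYPE('n))^2) * (f x * ph x)) = 0"
  by (simp add: z mult_ac)
 then show "(LINT x|lborel. f x * ph x) = 0" using gauss_int_pos[where 'n='n] by simp
qed

section \<open>Sobolev functions\<close>

text \<open>\<open>sob dl sg u K\<close>: the function \<open>u\<close> is the Fourier integral of an integrable Hermitian density \<open>f\<close> such that
 the norm of \<open>bracket (dl *R xi) powr sg * f xi\<close> in \<open>L\<^sup>2\<close> is at most \<open>K\<close>. The norms for small \<open>dl\<close> are equivalent to the
 one for \<open>dl = 1\<close>, but certain multipliers become contractions for them.\<close>

definition sob :: "real => real => (real^'n::finite => real) => real => bool" where
 "sob dl sg u K \<longleftrightarrow> 0 <= K & (\<exists>f. f \<in> borel_measurable borel & integrable lborel f & (\<forall>xi. f (- xi) = cnj (f xi)) &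
   (\<integral>\<^sup>+xi. ennreal ((bracket (dl *R xi) powr sg * norm (f xi))^2) \<partial>lborel) <= ennreal (K^2) &
   (\<forall>x. u x = Re (osc f x)))"

lemma integrableI_nn:
 fixes f :: "'a => 'b::{banach, second_countable_topology}"
 shows "f \<in> borel_measurable M ==> (\<integral>\<^sup>+x. ennreal (norm (f x)) \<partial>M) < \<infinity> ==> integrable M f"
 by (rule integrableI_bounded)

lemma lborel_nn_integral_reflect:
 fixes f :: "'a::euclidean_space => ennreal"
 assumes "f \<in> borel_measurable borel"
 shows "(\<integral>\<^sup>+x. f (- x) \<partial>lborel) = (\<integral>\<^sup>+x. f x \<partial>lborel)"
 using lborel_nn_integral_affine[OF assms, of "-1" 0] by simp

lemma osc_uminus: "osc (%xi. f (- xi)) x = osc f (- x)"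
 unfolding osc_def by (subst lborel_integral_reflect[symmetric]) simp

lemma osc_cnj:
 fixes f :: "real^'n::finite => complex"
 shows "osc (%xi. cnj (f xi)) x = cnj (osc f (- x))"
proof -
 have "cnj (LINT xi|lborel. G xi) = (LINT xi|lborel. cnj (G xi))" for G :: "real^'n => complex" by simp
 from this[of "%xi. exp (\<i> * cor (xi \<bullet> (- x))) * f xi"]
 show ?thesis unfolding osc_def by (simp only: complex_cnj_mult exp_cnj) simp
qed

lemma ennreal_half_add:
 assumes "0 <= a" "0 <= b"
 shows "ennreal (1/2 * a + 1/2 * b) = ennreal (1/2) * ennreal a + ennreal (1/2) * ennreal b"
proof -
 have "ennreal (1/2 * a + 1/2 * b) = ennreal (1/2 * a) + ennreal (1/2 * b)" using assms by (intro ennreal_plus) auto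
 also have "ennreal (1/2 * a) = ennreal (1/2) * ennreal a" using assms by (intro ennreal_mult) auto
 also have "ennreal (1/2 * b) = ennreal (1/2) * ennreal b" using assms by (intro ennreal_mult) auto
 finally show ?thesis .
qed

lemma osc_add: "integrable lborel f ==> integrable lborel g ==> osc (%xi. f xi + g xi) x = osc f x + osc g x"
 unfolding osc_def distrib_left by (intro Bochner_Integration.integral_add osc_integrable)

lemma osc_herm:
 assumes "!!xi. f (- xi) = cnj (f xi)"
 shows "osc f x = cor (Re (osc f x))"
proof -
 have "cnj (osc f x) = osc (%xi. cnj (f xi)) (- x)" by (simp add: osc_cnj)
 also have "... = osc (%xi. f (- xi)) (- x)" by (simp add: assms)
 also have "... = osc f x" by (simp add: osc_uminus)
 finally show ?thesis by (simp add: complex_eq_iff)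
qed

text \<open>An arbitrary density is replaced by its Hermitian part, which has the same real
  transform and, by convexity of the square and evenness of the weight, no larger norm.\<close>

lemma sobI:
 fixes f :: "real^'n::finite => complex"
 assumes [measurable]: "f \<in> borel_measurable borel" and fi: "integrable lborel f"
  and le: "(\<integral>\<^sup>+xi. ennreal ((bracket (dl *R xi) powr sg * norm (f xi))^2) \<partial>lborel) <= ennreal (K^2)"
  and u: "!!x. u x = Re (osc f x)" and K: "0 <= K"
 shows "sob dl sg u K"
proof -
 define g where "g xi = (f xi + cnj (f (- xi))) / 2" for xi
 have [measurable]: "g \<in> borel_measurable borel" unfolding g_def by measurable
 have fi': "integrable lborel (%xi. cnj (f (- xi)))" using fi by (simp add: lborel_integrable_reflect_iff)
 have gi: "integrable lborel g" unfolding g_def using fi fi' by simp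
 have og: "osc g x = (osc f x + cnj (osc f x)) / 2" for x
 proof -
  have "osc g x = (1/2) * osc (%xi. f xi + cnj (f (- xi))) x" unfolding g_def osc_cmult[symmetric] by simp
  also have "osc (%xi. f xi + cnj (f (- xi))) x = osc f x + osc (%xi. cnj (f (- xi))) x"
   by (rule osc_add[OF fi fi'])
  also have "osc (%xi. cnj (f (- xi))) x = cnj (osc f x)"
   using osc_cnj[of "%xi. f (- xi)" x] by (simp add: osc_uminus)
  finally show ?thesis by simp
 qed
 have u': "u x = Re (osc g x)" for x unfolding og u by simp
 let ?w = "%xi. bracket (dl *R xi) powr sg"
 have "(\<integral>\<^sup>+xi. ennreal ((?w xi * norm (g xi))^2) \<partial>lborel)
   <= (\<integral>\<^sup>+xi. ennreal (1/2) * ennreal ((?w xi * norm (f xi))^2) + ennreal (1/2) * ennreal ((?w (- xi) * norm (f (- xi)))^2) \<partial>lborel)"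
 proof (rule nn_integral_mono)
  fix xi :: "real^'n"
  have "(?w xi * norm (g xi))^2 = (?w xi)^2 * (norm (f xi + cnj (f (- xi))))^2 / 4"
   by (simp add: g_def norm_divide power_mult_distrib power_divide)
  also have "... <= (?w xi)^2 * (2 * (norm (f xi))^2 + 2 * (norm (cnj (f (- xi))))^2) / 4"
   by (intro divide_right_mono mult_left_mono norm_add_sq_le) auto
  also have "... = 1/2 * (?w xi * norm (f xi))^2 + 1/2 * (?w (- xi) * norm (f (- xi)))^2"
   by (simp add: power_mult_distrib algebra_simps)
  finally have "ennreal ((?w xi * norm (g xi))^2) <= ennreal (1/2 * (?w xi * norm (f xi))^2 + 1/2 * (?w (- xi) * norm (f (- xi)))^2)"
   by (rule ennreal_leI)
  then show "ennreal ((?w xi * norm (g xi))^2) <= ennreal (1/2) * ennreal ((?w xi * norm (f xi))^2) + ennreal (1/2) * ennreal ((?w (- xi) * norm (f (- xi)))^2)"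
   by (simp only: ennreal_half_add zero_le_power2)
 qed
 also have "... = ennreal (1/2) * (\<integral>\<^sup>+xi. ennreal ((?w xi * norm (f xi))^2) \<partial>lborel) + ennreal (1/2) * (\<integral>\<^sup>+xi. ennreal ((?w xi * norm (f xi))^2) \<partial>lborel)"
  using lborel_nn_integral_reflect[of "%xi. ennreal ((?w xi * norm (f xi))^2)"]
  by (simp add: nn_integral_add nn_integral_cmult)
 also have "... = (ennreal (1/2) + ennreal (1/2)) * (\<integral>\<^sup>+xi. ennreal ((?w xi * norm (f xi))^2) \<partial>lborel)"
  by (simp only: distrib_right)
 also have "ennreal (1/2) + ennreal (1/2) = 1"
  by (subst ennreal_plus[symmetric]) auto
 also have "1 * (\<integral>\<^sup>+xi. ennreal ((?w xi * norm (f xi))^2) \<partial>lborel) <= ennreal (K^2)" using le by simp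
 finally have le': "(\<integral>\<^sup>+xi. ennreal ((?w xi * norm (g xi))^2) \<partial>lborel) <= ennreal (K^2)" .
 have "g (- xi) = cnj (g xi)" for xi by (simp add: g_def add.commute)
 then show ?thesis unfolding sob_def using K gi le' u' by (intro conjI exI[of _ g]) auto
qed

lemma sobE:
 assumes "sob dl sg u K"
 obtains f where "f \<in> borel_measurable borel" "integrable lborel f" "!!xi. f (- xi) = cnj (f xi)"
  "(\<integral>\<^sup>+xi. ennreal ((bracket (dl *R xi) powr sg * norm (f xi))^2) \<partial>lborel) <= ennreal (K^2)"
  "!!x. u x = Re (osc f x)" "!!x. osc f x = cor (u x)" "0 <= K"
proof -
 from assms obtain f where f: "f \<in> borel_measurable borel" "integrable lborel f" "!!xi. f (- xi) = cnj (f xi)"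
  "(\<integral>\<^sup>+xi. ennreal ((bracket (dl *R xi) powr sg * norm (f xi))^2) \<partial>lborel) <= ennreal (K^2)"
  "!!x. u x = Re (osc f x)" and K: "0 <= K" unfolding sob_def by blast
 have "osc f x = cor (u x)" for x unfolding f(5) by (rule osc_herm) (rule f(3))
 from f this K show ?thesis by (rule that)
qed

text \<open>Cauchy--Schwarz for the measure \<open>k\<close>.\<close>

lemma young_superposition:
 fixes ph :: "real^'n::finite => ennreal" and zt :: "'w => real^'n"
 assumes M: "sigma_finite_measure M"
  and [measurable]: "ph \<in> borel_measurable borel" "k \<in> borel_measurable M" "zt \<in> borel_measurable M"
 shows "(\<integral>\<^sup>+xi. (\<integral>\<^sup>+w. k w * ph (xi - zt w) \<partial>M)^2 \<partial>lborel) <= (\<integral>\<^sup>+w. k w \<partial>M)^2 * (\<integral>\<^sup>+xi. (ph xi)^2 \<partial>lborel)"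
proof -
 interpret M: sigma_finite_measure M by (rule M)
 interpret P: pair_sigma_finite lborel M ..
 have M1 [measurable]: "(%p. ph (fst p - zt (snd p))) \<in> borel_measurable (lborel \<Otimes>\<^sub>M M)" by measurable
 have CS: "(\<integral>\<^sup>+w. k w * ph (xi - zt w) \<partial>M)^2 <= (\<integral>\<^sup>+w. k w \<partial>M) * (\<integral>\<^sup>+w. k w * (ph (xi - zt w))^2 \<partial>M)" for xi
 proof -
  let ?D = "density M k"
  have "(\<integral>\<^sup>+w. 1 * ph (xi - zt w) \<partial>?D)^2 <= (\<integral>\<^sup>+w. 1 ^ 2 \<partial>?D) * (\<integral>\<^sup>+w. (ph (xi - zt w))^2 \<partial>?D)"
   by (rule Cauchy_Schwarz_nn_integral) measurable
  moreover have "(\<integral>\<^sup>+w. ph (xi - zt w) \<partial>?D) = (\<integral>\<^sup>+w. k w * ph (xi - zt w) \<partial>M)"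
   by (rule nn_integral_density) measurable
  moreover have "(\<integral>\<^sup>+w. (ph (xi - zt w))^2 \<partial>?D) = (\<integral>\<^sup>+w. k w * (ph (xi - zt w))^2 \<partial>M)"
   by (rule nn_integral_density) measurable
  moreover have "(\<integral>\<^sup>+w. 1 \<partial>?D) = (\<integral>\<^sup>+w. k w * 1 \<partial>M)"
   by (rule nn_integral_density) measurable
  ultimately show ?thesis by simp
 qed
 have "(\<integral>\<^sup>+xi. (\<integral>\<^sup>+w. k w * ph (xi - zt w) \<partial>M)^2 \<partial>lborel) <= (\<integral>\<^sup>+xi. (\<integral>\<^sup>+w. k w \<partial>M) * (\<integral>\<^sup>+w. k w * (ph (xi - zt w))^2 \<partial>M) \<partial>lborel)"
  by (rule nn_integral_mono) (rule CS)
 also have "... = (\<integral>\<^sup>+w. k w \<partial>M) * (\<integral>\<^sup>+xi. (\<integral>\<^sup>+w. k w * (ph (xi - zt w))^2 \<partial>M) \<partial>lborel)"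
  by (rule nn_integral_cmult) measurable
 also have "(\<integral>\<^sup>+xi. (\<integral>\<^sup>+w. k w * (ph (xi - zt w))^2 \<partial>M) \<partial>lborel) = (\<integral>\<^sup>+w. (\<integral>\<^sup>+xi. k w * (ph (xi - zt w))^2 \<partial>lborel) \<partial>M)"
  by (rule P.Fubini'[symmetric]) measurable
 also have "... = (\<integral>\<^sup>+w. k w * (\<integral>\<^sup>+xi. (ph xi)^2 \<partial>lborel) \<partial>M)"
 proof (rule nn_integral_cong)
  fix w
  have "(\<integral>\<^sup>+xi. k w * (ph (xi - zt w))^2 \<partial>lborel) = k w * (\<integral>\<^sup>+xi. (ph (xi - zt w))^2 \<partial>lborel)"
   by (rule nn_integral_cmult) measurable
  also have "(\<integral>\<^sup>+xi. (ph (xi - zt w))^2 \<partial>lborel) = (\<integral>\<^sup>+xi. (ph xi)^2 \<partial>lborel)"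
   using lborel_nn_integral_translate[of "%xi. (ph xi)^2" "- zt w"] by simp
  finally show "(\<integral>\<^sup>+xi. k w * (ph (xi - zt w))^2 \<partial>lborel) = k w * (\<integral>\<^sup>+xi. (ph xi)^2 \<partial>lborel)" .
 qed
 also have "... = (\<integral>\<^sup>+w. k w \<partial>M) * (\<integral>\<^sup>+xi. (ph xi)^2 \<partial>lborel)"
  by (rule nn_integral_multc) measurable
 finally show ?thesis by (simp add: power2_eq_square mult.assoc)
qed

section \<open>Peetre's inequality and multiplication by superpositions of characters\<close>

lemma bracket_triangle: "bracket (a + b) <= bracket a + norm b"
proof -
 have "(bracket (a + b))^2 <= (bracket a + norm b)^2"
 proof -
  have "(norm (a + b))^2 <= (norm a + norm b)^2" by (simp add: norm_triangle_ineq power_mono)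
  moreover have "norm a * norm b <= bracket a * norm b" by (rule mult_right_mono[OF norm_le_bracket]) simp
  ultimately show ?thesis unfolding power2_sum by (simp add: bracket_def)
 qed
 then show ?thesis by (rule power2_le_imp_le) (use bracket_pos[of a] in simp)
qed

text \<open>Peetre's inequality, which controls the effect of a frequency translation on a weighted
  norm.\<close>

lemma bracket_peetre: "bracket a <= (1 + norm b) * bracket (a - b)"
proof -
 have "bracket a <= bracket (a - b) + norm b" using bracket_triangle[of "a - b" b] by simp
 also have "norm b <= norm b * bracket (a - b)" using mult_left_mono[OF bracket_ge1, of "norm b" "a - b"] by simp
 finally show ?thesis by (simp add: distrib_right)
qed

lemma bracket_powr_peetre: "bracket a powr sg <= (1 + norm b) powr \<bar>sg\<bar> * bracket (a - b) powr sg"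
proof (cases "0 <= sg")
 case True
 have "bracket a powr sg <= ((1 + norm b) * bracket (a - b)) powr sg"
  by (rule powr_mono2[OF True _ bracket_peetre]) (use bracket_pos less_imp_le in auto)
 then show ?thesis using True bracket_pos[of "a - b"] by (simp add: powr_mult)
next
 case False
 \<comment> \<open>For a negative exponent Peetre's inequality is used with the two points
   exchanged.\<close>
 have "bracket (a - b) <= (1 + norm b) * bracket a" using bracket_peetre[of "a - b" "- b"] by simp
 then have "((1 + norm b) * bracket a) powr sg <= bracket (a - b) powr sg"
  by (intro powr_mono2') (use False bracket_pos in auto)
 then have "(1 + norm b) powr (- sg) * ((1 + norm b) powr sg * bracket a powr sg) <= (1 + norm b) powr (- sg) * bracket (a - b) powr sg"
  using bracket_pos[of a] by (intro mult_left_mono) (auto simp: powr_mult)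
 moreover have "(1 + norm b) powr (- sg) * (1 + norm b) powr sg = 1"
 proof -
  have "0 < 1 + norm b" by (simp add: add_pos_nonneg)
  then show ?thesis by (simp add: powr_add[symmetric])
 qed
 ultimately show ?thesis using False by (simp flip: mult.assoc)
qed

lemma superposition_integrable:
 fixes f :: "real^'n::finite => complex" and zt :: "'w => real^'n"
 assumes M: "sigma_finite_measure M"
  and f: "integrable lborel f" and \<kappa>: "integrable M \<kappa>" and [measurable]: "zt \<in> borel_measurable M"
 shows "integrable (lborel \<Otimes>\<^sub>M M) (%(xi, w). \<kappa> w * f (xi - zt w))"
proof -
 interpret M: sigma_finite_measure M by (rule M)
 interpret P: pair_sigma_finite M lborel ..
 interpret Q: pair_sigma_finite lborel M ..
 have [measurable]: "f \<in> borel_measurable borel" "\<kappa> \<in> borel_measurable M" using f \<kappa> borel_measurable_integrable by force+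
 have "integrable (M \<Otimes>\<^sub>M lborel) (%(w, xi). \<kappa> w * f (xi - zt w))"
 proof (rule P.Fubini_integrable)
  show "(%(w, xi). \<kappa> w * f (xi - zt w)) \<in> borel_measurable (M \<Otimes>\<^sub>M lborel)" by measurable
  have i: "integrable lborel (%xi. f (xi - zt w))" for w using lborel_integrable_translate_iff[of f "- zt w"] f by simp
  have "(LINT xi|lborel. norm (f (xi - zt w))) = (LINT xi|lborel. norm (f xi))" for w
   using lborel_integral_translate[of "%xi. norm (f xi)" "- zt w"] by simp
  then show "integrable M (%w. LINT xi|lborel. norm (case (w, xi) of (w, xi) => \<kappa> w * f (xi - zt w)))"
   using \<kappa> by (simp add: norm_mult)
  show "AE w in M. integrable lborel (%xi. case (w, xi) of (w, xi) => \<kappa> w * f (xi - zt w))"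
   using i by simp
 qed
 from P.integrable_product_swap[OF this] show ?thesis by (simp add: split_beta')
qed

text \<open>Translating a density by \<open>zt w\<close> multiplies its transform by a character, so
  an integral of translates multiplies it by a superposition of characters. The index space
  \<open>M\<close> is kept general: Lebesgue space gives products of two fields, pairs of a scale
  and a frequency give powers of the bracket.\<close>

lemma osc_superposition:
 fixes f :: "real^'n::finite => complex" and zt :: "'w => real^'n"
 assumes M: "sigma_finite_measure M"
  and f: "integrable lborel f" and \<kappa>: "integrable M \<kappa>" and [measurable]: "zt \<in> borel_measurable M"
 shows "integrable lborel (%xi. LINT w|M. \<kappa> w * f (xi - zt w))"
  and "osc (%xi. LINT w|M. \<kappa> w * f (xi - zt w)) x = (LINT w|M. exp (\<i> * cor (zt w \<bullet> x)) * \<kappa> w) * osc f x"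
proof -
 interpret M: sigma_finite_measure M by (rule M)
 interpret Q: pair_sigma_finite lborel M ..
 have [measurable]: "f \<in> borel_measurable borel" "\<kappa> \<in> borel_measurable M" using f \<kappa> borel_measurable_integrable by force+
 note i = superposition_integrable[OF M f \<kappa> assms(4)]
 show "integrable lborel (%xi. LINT w|M. \<kappa> w * f (xi - zt w))" by (rule Q.integrable_fst[OF i])
 let ?e = "%xi. exp (\<i> * cor (xi \<bullet> x))"
 have i2: "integrable (lborel \<Otimes>\<^sub>M M) (%(xi, w). ?e xi * (\<kappa> w * f (xi - zt w)))"
 proof (rule Bochner_Integration.integrable_bound[OF i])
  show "(%(xi, w). ?e xi * (\<kappa> w * f (xi - zt w))) \<in> borel_measurable (lborel \<Otimes>\<^sub>M M)" by measurable
 qed (auto simp: norm_mult)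
 have "osc (%xi. LINT w|M. \<kappa> w * f (xi - zt w)) x = (LINT xi|lborel. LINT w|M. ?e xi * (\<kappa> w * f (xi - zt w)))"
  unfolding osc_def by simp
 also have "... = (LINT w|M. LINT xi|lborel. ?e xi * (\<kappa> w * f (xi - zt w)))"
  by (rule Q.Fubini_integral[OF i2, symmetric])
 also have "... = (LINT w|M. (?e (zt w) * \<kappa> w) * osc f x)"
 proof (rule Bochner_Integration.integral_cong[OF refl])
  fix w
  have "(LINT xi|lborel. ?e xi * (\<kappa> w * f (xi - zt w))) = (LINT xi|lborel. ?e (xi + zt w) * (\<kappa> w * f xi))"
   by (subst lborel_integral_translate[of _ "zt w", symmetric]) simp
  also have "... = (LINT xi|lborel. (?e (zt w) * \<kappa> w) * (?e xi * f xi))"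
  proof (rule Bochner_Integration.integral_cong[OF refl])
   fix xi
   have "?e (xi + zt w) = ?e xi * ?e (zt w)" by (simp only: inner_add_left of_real_add distrib_left exp_add)
   then show "?e (xi + zt w) * (\<kappa> w * f xi) = (?e (zt w) * \<kappa> w) * (?e xi * f xi)" by (simp only: mult_ac)
  qed
  finally show "(LINT xi|lborel. ?e xi * (\<kappa> w * f (xi - zt w))) = (?e (zt w) * \<kappa> w) * osc f x"
   by (simp add: osc_def)
 qed
 also have "... = (LINT w|M. ?e (zt w) * \<kappa> w) * osc f x" by simp
 finally show "osc (%xi. LINT w|M. \<kappa> w * f (xi - zt w)) x = (LINT w|M. ?e (zt w) * \<kappa> w) * osc f x" .
qed

text \<open>The cost of such a multiplier is the integral of the kernel against Peetre's factor, by
  Young's inequality. In the norm with parameter \<open>dl\<close> this factor is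
  \<open>(1 + dl * norm (zt w)) powr \<bar>sg\<bar>\<close>, which tends to 1 with
  \<open>dl\<close>.\<close>

lemma sob_superposition:
 fixes zt :: "'w => real^'n::finite"
 assumes u: "sob dl sg u K" and dl: "0 <= dl"
  and M: "sigma_finite_measure M"
  and [measurable]: "\<kappa> \<in> borel_measurable M" "zt \<in> borel_measurable M"
  and A: "(\<integral>\<^sup>+w. ennreal ((1 + dl * norm (zt w)) powr \<bar>sg\<bar> * norm (\<kappa> w)) \<partial>M) <= ennreal A" "0 <= A"
  and a: "!!x. cor (a x) = (LINT w|M. exp (\<i> * cor (zt w \<bullet> x)) * \<kappa> w)"
 shows "sob dl sg (%x. a x * u x) (A * K)"
proof -
 interpret M: sigma_finite_measure M by (rule M)
 obtain f where f [measurable]: "f \<in> borel_measurable borel" and fi: "integrable lborel f"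
  and fle: "(\<integral>\<^sup>+xi. ennreal ((bracket (dl *R xi) powr sg * norm (f xi))^2) \<partial>lborel) <= ennreal (K^2)"
  and fu: "!!x. osc f x = cor (u x)" and K: "0 <= K"
  using u by (rule sobE) blast
 have k1: "1 <= (1 + dl * norm (zt w)) powr \<bar>sg\<bar>" for w using dl by (intro ge_one_powr_ge_zero) auto
 have \<kappa>: "integrable M \<kappa>"
 proof (rule integrableI_nn)
  have "(\<integral>\<^sup>+w. ennreal (norm (\<kappa> w)) \<partial>M) <= (\<integral>\<^sup>+w. ennreal ((1 + dl * norm (zt w)) powr \<bar>sg\<bar> * norm (\<kappa> w)) \<partial>M)"
   using mult_right_mono[OF k1 norm_ge_zero] by (intro nn_integral_mono ennreal_leI) simp
  also have "... < \<infinity>" using A le_less_trans by fastforce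
  finally show "(\<integral>\<^sup>+w. ennreal (norm (\<kappa> w)) \<partial>M) < \<infinity>" .
 qed measurable
 define g where "g xi = (LINT w|M. \<kappa> w * f (xi - zt w))" for xi
 have gi: "integrable lborel g" unfolding g_def by (rule osc_superposition(1)[OF M fi \<kappa>]) measurable
 have og: "osc g x = cor (a x * u x)" for x
  unfolding g_def osc_superposition(2)[OF M fi \<kappa> assms(5)] a[symmetric] fu by simp
 let ?w = "%xi. bracket (dl *R xi) powr sg"
 let ?k = "%w. ennreal ((1 + dl * norm (zt w)) powr \<bar>sg\<bar> * norm (\<kappa> w))"
 let ?p = "%xi. ennreal (?w xi * norm (f xi))"
 have pt: "ennreal (?w xi * norm (g xi)) <= (\<integral>\<^sup>+w. ?k w * ?p (xi - zt w) \<partial>M)" for xi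
 proof -
  have "ennreal (norm (g xi)) <= (\<integral>\<^sup>+w. ennreal (norm (\<kappa> w * f (xi - zt w))) \<partial>M)"
  \<comment> \<open>Where the integrand is not integrable, \<open>g xi\<close> is 0 by convention
    and the bound is trivial.\<close>
  proof (cases "integrable M (%w. \<kappa> w * f (xi - zt w))")
   case True then show ?thesis unfolding g_def by (rule integral_norm_bound_ennreal)
  next
   case False then show ?thesis unfolding g_def by (simp add: not_integrable_integral_eq)
  qed
  then have "ennreal (?w xi * norm (g xi)) <= ennreal (?w xi) * (\<integral>\<^sup>+w. ennreal (norm (\<kappa> w * f (xi - zt w))) \<partial>M)"
   by (simp add: ennreal_mult mult_left_mono)
  also have "... = (\<integral>\<^sup>+w. ennreal (?w xi) * ennreal (norm (\<kappa> w * f (xi - zt w))) \<partial>M)"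
   by (rule nn_integral_cmult[symmetric]) measurable
  also have "... <= (\<integral>\<^sup>+w. ?k w * ?p (xi - zt w) \<partial>M)"
  proof (rule nn_integral_mono)
   fix w
   have "?w xi <= (1 + dl * norm (zt w)) powr \<bar>sg\<bar> * ?w (xi - zt w)"
    using bracket_powr_peetre[of "dl *R xi" sg "dl *R zt w"] dl by (simp add: scaleR_diff_right)
   then have "?w xi * norm (\<kappa> w * f (xi - zt w)) <= ((1 + dl * norm (zt w)) powr \<bar>sg\<bar> * ?w (xi - zt w)) * norm (\<kappa> w * f (xi - zt w))"
    by (rule mult_right_mono) simp
   then have "ennreal (?w xi * norm (\<kappa> w * f (xi - zt w))) <= ennreal (((1 + dl * norm (zt w)) powr \<bar>sg\<bar> * norm (\<kappa> w)) * (?w (xi - zt w) * norm (f (xi - zt w))))"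
    by (intro ennreal_leI) (simp add: norm_mult mult_ac)
   then show "ennreal (?w xi) * ennreal (norm (\<kappa> w * f (xi - zt w))) <= ?k w * ?p (xi - zt w)"
    by (simp add: ennreal_mult[symmetric])
  qed
  finally show ?thesis .
 qed
 have sq: "ennreal (r^2) = (ennreal r)^2" if "0 <= r" for r by (simp add: ennreal_power that)
 have "(\<integral>\<^sup>+xi. ennreal ((?w xi * norm (g xi))^2) \<partial>lborel) <= (\<integral>\<^sup>+xi. (\<integral>\<^sup>+w. ?k w * ?p (xi - zt w) \<partial>M)^2 \<partial>lborel)"
 proof (rule nn_integral_mono)
  fix xi
  have "ennreal ((?w xi * norm (g xi))^2) = (ennreal (?w xi * norm (g xi)))^2" by (rule sq) simp
  also have "... <= (\<integral>\<^sup>+w. ?k w * ?p (xi - zt w) \<partial>M)^2" by (rule power_mono[OF pt]) simp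
  finally show "ennreal ((?w xi * norm (g xi))^2) <= (\<integral>\<^sup>+w. ?k w * ?p (xi - zt w) \<partial>M)^2" .
 qed
 also have "... <= (\<integral>\<^sup>+w. ?k w \<partial>M)^2 * (\<integral>\<^sup>+xi. (?p xi)^2 \<partial>lborel)"
  by (rule young_superposition[OF M]) measurable
 also have "(\<integral>\<^sup>+xi. (?p xi)^2 \<partial>lborel) = (\<integral>\<^sup>+xi. ennreal ((?w xi * norm (f xi))^2) \<partial>lborel)" by (simp add: sq)
 also have "(\<integral>\<^sup>+w. ?k w \<partial>M)^2 * ... <= (ennreal A)^2 * ennreal (K^2)"
  by (intro mult_mono power_mono A fle) auto
 also have "... = ennreal ((A * K)^2)" using A K by (simp add: sq power_mult_distrib ennreal_mult)
 finally have gle: "(\<integral>\<^sup>+xi. ennreal ((?w xi * norm (g xi))^2) \<partial>lborel) <= ennreal ((A * K)^2)" .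
 show ?thesis
  by (rule sobI[of g]) (use gi gle og A K in "auto simp: borel_measurable_integrable")
qed

text \<open>The constant of the embedding into bounded functions: the L2 norm of
  \<open>bracket xi powr (- sg)\<close>, finite for \<open>sg\<close> above half the
  dimension.\<close>

definition sob_const :: "'n::finite itself => real => real" where
 "sob_const _ sg = sqrt (LINT xi::real^'n|lborel. bracket xi powr (- (2 * sg)))"

lemma sob_const_nonneg: "0 <= sob_const TYPE('n::finite) sg"
 unfolding sob_const_def by (intro real_sqrt_ge_zero integral_nonneg_AE) auto

lemma bracket_powr_integrable:
 assumes "sg > real CARD('n::finite) / 2"
 shows "integrable lborel (%xi::real^'n. bracket xi powr (- (2 * sg)))"
proof (rule Bochner_Integration.integrable_bound)
 show "integrable lborel (%xi::real^'n. 2 powr (2 * sg) * (1 + norm xi) powr (- (2 * sg)))"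
  by (intro integrable_mult_right integrable_one_plus_norm_powr) (use assms in auto)
 have "bracket xi powr (- (2 * sg)) <= 2 powr (2 * sg) * (1 + norm xi) powr (- (2 * sg))" for xi :: "real^'n"
 proof -
  have "0 < 1 + norm xi" by (simp add: add_pos_nonneg)
  moreover have "0 < sg" using assms by (meson divide_nonneg_nonneg le_less_trans of_nat_0_le_iff zero_le_numeral)
  ultimately have "bracket xi powr (- (2 * sg)) <= ((1 + norm xi) / 2) powr (- (2 * sg))"
   using le_bracket[of xi] by (intro powr_mono2') auto
  also have "... = 2 powr (2 * sg) * (1 + norm xi) powr (- (2 * sg))"
  proof -
   have "((1 + norm xi) / 2) powr (- (2 * sg)) = (1 + norm xi) powr (- (2 * sg)) / 2 powr (- (2 * sg))"
    by (rule powr_divide)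
   also have "2 powr (- (2 * sg)) = inverse ((2::real) powr (2 * sg))" by (rule powr_minus)
   finally show ?thesis by (simp only: divide_inverse[of "_ powr _"] inverse_inverse_eq mult.commute)
  qed
  finally show ?thesis .
 qed
 then show "AE xi::real^'n in lborel. norm (bracket xi powr (- (2 * sg))) <= norm (2 powr (2 * sg) * (1 + norm xi) powr (- (2 * sg)))"
  by simp
qed measurable

lemma ennreal_power2_le_cancel:
 assumes "x^2 <= (ennreal c)^2" "0 <= c" shows "x <= ennreal c"
proof (cases x rule: ennreal_cases)
 case (real r)
 then have "ennreal (r^2) <= ennreal (c^2)" using assms by (simp add: ennreal_power)
 then have "r^2 <= c^2" by (simp add: ennreal_le_iff)
 then show ?thesis using real assms by (auto intro!: ennreal_leI simp: power2_le_iff_abs_le)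
next
 case top
 then show ?thesis using assms by (simp add: ennreal_power top_unique)
qed

abbreviation wl2 :: "real => (real^'n::finite => complex) => real => bool" where
 "wl2 sg f K == (\<integral>\<^sup>+xi. ennreal ((bracket xi powr sg * norm (f xi))^2) \<partial>lborel) <= ennreal (K^2)"

text \<open>Cauchy-Schwarz, after splitting off the square-integrable factor
  \<open>bracket xi powr (- sg)\<close>. Integrability of the density is what makes these Sobolev
  functions continuous with pointwise values.\<close>

lemma sob_density_L1:
 fixes f :: "real^'n::finite => complex"
 assumes sg: "sg > real CARD('n) / 2" and [measurable]: "f \<in> borel_measurable borel"
  and le: "wl2 sg f K" and K: "0 <= K"
 shows "(\<integral>\<^sup>+xi. ennreal (norm (f xi)) \<partial>lborel) <= ennreal (sob_const TYPE('n) sg * K)"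
  and "integrable lborel f"
proof -
 let ?C = "sob_const TYPE('n) sg"
 have sq: "ennreal (r^2) = (ennreal r)^2" if "0 <= r" for r by (simp add: ennreal_power that)
 have "(\<integral>\<^sup>+xi. ennreal (norm (f xi)) \<partial>lborel) = (\<integral>\<^sup>+xi. ennreal (bracket xi powr (- sg)) * ennreal (bracket xi powr sg * norm (f xi)) \<partial>lborel)"
 proof (rule nn_integral_cong)
  fix xi :: "real^'n"
  have "bracket xi powr (- sg) * (bracket xi powr sg * norm (f xi)) = norm (f xi)"
   using bracket_pos[of xi] by (simp add: powr_minus field_simps)
  then show "ennreal (norm (f xi)) = ennreal (bracket xi powr (- sg)) * ennreal (bracket xi powr sg * norm (f xi))"
   by (subst ennreal_mult[symmetric]) auto
 qed
 then have "(\<integral>\<^sup>+xi. ennreal (norm (f xi)) \<partial>lborel)^2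
   <= (\<integral>\<^sup>+xi. (ennreal (bracket (xi::real^'n) powr (- sg)))^2 \<partial>lborel) * (\<integral>\<^sup>+xi. (ennreal (bracket xi powr sg * norm (f xi)))^2 \<partial>lborel)"
  by (simp only:) (rule Cauchy_Schwarz_nn_integral, measurable)
 also have "(\<integral>\<^sup>+xi. (ennreal (bracket (xi::real^'n) powr (- sg)))^2 \<partial>lborel) = ennreal (?C^2)"
 proof -
  have "(ennreal (bracket xi powr (- sg)))^2 = ennreal (bracket xi powr (- (2 * sg)))" for xi :: "real^'n"
   by (subst sq[symmetric]) (auto simp: power2_eq_square powr_add[symmetric])
  then show ?thesis
   unfolding sob_const_def by (simp add: nn_integral_eq_integral[OF bracket_powr_integrable[OF sg]] integral_nonneg_AE)
 qed
 also have "(\<integral>\<^sup>+xi. (ennreal (bracket xi powr sg * norm (f xi)))^2 \<partial>lborel) <= ennreal (K^2)"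
  using le by (simp add: sq)
 also have "ennreal (?C^2) * ennreal (K^2) = (ennreal (?C * K))^2"
  using sob_const_nonneg[where 'n='n, of sg] K by (simp add: sq ennreal_mult power_mult_distrib)
 finally have s: "(\<integral>\<^sup>+xi. ennreal (norm (f xi)) \<partial>lborel)^2 <= (ennreal (?C * K))^2"
  by (simp add: mult_left_mono)
 show L1: "(\<integral>\<^sup>+xi. ennreal (norm (f xi)) \<partial>lborel) <= ennreal (?C * K)"
  using s sob_const_nonneg[where 'n='n, of sg] K by (intro ennreal_power2_le_cancel) auto
 show "integrable lborel f"
  by (rule integrableI_nn) (simp, rule le_less_trans[OF L1], simp)
qed

lemma sobI1:
 fixes f :: "real^'n::finite => complex"
 assumes sg: "sg > real CARD('n) / 2" and "f \<in> borel_measurable borel"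
  and "wl2 sg f K"
  and "!!x. u x = Re (osc f x)" and "0 <= K"
 shows "sob 1 sg u K"
proof (rule sobI[of f])
 show "integrable lborel f" by (rule sob_density_L1(2)[OF sg assms(2,3,5)])
qed (use assms in auto)

lemma sobE1:
 assumes "sob 1 sg u K"
 obtains f where "f \<in> borel_measurable borel" "integrable lborel f" "!!xi. f (- xi) = cnj (f xi)"
  "wl2 sg f K"
  "!!x. u x = Re (osc f x)" "!!x. osc f x = cor (u x)" "0 <= K"
 by (rule sobE[OF assms, unfolded scaleR_one]) (rule that)

lemma sob_bound:
 assumes sg: "sg > real CARD('n::finite) / 2" and "sob 1 sg (u :: real^'n => real) K"
 shows "\<bar>u x\<bar> <= sob_const TYPE('n) sg * K"
proof -
 obtain f where f: "f \<in> borel_measurable borel" "integrable lborel f"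
  "wl2 sg f K"
  "!!x. u x = Re (osc f x)" "0 <= K" by (rule sobE1[OF assms(2)], rule that, assumption+)
 have "ennreal (LINT xi|lborel. norm (f xi)) <= ennreal (sob_const TYPE('n) sg * K)"
  using sob_density_L1(1)[OF sg f(1,3,5)] f(2) by (subst (asm) nn_integral_eq_integral) auto
 then have "(LINT xi|lborel. norm (f xi)) <= sob_const TYPE('n) sg * K"
  using f(5) sob_const_nonneg[where 'n='n, of sg] by (simp add: ennreal_le_iff)
 moreover have "\<bar>u x\<bar> <= norm (osc f x)" unfolding f(4) by (rule abs_Re_le_cmod)
 ultimately show ?thesis using osc_bound[OF f(2), of x] by linarith
qed

lemma sob_mono: "sob dl sg u K ==> K <= L ==> sob dl sg u L"
proof -
 assume u: "sob dl sg u K" and KL: "K <= L"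
 then have "0 <= K" by (simp add: sob_def)
 then have "ennreal (K^2) <= ennreal (L^2)" using KL by (intro ennreal_leI power_mono)
 then show ?thesis using u KL unfolding sob_def by (meson order_trans)
qed

lemma sob_order_mono:
 assumes "sob dl sg u K" "tu <= sg" shows "sob dl tu u K"
proof -
 obtain f where f: "f \<in> borel_measurable borel" "integrable lborel f"
  "(\<integral>\<^sup>+xi. ennreal ((bracket (dl *R xi) powr sg * norm (f xi))^2) \<partial>lborel) <= ennreal (K^2)"
  "!!x. u x = Re (osc f x)" "0 <= K" by (rule sobE[OF assms(1)], rule that, assumption+)
 have "(\<integral>\<^sup>+xi. ennreal ((bracket (dl *R xi) powr tu * norm (f xi))^2) \<partial>lborel) <= (\<integral>\<^sup>+xi. ennreal ((bracket (dl *R xi) powr sg * norm (f xi))^2) \<partial>lborel)"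
  by (intro nn_integral_mono ennreal_leI power_mono mult_right_mono powr_mono assms(2) bracket_ge1) auto
 with f show ?thesis by (intro sobI[of f]) auto
qed

lemma sob_density_bound:
 fixes f g :: "real^'n::finite => complex"
 assumes [measurable]: "f \<in> borel_measurable borel" "g \<in> borel_measurable borel"
  and le: "wl2 sg f K"
  and pt: "!!xi. bracket xi powr tu * norm (g xi) <= c * (bracket xi powr sg * norm (f xi))" and c: "0 <= c" "0 <= K"
 shows "wl2 tu g (c * K)"
proof -
 have "(\<integral>\<^sup>+xi. ennreal ((bracket xi powr tu * norm (g xi))^2) \<partial>lborel) <= (\<integral>\<^sup>+xi. ennreal (c^2) * ennreal ((bracket xi powr sg * norm (f xi))^2) \<partial>lborel)"
 proof (rule nn_integral_mono)
  fix xi :: "real^'n"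
  have "(bracket xi powr tu * norm (g xi))^2 <= (c * (bracket xi powr sg * norm (f xi)))^2"
   by (rule power_mono[OF pt]) simp
  then have "ennreal ((bracket xi powr tu * norm (g xi))^2) <= ennreal (c^2 * (bracket xi powr sg * norm (f xi))^2)"
   by (intro ennreal_leI) (simp add: power_mult_distrib)
  then show "ennreal ((bracket xi powr tu * norm (g xi))^2) <= ennreal (c^2) * ennreal ((bracket xi powr sg * norm (f xi))^2)"
   by (simp add: ennreal_mult)
 qed
 also have "... = ennreal (c^2) * (\<integral>\<^sup>+xi. ennreal ((bracket xi powr sg * norm (f xi))^2) \<partial>lborel)"
  by (rule nn_integral_cmult) measurable
 also have "... <= ennreal (c^2) * ennreal (K^2)" by (rule mult_left_mono[OF le]) simp
 also have "... = ennreal ((c * K)^2)" by (simp add: power_mult_distrib ennreal_mult)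
 finally show ?thesis .
qed

subsection \<open>Derivatives\<close>

lemma has_derivative_Re_osc:
 assumes "integrable lborel f" "integrable lborel (%xi. norm xi * norm (f xi))"
 shows "((%x. Re (osc f x)) has_derivative (%v. Re (osc (%xi. \<i> * cor (xi \<bullet> v) * f xi) x))) (at x)"
 by (rule has_derivative_Re[OF has_derivative_osc_integral[OF assms]])

lemma pderivative_Re_osc:
 assumes "integrable lborel f" "integrable lborel (%xi. norm xi * norm (f xi))"
 shows "pd j (%x. Re (osc f x)) x = Re (osc (%xi. \<i> * cor (xi $ j) * f xi) x)"
 using pderivative_eqI[OF has_derivative_Re_osc[OF assms], of j] by (simp add: inner_axis)

lemma deriv_density:
 fixes f :: "real^'n::finite => complex"
 assumes sg: "sg > real CARD('n) / 2" and [measurable]: "f \<in> borel_measurable borel"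
  and le: "wl2 (sg + 1) f K" and K: "0 <= K"
 shows "integrable lborel (%xi. norm xi * norm (f xi))"
  and "(\<integral>\<^sup>+xi. ennreal ((bracket xi powr sg * norm (\<i> * cor (xi $ j) * f xi))^2) \<partial>lborel) <= ennreal (K^2)"
proof -
 have b: "bracket xi powr (sg + 1) = bracket xi powr sg * bracket xi" for xi :: "real^'n"
  using bracket_pos[of xi] by (simp add: powr_add)
 have pt: "bracket xi powr sg * (r * norm (f xi)) <= 1 * (bracket xi powr (sg + 1) * norm (f xi))" if "r <= bracket xi" for r xi
  unfolding b using that by (simp add: mult.assoc mult_left_mono mult_right_mono)
 have "(\<integral>\<^sup>+xi. ennreal ((bracket xi powr sg * norm (cor (norm xi) * f xi))^2) \<partial>lborel) <= ennreal ((1 * K)^2)"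
  by (rule sob_density_bound[OF _ _ le]) (use K pt[OF norm_le_bracket] in "auto simp: norm_mult")
 then have "integrable lborel (%xi. cor (norm xi) * f xi)"
  by (intro sob_density_L1(2)[OF sg _ _ K]) auto
 then have "integrable lborel (%xi. norm (cor (norm xi) * f xi))" by (rule integrable_norm)
 then show "integrable lborel (%xi. norm xi * norm (f xi))" by (simp add: norm_mult)
 have "\<bar>xi $ j\<bar> <= bracket xi" for xi :: "real^'n" using component_le_norm_cart[of xi j] norm_le_bracket[of xi] by linarith
 then have "(\<integral>\<^sup>+xi. ennreal ((bracket xi powr sg * norm (\<i> * cor (xi $ j) * f xi))^2) \<partial>lborel) <= ennreal ((1 * K)^2)"
  by (intro sob_density_bound[OF _ _ le]) (use K pt in "auto simp: norm_mult")
 then show "(\<integral>\<^sup>+xi. ennreal ((bracket xi powr sg * norm (\<i> * cor (xi $ j) * f xi))^2) \<partial>lborel) <= ennreal (K^2)" by simp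
qed

lemma sob_deriv:
 assumes sg: "sg > real CARD('n::finite) / 2" and u: "sob 1 (sg + 1) (u :: real^'n => real) K"
 shows "u differentiable (at x)" and "sob 1 sg (pd j u) K"
proof -
 obtain f where f [measurable]: "f \<in> borel_measurable borel" and fi: "integrable lborel f"
  and le: "wl2 (sg + 1) f K"
  and fu: "!!x. u x = Re (osc f x)" and K: "0 <= K" by (rule sobE1[OF u], rule that, assumption+)
 have u': "u = (%x. Re (osc f x))" by (rule ext) (rule fu)
 note d = deriv_density[OF sg f le K]
 show "u differentiable (at x)" unfolding u' by (rule differentiableI[OF has_derivative_Re_osc[OF fi d(1)]])
 show "sob 1 sg (pd j u) K"
  by (rule sobI1[OF sg _ d(2)]) (use K in "auto simp: u' pderivative_Re_osc[OF fi d(1)]")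
qed

lemma osc_continuous:
 fixes f :: "real^'n::finite => complex"
 assumes f: "integrable lborel f" shows "continuous_on UNIV (osc f)"
proof -
 have [measurable]: "f \<in> borel_measurable borel" using f borel_measurable_integrable by force
 have "isCont (osc f) x" for x
  unfolding isCont_def tendsto_at_iff_sequentially
 proof (intro allI impI)
  fix X assume X: "X \<longlonglongrightarrow> x"
  show "(osc f \<circ> X) \<longlonglongrightarrow> osc f x"
   unfolding osc_def o_def
  proof (rule integral_dominated_convergence[where w="%xi. norm (f xi)"])
   show "AE xi in lborel. (%i. exp (\<i> * cor (xi \<bullet> X i)) * f xi) \<longlonglongrightarrow> exp (\<i> * cor (xi \<bullet> x)) * f xi"
    by (intro AE_I2 tendsto_intros X)
   show "AE xi in lborel. norm (exp (\<i> * cor (xi \<bullet> X i)) * f xi) <= norm (f xi)" for i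
    by (simp add: norm_mult)
  qed (use f in "auto intro: integrable_norm")
 qed
 then show ?thesis by (intro continuous_at_imp_continuous_on) auto
qed

lemma sob_continuous:
 assumes u: "sob dl sg u K" shows "continuous_on UNIV u"
proof -
 obtain f where f: "integrable lborel f" and fu: "!!x. u x = Re (osc f x)" by (rule sobE[OF u], rule that, assumption+)
 have "continuous_on UNIV (%x. Re (osc f x))" by (intro continuous_on_Re osc_continuous f)
 then show ?thesis using fu by (simp cong: continuous_on_cong)
qed

text \<open>On the frequency side both orders multiply the density by the same product of
  coordinates.\<close>

lemma sob_second_deriv_commute:
 assumes sg: "sg > real CARD('n::finite) / 2" and u: "sob 1 (sg + 2) (u :: real^'n => real) K"
 shows "pd i (pd j u) x = pd j (pd i u) x"
proof -
 obtain f where f [measurable]: "f \<in> borel_measurable borel" and fi: "integrable lborel f"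
  and le: "wl2 (sg + 2) f K"
  and fu: "!!x. u x = Re (osc f x)" and K: "0 <= K" by (rule sobE1[OF u], rule that, assumption+)
 have u': "u = (%x. Re (osc f x))" by (rule ext) (rule fu)
 have sg1: "sg + 1 > real CARD('n) / 2" using sg by simp
 have le': "wl2 (sg + 1 + 1) f K" using le by (simp add: add.assoc)
 note d1 = deriv_density[OF sg1 f le' K]
 define g where "g j = (%xi. \<i> * cor (xi $ j) * f xi)" for j
 have [measurable]: "g j \<in> borel_measurable borel" for j unfolding g_def by measurable
 have gi: "integrable lborel (g j)" for j
  using sob_density_L1(2)[OF sg1 _ d1(2) K] by (simp add: g_def)
 have gd: "integrable lborel (%xi. norm xi * norm (g j xi))" for j
  by (rule deriv_density(1)[OF sg _ _ K]) (use d1(2)[of j] in "auto simp: g_def")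
 have p: "pd j u = (%x. Re (osc (g j) x))" for j
  unfolding u' g_def by (rule ext) (rule pderivative_Re_osc[OF fi d1(1)])
 show ?thesis unfolding p pderivative_Re_osc[OF gi gd] by (simp add: g_def mult_ac)
qed

subsection \<open>Constant coefficient resolvent\<close>

lemma sob_laplace_density:
 assumes sg: "sg > real CARD('n::finite) / 2" and f [measurable]: "(f :: real^'n => complex) \<in> borel_measurable borel"
  and le: "wl2 (sg + 2) f K" and K: "0 <= K"
 shows "(\<Sum>i\<in>UNIV. pd i (pd i (%x. Re (osc f x))) x) = - Re (osc (%xi. cor ((norm xi)^2) * f xi) x)"
  and "integrable lborel (%xi. cor ((norm xi)^2) * f xi)"
proof -
 have sg1: "sg + 1 > real CARD('n) / 2" using sg by simp
 have sg2: "sg + 2 > real CARD('n) / 2" using sg by simp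
 have fi: "integrable lborel f" by (rule sob_density_L1(2)[OF sg2 f le K])
 have le': "wl2 (sg + 1 + 1) f K" using le by (simp add: add.assoc)
 note d1 = deriv_density[OF sg1 f le' K]
 define g where "g j = (%xi. \<i> * cor (xi $ j) * f xi)" for j
 have gm [measurable]: "g j \<in> borel_measurable borel" for j unfolding g_def by measurable
 have gi: "integrable lborel (g j)" for j
  using sob_density_L1(2)[OF sg1 _ d1(2) K] by (simp add: g_def)
 have gle: "wl2 (sg + 1) (g j) K" for j
  using d1(2)[of j] by (simp add: g_def)
 note d2 = deriv_density[OF sg gm gle K]
 have hi: "integrable lborel (%xi. \<i> * cor (xi $ j) * g j xi)" for j
  by (rule sob_density_L1(2)[OF sg _ d2(2) K]) measurable
 have p: "pd j (%x. Re (osc f x)) = (%x. Re (osc (g j) x))" for j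
  unfolding g_def by (rule ext) (rule pderivative_Re_osc[OF fi d1(1)])
 have e: "cor ((norm xi)^2) * f xi = - (\<Sum>i\<in>UNIV. \<i> * cor (xi $ i) * g i xi)" for xi :: "real^'n"
  by (simp add: g_def power2_norm_eq_inner inner_vec_def sum_distrib_left sum_distrib_right mult_ac flip: sum_negf)
 show "integrable lborel (%xi. cor ((norm xi)^2) * f xi)" unfolding e using hi by simp
 have "osc (%xi. cor ((norm xi)^2) * f xi) x = - (\<Sum>i\<in>UNIV. osc (%xi. \<i> * cor (xi $ i) * g i xi) x)"
  unfolding e osc_def using osc_integrable[OF hi] by (simp add: sum_distrib_left)
 then show "(\<Sum>i\<in>UNIV. pd i (pd i (%x. Re (osc f x))) x) = - Re (osc (%xi. cor ((norm xi)^2) * f xi) x)"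
  unfolding p pderivative_Re_osc[OF gi d2(1)] by simp
qed

text \<open>The density is divided by the symbol \<mu> + |xi|^2. The constant comes from 1 + |xi|^2
  \<le> max 1 (1/\<mu>) times the symbol.\<close>

lemma sob_resolvent:
 assumes sg: "sg > real CARD('n::finite) / 2" and f: "sob 1 sg (f :: real^'n => real) K" and \<mu>: "\<mu> > 0"
 shows "\<exists>u. sob 1 (sg + 2) u (max 1 (1 / \<mu>) * K) & (\<forall>x. \<mu> * u x - (\<Sum>i\<in>UNIV. pd i (pd i u) x) = f x)"
proof -
 obtain h where h [measurable]: "h \<in> borel_measurable borel" and hi: "integrable lborel h"
  and le: "wl2 sg h K"
  and fu: "!!x. f x = Re (osc h x)" and K: "0 <= K" by (rule sobE1[OF f], rule that, assumption+)
 define g where "g xi = h xi / cor (\<mu> + (norm xi)^2)" for xi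
 have [measurable]: "g \<in> borel_measurable borel" unfolding g_def by measurable
 have p: "0 < \<mu> + (norm xi)^2" for xi :: "real^'n" using \<mu> by (simp add: add_pos_nonneg)
 let ?m = "max 1 (1 / \<mu>)"
 have pt: "bracket xi powr (sg + 2) * norm (g xi) <= ?m * (bracket xi powr sg * norm (h xi))" for xi
 proof -
  have "bracket xi powr 2 = 1 + (norm xi)^2"
   using powr_realpow[OF bracket_pos[of xi], of 2] by (simp add: bracket_def)
  also have "... <= ?m * (\<mu> + (norm xi)^2)"
  proof -
   have "1 <= ?m * \<mu>" using \<mu> by (simp add: max_def field_simps)
   moreover have "1 * (norm xi)^2 <= ?m * (norm xi)^2" by (intro mult_right_mono) auto
   ultimately show ?thesis by (simp add: distrib_left)
  qed
  finally have "bracket xi powr 2 / (\<mu> + (norm xi)^2) <= ?m" using p[of xi] by (simp add: pos_divide_le_eq)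
  then have "(bracket xi powr 2 / (\<mu> + (norm xi)^2)) * (bracket xi powr sg * norm (h xi)) <= ?m * (bracket xi powr sg * norm (h xi))"
   by (rule mult_right_mono) simp
  moreover have "norm (g xi) = norm (h xi) / (\<mu> + (norm xi)^2)"
   unfolding g_def norm_divide norm_of_real using p[of xi] by simp
  ultimately show ?thesis by (simp add: powr_add mult_ac)
 qed
 have gle: "wl2 (sg + 2) g (?m * K)"
  by (rule sob_density_bound[OF _ _ le pt]) (use K in auto)
 have mK: "0 <= ?m * K" using K by simp
 have sg2: "sg + 2 > real CARD('n) / 2" using sg by simp
 define u where "u = (%x. Re (osc g x))"
 have "sob 1 (sg + 2) u (?m * K)" by (rule sobI1[OF sg2 _ gle]) (use mK in "auto simp: u_def")
 moreover have "\<mu> * u x - (\<Sum>i\<in>UNIV. pd i (pd i u) x) = f x" for x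
 proof -
  note L = sob_laplace_density[OF sg _ gle mK]
  have gi: "integrable lborel g" by (rule sob_density_L1(2)[OF sg2 _ gle mK]) measurable
  have "h xi = cor \<mu> * g xi + cor ((norm xi)^2) * g xi" for xi
  proof -
   have "cor (\<mu> + (norm xi)^2) ~= 0" using p[of xi] by (simp only: of_real_eq_0_iff)
   then have "cor (\<mu> + (norm xi)^2) * g xi = h xi" unfolding g_def by (simp del: of_real_add)
   then show ?thesis by (simp only: of_real_add distrib_right)
  qed
  then have "h = (%xi. cor \<mu> * g xi + cor ((norm xi)^2) * g xi)" by (rule ext)
  then have "osc h x = cor \<mu> * osc g x + osc (%xi. cor ((norm xi)^2) * g xi) x"
   using gi L(2) by (simp add: osc_add osc_cmult)
  then show ?thesis using L(1) by (simp add: fu u_def)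
 qed
 ultimately show ?thesis by blast
qed

text \<open>By injectivity of the transform the symbol times the density vanishes almost everywhere,
  and the symbol is positive.\<close>

lemma sob_resolvent_unique:
 assumes sg: "sg > real CARD('n::finite) / 2" and u: "sob 1 (sg + 2) (u :: real^'n => real) K" and \<mu>: "\<mu> > 0"
  and eq: "!!x. \<mu> * u x - (\<Sum>i\<in>UNIV. pd i (pd i u) x) = 0"
 shows "u x = 0"
proof -
 obtain g where g [measurable]: "g \<in> borel_measurable borel" and gi: "integrable lborel g" and gh: "!!xi. g (- xi) = cnj (g xi)"
  and le: "wl2 (sg + 2) g K"
  and gu: "!!x. u x = Re (osc g x)" and K: "0 <= K" by (rule sobE1[OF u], rule that, assumption+)
 have u': "u = (%x. Re (osc g x))" by (rule ext) (rule gu)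
 note L = sob_laplace_density[OF sg g le K]
 let ?h = "%xi. cor \<mu> * g xi + cor ((norm xi)^2) * g xi"
 have hi: "integrable lborel ?h" using gi L(2) by simp
 have "osc ?h x = cor (Re (osc ?h x))" for x by (rule osc_herm) (simp add: gh)
 moreover have "Re (osc ?h x) = 0" for x
  using eq[of x] L gi unfolding u' by (simp add: osc_add osc_cmult)
 ultimately have "osc ?h x = 0" for x by simp
 then have "AE xi in lborel. ?h xi = 0" by (rule osc_injective[OF hi])
 then have "AE xi in lborel. g xi = 0"
 proof (rule AE_mp, intro AE_I2 impI)
  fix xi assume "?h xi = 0"
  then have "cor (\<mu> + (norm xi)^2) * g xi = 0" by (simp add: distrib_right)
  moreover have "0 < \<mu> + (norm xi)^2" using \<mu> by (simp add: add_pos_nonneg)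
  ultimately show "g xi = 0" by (simp del: of_real_add)
 qed
 then have "osc g x = (LINT xi::real^'n|lborel. 0)"
  unfolding osc_def by (intro integral_cong_AE) (auto elim!: AE_mp)
 then show ?thesis by (simp add: gu)
qed

subsection \<open>Products\<close>

lemma bracket_powr_add_le:
 assumes "0 <= sg"
 shows "bracket (a + b) powr sg <= 2 powr sg * (bracket a powr sg + bracket b powr sg)"
proof -
 have "bracket (a + b) <= bracket a + bracket b"
  using bracket_triangle[of a b] norm_le_bracket[of b] by linarith
 then have "bracket (a + b) <= 2 * max (bracket a) (bracket b)" by simp
 then have "bracket (a + b) powr sg <= (2 * max (bracket a) (bracket b)) powr sg"
  by (intro powr_mono2 assms) (use bracket_pos less_imp_le in auto)
 also have "... = 2 powr sg * max (bracket a) (bracket b) powr sg"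
  by (rule powr_mult)
 also have "max (bracket a) (bracket b) powr sg <= bracket a powr sg + bracket b powr sg"
  by (simp add: max_def)
 finally show ?thesis by (simp add: mult_left_mono)
qed

lemma nn_integral_sq_add_le:
 fixes a b :: "'a => ennreal"
 assumes [measurable]: "a \<in> borel_measurable M" "b \<in> borel_measurable M"
 shows "(\<integral>\<^sup>+x. (a x + b x)^2 \<partial>M) <= 2 * (\<integral>\<^sup>+x. (a x)^2 \<partial>M) + 2 * (\<integral>\<^sup>+x. (b x)^2 \<partial>M)"
proof -
 have "(r + q)^2 <= 2 * r^2 + 2 * q^2" for r q :: ennreal
 proof (cases "r = top \<or> q = top")
  case False
  then obtain x y where r: "r = ennreal x" "0 <= x" and q: "q = ennreal y" "0 <= y"
   by (metis ennreal_cases)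
  have "(x + y)^2 <= 2 * x^2 + 2 * y^2" using sum_squares_bound[of x y] by (simp add: power2_sum)
  then have "ennreal ((x + y)^2) <= ennreal (2 * x^2 + 2 * y^2)" by (rule ennreal_leI)
  moreover have "ennreal ((x + y)^2) = (r + q)^2" using r q by (simp add: ennreal_power ennreal_plus[symmetric] del: ennreal_plus)
  moreover have "ennreal (2 * x^2 + 2 * y^2) = 2 * r^2 + 2 * q^2" using r q by (simp add: ennreal_power ennreal_plus ennreal_mult)
  ultimately show ?thesis by simp
 qed (auto simp: power2_eq_square ennreal_mult_top ennreal_top_mult)
 then have "(\<integral>\<^sup>+x. (a x + b x)^2 \<partial>M) <= (\<integral>\<^sup>+x. 2 * (a x)^2 + 2 * (b x)^2 \<partial>M)" by (intro nn_integral_mono)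
 then show ?thesis by (simp add: nn_integral_add nn_integral_cmult)
qed

text \<open>The density of a product is a convolution. The weight at \<open>xi\<close> is at most a
  constant times the sum of the weights at \<open>xi - w\<close> and at \<open>w\<close>, so in each
  of two terms one factor keeps the weight and the other is measured in L1, where
  \<open>sg > n/2\<close> enters.\<close>

lemma sob_product:
 assumes sg: "sg > real CARD('n::finite) / 2"
  and u: "sob 1 sg (u :: real^'n => real) K" and v: "sob 1 sg v L"
 shows "sob 1 sg (%x. u x * v x) (2 * 2 powr sg * sob_const TYPE('n) sg * K * L)"
proof -
 obtain f where f [measurable]: "f \<in> borel_measurable borel" and fi: "integrable lborel f"
  and fle: "wl2 sg f K"
  and fu: "!!x. osc f x = cor (u x)" and K: "0 <= K" by (rule sobE1[OF u], rule that, assumption+)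
 obtain g where g [measurable]: "g \<in> borel_measurable borel" and gi: "integrable lborel g"
  and gle: "wl2 sg g L"
  and gv: "!!x. osc g x = cor (v x)" and L: "0 <= L" by (rule sobE1[OF v], rule that, assumption+)
 have sg0: "0 <= sg" using sg by (meson divide_nonneg_nonneg le_less_trans less_imp_le of_nat_0_le_iff zero_le_numeral)
 let ?C = "sob_const TYPE('n) sg"
 have C0: "0 <= ?C" by (rule sob_const_nonneg)
 define h where "h xi = (LINT w|lborel. g w * f (xi - w))" for xi
 have idm: "(%w::real^'n. w) \<in> borel_measurable lborel" by simp
 have hi: "integrable lborel h" unfolding h_def by (rule osc_superposition(1)[OF sigma_finite_lborel fi gi idm])
 have oh: "osc h x = cor (u x * v x)" for x
  unfolding h_def osc_superposition(2)[OF sigma_finite_lborel fi gi idm] fu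
  using gv[of x] by (simp add: osc_def mult.commute)
 let ?w = "%xi. bracket xi powr sg"
 let ?F = "%xi. ennreal (?w xi * norm (f xi))" and ?G = "%xi. ennreal (?w xi * norm (g xi))"
 let ?f = "%xi. ennreal (norm (f xi))" and ?g = "%xi. ennreal (norm (g xi))"
 let ?A = "%xi. \<integral>\<^sup>+w. ?g w * ?F (xi - w) \<partial>lborel" and ?B = "%xi. \<integral>\<^sup>+w. ?f w * ?G (xi - w) \<partial>lborel"
 have pt: "ennreal (?w xi * norm (h xi)) <= ennreal (2 powr sg) * (?A xi + ?B xi)" for xi
 proof -
  have "ennreal (norm (h xi)) <= (\<integral>\<^sup>+w. ennreal (norm (g w * f (xi - w))) \<partial>lborel)"
  proof (cases "integrable lborel (%w. g w * f (xi - w))")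
   case True then show ?thesis unfolding h_def by (rule integral_norm_bound_ennreal)
  next
   case False then show ?thesis unfolding h_def by (simp add: not_integrable_integral_eq)
  qed
  then have "ennreal (?w xi * norm (h xi)) <= ennreal (?w xi) * (\<integral>\<^sup>+w. ennreal (norm (g w * f (xi - w))) \<partial>lborel)"
   by (simp add: ennreal_mult mult_left_mono)
  also have "... = (\<integral>\<^sup>+w. ennreal (?w xi) * ennreal (norm (g w * f (xi - w))) \<partial>lborel)"
   by (rule nn_integral_cmult[symmetric]) measurable
  also have "... <= (\<integral>\<^sup>+w. ennreal (2 powr sg) * (?g w * ?F (xi - w) + ?f (xi - w) * ?G w) \<partial>lborel)"
  proof (rule nn_integral_mono)
   fix w
   have "?w xi <= 2 powr sg * (?w (xi - w) + ?w w)" using bracket_powr_add_le[OF sg0, of "xi - w" w] by simp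
   then have "?w xi * norm (g w * f (xi - w)) <= (2 powr sg * (?w (xi - w) + ?w w)) * norm (g w * f (xi - w))"
    by (rule mult_right_mono) simp
   also have "... = 2 powr sg * (norm (g w) * (?w (xi - w) * norm (f (xi - w))) + norm (f (xi - w)) * (?w w * norm (g w)))"
    by (simp add: norm_mult algebra_simps)
   finally have "ennreal (?w xi * norm (g w * f (xi - w)))
     <= ennreal (2 powr sg * (norm (g w) * (?w (xi - w) * norm (f (xi - w))) + norm (f (xi - w)) * (?w w * norm (g w))))"
    by (rule ennreal_leI)
   then show "ennreal (?w xi) * ennreal (norm (g w * f (xi - w))) <= ennreal (2 powr sg) * (?g w * ?F (xi - w) + ?f (xi - w) * ?G w)"
    by (simp add: ennreal_mult ennreal_plus)
  qed
  also have "... = ennreal (2 powr sg) * (?A xi + (\<integral>\<^sup>+w. ?f (xi - w) * ?G w \<partial>lborel))"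
   by (simp add: nn_integral_cmult nn_integral_add)
  also have "(\<integral>\<^sup>+w. ?f (xi - w) * ?G w \<partial>lborel) = ?B xi"
   using lborel_nn_integral_affine[of "%w. ?f (xi - w) * ?G w" "-1" xi] by simp
  finally show ?thesis .
 qed
 have sq: "ennreal (r^2) = (ennreal r)^2" if "0 <= r" for r by (simp add: ennreal_power that)
 have Am [measurable]: "?A \<in> borel_measurable lborel" "?B \<in> borel_measurable lborel" by measurable
 have A2: "(\<integral>\<^sup>+xi. (?A xi)^2 \<partial>lborel) <= ennreal ((?C * L * K)^2)"
 proof -
  have "(\<integral>\<^sup>+xi. (?A xi)^2 \<partial>lborel) <= (\<integral>\<^sup>+w. ?g w \<partial>lborel)^2 * (\<integral>\<^sup>+xi. (?F xi)^2 \<partial>lborel)"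
   by (rule young_superposition[OF sigma_finite_lborel]) measurable
  also have "... <= (ennreal (?C * L))^2 * ennreal (K^2)"
   using fle by (intro mult_mono power_mono sob_density_L1(1)[OF sg g gle L]) (auto simp: sq)
  finally show ?thesis using C0 L K by (simp add: sq ennreal_mult power_mult_distrib)
 qed
 have B2: "(\<integral>\<^sup>+xi. (?B xi)^2 \<partial>lborel) <= ennreal ((?C * L * K)^2)"
 proof -
  have "(\<integral>\<^sup>+xi. (?B xi)^2 \<partial>lborel) <= (\<integral>\<^sup>+w. ?f w \<partial>lborel)^2 * (\<integral>\<^sup>+xi. (?G xi)^2 \<partial>lborel)"
   by (rule young_superposition[OF sigma_finite_lborel]) measurable
  also have "... <= (ennreal (?C * K))^2 * ennreal (L^2)"
   using gle by (intro mult_mono power_mono sob_density_L1(1)[OF sg f fle K]) (auto simp: sq)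
  finally show ?thesis using C0 L K by (simp add: sq ennreal_mult power_mult_distrib mult_ac)
 qed
 have "(\<integral>\<^sup>+xi. ennreal ((?w xi * norm (h xi))^2) \<partial>lborel) <= (\<integral>\<^sup>+xi. (ennreal (2 powr sg))^2 * (?A xi + ?B xi)^2 \<partial>lborel)"
 proof (rule nn_integral_mono)
  fix xi
  have "ennreal ((?w xi * norm (h xi))^2) = (ennreal (?w xi * norm (h xi)))^2" by (rule sq) simp
  also have "... <= (ennreal (2 powr sg) * (?A xi + ?B xi))^2" by (rule power_mono[OF pt]) simp
  finally show "ennreal ((?w xi * norm (h xi))^2) <= (ennreal (2 powr sg))^2 * (?A xi + ?B xi)^2" by (simp only: power_mult_distrib)
 qed
 also have "... = (ennreal (2 powr sg))^2 * (\<integral>\<^sup>+xi. (?A xi + ?B xi)^2 \<partial>lborel)" by (rule nn_integral_cmult) measurable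
 also have "... <= (ennreal (2 powr sg))^2 * (2 * ennreal ((?C * L * K)^2) + 2 * ennreal ((?C * L * K)^2))"
  by (intro mult_left_mono order_trans[OF nn_integral_sq_add_le] add_mono A2 B2) auto
 also have "... = ennreal ((2 * 2 powr sg * ?C * K * L)^2)"
 proof -
  have "2 * ennreal ((?C * L * K)^2) + 2 * ennreal ((?C * L * K)^2) = ennreal (4 * (?C * L * K)^2)"
   by (simp add: ennreal_mult flip: distrib_right)
  then have "(ennreal (2 powr sg))^2 * (2 * ennreal ((?C * L * K)^2) + 2 * ennreal ((?C * L * K)^2)) = ennreal ((2 powr sg)^2 * (4 * (?C * L * K)^2))"
   by (simp add: sq[symmetric] ennreal_mult)
  also have "(2 powr sg)^2 * (4 * (?C * L * K)^2) = (2 * 2 powr sg * ?C * K * L)^2" by (simp add: power_mult_distrib)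
  finally show ?thesis .
 qed
 finally have hle: "(\<integral>\<^sup>+xi. ennreal ((?w xi * norm (h xi))^2) \<partial>lborel) <= ennreal ((2 * 2 powr sg * ?C * K * L)^2)" .
 show ?thesis
  by (rule sobI1[OF sg _ hle]) (use hi oh C0 K L in "auto simp: borel_measurable_integrable")
qed

subsection \<open>The Hilbert space as a space of functions\<close>

text \<open>An isometric parametrization of the unweighted space of order \<open>sg\<close>:
  \<open>F\<close> is the frequency density multiplied by its weight. All orders share the parameter
  space \<open>l2\<close>.\<close>

definition ev :: "real => 'n::finite l2 => real^'n => real" where
 "ev sg F x = Re (osc (%xi. cor (bracket xi powr (- sg)) * rp F xi) x)"

lemma bracket_powr_cancel: "bracket xi powr sg * (bracket xi powr (- sg) * r) = r"
 using bracket_pos[of xi] by (simp add: powr_minus field_simps)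

lemma osc_cong_AE:
 fixes f g :: "real^'n::finite => complex"
 assumes [measurable]: "f \<in> borel_measurable borel" "g \<in> borel_measurable borel"
  and "AE xi in lborel. f xi = g xi"
 shows "osc f x = osc g x"
 unfolding osc_def by (rule integral_cong_AE) (use assms(3) in auto)

lemma ev_density:
 fixes F :: "'n::finite l2"
 assumes sg: "sg > real CARD('n) / 2"
 defines "f == %xi. cor (bracket xi powr (- sg)) * rp F xi"
 shows "f \<in> borel_measurable borel" "integrable lborel f" "!!xi. f (- xi) = cnj (f xi)"
  "(\<integral>\<^sup>+xi. ennreal ((bracket xi powr sg * norm (f xi))^2) \<partial>lborel) = ennreal ((norm F)^2)"
  "cor (ev sg F x) = osc f x"
proof -
 show fm: "f \<in> borel_measurable borel" unfolding f_def by measurable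
 show h: "f (- xi) = cnj (f xi)" for xi by (simp add: f_def rp_herm)
 show le: "(\<integral>\<^sup>+xi. ennreal ((bracket xi powr sg * norm (f xi))^2) \<partial>lborel) = ennreal ((norm F)^2)"
  by (simp add: f_def norm_mult bracket_powr_cancel norm_l2_nn)
 show "integrable lborel f" by (rule sob_density_L1(2)[OF sg fm _ norm_ge_zero[of F]]) (simp add: le)
 show "cor (ev sg F x) = osc f x"
  using osc_herm[of f x, OF h] by (simp add: ev_def f_def)
qed

lemma sob_ev: "sg > real CARD('n::finite) / 2 ==> sob 1 sg (ev sg (F :: 'n l2)) (norm F)"
 by (rule sobI1[OF _ ev_density(1)[of sg F] _ _ norm_ge_zero[of F]]) (simp_all add: ev_density(4) ev_def)

lemma sob_ev_ex:
 assumes "sob 1 sg u K" shows "\<exists>F. norm F <= K & u = ev sg F"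
proof -
 obtain f where f [measurable]: "f \<in> borel_measurable borel" and fi: "integrable lborel f" and fh: "!!xi. f (- xi) = cnj (f xi)"
  and fle: "wl2 sg f K"
  and fu: "!!x. u x = Re (osc f x)" and K: "0 <= K" by (rule sobE1[OF assms], rule that, assumption+)
 define g where "g xi = cor (bracket xi powr sg) * f xi" for xi
 have [measurable]: "g \<in> borel_measurable borel" unfolding g_def by measurable
 have g: "g \<in> L2H & norm (mk g) <= K"
  by (rule L2H_norm_leI) (use fle K in "auto simp: g_def fh norm_mult")
 have "ev sg (mk g) x = u x" for x
 proof -
  have "osc (%xi. cor (bracket xi powr (- sg)) * rp (mk g) xi) x = osc f x"
  proof (rule osc_cong_AE)
   show "AE xi in lborel. cor (bracket xi powr (- sg)) * rp (mk g) xi = f xi"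
    using rp_mk[OF conjunct1[OF g]]
   proof eventually_elim
    case (elim xi)
    then show ?case using bracket_pos[of xi] unfolding g_def
     by (simp add: powr_minus flip: mult.assoc of_real_mult)
   qed
  qed measurable
  then show ?thesis by (simp add: ev_def fu)
 qed
 then show ?thesis using g by (metis ext)
qed

lemma ev_add:
 assumes sg: "sg > real CARD('n::finite) / 2"
 shows "ev sg (F + G :: 'n l2) x = ev sg F x + ev sg G x"
proof -
 let ?d = "%F xi. cor (bracket xi powr (- sg)) * rp F xi"
 have "osc (?d (F + G)) x = osc (%xi. ?d F xi + ?d G xi) x"
  by (rule osc_cong_AE) (use rp_add[of F G] in "auto simp: distrib_left elim!: AE_mp")
 then show ?thesis unfolding ev_def using ev_density(2)[OF sg] by (simp add: osc_add)
qed

lemma ev_scaleR: "ev sg (r *R F) x = r * ev sg F x"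
proof -
 let ?d = "%F xi. cor (bracket xi powr (- sg)) * rp F xi"
 have "osc (?d (r *R F)) x = osc (%xi. cor r * ?d F xi) x"
  by (rule osc_cong_AE) (use rp_scaleR[of r F] in "auto simp: scaleR_conv_of_real elim!: AE_mp")
 then show ?thesis unfolding ev_def by (simp add: osc_cmult)
qed

lemma ev_linear:
 assumes sg: "sg > real CARD('n::finite) / 2"
 shows "bounded_linear (%F :: 'n l2. ev sg F x)"
proof (rule bounded_linear_intro)
 show "norm (ev sg F x) <= norm F * sob_const TYPE('n) sg" for F :: "'n l2"
  using sob_bound[OF sg sob_ev[OF sg, of F]] by (simp add: mult.commute)
qed (simp_all add: ev_add[OF sg] ev_scaleR)

lemma ev_inject:
 assumes sg: "sg > real CARD('n::finite) / 2" and eq: "!!x. ev sg F x = ev sg (G :: 'n l2) x"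
 shows "F = G"
proof -
 let ?d = "%F xi. cor (bracket xi powr (- sg)) * rp F xi"
 note L = ev_linear[OF sg]
 have z: "ev sg (F - G) x = 0" for x
  using eq linear_diff[OF bounded_linear.linear[OF L]] by simp
 have "AE xi in lborel. ?d (F - G) xi = 0"
  by (rule osc_injective[OF ev_density(2)[OF sg]]) (use z ev_density(5)[OF sg, of "F - G"] in simp)
 then have "AE xi in lborel. rp (F - G) xi = rp 0 xi"
  using rp_zero
 proof eventually_elim
  case (elim xi) then show ?case using bracket_pos[of xi] by auto
 qed
 then have "F - G = 0" by (rule l2_eqI)
 then show ?thesis by simp
qed

lemma sob_add:
 assumes sg: "sg > real CARD('n::finite) / 2" and "sob 1 sg (u :: real^'n => real) K" "sob 1 sg v L"
 shows "sob 1 sg (%x. u x + v x) (K + L)"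
proof -
 obtain F G where F: "norm F <= K" "u = ev sg F" and G: "norm G <= L" "v = ev sg G"
  using sob_ev_ex[OF assms(2)] sob_ev_ex[OF assms(3)] by blast
 have "norm (F + G) <= K + L" using F G norm_triangle_ineq[of F G] by linarith
 from sob_mono[OF sob_ev[OF sg] this] show ?thesis unfolding F(2) G(2) ev_add[OF sg, abs_def] .
qed

lemma sob_cmult:
 assumes sg: "sg > real CARD('n::finite) / 2" and "sob 1 sg (u :: real^'n => real) K"
 shows "sob 1 sg (%x. c * u x) (\<bar>c\<bar> * K)"
proof -
 obtain F where F: "norm F <= K" "u = ev sg F" using sob_ev_ex[OF assms(2)] by blast
 have "norm (c *R F) <= \<bar>c\<bar> * K" using F by (simp add: mult_left_mono)
 from sob_mono[OF sob_ev[OF sg] this] show ?thesis unfolding F(2) ev_scaleR[abs_def] .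
qed

lemma sob_zero: "0 <= K ==> sob dl sg (%x::real^'n::finite. 0) K"
 by (rule sobI[of "%_. 0"]) (auto simp: osc_def)

lemma sob_sum:
 assumes sg: "sg > real CARD('n::finite) / 2" and "!!i. i \<in> I ==> sob 1 sg (u i :: real^'n => real) (K i)"
 shows "sob 1 sg (%x. \<Sum>i\<in>I. u i x) (\<Sum>i\<in>I. K i)"
 using assms(2)
proof (induction I rule: infinite_finite_induct)
 case (insert i I)
 then show ?case using sob_add[OF sg, of "u i" "K i" "%x. \<Sum>i\<in>I. u i x" "\<Sum>i\<in>I. K i"] by simp
qed (auto intro: sob_zero)

subsection \<open>Multipliers that are mixtures of dilated Schwartz functions\<close>

text \<open>The unnormalized Gamma density of shape \<open>q\<close> and rate 1/2. Mixing the
  Gaussians exp (- r |x|^2 / 2) with it yields a multiple of (1 + |x|^2)^(-q), which realizes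
  negative powers of the bracket as superpositions of characters.\<close>

definition gam :: "real => real => real" where
 "gam q r = (if 0 < r then r powr (q - 1) * exp (- r / 2) else 0)"

lemma gam_nonneg: "0 <= gam q r" by (simp add: gam_def)

lemma gam_measurable [measurable]: "gam q \<in> borel_measurable borel"
 unfolding gam_def[abs_def] by measurable

lemma gam_integrable:
 assumes "0 < q" shows "integrable lborel (gam q)"
proof -
 have "(%t. cor t powr (cor q - 1) / of_real (exp (1/2 * t))) absolutely_integrable_on {0<..}"
  by (rule absolutely_integrable_Gamma_integral) (use assms in auto)
 then have "integrable lebesgue (%t. norm (indicat_real {0<..} t *R (cor t powr (cor q - 1) / of_real (exp (1/2 * t)))))"
  unfolding set_integrable_def by (rule integrable_norm)
 moreover have "norm (indicat_real {0<..} t *R (cor t powr (cor q - 1) / of_real (exp (1/2 * t)))) = gam q t" for t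
 proof (cases "0 < t")
  case True
  have "norm (cor t powr (cor q - 1)) = t powr (q - 1)"
   using True by (subst norm_powr_real_powr) auto
  moreover have "exp (- t / 2) = inverse (exp (1/2 * t))" unfolding exp_minus[symmetric] by simp
  moreover have "indicat_real {0<..} t = 1" using True by simp
  ultimately show ?thesis
   by (simp only: gam_def norm_scaleR norm_divide norm_of_real True if_True abs_one abs_exp_cancel mult_1_left divide_inverse[of _ "exp _"])
 qed (simp add: gam_def)
 ultimately have "integrable lebesgue (gam q)" by simp
 then show ?thesis by (subst (asm) integrable_completion) auto
qed

definition gam_int :: "real => real" where "gam_int q = (LINT r|lborel. gam q r)"

lemma gam_int_pos: assumes "0 < q" shows "0 < gam_int q"
proof -
 have "gam_int q ~= 0"
 proof
  assume "gam_int q = 0"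
  then have ae: "AE r in lborel. gam q r = 0"
   unfolding gam_int_def by (subst (asm) integral_nonneg_eq_0_iff_AE[OF gam_integrable[OF assms]]) (auto simp: gam_nonneg)
  have "AE r in lborel. r \<notin> {0<..<1::real}"
   using ae by (rule AE_mp) (auto simp: gam_def)
  then have "{0<..<1::real} \<in> null_sets lborel" by (subst AE_iff_null_sets) auto
  then show False by (simp add: null_sets_def)
 qed
 moreover have "0 <= gam_int q" unfolding gam_int_def by (rule integral_nonneg_AE) (simp add: gam_nonneg)
 ultimately show ?thesis by simp
qed

lemma one_plus_powr_le:
 fixes y N :: real
 assumes "0 <= N" "0 <= y" shows "(1 + y) powr N <= 2 powr N * (1 + y powr N)"
proof -
 have "(1 + y) powr N <= (2 * max 1 y) powr N" by (rule powr_mono2) (use assms in auto)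
 also have "... = 2 powr N * max 1 y powr N" by (rule powr_mult)
 also have "max 1 y powr N <= 1 + y powr N" by (simp add: max_def)
 finally show ?thesis by (simp add: mult_left_mono)
qed

lemma gam_weight_integrable:
 assumes "0 < q" "0 <= N" shows "integrable lborel (%r. (1 + sqrt r) powr N * gam q r)"
proof (rule Bochner_Integration.integrable_bound)
 show "integrable lborel (%r. 2 powr N * (gam q r + gam (q + N / 2) r))"
  by (intro integrable_mult_right Bochner_Integration.integrable_add gam_integrable) (use assms in auto)
 have "(1 + sqrt r) powr N * gam q r <= 2 powr N * (gam q r + gam (q + N / 2) r)" for r
 proof (cases "0 < r")
  case True
  then have "(1 + sqrt r) powr N * gam q r <= 2 powr N * (1 + sqrt r powr N) * gam q r"
   by (intro mult_right_mono one_plus_powr_le gam_nonneg) (use assms in auto)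
  also have "sqrt r powr N * gam q r = gam (q + N / 2) r"
   using True by (simp add: gam_def powr_half_sqrt[symmetric] powr_powr powr_add[symmetric] flip: mult.assoc) (simp add: algebra_simps)
  then have "2 powr N * (1 + sqrt r powr N) * gam q r = 2 powr N * (gam q r + gam (q + N / 2) r)"
   by (simp add: distrib_left distrib_right mult.assoc)
  finally show ?thesis .
 qed (simp add: gam_def)
 moreover have "0 <= (1 + sqrt r) powr N * gam q r" for r by (simp add: gam_nonneg)
 ultimately show "AE r in lborel. norm ((1 + sqrt r) powr N * gam q r) <= norm (2 powr N * (gam q r + gam (q + N / 2) r))"
  by (simp add: gam_nonneg)
qed measurable

lemma schwartz_weight_integrable:
 assumes "schwartz (psi :: real^'n::finite => complex)"
 shows "integrable lborel (%et. (1 + norm et) powr N * norm (psi et))"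
proof -
 define m where "m = nat \<lceil>\<bar>N\<bar>\<rceil>"
 have [measurable]: "psi \<in> borel_measurable borel" by (rule schwartz_measurable[OF assms])
 obtain C where C: "!!x. (1 + norm x) ^ (Suc CARD('n) + m) * norm (psi x) <= C" using schwartz_bounded[OF assms] by blast
 have "(1 + norm x) ^ Suc CARD('n) * norm ((1 + norm x) powr N * norm (psi x)) <= C" for x
 proof -
  have "(1 + norm x) powr N <= (1 + norm x) powr real m" by (rule powr_mono) (auto simp: m_def, linarith)
  also have "... = (1 + norm x) ^ m" by (rule powr_realpow) (simp add: add_pos_nonneg)
  finally have "(1 + norm x) ^ Suc CARD('n) * ((1 + norm x) powr N * norm (psi x)) <= (1 + norm x) ^ Suc CARD('n) * ((1 + norm x) ^ m * norm (psi x))"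
   by (intro mult_left_mono mult_right_mono) auto
  also have "... <= C" using C[of x] by (simp add: power_add mult.assoc)
  finally show ?thesis by (simp add: norm_mult)
 qed
 then show ?thesis by (intro integrable_decay(1)) auto
qed

abbreviation PM :: "(real \<times> (real^'n::finite)) measure" where "PM == lborel \<Otimes>\<^sub>M lborel"

text \<open>Kernel and frequency shift on pairs of a scale \<open>r\<close> and a frequency
  \<open>et\<close>: the dilate \<open>osc psi ((ep * sqrt r) *R x)\<close> is a superposition of
  the characters with frequencies \<open>gz ep (r, et)\<close>.\<close>

definition gk :: "real => (real^'n::finite => complex) => real \<times> (real^'n) => complex" where
 "gk q psi w = cor (gam q (fst w)) * psi (snd w)"

definition gz :: "real => real \<times> (real^'n::finite) => real^'n" where
 "gz ep w = (ep * sqrt (fst w)) *R snd w"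

lemma gz_measurable [measurable]: "gz ep \<in> borel_measurable (lborel \<Otimes>\<^sub>M lborel)"
 unfolding gz_def[abs_def] by measurable

lemma gk_measurable: "psi \<in> borel_measurable borel ==> gk q psi \<in> borel_measurable (lborel \<Otimes>\<^sub>M lborel)"
proof -
 assume [measurable]: "psi \<in> borel_measurable borel"
 show ?thesis unfolding gk_def[abs_def] by measurable
qed

text \<open>Peetre's factor is dominated by a product of a function of the scale and a function of
  the frequency, which separates the integrations. The dominating function is the same for all
  \<open>ep\<close> and \<open>dl\<close> in [0, 1].\<close>

lemma gk_weight_integrable:
 assumes S: "schwartz (psi :: real^'n::finite => complex)" and q: "0 < q" and N: "0 <= N" and ep: "0 <= ep" "ep <= 1"
 shows "integrable (lborel \<Otimes>\<^sub>M lborel) (%w. (1 + norm (gz ep w)) powr N * norm (gk q psi w))"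
  and "0 <= dl ==> dl <= 1 ==> integrable (lborel \<Otimes>\<^sub>M lborel) (%w. (1 + dl * norm (gz ep w)) powr N * norm (gk q psi w))"
  and "(LINT w|PM. (1 + norm (gz ep w)) powr N * norm (gk q psi w))
   <= (LINT r|lborel. (1 + sqrt r) powr N * gam q r) * (LINT et|lborel. (1 + norm et) powr N * norm (psi et))"
  and "integrable (lborel \<Otimes>\<^sub>M lborel) (gk q psi)"
proof -
 have [measurable]: "psi \<in> borel_measurable borel" by (rule schwartz_measurable[OF S])
 note [measurable] = gk_measurable[OF this]
 define V where "V r et = ((1 + sqrt r) powr N * gam q r) * ((1 + norm et) powr N * norm (psi et))" for r and et :: "real^'n"
 have Vi: "integrable (lborel \<Otimes>\<^sub>M lborel) (%(r, et). V r et)"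
 proof (rule lborel_pair.Fubini_integrable)
  show "(%(r, et). V r et) \<in> borel_measurable (lborel \<Otimes>\<^sub>M lborel)" unfolding V_def by measurable
  have "(LINT et|lborel. norm (V r et)) = norm ((1 + sqrt r) powr N * gam q r) * (LINT et|lborel. (1 + norm et) powr N * norm (psi et))" for r
   unfolding V_def norm_mult[of "(1 + sqrt r) powr N * gam q r"] by (simp add: norm_mult)
  then show "integrable lborel (%r. LINT et|lborel. norm (case (r, et) of (r, et) => V r et))"
   using gam_weight_integrable[OF q N] by (simp del: norm_mult)
  show "AE r in lborel. integrable lborel (%et. case (r, et) of (r, et) => V r et)"
   unfolding V_def using schwartz_weight_integrable[OF S] by simp
 qed
 have Vint: "(LINT w|PM. (case w of (r, et) => V r et))
   = (LINT r|lborel. (1 + sqrt r) powr N * gam q r) * (LINT et|lborel. (1 + norm et) powr N * norm (psi et))"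
 proof -
  have "(LINT r|lborel. LINT et|lborel. V r et) = (LINT r|lborel. (1 + sqrt r) powr N * gam q r) * (LINT et|lborel. (1 + norm et) powr N * norm (psi et))"
   unfolding V_def by simp
  with lborel_pair.integral_fst'[OF Vi] show ?thesis by simp
 qed
 have pt: "(1 + dl * norm (gz ep w)) powr N * norm (gk q psi w) <= (case w of (r, et) => V r et)" if dl: "0 <= dl" "dl <= 1" for w dl
 proof (cases "0 < fst w")
  case True
  obtain r et where w: "w = (r, et)" by (cases w)
  have r: "0 <= sqrt r" using True w by simp
  have "dl * norm (gz ep w) = (dl * ep) * (sqrt r * norm et)" using r ep by (simp add: w gz_def abs_mult)
  also have "... <= 1 * (sqrt r * norm et)" by (intro mult_right_mono mult_le_one) (use r ep dl in auto)
  finally have "1 + dl * norm (gz ep w) <= 1 + sqrt r * norm et + (sqrt r + norm et)"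
   using add_nonneg_nonneg[OF r norm_ge_zero[of et]] by simp
  also have "... = (1 + sqrt r) * (1 + norm et)" by (simp add: algebra_simps)
  finally have "1 + dl * norm (gz ep w) <= (1 + sqrt r) * (1 + norm et)" .
  then have "(1 + dl * norm (gz ep w)) powr N <= ((1 + sqrt r) * (1 + norm et)) powr N"
   by (intro powr_mono2) (use N dl in auto)
  also have "... = (1 + sqrt r) powr N * (1 + norm et) powr N" by (rule powr_mult)
  finally have "(1 + dl * norm (gz ep w)) powr N * norm (gk q psi w) <= ((1 + sqrt r) powr N * (1 + norm et) powr N) * norm (gk q psi w)"
   by (rule mult_right_mono) simp
  then show ?thesis by (simp add: w V_def gk_def norm_mult gam_nonneg mult_ac)
 next
  case False
  then show ?thesis by (cases w) (simp add: gk_def gam_def V_def)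
 qed
 show 1: "integrable (lborel \<Otimes>\<^sub>M lborel) (%w. (1 + dl * norm (gz ep w)) powr N * norm (gk q psi w))" if "0 <= dl" "dl <= 1" for dl
 proof (rule Bochner_Integration.integrable_bound[OF Vi])
  show "AE w in lborel \<Otimes>\<^sub>M lborel. norm ((1 + dl * norm (gz ep w)) powr N * norm (gk q psi w)) <= norm (case w of (r, et) => V r et)"
  proof (rule AE_I2)
   fix w :: "real \<times> (real^'n)"
   have "norm ((1 + dl * norm (gz ep w)) powr N * norm (gk q psi w)) = (1 + dl * norm (gz ep w)) powr N * norm (gk q psi w)" by simp
   also note pt[OF that, of w]
   finally show "norm ((1 + dl * norm (gz ep w)) powr N * norm (gk q psi w)) <= norm (case w of (r, et) => V r et)" by simp
  qed
 qed measurable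
 show 2: "integrable (lborel \<Otimes>\<^sub>M lborel) (%w. (1 + norm (gz ep w)) powr N * norm (gk q psi w))" using 1[of 1] by simp
 show "(LINT w|PM. (1 + norm (gz ep w)) powr N * norm (gk q psi w))
   <= (LINT r|lborel. (1 + sqrt r) powr N * gam q r) * (LINT et|lborel. (1 + norm et) powr N * norm (psi et))"
  unfolding Vint[symmetric] by (rule integral_mono[OF 2 Vi]) (use pt[of 1] in simp)
 have "integrable (lborel \<Otimes>\<^sub>M lborel) (%w. norm (gk q psi w))" using 1[of 0] by simp
 then show "integrable (lborel \<Otimes>\<^sub>M lborel) (gk q psi)" by (rule integrable_norm_cancel) measurable
qed

lemma gk_osc:
 assumes S: "schwartz (psi :: real^'n::finite => complex)" and q: "0 < q"
 shows "(LINT w|PM. exp (\<i> * cor (gz ep w \<bullet> x)) * gk q psi w)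
  = (LINT r|lborel. cor (gam q r) * osc psi ((ep * sqrt r) *R x))"
proof -
 have [measurable]: "psi \<in> borel_measurable borel" by (rule schwartz_measurable[OF S])
 note [measurable] = gk_measurable[OF this]
 have "integrable (lborel \<Otimes>\<^sub>M lborel) (%w. exp (\<i> * cor (gz ep w \<bullet> x)) * gk q psi w)"
 proof (rule Bochner_Integration.integrable_bound[OF gk_weight_integrable(4)[OF S q order_refl, of 0]])
  have "(%w. exp (\<i> * cor (gz ep w \<bullet> x))) = (%xi. exp (\<i> * cor (xi \<bullet> x))) \<circ> gz ep" by (simp add: comp_def)
  also have "... \<in> borel_measurable (lborel \<Otimes>\<^sub>M lborel)" by (rule measurable_comp[OF gz_measurable exp_i_meas])
  finally show "(%w. exp (\<i> * cor (gz ep w \<bullet> x)) * gk q psi w) \<in> borel_measurable (lborel \<Otimes>\<^sub>M lborel)" by measurable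
 qed (auto simp: norm_mult)
 from lborel_pair.integral_fst'[OF this]
 have "(LINT w|PM. exp (\<i> * cor (gz ep w \<bullet> x)) * gk q psi w)
  = (LINT r|lborel. LINT et|lborel. exp (\<i> * cor (gz ep (r, et) \<bullet> x)) * gk q psi (r, et))" by simp
 also have "... = (LINT r|lborel. LINT et|lborel. cor (gam q r) * (exp (\<i> * cor (et \<bullet> ((ep * sqrt r) *R x))) * psi et))"
  by (intro Bochner_Integration.integral_cong refl) (simp add: gz_def gk_def mult_ac)
 also have "... = (LINT r|lborel. cor (gam q r) * osc psi ((ep * sqrt r) *R x))"
  by (simp add: osc_def)
 finally show ?thesis .
qed

lemma sigma_finite_pair: "sigma_finite_measure (lborel \<Otimes>\<^sub>M (lborel :: (real^'n::finite) measure) :: (real \<times> (real^'n)) measure)"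
 unfolding lborel_prod by (rule sigma_finite_lborel)

lemma sob_mixture:
 assumes S: "schwartz (psi :: real^'n::finite => complex)" and q: "0 < q" and ep: "0 <= ep" "ep <= 1" and dl: "0 <= dl" "dl <= 1"
  and a: "!!x. cor (a x) = (LINT r|lborel. cor (gam q r) * osc psi (sqrt r *R x))"
  and A: "(LINT w|PM. (1 + dl * norm (gz ep w)) powr \<bar>sg\<bar> * norm (gk q psi w)) <= A"
  and u: "sob dl sg u K"
 shows "sob dl sg (%x. a (ep *R x) * u x) (A * K)"
proof (rule sob_superposition[OF u dl(1) sigma_finite_pair])
 show "gk q psi \<in> borel_measurable (lborel \<Otimes>\<^sub>M lborel)" by (rule gk_measurable[OF schwartz_measurable[OF S]])
 show "gz ep \<in> borel_measurable (lborel \<Otimes>\<^sub>M lborel)" by measurable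
 show "(\<integral>\<^sup>+ w. ennreal ((1 + dl * norm (gz ep w)) powr \<bar>sg\<bar> * norm (gk q psi w)) \<partial>(lborel \<Otimes>\<^sub>M lborel)) <= ennreal A"
  using A by (subst nn_integral_eq_integral[OF gk_weight_integrable(2)[OF S q _ ep dl]]) (auto intro: ennreal_leI)
 show "0 <= A" by (rule order_trans[OF _ A]) (rule integral_nonneg_AE, simp)
 show "cor (a (ep *R x)) = (LINT w|PM. exp (\<i> * cor (gz ep w \<bullet> x)) * gk q psi w)" for x
  unfolding gk_osc[OF S q] a by (simp add: mult.commute)
qed

text \<open>The constant does not depend on \<open>ep\<close>. This allows \<open>ep\<close> to be
  chosen later, small in terms of these constants.\<close>

lemma sob_mixture_uniform:
 assumes S: "schwartz (psi :: real^'n::finite => complex)" and q: "0 < q"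
  and a: "!!x. cor (a x) = (LINT r|lborel. cor (gam q r) * osc psi (sqrt r *R x))"
 shows "EX A>=0. \<forall>ep\<in>{0..1}. \<forall>u K. sob 1 sg u K --> sob 1 sg (%x. a (ep *R x) * u x) (A * K)"
proof -
 let ?A = "(LINT r|lborel. (1 + sqrt r) powr \<bar>sg\<bar> * gam q r) * (LINT et|lborel. (1 + norm et) powr \<bar>sg\<bar> * norm (psi et))"
 have "0 <= ?A" by (intro mult_nonneg_nonneg integral_nonneg_AE) (auto simp: gam_nonneg)
 moreover have "sob 1 sg (%x. a (ep *R x) * u x) (?A * K)" if "ep \<in> {0..1}" "sob 1 sg u K" for ep u K
  by (rule sob_mixture[OF S q _ _ _ _ a _ that(2)]) (use that gk_weight_integrable(3)[OF S q, of "\<bar>sg\<bar>" ep] in auto)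
 ultimately show ?thesis by blast
qed

text \<open>Rescaling \<open>r\<close> by B = 1 + |x|^2 turns the mixture into the Gamma integral
  times a power of B.\<close>

lemma gauss_mixture:
 assumes q: "0 < q"
 shows "(LINT r|lborel. cor (gam q r) * gauss (sqrt r *R x)) = cor (gam_int q * bracket x powr (- (2 * q)))"
proof -
 define B where "B = 1 + x \<bullet> x"
 have B: "0 < B" by (simp add: B_def add_pos_nonneg)
 have "cor (gam q r) * gauss (sqrt r *R x) = cor (B powr (1 - q) * gam q (B * r))" for r
 proof (cases "0 < r")
  case True
  have "gam q (B * r) = B powr (q - 1) * r powr (q - 1) * exp (- (B * r) / 2)"
   using True B by (simp add: gam_def powr_mult)
  then have "B powr (1 - q) * gam q (B * r) = (B powr (1 - q) * B powr (q - 1)) * (r powr (q - 1) * exp (- (B * r) / 2))" by simp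
  also have "B powr (1 - q) * B powr (q - 1) = 1" using B by (simp flip: powr_add)
  also have "exp (- (B * r) / 2) = exp (- r / 2) * exp (- (r * (x \<bullet> x)) / 2)"
  proof -
   have "- (B * r) / 2 = - r / 2 + - (r * (x \<bullet> x)) / 2" by (simp add: B_def field_simps)
   then show ?thesis by (simp only: exp_add)
  qed
  finally show ?thesis using True by (simp add: gam_def gauss_def)
 next
  case False
  then have "\<not> 0 < B * r" using B by (simp add: zero_less_mult_iff)
  then show ?thesis using False by (simp add: gam_def)
 qed
 then have "(LINT r|lborel. cor (gam q r) * gauss (sqrt r *R x)) = cor (B powr (1 - q) * (LINT r|lborel. gam q (0 + B * r)))"
  by simp
 also have "(LINT r|lborel. gam q (0 + B * r)) = gam_int q / B"
  using lborel_integral_real_affine[of B "gam q" 0] B by (simp add: gam_int_def)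
 also have "B powr (1 - q) * (gam_int q / B) = gam_int q * B powr (- q)"
  using B by (simp add: powr_diff powr_minus field_simps)
 also have "B powr (- q) = bracket x powr (- (2 * q))" by (simp add: bracket_powr B_def)
 finally show ?thesis .
qed

lemma osc_gauss_normalized:
 "osc (%et. cor c / cor (gauss_int TYPE('n)) * gauss et) (x :: real^'n::finite) = cor c * gauss x"
 using gauss_int_pos[where 'n='n] unfolding osc_cmult osc_gauss by simp

lemma bracket_mixture:
 assumes q: "0 < q"
 shows "cor (bracket x powr (- (2 * q))) =
  (LINT r|lborel. cor (gam q r) * osc (%et. cor (1 / gam_int q) / cor (gauss_int TYPE('n)) * gauss et) (sqrt r *R (x :: real^'n::finite)))"
 unfolding osc_gauss_normalized mult.left_commute[of "cor (gam q _)"] integral_mult_right_zero gauss_mixture[OF q]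
 using gam_int_pos[OF q] by simp

lemma sob_mult_bracket:
 assumes p: "0 <= p"
 shows "EX A>=0. \<forall>ep\<in>{0..1}. \<forall>(u :: real^'n::finite => real) K. sob 1 sg u K --> sob 1 sg (%x. bracket (ep *R x) powr (- p) * u x) (A * K)"
proof (cases "p = 0")
 case True
 have "bracket x powr 0 = 1" for x :: "real^'n" using bracket_pos[of x] by simp
 then show ?thesis using True by (intro exI[of _ 1]) simp
next
 case False
 then have "0 < p / 2" using p by simp
 from sob_mixture_uniform[OF schwartz_cmult[OF schwartz_gauss] this bracket_mixture[OF this]]
 show ?thesis by simp
qed

text \<open>The coordinate is put into the profile: at the argument \<open>sqrt r *R x\<close> the
  function x_i times the Gaussian contributes a factor \<open>sqrt r\<close>, which turns the Gamma
  density of shape 1/2 into the one of shape 1.\<close>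

lemma sob_mult_coord_bracket:
 "EX A>=0. \<forall>ep\<in>{0..1}. \<forall>(u :: real^'n::finite => real) K. sob 1 sg u K -->
   sob 1 sg (%x. ((ep *R x) $ i * bracket (ep *R x) powr (- 2)) * u x) (A * K)"
proof -
 let ?K = "cor ((gauss_int TYPE('n))^2)"
 define ph where "ph x = cor (1 / gam_int 1) * (cor (x $ i) * gauss x)" for x :: "real^'n"
 \<comment> \<open>Fourier inversion, arranged so that \<open>osc psi = ph\<close>.\<close>
 define psi where "psi et = (1 / ?K) * osc ph (- et)" for et
 have S: "schwartz ph" unfolding ph_def by (intro schwartz_cmult schwartz_coord schwartz_gauss)
 have Spsi: "schwartz psi" unfolding psi_def by (intro schwartz_cmult schwartz_reflect schwartz_osc S)
 have K: "?K ~= 0" using gauss_int_pos[where 'n='n] by simp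
 have oscpsi: "osc psi x = ph x" for x
  unfolding psi_def osc_cmult osc_uminus osc_osc[OF S] using K by simp
 have g: "cor (gam (1/2) r) * osc psi (sqrt r *R x)
   = cor (x $ i / gam_int 1) * (cor (gam 1 r) * gauss (sqrt r *R x))" for r x
 proof -
  have "gam (1/2) r * sqrt r = gam 1 r"
   by (auto simp: gam_def powr_half_sqrt[symmetric] mult.commute[of _ "exp _"] powr_add[symmetric])
  then have "cor (gam 1 r) = cor (gam (1/2) r) * cor (sqrt r)" by (metis of_real_mult)
  then show ?thesis by (simp add: oscpsi ph_def)
 qed
 have "cor (x $ i * bracket x powr (- 2)) = (LINT r|lborel. cor (gam (1/2) r) * osc psi (sqrt r *R x))" for x
  unfolding g integral_mult_right_zero gauss_mixture[OF zero_less_one] using gam_int_pos[of 1] by simp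
 from sob_mixture_uniform[OF Spsi _ this, of sg] show ?thesis by simp
qed

text \<open>In the norm with small \<open>dl\<close>, multiplication by \<open>\<langle>ep x\<rangle>\<^sup>-\<^sup>2\<close> is almost a contraction, because its kernel
 is a probability density.\<close>

lemma sob_mult_bracket_near_one:
 assumes ep: "0 <= ep" "ep <= 1" and b: "1 < b"
 shows "\<exists>dl>0. dl <= 1 & (\<forall>(u :: real^'n::finite => real) K. sob dl sg u K --> sob dl sg (%x. bracket (ep *R x) powr (- 2) * u x) (b * K))"
proof -
 let ?c = "cor (1 / gam_int 1) / cor (gauss_int TYPE('n))"
 define psi where "psi = (%et::real^'n. ?c * gauss et)"
 have S: "schwartz psi" unfolding psi_def by (rule schwartz_cmult[OF schwartz_gauss])
 have mix: "cor (bracket x powr (- 2)) = (LINT r|lborel. cor (gam 1 r) * osc psi (sqrt r *R x))" for x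
  using bracket_mixture[of 1 x] by (simp add: psi_def)
 let ?M = "lborel \<Otimes>\<^sub>M lborel :: (real \<times> (real^'n)) measure"
 let ?h = "%k. 1 / real (Suc k)"
 define I where "I k = (LINT w|?M. (1 + ?h k * norm (gz ep w)) powr \<bar>sg\<bar> * norm (gk 1 psi w))" for k
 have [measurable]: "gk 1 psi \<in> borel_measurable ?M" by (rule gk_measurable[OF schwartz_measurable[OF S]])
 \<comment> \<open>The kernel is nonnegative, so its mass is the value of the multiplier at
   0.\<close>
 have "(LINT w|?M. norm (gk 1 psi w)) = 1"
 proof -
  have cp: "0 < 1 / gam_int 1 / gauss_int TYPE('n)" using gam_int_pos[of 1] gauss_int_pos[where 'n='n] by simp
  have "norm (gk 1 psi w) = Re (gk 1 psi w)" for w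
  proof -
   have "gk 1 psi w = cor (gam 1 (fst w) * ((1 / gam_int 1 / gauss_int TYPE('n)) * exp (- (snd w \<bullet> snd w) / 2)))"
    by (simp add: gk_def psi_def gauss_def)
   moreover have "0 <= gam 1 (fst w) * ((1 / gam_int 1 / gauss_int TYPE('n)) * exp (- (snd w \<bullet> snd w) / 2))"
    by (intro mult_nonneg_nonneg gam_nonneg less_imp_le[OF cp]) simp
   ultimately show ?thesis by (simp only: norm_of_real Re_complex_of_real abs_of_nonneg)
  qed
  then have "(LINT w|?M. norm (gk 1 psi w)) = Re (LINT w|?M. gk 1 psi w)"
   using integral_Re[OF gk_weight_integrable(4)[OF S zero_less_one order_refl, of 0]] by simp
  also have "(LINT w|?M. gk 1 psi w) = cor (bracket (0::real^'n) powr (- 2))"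
   using gk_osc[OF S zero_less_one, of 0 0] mix[of 0] by simp
  finally show ?thesis by (simp add: bracket_def)
 qed
 moreover have "I \<longlonglongrightarrow> (LINT w|?M. norm (gk 1 psi w))"
  unfolding I_def
 proof (rule integral_dominated_convergence[where w="%w. (1 + norm (gz ep w)) powr \<bar>sg\<bar> * norm (gk 1 psi w)"])
  show "integrable ?M (%w. (1 + norm (gz ep w)) powr \<bar>sg\<bar> * norm (gk 1 psi w))"
   by (rule gk_weight_integrable(1)[OF S]) (use ep in auto)
  show "AE w in ?M. (%k. (1 + ?h k * norm (gz ep w)) powr \<bar>sg\<bar> * norm (gk 1 psi w)) \<longlonglongrightarrow> norm (gk 1 psi w)"
  proof (rule AE_I2)
   fix w :: "real \<times> (real^'n)"
   have "(%k. (1 + ?h k * norm (gz ep w)) powr \<bar>sg\<bar> * norm (gk 1 psi w)) \<longlonglongrightarrow> (1 + 0 * norm (gz ep w)) powr \<bar>sg\<bar> * norm (gk 1 psi w)"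
    by (intro tendsto_intros lim_1_over_n[THEN LIMSEQ_Suc]) auto
   then show "(%k. (1 + ?h k * norm (gz ep w)) powr \<bar>sg\<bar> * norm (gk 1 psi w)) \<longlonglongrightarrow> norm (gk 1 psi w)" by simp
  qed
  show "AE w in ?M. norm ((1 + ?h k * norm (gz ep w)) powr \<bar>sg\<bar> * norm (gk 1 psi w)) <= (1 + norm (gz ep w)) powr \<bar>sg\<bar> * norm (gk 1 psi w)" for k
  proof (rule AE_I2)
   fix w :: "real \<times> (real^'n)"
   have "?h k * norm (gz ep w) <= 1 * norm (gz ep w)" by (rule mult_right_mono) auto
   then have "(1 + ?h k * norm (gz ep w)) powr \<bar>sg\<bar> <= (1 + norm (gz ep w)) powr \<bar>sg\<bar>" by (intro powr_mono2) auto
   then show "norm ((1 + ?h k * norm (gz ep w)) powr \<bar>sg\<bar> * norm (gk 1 psi w)) <= (1 + norm (gz ep w)) powr \<bar>sg\<bar> * norm (gk 1 psi w)"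
    by (simp add: mult_right_mono)
  qed
 qed measurable
 ultimately have "I \<longlonglongrightarrow> 1" by simp
 then have "\<forall>\<^sub>F k in sequentially. I k < b" using b by (rule order_tendstoD)
 then obtain k where k: "I k < b" by (auto simp: eventually_sequentially)
 have "sob (?h k) sg (%x. bracket (ep *R x) powr (- 2) * u x) (b * K)" if "sob (?h k) sg u K" for u :: "real^'n => real" and K
  by (rule sob_mixture[OF S zero_less_one ep _ _ mix _ that]) (use k in "auto simp: I_def")
 then show ?thesis by (intro exI[of _ "?h k"]) auto
qed

subsection \<open>Comparison of weights\<close>

lemma bracket_scale_le: assumes "0 < dl" "dl <= 1"
 shows "bracket (dl *R x) <= bracket x" "bracket x <= bracket (dl *R x) / dl"
proof -
 have d2: "dl^2 <= 1" using assms by (simp add: power_le_one)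
 have "dl^2 * (norm x)^2 <= 1 * (norm x)^2" by (rule mult_right_mono[OF d2]) simp
 then show "bracket (dl *R x) <= bracket x" unfolding bracket_def by (simp add: power_mult_distrib)
 have "(dl * bracket x)^2 <= (bracket (dl *R x))^2"
  using d2 by (simp add: bracket_def power_mult_distrib distrib_left)
 then have "dl * bracket x <= bracket (dl *R x)" by (rule power2_le_imp_le) (use bracket_pos less_imp_le in auto)
 then show "bracket x <= bracket (dl *R x) / dl" using assms by (simp add: pos_le_divide_eq mult.commute)
qed

lemma sob_rescale:
 assumes dl: "0 < dl" "dl <= 1" and sg: "0 <= sg"
 shows "sob 1 sg u K ==> sob dl sg u K"
  and "sob dl sg u K ==> sob 1 sg u (dl powr (- sg) * K)"
proof -
 assume u: "sob 1 sg u K"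
 obtain f where f: "f \<in> borel_measurable borel" "integrable lborel f"
  and le: "wl2 sg f K"
  and fu: "!!x. u x = Re (osc f x)" and K: "0 <= K" by (rule sobE1[OF u], rule that, assumption+)
 have "(\<integral>\<^sup>+xi. ennreal ((bracket (dl *R xi) powr sg * norm (f xi))^2) \<partial>lborel) <= (\<integral>\<^sup>+xi. ennreal ((bracket xi powr sg * norm (f xi))^2) \<partial>lborel)"
  by (intro nn_integral_mono ennreal_leI power_mono mult_right_mono powr_mono2 sg bracket_scale_le[OF dl]) (use bracket_pos less_imp_le in auto)
 with f le fu K show "sob dl sg u K" by (intro sobI[of f]) auto
next
 assume u: "sob dl sg u K"
 obtain f where f: "f \<in> borel_measurable borel" "integrable lborel f"
  and le: "(\<integral>\<^sup>+xi. ennreal ((bracket (dl *R xi) powr sg * norm (f xi))^2) \<partial>lborel) <= ennreal (K^2)"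
  and fu: "!!x. u x = Re (osc f x)" and K: "0 <= K" by (rule sobE[OF u], rule that, assumption+)
 note [measurable] = f(1)
 let ?D = "dl powr (- sg)"
 have "(\<integral>\<^sup>+xi. ennreal ((bracket (1 *R xi) powr sg * norm (f xi))^2) \<partial>lborel) <= (\<integral>\<^sup>+xi. ennreal (?D^2) * ennreal ((bracket (dl *R xi) powr sg * norm (f xi))^2) \<partial>lborel)"
 proof (rule nn_integral_mono)
  fix xi :: "real^'a"
  have "bracket xi powr sg <= (bracket (dl *R xi) / dl) powr sg"
   by (intro powr_mono2 sg bracket_scale_le[OF dl]) (use bracket_pos less_imp_le in auto)
  also have "... = ?D * bracket (dl *R xi) powr sg"
   by (simp add: powr_divide powr_minus_divide)
  finally have "(bracket xi powr sg * norm (f xi))^2 <= (?D * bracket (dl *R xi) powr sg * norm (f xi))^2"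
   by (intro power_mono mult_right_mono) auto
  then have "ennreal ((bracket xi powr sg * norm (f xi))^2) <= ennreal (?D^2 * (bracket (dl *R xi) powr sg * norm (f xi))^2)"
   by (intro ennreal_leI) (simp add: power_mult_distrib mult.assoc)
  then show "ennreal ((bracket (1 *R xi) powr sg * norm (f xi))^2) <= ennreal (?D^2) * ennreal ((bracket (dl *R xi) powr sg * norm (f xi))^2)"
   by (simp add: ennreal_mult)
 qed
 also have "... = ennreal (?D^2) * (\<integral>\<^sup>+xi. ennreal ((bracket (dl *R xi) powr sg * norm (f xi))^2) \<partial>lborel)"
  by (rule nn_integral_cmult) measurable
 also have "... <= ennreal (?D^2) * ennreal (K^2)" by (rule mult_left_mono[OF le]) simp
 also have "... = ennreal ((?D * K)^2)" by (simp add: power_mult_distrib ennreal_mult)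
 finally show "sob 1 sg u (?D * K)" using f fu K by (intro sobI[of f]) auto
qed

lemma order_pos: "sg > real CARD('n::finite) / 2 ==> 0 <= sg"
 by (meson divide_nonneg_nonneg le_less_trans less_imp_le of_nat_0_le_iff zero_le_numeral)

lemma gchoose_abs_summable:
 fixes a r :: real assumes "0 <= r" "r < 1" shows "summable (%k. \<bar>a gchoose k\<bar> * r ^ k)"
proof -
 obtain r' where r': "r < r'" "r' < 1" using dense[OF assms(2)] by blast
 have "summable (%k. (a gchoose k) * r' ^ k)"
  using gen_binomial_real[of r' a] r' assms by (simp add: sums_iff)
 from powser_insidea[OF this, of r] r' assms show ?thesis by (simp add: abs_mult)
qed

text \<open>\<open>(\<langle>x\<rangle>/\<langle>ep x\<rangle>)\<^sup>p = ep\<^sup>-\<^sup>p (1 - (1-ep\<^sup>2)\<langle>ep x\<rangle>\<^sup>-\<^sup>2)\<^sup>p\<^sup>/\<^sup>2\<close> is expanded in a binomial series, which converges in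
 operator norm.\<close>

lemma sob_weight_ratio:
 assumes sg: "sg > real CARD('n::finite) / 2" and ep: "0 < ep" "ep <= 1"
 shows "EX A>=0. \<forall>(u :: real^'n => real) K. sob 1 sg u K --> sob 1 sg (%x. (bracket x / bracket (ep *R x)) powr p * u x) (A * K)"
proof -
 note sg0 = order_pos[OF sg]
 define c where "c = 1 - ep^2"
 \<comment> \<open>With this \<open>b\<close> the product \<open>c * b\<close> equals 1 - ep^2/2 -
   ep^4/2 and stays below 1, so the binomial series converges with ratio
   \<open>c * b\<close>.\<close>
 define b where "b = 1 + ep^2 / 2"
 have e2: "0 < ep^2" "ep^2 <= 1" using ep by (auto simp: power_le_one)
 have c: "0 <= c" "c < 1" using e2 by (auto simp: c_def)
 have b: "1 < b" using e2 by (simp add: b_def)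
 have "c * b = 1 - (ep^2 / 2 + (ep^2)^2 / 2)" by (simp add: c_def b_def field_simps power2_eq_square)
 moreover have "0 < ep^2 / 2 + (ep^2)^2 / 2" by (rule add_pos_nonneg) (use e2 in simp_all)
 moreover have "0 <= c * b" using c b by simp
 ultimately have cb: "0 <= c * b" "c * b < 1" by linarith+
 obtain dl where dl: "0 < dl" "dl <= 1" and near: "!!(u :: real^'n => real) K. sob dl sg u K ==> sob dl sg (%x. bracket (ep *R x) powr (- 2) * u x) (b * K)"
  using sob_mult_bracket_near_one[OF less_imp_le[OF ep(1)] ep(2) b, of sg] by blast
 define y where "y x = bracket (ep *R x) powr (- 2)" for x :: "real^'n"
 define D where "D = dl powr (- sg)"
 define S where "S = (\<Sum>k. \<bar>(p/2) gchoose k\<bar> * (c * b) ^ k)"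
 have Ss: "summable (%k. \<bar>(p/2) gchoose k\<bar> * (c * b) ^ k)" by (rule gchoose_abs_summable[OF cb])
 have S0: "0 <= S" unfolding S_def by (rule suminf_nonneg[OF Ss]) (use cb in auto)
 have y: "0 < y x" "y x <= 1" for x
 proof -
  show "0 < y x" using bracket_pos[of "ep *R x"] by (simp add: y_def)
  have "bracket (ep *R x) powr (- 2) <= bracket (ep *R x) powr 0" by (rule powr_mono) (use bracket_ge1 in auto)
  then show "y x <= 1" using bracket_pos[of "ep *R x"] by (simp add: y_def)
 qed
 have main: "sob 1 sg (%x. (1 - c * y x) powr (p/2) * u x) (S * D * K)" if u: "sob 1 sg u K" for u :: "real^'n => real" and K
 proof -
  have K: "0 <= K" using u by (simp add: sob_def)
  \<comment> \<open>In the norm with the small \<open>dl\<close> each factor \<open>y\<close> costs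
    only \<open>b\<close>. The passage back to \<open>dl = 1\<close> costs the factor
    \<open>D\<close> once and not once per power.\<close>
  have pw: "sob dl sg (%x. y x ^ k * u x) (b ^ k * K)" for k
  proof (induction k)
   case 0 then show ?case using sob_rescale(1)[OF dl sg0 u] by simp
  next
   case (Suc k) from near[OF this] show ?case by (simp add: y_def mult.assoc)
  qed
  have "sob 1 sg (%x. y x ^ k * u x) (D * (b ^ k * K))" for k
   unfolding D_def by (rule sob_rescale(2)[OF dl sg0 pw])
  then have "\<exists>F. norm F <= D * (b ^ k * K) & (%x. y x ^ k * u x) = ev sg F" for k by (rule sob_ev_ex)
  then obtain F where F: "!!k. norm (F k) <= D * (b ^ k * K)" "!!k. (%x. y x ^ k * u x) = ev sg (F k)" by metis
  define a where "a k = ((p/2) gchoose k) * (- c) ^ k" for k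
  have nb: "norm (a k *R F k) <= (\<bar>(p/2) gchoose k\<bar> * (c * b) ^ k) * (D * K)" for k
  proof -
   have "norm (a k *R F k) <= \<bar>a k\<bar> * (D * (b ^ k * K))" using F(1)[of k] by (simp add: mult_left_mono)
   also have "... = (\<bar>(p/2) gchoose k\<bar> * (c * b) ^ k) * (D * K)"
    using c by (simp add: a_def abs_mult power_abs power_mult_distrib mult_ac)
   finally show ?thesis .
  qed
  have sn: "summable (%k. norm (a k *R F k))"
   by (rule summable_comparison_test'[OF summable_mult2[OF Ss, of "D * K"], of 0]) (use nb in simp)
  define G where "G = (\<Sum>k. a k *R F k)"
  have Gs: "(%k. a k *R F k) sums G" unfolding G_def by (rule summable_sums[OF summable_norm_cancel[OF sn]])
  have "norm G <= (\<Sum>k. norm (a k *R F k))" unfolding G_def by (rule summable_norm[OF sn])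
  also have "... <= (\<Sum>k. (\<bar>(p/2) gchoose k\<bar> * (c * b) ^ k) * (D * K))" by (rule suminf_le[OF nb sn summable_mult2[OF Ss]])
  also have "... = S * (D * K)" unfolding S_def by (rule suminf_mult2[OF Ss, symmetric])
  finally have nG: "norm G <= S * D * K" by simp
  have "ev sg G x = (1 - c * y x) powr (p/2) * u x" for x
  proof -
   have "(%k. ev sg (a k *R F k) x) sums ev sg G x" by (rule bounded_linear.sums[OF ev_linear[OF sg] Gs])
   moreover have "ev sg (a k *R F k) x = (((p/2) gchoose k) * (- c * y x) ^ k) * u x" for k
    unfolding ev_scaleR F(2)[symmetric] a_def power_mult_distrib by simp
   moreover have "(%k. (((p/2) gchoose k) * (- c * y x) ^ k) * u x) sums ((1 + - c * y x) powr (p/2) * u x)"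
   proof (intro sums_mult2 gen_binomial_real)
    have "\<bar>- c * y x\<bar> = c * y x" using c y[of x] by (simp add: abs_mult)
    also have "... <= c * 1" using c y by (intro mult_left_mono) auto
    finally show "\<bar>- c * y x\<bar> < 1" using c by simp
   qed
   ultimately show ?thesis using sums_unique2 by fastforce
  qed
  then have "(%x. (1 - c * y x) powr (p/2) * u x) = ev sg G" by (simp add: fun_eq_iff)
  then show ?thesis using sob_mono[OF sob_ev[OF sg] nG] by simp
 qed
 \<comment> \<open>Rests on 1 - (1 - ep^2) / <ep x>^2 = ep^2 <x>^2 / <ep x>^2.\<close>
 have ratio: "(bracket x / bracket (ep *R x)) powr p = ep powr (- p) * (1 - c * y x) powr (p/2)" for x :: "real^'n"
 proof -
  let ?q = "bracket (ep *R x)"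
  have q: "0 < ?q" by (rule bracket_pos)
  have y2: "y x = 1 / ?q^2" using powr_realpow[OF q, of 2] by (simp add: y_def powr_minus divide_inverse)
  have q2: "?q^2 = 1 + ep^2 * (norm x)^2" by (simp add: bracket_def power_mult_distrib)
  have "1 - c * y x = (?q^2 - c) / ?q^2" using q by (simp add: y2 diff_divide_distrib)
  also have "?q^2 - c = (ep * bracket x)^2" unfolding q2 by (simp add: c_def bracket_def power_mult_distrib distrib_left)
  finally have e: "1 - c * y x = (ep * (bracket x / ?q))^2" by (simp add: power_divide)
  have pos: "0 < ep * (bracket x / ?q)" using ep q bracket_pos[of x] by simp
  have "(1 - c * y x) powr (p/2) = ((ep * (bracket x / ?q)) powr 2) powr (p/2)"
   unfolding e using powr_realpow[OF pos, of 2] by simp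
  also have "... = (ep * (bracket x / ?q)) powr p" by (simp add: powr_powr)
  also have "... = ep powr p * (bracket x / ?q) powr p" by (rule powr_mult)
  finally show ?thesis using ep by (simp add: powr_minus)
 qed
 have "sob 1 sg (%x. (bracket x / bracket (ep *R x)) powr p * u x) ((\<bar>ep powr (- p)\<bar> * (S * D)) * K)" if u: "sob 1 sg u K" for u :: "real^'n => real" and K
  using sob_cmult[OF sg main[OF u], of "ep powr (- p)"] unfolding ratio by (simp add: mult.assoc)
 moreover have "0 <= \<bar>ep powr (- p)\<bar> * (S * D)" using S0 by (simp add: D_def)
 ultimately show ?thesis by blast
qed

subsection \<open>Weighted Sobolev functions\<close>

definition wsob :: "real => real => (real^'n::finite => real) => real => bool" where
 "wsob sg t u K = sob 1 sg (%x. bracket x powr t * u x) K"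

text \<open>The weighted counterpart of \<open>ev\<close>: for every order and weight the same
  \<open>l2\<close> parametrizes the fields isometrically.\<close>

definition fld :: "real => real => 'n::finite l2 => real^'n => real" where
 "fld sg t F x = bracket x powr (- t) * ev sg F x"

lemma bracket_powr_cancel': "bracket x powr (- t) * (bracket x powr t * r) = r"
 using bracket_powr_cancel[of x "- t" r] by simp

lemma wsob_zero_weight [simp]: "wsob sg 0 u K = sob 1 sg u K"
proof -
 have "bracket x powr 0 = 1" for x :: "real^'a" using bracket_pos[of x] by simp
 then show ?thesis by (simp add: wsob_def)
qed

lemma fld_zero_weight [simp]: "fld sg 0 F = ev sg F"
proof -
 have "bracket x powr 0 = 1" for x :: "real^'a" using bracket_pos[of x] by simp
 then show ?thesis by (simp add: fld_def fun_eq_iff)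
qed

lemma wsob_fld: "sg > real CARD('n::finite) / 2 ==> wsob sg t (fld sg t (F :: 'n l2)) (norm F)"
 unfolding wsob_def fld_def by (simp add: bracket_powr_cancel sob_ev)

lemma wsob_fld_ex: assumes "wsob sg t u K" shows "\<exists>F. norm F <= K & u = fld sg t F"
proof -
 obtain F where F: "norm F <= K" "(%x. bracket x powr t * u x) = ev sg F" using sob_ev_ex assms wsob_def by blast
 have "u x = fld sg t F x" for x unfolding fld_def F(2)[symmetric] by (simp add: bracket_powr_cancel')
 then show ?thesis using F by blast
qed

lemma fld_linear: "sg > real CARD('n::finite) / 2 ==> bounded_linear (%F :: 'n l2. fld sg t F x)"
 unfolding fld_def by (intro bounded_linear_compose[OF bounded_linear_mult_right] ev_linear)

lemma fld_add: "sg > real CARD('n::finite) / 2 ==> fld sg t (F + G :: 'n l2) x = fld sg t F x + fld sg t G x"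
 by (simp add: fld_def ev_add distrib_left)

lemma fld_scaleR: "fld sg t (r *R F) x = r * fld sg t F x"
 by (simp add: fld_def ev_scaleR)

lemma fld_inject:
 assumes sg: "sg > real CARD('n::finite) / 2" and eq: "!!x. fld sg t F x = fld sg t (G :: 'n l2) x"
 shows "F = G"
proof (rule ev_inject[OF sg])
 fix x :: "real^'n"
 show "ev sg F x = ev sg G x" using eq[of x] bracket_pos[of x] by (simp add: fld_def)
qed

lemma wsob_order_mono: "wsob sg t u K ==> tu <= sg ==> wsob tu t u K"
 unfolding wsob_def by (rule sob_order_mono)

lemma wsob_add:
 "sg > real CARD('n::finite) / 2 ==> wsob sg t (u :: real^'n => real) K ==> wsob sg t v L ==> wsob sg t (%x. u x + v x) (K + L)"
 unfolding wsob_def distrib_left by (rule sob_add)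

lemma wsob_cmult:
 "sg > real CARD('n::finite) / 2 ==> wsob sg t (u :: real^'n => real) K ==> wsob sg t (%x. c * u x) (\<bar>c\<bar> * K)"
 unfolding wsob_def mult.left_commute[of "bracket _ powr _"] by (rule sob_cmult)

lemma wsob_unweighted:
 assumes "0 <= t"
 shows "EX A>=0. \<forall>(u :: real^'n::finite => real) K. wsob sg t u K --> sob 1 sg u (A * K)"
proof -
 obtain A where A: "0 <= A" "!!ep (u :: real^'n => real) K. ep \<in> {0..1} ==> sob 1 sg u K ==> sob 1 sg (%x. bracket (ep *R x) powr (- t) * u x) (A * K)"
  using sob_mult_bracket[OF assms, of sg] by blast
 have "sob 1 sg u (A * K)" if "wsob sg t u K" for u :: "real^'n => real" and K
  using A(2)[of 1, OF _ that[unfolded wsob_def]] by (simp add: bracket_powr_cancel')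
 then show ?thesis using A(1) by blast
qed

text \<open>The weight stays on one factor and the other is measured without it, which is possible
  because the weight is at least 1 for \<open>t >= 0\<close>.\<close>

lemma wsob_product:
 assumes sg: "sg > real CARD('n::finite) / 2" and t: "0 <= t"
 shows "EX A>=0. \<forall>(u :: real^'n => real) v K L. wsob sg t u K --> wsob sg t v L --> wsob sg t (%x. u x * v x) (A * K * L)"
proof -
 obtain A where A: "0 <= A" "!!(u :: real^'n => real) K. wsob sg t u K ==> sob 1 sg u (A * K)"
  using wsob_unweighted[OF t, of sg] by blast
 let ?C = "2 * 2 powr sg * sob_const TYPE('n) sg"
 have "wsob sg t (%x. u x * v x) ((?C * A) * K * L)" if "wsob sg t u K" "wsob sg t v L" for u v :: "real^'n => real" and K L
  using sob_product[OF sg that(1)[unfolded wsob_def] A(2)[OF that(2)]] by (simp add: wsob_def mult_ac)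
 moreover have "0 <= ?C * A" using A(1) sob_const_nonneg[where 'n='n, of sg] by simp
 ultimately show ?thesis by blast
qed

lemma pderivative_bracket_powr: "pd i (%x. bracket x powr p) x = p * (x $ i * bracket x powr (- 2)) * bracket x powr p"
proof -
 have "bracket x powr (p - 2) = bracket x powr p * bracket x powr (- 2)" by (simp flip: powr_add)
 then show ?thesis by (simp add: pderivative_eqI[OF has_derivative_bracket_powr] inner_axis)
qed

lemma bracket_powr_differentiable: "(%x. bracket x powr p) differentiable (at x)"
 by (rule differentiableI[OF has_derivative_bracket_powr])

text \<open>Moving the weight through \<open>pd i\<close> produces the multiplier
  \<open>- t * (x $ i * bracket x powr (- 2))\<close>, bounded by
  \<open>sob_mult_coord_bracket\<close>.\<close>

lemma wsob_deriv:
 assumes sg: "sg > real CARD('n::finite) / 2"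
 shows "wsob (sg + 1) t (u :: real^'n => real) K ==> u differentiable (at x)"
  and "EX A>=0. \<forall>(u :: real^'n => real) K. wsob (sg + 1) t u K --> wsob sg t (pd i u) (A * K)"
proof -
 have d: "u differentiable (at x)" and e: "bracket x powr t * pd i u x = pd i (%x. bracket x powr t * u x) x
    + (- t) * ((x $ i * bracket x powr (- 2)) * (bracket x powr t * u x))"
  if u: "wsob (sg + 1) t u K" for u :: "real^'n => real" and K x
 proof -
  have d1: "(%x. bracket x powr t * u x) differentiable (at x)" for x by (rule sob_deriv(1)[OF sg u[unfolded wsob_def]])
  have ueq: "u = (%x. bracket x powr (- t) * (bracket x powr t * u x))" by (simp add: bracket_powr_cancel')
  show d: "u differentiable (at x)" for x by (subst ueq) (intro differentiable_mult bracket_powr_differentiable d1)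
  show "bracket x powr t * pd i u x = pd i (%x. bracket x powr t * u x) x
    + (- t) * ((x $ i * bracket x powr (- 2)) * (bracket x powr t * u x))"
   by (subst pderivative_mult[OF bracket_powr_differentiable d]) (simp add: pderivative_bracket_powr)
 qed
 show "wsob (sg + 1) t u K ==> u differentiable (at x)" by (rule d)
 obtain A where A: "0 <= A" "!!ep (u :: real^'n => real) K. ep \<in> {0..1} ==> sob 1 sg u K ==> sob 1 sg (%x. ((ep *R x) $ i * bracket (ep *R x) powr (- 2)) * u x) (A * K)"
  using sob_mult_coord_bracket[of sg i] by blast
 have "wsob sg t (pd i u) ((1 + \<bar>t\<bar> * A) * K)" if u: "wsob (sg + 1) t u K" for u :: "real^'n => real" and K
 proof -
  note u' = u[unfolded wsob_def]
  have "sob 1 sg (%x. pd i (%x. bracket x powr t * u x) x + (- t) * ((x $ i * bracket x powr (- 2)) * (bracket x powr t * u x)))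
    (K + \<bar>- t\<bar> * (A * K))"
   using A(2)[of 1, OF _ sob_order_mono[OF u', of sg]] by (intro sob_add sob_cmult sob_deriv(2) sg u') simp
  then show ?thesis unfolding wsob_def e[OF u] by (simp add: algebra_simps)
 qed
 moreover have "0 <= 1 + \<bar>t\<bar> * A" using A(1) by simp
 ultimately show "EX A>=0. \<forall>(u :: real^'n => real) K. wsob (sg + 1) t u K --> wsob sg t (pd i u) (A * K)" by blast
qed

text \<open>Turns an equation into a bounded operator: existence with a norm bound gives a map by
  choice, and uniqueness, together with stability under sums and multiples, makes this map
  linear.\<close>

lemma lift_relation:
 fixes P :: "(real^'n::finite => real) => (real^'n => real) => bool"
 assumes ex: "!!F :: 'n l2. \<exists>G :: 'n l2. norm G <= C * norm F & P (fld sg t F) (fld tu t' G)"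
  and add: "!!(F :: 'n l2) (G :: 'n l2) F' G'. P (fld sg t F) (fld tu t' G) ==> P (fld sg t F') (fld tu t' G') ==> P (fld sg t (F + F')) (fld tu t' (G + G'))"
  and scale: "!!(F :: 'n l2) (G :: 'n l2) r. P (fld sg t F) (fld tu t' G) ==> P (fld sg t (r *R F)) (fld tu t' (r *R G))"
  and uniq: "!!(F :: 'n l2) (G :: 'n l2) G'. P (fld sg t F) (fld tu t' G) ==> P (fld sg t F) (fld tu t' G') ==> G = G'"
 shows "\<exists>T :: 'n l2 => 'n l2. bounded_linear T & (\<forall>F. norm (T F) <= C * norm F & P (fld sg t F) (fld tu t' (T F)))"
proof -
 obtain T where T: "!!F :: 'n l2. norm (T F :: 'n l2) <= C * norm F" "!!F. P (fld sg t F) (fld tu t' (T F))" using ex by metis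
 have "bounded_linear T"
 proof (rule bounded_linear_intro)
  show "T (F + G) = T F + T G" for F G by (rule uniq[OF T(2) add[OF T(2) T(2)]])
  show "T (r *R F) = r *R T F" for r F by (rule uniq[OF T(2) scale[OF T(2)]])
  show "norm (T F) <= norm F * C" for F using T(1)[of F] by (simp add: mult.commute)
 qed
 then show ?thesis using T by blast
qed

subsection \<open>The resolvent of the Laplacian on weighted spaces\<close>

definition lap :: "(real^'n::finite => real) => real^'n => real" where
 "lap u x = (\<Sum>i\<in>UNIV. pd i (pd i u) x)"

lemma wsob_pderivative_add:
 assumes sg: "sg > real CARD('n::finite) / 2" and u: "wsob (sg + 1) t (u :: real^'n => real) K" and v: "wsob (sg + 1) t v L"
 shows "pd i (%x. u x + v x) = (%x. pd i u x + pd i v x)"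
 by (rule ext) (rule pderivative_add[OF wsob_deriv(1)[OF sg u] wsob_deriv(1)[OF sg v]])

lemma wsob_pderivative_cmult:
 assumes sg: "sg > real CARD('n::finite) / 2" and u: "wsob (sg + 1) t (u :: real^'n => real) K"
 shows "pd i (%x. c * u x) = (%x. c * pd i u x)"
 by (rule ext) (rule pderivative_cmult[OF wsob_deriv(1)[OF sg u]])

lemma wsob_pderivative_ex:
 assumes sg: "sg > real CARD('n::finite) / 2" and u: "wsob (sg + 2) t (u :: real^'n => real) K"
 shows "\<exists>K'. wsob (sg + 1) t (pd i u) K'"
proof -
 have "sg + 1 > real CARD('n) / 2" "wsob (sg + 1 + 1) t u K" using sg u by (simp_all add: add.assoc)
 then show ?thesis using wsob_deriv(2)[of "sg + 1" t i] by blast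
qed

lemma lap_add:
 assumes sg: "sg > real CARD('n::finite) / 2" and u: "wsob (sg + 2) t (u :: real^'n => real) K" and v: "wsob (sg + 2) t v L"
 shows "lap (%x. u x + v x) x = lap u x + lap v x"
proof -
 have "wsob (sg + 1) t u K" "wsob (sg + 1) t v L" using u v by (auto elim: wsob_order_mono)
 note e = wsob_pderivative_add[OF sg this]
 have "pd i (pd i (%x. u x + v x)) x = pd i (pd i u) x + pd i (pd i v) x" for i
 proof -
  obtain K' L' where "wsob (sg + 1) t (pd i u) K'" "wsob (sg + 1) t (pd i v) L'"
   using wsob_pderivative_ex[OF sg u] wsob_pderivative_ex[OF sg v] by blast
  from wsob_pderivative_add[OF sg this, of i] show ?thesis unfolding e by simp
 qed
 then show ?thesis by (simp add: lap_def sum.distrib)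
qed

lemma lap_cmult:
 assumes sg: "sg > real CARD('n::finite) / 2" and u: "wsob (sg + 2) t (u :: real^'n => real) K"
 shows "lap (%x. c * u x) x = c * lap u x"
proof -
 have "wsob (sg + 1) t u K" using u by (auto elim: wsob_order_mono)
 note e = wsob_pderivative_cmult[OF sg this]
 have "pd i (pd i (%x. c * u x)) x = c * pd i (pd i u) x" for i
 proof -
  obtain K' where "wsob (sg + 1) t (pd i u) K'"
   using wsob_pderivative_ex[OF sg u] by blast
  from wsob_pderivative_cmult[OF sg this, of i] show ?thesis unfolding e by simp
 qed
 then show ?thesis by (simp add: lap_def sum_distrib_left)
qed

definition drift :: "real => 'n::finite => real^'n => real" where
 "drift ep i x = (ep *R x) $ i * bracket (ep *R x) powr (- 2)"

text \<open>The difference between \<open>-\<langle>ep x\<rangle>\<^sup>t \<Delta> \<langle>ep x\<rangle>\<^sup>-\<^sup>t\<close> and \<open>-\<Delta>\<close>; it is small with \<open>ep\<close>.\<close>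

definition weight_error :: "real => real => (real^'n::finite => real) => real^'n => real" where
 "weight_error t ep w x = (\<Sum>i\<in>UNIV. t * ep * pd i (%x. drift ep i x * w x) x
   + t * ep * (drift ep i x * pd i w x) + (- (t * ep)\<^sup>2) * (drift ep i x * (drift ep i x * w x)))"

lemma sob_drift:
 "EX A>=0. \<forall>ep\<in>{0..1}. \<forall>(u :: real^'n::finite => real) K i. sob 1 sg u K --> sob 1 sg (%x. drift ep i x * u x) (A * K)"
proof -
 have "\<forall>i. EX A>=0. \<forall>ep\<in>{0..1}. \<forall>(u :: real^'n => real) K. sob 1 sg u K --> sob 1 sg (%x. drift ep i x * u x) (A * K)"
  unfolding drift_def using sob_mult_coord_bracket by blast
 then obtain A where A: "!!i. 0 <= A i" "!!i ep (u :: real^'n => real) K. ep \<in> {0..1} ==> sob 1 sg u K ==> sob 1 sg (%x. drift ep i x * u x) (A i * K)"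
  by metis
 have Ai: "A i <= (\<Sum>i\<in>UNIV. A i)" for i by (rule member_le_sum) (use A(1) in auto)
 have "sob 1 sg (%x. drift ep i x * u x) ((\<Sum>i\<in>UNIV. A i) * K)" if "ep \<in> {0..1}" "sob 1 sg u K" for ep i and u :: "real^'n => real" and K
 proof (rule sob_mono[OF A(2)[OF that]])
  have "0 <= K" using that(2) by (simp add: sob_def)
  then show "A i * K <= (\<Sum>i\<in>UNIV. A i) * K" by (rule mult_right_mono[OF Ai])
 qed
 moreover have "0 <= (\<Sum>i\<in>UNIV. A i)" using A(1) by (simp add: sum_nonneg)
 ultimately show ?thesis by blast
qed

text \<open>Every term carries a factor \<open>ep\<close>, while the bounds of
  \<open>sob_drift\<close> are uniform in \<open>ep\<close>; the last term uses
  \<open>ep^2 <= ep\<close>.\<close>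

lemma sob_weight_error:
 assumes sg: "sg > real CARD('n::finite) / 2"
 shows "EX C>=0. \<forall>ep\<in>{0..1}. \<forall>(w :: real^'n => real) K. sob 1 (sg + 2) w K --> sob 1 sg (weight_error t ep w) (ep * C * K)"
proof -
 obtain A1 where A1: "0 <= A1" "!!ep (u :: real^'n => real) K i. ep \<in> {0..1} ==> sob 1 (sg + 1) u K ==> sob 1 (sg + 1) (%x. drift ep i x * u x) (A1 * K)"
  using sob_drift[of "sg + 1"] by blast
 obtain A0 where A0: "0 <= A0" "!!ep (u :: real^'n => real) K i. ep \<in> {0..1} ==> sob 1 sg u K ==> sob 1 sg (%x. drift ep i x * u x) (A0 * K)"
  using sob_drift[of "sg"] by blast
 define C where "C = (\<Sum>i\<in>(UNIV::'n set). \<bar>t\<bar> * A1 + \<bar>t\<bar> * A0 + t^2 * (A0 * A0))"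
 have "sob 1 sg (weight_error t ep w) (ep * C * K)" if ep: "ep \<in> {0..1}" and w: "sob 1 (sg + 2) w K" for ep and w :: "real^'n => real" and K
 proof -
  have K: "0 <= K" using w by (simp add: sob_def)
  have w1: "sob 1 (sg + 1) w K" and w0: "sob 1 sg w K" using w by (auto elim: sob_order_mono)
  have dw: "sob 1 (sg + 1) (pd i w) K" for i
   by (rule sob_deriv(2)) (use sg w in "simp_all add: add.assoc")
  have "sob 1 sg (weight_error t ep w) (\<Sum>i\<in>(UNIV::'n set). \<bar>t * ep\<bar> * (A1 * K) + \<bar>t * ep\<bar> * (A0 * K) + \<bar>- (t * ep)\<^sup>2\<bar> * (A0 * (A0 * K)))"
   unfolding weight_error_def[abs_def]
   by (intro sob_sum sob_add sob_cmult sg sob_deriv(2) A1(2) A0(2) ep w1 w0 sob_order_mono[OF dw]) simp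
  moreover have "(\<Sum>i\<in>(UNIV::'n set). \<bar>t * ep\<bar> * (A1 * K) + \<bar>t * ep\<bar> * (A0 * K) + \<bar>- (t * ep)\<^sup>2\<bar> * (A0 * (A0 * K))) <= ep * C * K"
   unfolding C_def sum_distrib_left sum_distrib_right
  proof (rule sum_mono)
   fix i :: 'n
   have "ep^2 <= ep" using ep by (simp add: power2_eq_square mult_left_le)
   then have "ep^2 * (t^2 * (A0 * (A0 * K))) <= ep * (t^2 * (A0 * (A0 * K)))" by (rule mult_right_mono) (use A0 K in auto)
   then show "\<bar>t * ep\<bar> * (A1 * K) + \<bar>t * ep\<bar> * (A0 * K) + \<bar>- (t * ep)\<^sup>2\<bar> * (A0 * (A0 * K)) <= ep * (\<bar>t\<bar> * A1 + \<bar>t\<bar> * A0 + t^2 * (A0 * A0)) * K"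
    using ep by (simp add: abs_mult power_mult_distrib algebra_simps)
  qed
  ultimately show ?thesis by (rule sob_mono)
 qed
 moreover have "0 <= C" unfolding C_def using A0 A1 by (intro sum_nonneg) auto
 ultimately show ?thesis by blast
qed

lemma has_derivative_bracket_scale_powr:
 "((%x. bracket (ep *R x) powr p) has_derivative (%v. p * bracket (ep *R x) powr (p - 2) * ((ep *R x) \<bullet> (ep *R v)))) (at x)"
 by (rule has_derivative_compose[OF _ has_derivative_bracket_powr, of "%x. ep *R x" "%v. ep *R v"])
   (auto intro!: derivative_eq_intros)

lemma pderivative_bracket_scale_powr:
 "pd i (%x. bracket (ep *R x) powr p) x = p * ep * drift ep i x * bracket (ep *R x) powr p"
proof -
 have "bracket (ep *R x) powr (p - 2) = bracket (ep *R x) powr p * bracket (ep *R x) powr (- 2)" by (simp flip: powr_add)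
 then show ?thesis by (simp add: pderivative_eqI[OF has_derivative_bracket_scale_powr] inner_axis drift_def)
qed

lemma lap_weight:
 assumes sg: "sg > real CARD('n::finite) / 2" and ep: "ep \<in> {0..1}" and w: "sob 1 (sg + 2) (w :: real^'n => real) K"
 shows "lap (%x. bracket (ep *R x) powr (- t) * w x) x = bracket (ep *R x) powr (- t) * (lap w x - weight_error t ep w x)"
proof -
 have w1: "sob 1 (sg + 1) w K" using w by (auto elim: sob_order_mono)
 obtain A1 where A1: "!!ep (u :: real^'n => real) K i. ep \<in> {0..1} ==> sob 1 (sg + 1) u K ==> sob 1 (sg + 1) (%x. drift ep i x * u x) (A1 * K)"
  using sob_drift[of "sg + 1"] by blast
 let ?rh = "%x::real^'n. bracket (ep *R x) powr (- t)"
 have drh: "?rh differentiable (at x)" for x by (rule differentiableI[OF has_derivative_bracket_scale_powr])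
 have step: "pd i (%x. ?rh x * v x) = (%x. ?rh x * (pd i v x - t * ep * (drift ep i x * v x)))"
  if "!!x. v differentiable (at x)" for v :: "real^'n => real" and i
  by (rule ext, subst pderivative_mult[OF drh that]) (simp add: pderivative_bracket_scale_powr algebra_simps)
 have dw: "w differentiable (at x)" for x by (rule sob_deriv(1)[OF sg w1])
 have ddw: "pd i w differentiable (at x)" for i x
  by (rule sob_deriv(1)[OF sg sob_deriv(2)]) (use sg w in "simp_all add: add.assoc")
 have dbw: "(%x. drift ep i x * w x) differentiable (at x)" for i x by (rule sob_deriv(1)[OF sg A1[OF ep w1]])
 have "pd i (pd i (%x. ?rh x * w x)) x = ?rh x * (pd i (pd i w) x
   - (t * ep * pd i (%x. drift ep i x * w x) x + t * ep * (drift ep i x * pd i w x) + (- (t * ep)\<^sup>2) * (drift ep i x * (drift ep i x * w x))))" for i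
 proof -
  let ?v = "%x. pd i w x + (- (t * ep)) * (drift ep i x * w x)"
  have dv: "?v differentiable (at x)" for x
   by (intro differentiable_add ddw differentiable_mult dbw differentiable_const)
  have dm: "(%x. (- (t * ep)) * (drift ep i x * w x)) differentiable (at x)" for x
   by (intro differentiable_mult dbw differentiable_const)
  have "pd i (%x. ?rh x * w x) = (%x. ?rh x * ?v x)" by (simp add: step[OF dw])
  then have "pd i (pd i (%x. ?rh x * w x)) x = ?rh x * (pd i ?v x - t * ep * (drift ep i x * ?v x))"
   by (simp only: step[OF dv])
  also have "pd i ?v x = pd i (pd i w) x + (- (t * ep)) * pd i (%x. drift ep i x * w x) x"
   by (subst pderivative_add[OF ddw dm], subst pderivative_cmult[OF dbw], rule refl)
  finally show ?thesis by (simp add: algebra_simps power2_eq_square)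
 qed
 then show ?thesis unfolding lap_def weight_error_def by (simp add: sum_distrib_left[symmetric] sum_subtractf)
qed

lemma weight_error_add:
 assumes sg: "sg > real CARD('n::finite) / 2" and ep: "ep \<in> {0..1}" and v: "sob 1 (sg + 2) (v :: real^'n => real) K" and w: "sob 1 (sg + 2) w L"
 shows "weight_error t ep (%x. v x + w x) x = weight_error t ep v x + weight_error t ep w x"
  and "weight_error t ep (%x. c * v x) x = c * weight_error t ep v x"
proof -
 have v1: "sob 1 (sg + 1) v K" and w1: "sob 1 (sg + 1) w L" using v w by (auto elim: sob_order_mono)
 obtain A1 where A1: "!!ep (u :: real^'n => real) K i. ep \<in> {0..1} ==> sob 1 (sg + 1) u K ==> sob 1 (sg + 1) (%x. drift ep i x * u x) (A1 * K)"
  using sob_drift[of "sg + 1"] by blast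
 note d = sob_deriv(1)[OF sg v1] sob_deriv(1)[OF sg w1]
 note db = sob_deriv(1)[OF sg A1[OF ep v1]] sob_deriv(1)[OF sg A1[OF ep w1]]
 have "pd i (%x. drift ep i x * (v x + w x)) x = pd i (%x. drift ep i x * v x) x + pd i (%x. drift ep i x * w x) x" for i
  unfolding distrib_left by (rule pderivative_add[OF db])
 then show "weight_error t ep (%x. v x + w x) x = weight_error t ep v x + weight_error t ep w x"
  unfolding weight_error_def by (simp add: pderivative_add[OF d] sum.distrib[symmetric] algebra_simps)
 have "pd i (%x. drift ep i x * (c * v x)) x = c * pd i (%x. drift ep i x * v x) x" for i
  unfolding mult.left_commute[of _ c] by (rule pderivative_cmult[OF db(1)])
 then show "weight_error t ep (%x. c * v x) x = c * weight_error t ep v x"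
  unfolding weight_error_def by (simp add: pderivative_cmult[OF d(1)] sum_distrib_left algebra_simps)
qed

lemma wsob_resolvent_unique:
 assumes sg: "sg > real CARD('n::finite) / 2" and t: "0 <= t" and \<mu>: "\<mu> > 0"
  and u: "wsob (sg + 2) t (u :: real^'n => real) K" and v: "wsob (sg + 2) t v L"
  and eq: "!!x. \<mu> * u x - lap u x = \<mu> * v x - lap v x"
 shows "u x = v x"
proof -
 have v': "wsob (sg + 2) t (%x. (-1) * v x) (\<bar>-1\<bar> * L)" by (rule wsob_cmult[OF _ v]) (use sg in simp)
 have d: "wsob (sg + 2) t (%x. u x + (-1) * v x) (K + \<bar>-1\<bar> * L)"
  by (rule wsob_add[OF _ u v']) (use sg in simp)
 obtain A where "!!(u :: real^'n => real) K. wsob (sg + 2) t u K ==> sob 1 (sg + 2) u (A * K)"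
  using wsob_unweighted[OF t, of "sg + 2"] by blast
 note d' = this[OF d]
 have "\<mu> * (u x + (-1) * v x) - lap (%x. u x + (-1) * v x) x = 0" for x
  unfolding lap_add[OF sg u v'] lap_cmult[OF sg v] using eq[of x] by (simp add: algebra_simps)
 then have "u x + (-1) * v x = 0"
  by (intro sob_resolvent_unique[OF sg d' \<mu>]) (simp add: lap_def)
 then show ?thesis by simp
qed

text \<open>For w = <ep x>^t u the equation becomes (\<mu> - lap) w + weight_error t ep w = <ep x>^t
  f. The unweighted resolvent turns it into \<open>F + T F = H\<close> with \<open>T\<close> of norm
  at most 1/2, which is solved by contraction; \<open>sob_weight_ratio\<close> exchanges <x> and <ep
  x> at both ends.\<close>

lemma wsob_resolvent:
 assumes sg: "sg > real CARD('n::finite) / 2" and \<mu>: "\<mu> > 0"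
 shows "EX A>=0. \<forall>(f :: real^'n => real) K. wsob sg t f K --> (\<exists>u. wsob (sg + 2) t u (A * K) & (\<forall>x. \<mu> * u x - lap u x = f x))"
proof -
 have sg2: "sg + 2 > real CARD('n) / 2" using sg by simp
 define m where "m = max 1 (1 / \<mu>)"
 have m: "1 <= m" by (simp add: m_def)
 obtain C where C: "0 <= C" "!!ep (w :: real^'n => real) K. ep \<in> {0..1} ==> sob 1 (sg + 2) w K ==> sob 1 sg (weight_error t ep w) (ep * C * K)"
  using sob_weight_error[OF sg, of t] by blast
 \<comment> \<open>Small enough for \<open>ep * (m * C) <= 1/2\<close>, the norm of the weight error
   followed by the resolvent.\<close>
 define ep where "ep = 1 / (2 * (1 + m * C))"
 have mC: "0 <= m * C" using m C by simp
 have ep: "0 < ep" "ep <= 1" "ep * (m * C) <= 1/2" using mC by (auto simp: ep_def field_simps add_pos_nonneg)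
 then have epI: "ep \<in> {0..1}" by simp
 let ?P = "%w v. \<forall>x. \<mu> * v x - lap v x = weight_error t ep w x"
 have s: "sob 1 (sg + 2) (fld (sg + 2) 0 F) (norm F)" for F :: "'n l2" using sob_ev[OF sg2] by simp
 have ws: "wsob (sg + 2) 0 (fld (sg + 2) 0 F) (norm F)" for F :: "'n l2" by (rule wsob_fld[OF sg2])
 have "\<exists>T :: 'n l2 => 'n l2. bounded_linear T & (\<forall>F. norm (T F) <= (1/2) * norm F & ?P (fld (sg + 2) 0 F) (fld (sg + 2) 0 (T F)))"
 proof (rule lift_relation)
  fix F :: "'n l2"
  obtain v where v: "sob 1 (sg + 2) v (m * (ep * C * norm F))" "\<forall>x. \<mu> * v x - lap v x = weight_error t ep (fld (sg + 2) 0 F) x"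
   using sob_resolvent[OF sg C(2)[OF epI s[of F]] \<mu>] unfolding m_def lap_def by blast
  obtain G where G: "norm G <= m * (ep * C * norm F)" "v = ev (sg + 2) G" using sob_ev_ex[OF v(1)] by blast
  have "m * (ep * C * norm F) = (ep * (m * C)) * norm F" by simp
  also have "... <= (1/2) * norm F" by (rule mult_right_mono[OF ep(3)]) simp
  finally have "norm G <= (1/2) * norm F" using G(1) by linarith
  then show "\<exists>G. norm G <= (1/2) * norm F & ?P (fld (sg + 2) 0 F) (fld (sg + 2) 0 G)"
   using G(2) v(2) by (intro exI[of _ G]) simp
 next
  fix F G F' G' :: "'n l2" and r
  assume P: "?P (fld (sg + 2) 0 F) (fld (sg + 2) 0 G)"
  have e: "fld (sg + 2) 0 (F + F') = (%x. fld (sg + 2) 0 F x + fld (sg + 2) 0 F' x)" for F F' :: "'n l2"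
   by (rule ext) (rule fld_add[OF sg2])
  have e': "fld (sg + 2) 0 (r *R F) = (%x. r * fld (sg + 2) 0 F x)" for F :: "'n l2"
   by (rule ext) (rule fld_scaleR)
  show "?P (fld (sg + 2) 0 (r *R F)) (fld (sg + 2) 0 (r *R G))"
   unfolding e' weight_error_add(2)[OF sg epI s s] lap_cmult[OF sg ws]
  proof
   fix x
   show "\<mu> * (r * fld (sg + 2) 0 G x) - r * lap (fld (sg + 2) 0 G) x = r * weight_error t ep (fld (sg + 2) 0 F) x"
    using arg_cong[OF spec[OF P, of x], of "%y. r * y"] by (simp only: right_diff_distrib mult.left_commute[of r \<mu>])
  qed
  assume P': "?P (fld (sg + 2) 0 F') (fld (sg + 2) 0 G')"
  show "?P (fld (sg + 2) 0 (F + F')) (fld (sg + 2) 0 (G + G'))"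
   unfolding e weight_error_add(1)[OF sg epI s s] lap_add[OF sg ws ws] using P P' by (simp add: algebra_simps)
 next
  fix F G G' :: "'n l2"
  assume "?P (fld (sg + 2) 0 F) (fld (sg + 2) 0 G)" "?P (fld (sg + 2) 0 F) (fld (sg + 2) 0 G')"
  then have "fld (sg + 2) 0 G x = fld (sg + 2) 0 G' x" for x
   by (intro wsob_resolvent_unique[OF sg order_refl \<mu> ws ws]) simp
  then show "G = G'" by (rule fld_inject[OF sg2])
 qed
 then obtain T :: "'n l2 => 'n l2" where T: "bounded_linear T" "!!F. norm (T F) <= (1/2) * norm F" "!!F. ?P (fld (sg + 2) 0 F) (fld (sg + 2) 0 (T F))" by blast
 obtain A1 where A1: "0 <= A1" "!!(u :: real^'n => real) K. sob 1 sg u K ==> sob 1 sg (%x. (bracket x / bracket (ep *R x)) powr (- t) * u x) (A1 * K)"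
  using sob_weight_ratio[OF sg ep(1,2), of "- t"] by blast
 obtain A2 where A2: "0 <= A2" "!!(u :: real^'n => real) K. sob 1 (sg + 2) u K ==> sob 1 (sg + 2) (%x. (bracket x / bracket (ep *R x)) powr t * u x) (A2 * K)"
  using sob_weight_ratio[OF sg2 ep(1,2), of t] by blast
 have "\<exists>u. wsob (sg + 2) t u ((A2 * (2 * (m * A1))) * K) & (\<forall>x. \<mu> * u x - lap u x = f x)" if f: "wsob sg t f K" for f :: "real^'n => real" and K
 proof -
  let ?rh = "%p x. bracket (ep *R x) powr p"
  have rh: "0 < bracket (ep *R x)" for x :: "real^'n" by (rule bracket_pos)
  have rh1: "?rh (- t) x * ?rh t x = 1" for x :: "real^'n" using rh[of x] by (simp flip: powr_add)
  have e1: "(bracket x / bracket (ep *R x)) powr (- t) * (bracket x powr t * f x) = ?rh t x * f x" for x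
   using bracket_pos[of x] by (simp add: powr_divide powr_minus field_simps)
  have "sob 1 sg (%x. ?rh t x * f x) (A1 * K)" using A1(2)[OF f[unfolded wsob_def]] unfolding e1 .
  from sob_resolvent[OF sg this \<mu>] obtain v where v: "sob 1 (sg + 2) v (m * (A1 * K))" "!!x. \<mu> * v x - lap v x = ?rh t x * f x"
   unfolding m_def lap_def by blast
  obtain H where H: "norm H <= m * (A1 * K)" "v = ev (sg + 2) H" using sob_ev_ex[OF v(1)] by blast
  have "\<exists>!F. H - T F = F"
  proof (rule banach_fix_type[of "1/2"], simp, simp, intro allI)
   fix F G
   have "dist (H - T F) (H - T G) = norm (T (G - F))" by (simp add: dist_norm linear_diff[OF bounded_linear.linear[OF T(1)]])
   also have "... <= 1/2 * dist F G" using T(2)[of "G - F"] by (simp add: dist_norm norm_minus_commute)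
   finally show "dist (H - T F) (H - T G) <= 1/2 * dist F G" .
  qed
  then obtain F where F: "H = F + T F" by (metis diff_add_cancel)
  have "norm F <= norm H + norm (T F)" using F norm_triangle_ineq4[of H "T F"] by simp
  then have nF: "norm F <= 2 * (m * (A1 * K))" using T(2)[of F] H(1) by linarith
  define w where "w = ev (sg + 2) F"
  have w: "sob 1 (sg + 2) w (2 * (m * (A1 * K)))" unfolding w_def by (rule sob_mono[OF sob_ev[OF sg2] nF])
  define u where "u = (%x. ?rh (- t) x * w x)"
  have e2: "bracket x powr t * u x = (bracket x / bracket (ep *R x)) powr t * w x" for x
   using bracket_pos[of x] rh[of x] by (simp add: u_def powr_divide powr_minus field_simps)
  have "wsob (sg + 2) t u (A2 * (2 * (m * (A1 * K))))" unfolding wsob_def e2 by (rule A2(2)[OF w])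
  then have "wsob (sg + 2) t u ((A2 * (2 * (m * A1))) * K)" by (simp add: mult.assoc)
  moreover have "\<mu> * u x - lap u x = f x" for x
  proof -
   have "v = (%x. fld (sg + 2) 0 F x + fld (sg + 2) 0 (T F) x)" unfolding H(2) F using fld_add[OF sg2, of 0] by (simp add: fun_eq_iff)
   then have "\<mu> * (fld (sg + 2) 0 F x + fld (sg + 2) 0 (T F) x) - (lap (fld (sg + 2) 0 F) x + lap (fld (sg + 2) 0 (T F)) x) = ?rh t x * f x"
    using v(2)[of x] lap_add[OF sg ws ws] by simp
   moreover have "\<mu> * fld (sg + 2) 0 (T F) x - lap (fld (sg + 2) 0 (T F)) x = weight_error t ep w x" using T(3)[of F] by (simp add: w_def)
   ultimately have "\<mu> * w x - lap w x + weight_error t ep w x = ?rh t x * f x" by (simp add: w_def algebra_simps)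
   then have "?rh (- t) x * (\<mu> * w x - lap w x + weight_error t ep w x) = f x" using rh1[of x] by (simp flip: mult.assoc)
   then show ?thesis unfolding u_def lap_weight[OF sg epI w] by (simp add: algebra_simps)
  qed
  ultimately show ?thesis by blast
 qed
 moreover have "0 <= A2 * (2 * (m * A1))" using A1 A2 m by simp
 ultimately show ?thesis by blast
qed

section \<open>Smooth solution of a quadratic fixed point equation\<close>

text \<open>The index set of the Leibniz rule: every way to distribute directions over the two
  factors of \<open>B x x\<close>, keeping their order.\<close>

fun splits :: "'a list => ('a list \<times> 'a list) list" where
 "splits [] = [([], [])]"
| "splits (v # vs) = map (%p. (v # fst p, snd p)) (splits vs) @ map (%p. (fst p, v # snd p)) (splits vs)"

lemma splits_length: "p \<in> set (splits vs) ==> length (fst p) + length (snd p) = length vs"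
 by (induction vs arbitrary: p) auto

lemma splits_prod: "p \<in> set (splits vs) ==> prod_list (map g (fst p)) * prod_list (map g (snd p)) = (prod_list (map g vs) :: real)"
 by (induction vs arbitrary: p) auto

lemma length_splits: "length (splits vs) = 2 ^ length vs"
 by (induction vs) auto

abbreviation split_sum :: "('a list \<times> 'a list => 'b::ab_group_add) => 'a list => 'b" where
 "split_sum g vs == sum_list (map g (splits vs))"

lemma split_sum_fst: "split_sum g vs = g ([], vs) + split_sum (%p. if fst p = [] then 0 else g p) vs"
proof (induction vs arbitrary: g)
 case (Cons v vs)
 show ?case using Cons[of "%p. g (fst p, v # snd p)"] by (simp add: comp_def algebra_simps cong: if_cong)
qed simp

lemma split_sum_snd: "split_sum g vs = g (vs, []) + split_sum (%p. if snd p = [] then 0 else g p) vs"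
proof (induction vs arbitrary: g)
 case (Cons v vs)
 show ?case using Cons[of "%p. g (v # fst p, snd p)"] by (simp add: comp_def algebra_simps cong: if_cong)
qed simp

abbreviation proper_sum :: "('a list \<times> 'a list => 'b::ab_group_add) => 'a list => 'b" where
 "proper_sum g == split_sum (%p. if fst p = [] \<or> snd p = [] then 0 else g p)"

text \<open>Isolates the two splittings with an empty side. In the derivative of
  \<open>B x x\<close> only these contain the unknown derivative of full order.\<close>

lemma split_sum_proper:
 assumes "vs ~= []" shows "split_sum g vs = g ([], vs) + g (vs, []) + proper_sum g vs"
proof -
 have "(if fst p = [] then 0 else if snd p = [] then 0 else g p) = (if fst p = [] \<or> snd p = [] then 0 else g p)" for p by simp
 then show ?thesis
  using split_sum_snd[of g vs] split_sum_fst[of "%p. if snd p = [] then 0 else g p" vs] assms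
  by (simp add: algebra_simps cong: if_cong)
qed

lemma split_sum_append:
 "split_sum g (xs @ ys) = sum_list (map (%p. split_sum (%q. g (fst p @ fst q, snd p @ snd q)) ys) (splits xs))"
 by (induction xs arbitrary: g) (simp_all add: comp_def)

lemma split_sum_middle:
 "split_sum g (xs @ v # ys) = sum_list (map (%p. split_sum (%q. g (fst p @ v # fst q, snd p @ snd q) + g (fst p @ fst q, snd p @ v # snd q)) ys) (splits xs))"
 by (simp add: split_sum_append comp_def sum_list_addf)

lemma norm_sum_list_le:
 fixes f :: "'a => 'b::real_normed_vector"
 shows "(!!p. p \<in> set ps ==> norm (f p) <= c) ==> norm (sum_list (map f ps)) <= real (length ps) * c"
proof (induction ps)
 case (Cons p ps)
 have "norm (f p + sum_list (map f ps)) <= c + real (length ps) * c"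
  by (rule norm_triangle_mono) (use Cons in auto)
 then show ?case by (simp add: algebra_simps)
qed simp

lemma sum_list_scaleR: "sum_list (map (%p. r *R f p) ps) = r *R (sum_list (map f ps) :: 'b::real_vector)"
 by (induction ps) (simp_all add: scaleR_add_right)

text \<open>Data of the fixed point equation \<open>x = L e + B x x\<close>. The bounds
  \<open>l\<close> and \<open>b\<close> are parameters because the radii below are computed from
  them.\<close>

locale quad =
 fixes L :: "'e::real_normed_vector => 'x::banach" and B :: "'x => 'x => 'x" and l b :: real
 assumes L: "bounded_linear L" and B: "bounded_bilinear B"
  and l: "norm (L e) <= l * norm e" "0 <= l" and b: "norm (B x y) <= b * norm x * norm y" "0 < b"
begin

sublocale L: bounded_linear L by (rule L)
sublocale B: bounded_bilinear B by (rule B)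

text \<open>With \<open>b * R = 1/8\<close> each of \<open>B x\<close> and \<open>B _ x\<close> has
  norm at most 1/8 on the \<open>R\<close>-ball, so both the quadratic map and its linearization
  contract with constant 1/4. The radius \<open>r\<close> then gives
  \<open>norm (L e) <= R / 2\<close>.\<close>

definition "R = 1 / (8 * b)"
definition "r = R / (2 * (l + 1))"

lemma R: "0 < R" "b * R = 1/8" and r: "0 < r"
 using b l by (auto simp: R_def r_def)

lemma B_le: "norm x <= R ==> norm (B x y) <= (1/8) * norm y" "norm x <= R ==> norm (B y x) <= (1/8) * norm y"
proof -
 assume x: "norm x <= R"
 have "b * norm x <= b * R" using x b by (intro mult_left_mono) auto
 then have bx: "b * norm x <= 1/8" using R by simp
 show "norm (B x y) <= (1/8) * norm y" using b(1)[of x y] mult_right_mono[OF bx norm_ge_zero[of y]] by linarith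
 show "norm (B y x) <= (1/8) * norm y" using b(1)[of y x] mult_right_mono[OF bx norm_ge_zero[of y]] by (simp add: mult_ac)
qed

lemma linearized_bound:
 assumes "norm x <= R" "norm y <= R" "z = w + (B x z + B z y)" shows "norm z <= 2 * norm w"
proof -
 have "norm z <= norm w + (norm (B x z) + norm (B z y))"
  by (subst assms(3)) (meson add_left_mono norm_triangle_ineq order_trans)
 then show ?thesis using B_le(1)[OF assms(1), of z] B_le(2)[OF assms(2), of z] norm_ge_zero[of z] by linarith
qed

lemma linearized_ex:
 assumes "norm x <= R" shows "\<exists>z. z = w + (B x z + B z x)"
proof -
 have "\<exists>!z. w + (B x z + B z x) = z"
 proof (rule banach_fix_type[of "1/4"], simp, simp, intro allI)
  fix y z
  have e: "w + (B x y + B y x) - (w + (B x z + B z x)) = B x (y - z) + B (y - z) x" by (simp add: B.diff_left B.diff_right)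
  show "dist (w + (B x y + B y x)) (w + (B x z + B z x)) <= 1/4 * dist y z"
   unfolding dist_norm e using norm_triangle_ineq[of "B x (y - z)" "B (y - z) x"] B_le[OF assms, of "y - z"] by linarith
 qed
 then show ?thesis by metis
qed

definition inv_lin :: "'x => 'x => 'x" where "inv_lin x w = (SOME z. z = w + (B x z + B z x))"

lemma inv_lin: "norm x <= R ==> inv_lin x w = w + (B x (inv_lin x w) + B (inv_lin x w) x)"
 unfolding inv_lin_def using someI_ex[OF linearized_ex] .

lemma norm_L_le: assumes e: "norm e < r" shows "norm (L e) <= R / 2"
proof -
 have "norm (L e) <= l * norm e" by (rule l)
 also have "... <= (l + 1) * r" using e l by (intro mult_mono) auto
 also have "(l + 1) * r = R / 2" using l by (simp add: r_def field_simps)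
 finally show ?thesis .
qed

lemma solution_ex:
 assumes e: "norm e < r" shows "\<exists>x. norm x <= R & x = L e + B x x"
proof -
 note Le = norm_L_le[OF e]
 have "\<exists>!x\<in>cball 0 R. L e + B x x = x"
 proof (rule Banach_fix[of _ "1/4"])
  show "complete (cball 0 R :: 'x set)" by (simp add: complete_eq_closed)
  show "(cball 0 R :: 'x set) ~= {}" using R by simp
  show "(%x. L e + B x x) ` cball 0 R \<subseteq> cball 0 R"
  proof clarsimp
   fix x :: 'x assume "norm x <= R"
   then show "norm (L e + B x x) <= R" using norm_triangle_ineq[of "L e" "B x x"] B_le(1)[of x x] Le R by linarith
  qed
  fix x y :: 'x assume "x \<in> cball 0 R" "y \<in> cball 0 R"
  then have x: "norm x <= R" and y: "norm y <= R" by auto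
  have e: "L e + B x x - (L e + B y y) = B x (x - y) + B (x - y) y" by (simp add: B.diff_left B.diff_right)
  show "dist (L e + B x x) (L e + B y y) <= 1/4 * dist x y"
   unfolding dist_norm e using norm_triangle_ineq[of "B x (x - y)" "B (x - y) y"] B_le(1)[OF x, of "x - y"] B_le(2)[OF y, of "x - y"] by linarith
 qed auto
 then show ?thesis by (metis mem_cball_0)
qed

definition sol :: "'e => 'x" where "sol e = (SOME x. norm x <= R & x = L e + B x x)"

lemma sol: assumes "norm e < r" shows "norm (sol e) <= R" "sol e = L e + B (sol e) (sol e)"
 using someI_ex[OF solution_ex[OF assms]] unfolding sol_def by auto

text \<open>The difference solves a linearized equation with source 0. Uniqueness in the
  \<open>R\<close>-ball later identifies solutions found in different function spaces.\<close>

lemma sol_unique: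
 assumes "norm x <= R" "x = L e + B x x" "norm y <= R" "y = L e + B y y" shows "x = y"
proof -
 have "x - y = (L e + B x x) - (L e + B y y)" using assms(2,4) by metis
 also have "... = 0 + (B x (x - y) + B (x - y) y)" by (simp add: B.diff_left B.diff_right)
 finally have "x - y = 0 + (B x (x - y) + B (x - y) y)" .
 from linearized_bound[OF assms(1,3) this] show ?thesis by simp
qed

lemma sol_bound: assumes "norm e < r" shows "norm (sol e) <= 2 * l * norm e"
proof -
 have "norm (sol e) <= norm (L e) + norm (B (sol e) (sol e))" by (subst sol(2)[OF assms]) (rule norm_triangle_ineq)
 then show ?thesis using B_le(1)[OF sol(1)[OF assms], of "sol e"] l(1)[of e] norm_ge_zero[of "sol e"] mult_nonneg_nonneg[OF l(2) norm_ge_zero[of e]] by linarith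
qed

lemma sol_lipschitz:
 assumes "norm e < r" "norm e' < r" shows "norm (sol e' - sol e) <= 2 * l * norm (e' - e)"
proof -
 have "sol e' - sol e = (L e' + B (sol e') (sol e')) - (L e + B (sol e) (sol e))" using sol(2)[OF assms(1)] sol(2)[OF assms(2)] by metis
 also have "... = L (e' - e) + (B (sol e') (sol e' - sol e) + B (sol e' - sol e) (sol e))"
  by (simp add: B.diff_left B.diff_right L.diff)
 finally have "sol e' - sol e = L (e' - e) + (B (sol e') (sol e' - sol e) + B (sol e' - sol e) (sol e))" .
 from linearized_bound[OF sol(1)[OF assms(2)] sol(1)[OF assms(1)] this] show ?thesis using l(1)[of "e' - e"] by simp
qed

definition src :: "'e list => 'x" where "src vs = (if length vs = 1 then L (hd vs) else 0)"

text \<open>Differentiating the fixed point equation along \<open>vs\<close> gives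
  \<open>src vs\<close> plus the sum of \<open>B\<close> over all splittings. The two splittings
  with an empty side contain the derivative of full order and are inverted by
  \<open>inv_lin\<close>; the others call shorter lists. These lists of directions become the
  arguments of the Frechet derivatives.\<close>

function D :: "'e => 'e list => 'x" where
 "D e vs = (if vs = [] then sol e else inv_lin (sol e)
   (src vs + sum_list (map (%p. if fst p = [] \<or> snd p = [] then 0 else B (D e (fst p)) (D e (snd p))) (splits vs))))"
 by auto
termination
proof (relation "Wellfounded.measure (%(e, vs). length vs)", simp_all)
 fix vs :: "'e list" and p
 assume "p \<in> set (splits vs)" and n: "fst p ~= [] & snd p ~= []"
 moreover have "0 < length (fst p)" "0 < length (snd p)" using n by auto
 ultimately show "length (fst p) < length vs" "length (snd p) < length vs" using splits_length[of p vs] by linarith+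
qed

declare D.simps [simp del]

abbreviation "BD e == (%p. B (D e (fst p)) (D e (snd p)))"

lemma D_Nil [simp]: "D e [] = sol e" by (simp add: D.simps)

lemma D_proper:
 assumes "norm e < r" "vs ~= []"
 shows "D e vs = (src vs + proper_sum (BD e) vs) + (B (sol e) (D e vs) + B (D e vs) (sol e))"
 using inv_lin[OF sol(1)[OF assms(1)], of "src vs + proper_sum (BD e) vs"] assms(2) by (simp add: D.simps[of e vs])

lemma D_eq:
 assumes "norm e < r"
 shows "D e vs = (if vs = [] then L e else src vs) + split_sum (BD e) vs"
proof (cases "vs = []")
 case True then show ?thesis using sol(2)[OF assms] by simp
next
 case False
 have "split_sum (BD e) vs = B (sol e) (D e vs) + B (D e vs) (sol e) + proper_sum (BD e) vs"
  using split_sum_proper[OF False, of "BD e"] by simp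
 then show ?thesis using D_proper[OF assms False] False by (simp add: algebra_simps)
qed

abbreviation "P == (%vs :: 'e list. prod_list (map norm vs))"

lemma P_nonneg: "0 <= P vs" by (induction vs) auto

lemma norm_proper_sum_le:
 assumes "!!p. p \<in> set (splits vs) ==> fst p ~= [] ==> snd p ~= [] ==> norm (g p) <= c" and "0 <= c"
 shows "norm (proper_sum g vs) <= 2 ^ length vs * c"
 using norm_sum_list_le[of "splits vs" "%p. if fst p = [] \<or> snd p = [] then 0 else g p" c] assms by (simp add: length_splits)

lemma norm_src_le: "norm (src vs) <= l * P vs"
proof (cases "length vs = 1")
 case True
 then obtain v where "vs = [v]" by (auto simp: length_Suc_conv)
 then show ?thesis using l by (simp add: src_def)
qed (use l P_nonneg[of vs] in "simp add: src_def")

lemma proper_lengths: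
 assumes "p \<in> set (splits vs)" "fst p ~= []" "snd p ~= []"
 shows "length (fst p) < length vs" "length (snd p) < length vs"
proof -
 have "0 < length (fst p)" "0 < length (snd p)" using assms(2,3) by auto
 then show "length (fst p) < length vs" "length (snd p) < length vs" using splits_length[OF assms(1)] by linarith+
qed

lemma norm_B_le_prod:
 assumes "p \<in> set (splits vs)" "norm x <= c * P (fst p)" "norm y <= d * P (snd p)" "0 <= c" "0 <= d"
 shows "norm (B x y) <= b * c * d * P vs"
proof -
 have "norm (B x y) <= b * (norm x * norm y)" using b(1)[of x y] by (simp add: mult.assoc)
 also have "... <= b * ((c * P (fst p)) * (d * P (snd p)))"
  using assms b P_nonneg by (intro mult_left_mono mult_mono) auto
 also have "... = b * c * d * P vs" using splits_prod[OF assms(1), of norm] by (simp add: mult_ac)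
 finally show ?thesis .
qed

lemma D_bounded: "EX C>=0. \<forall>e vs. norm e < r --> length vs <= k --> norm (D e vs) <= C * P vs"
proof (induction k)
 case 0
 show ?case using sol(1) R by (intro exI[of _ R]) auto
next
 case (Suc k)
 then obtain C where C: "0 <= C" "!!e vs. norm e < r ==> length vs <= k ==> norm (D e vs) <= C * P vs" by blast
 define C' where "C' = max C (2 * (l + 2 ^ Suc k * (b * C * C)))"
 have "norm (D e vs) <= C' * P vs" if e: "norm e < r" and k: "length vs <= Suc k" for e vs
 proof (cases "length vs <= k")
  case True
  have "C * P vs <= C' * P vs" by (intro mult_right_mono P_nonneg) (simp add: C'_def)
  then show ?thesis using C(2)[OF e True] by linarith
 next
  case False
  then have n: "vs ~= []" and lk: "length vs = Suc k" using k by auto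
  have "norm (proper_sum (BD e) vs) <= 2 ^ length vs * (b * C * C * P vs)"
  proof (rule norm_proper_sum_le)
   show "0 <= b * C * C * P vs" using b C P_nonneg by simp
   fix p assume p: "p \<in> set (splits vs)" "fst p ~= []" "snd p ~= []"
   show "norm (BD e p) <= b * C * C * P vs"
    by (rule norm_B_le_prod[OF p(1)]) (use proper_lengths[OF p] lk C e in auto)
  qed
  then have "norm (src vs + proper_sum (BD e) vs) <= l * P vs + 2 ^ Suc k * (b * C * C * P vs)"
   using norm_triangle_ineq[of "src vs" "proper_sum (BD e) vs"] norm_src_le[of vs] lk by simp
  then have "norm (D e vs) <= 2 * (l + 2 ^ Suc k * (b * C * C)) * P vs"
   using linearized_bound[OF sol(1)[OF e] sol(1)[OF e] D_proper[OF e n]] by (simp add: algebra_simps)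
  also have "... <= C' * P vs" by (intro mult_right_mono P_nonneg) (simp add: C'_def)
  finally show ?thesis .
 qed
 moreover have "0 <= C'" using C by (simp add: C'_def)
 ultimately show ?case by blast
qed

text \<open>A common form of two recursions: the difference of derivatives at two points, with
  \<open>W = 0\<close>, and the remainder of their first-order expansion, with \<open>W\<close>
  quadratic in the increment. The number \<open>c\<close> measures both the initial value and the
  forcing.\<close>

definition split_linear where
 "split_linear k M c X Y Z W \<longleftrightarrow> 0 <= c & norm (X []) <= R & norm (Y []) <= R & norm (Z []) <= c &
  (\<forall>vs. length vs <= k --> norm (X vs) <= M * P vs & norm (Y vs) <= M * P vs) &
  (\<forall>vs. vs ~= [] --> length vs <= k --> Z vs = split_sum (%p. B (Z (fst p)) (X (snd p)) + B (Y (fst p)) (Z (snd p)) + W p) vs &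
   (\<forall>p\<in>set (splits vs). norm (W p) <= c * P vs))"

text \<open>Induction on the length of the list. The terms with \<open>Z vs\<close> itself are
  absorbed by \<open>linearized_bound\<close>, all other occurrences of \<open>Z\<close> have
  shorter arguments.\<close>

lemma split_linear_bound:
 assumes M: "0 <= M"
 shows "EX C>=0. \<forall>X Y Z W c vs. split_linear k M c X Y Z W --> length vs <= k --> norm (Z vs) <= C * c * P vs"
proof (induction k)
 case 0
 show ?case by (intro exI[of _ 1]) (auto simp: split_linear_def)
next
 case (Suc k)
 then obtain C where C: "0 <= C" "!!X Y Z W c vs. split_linear k M c X Y Z W ==> length vs <= k ==> norm (Z vs) <= C * c * P vs" by blast
 define C' where "C' = max C (2 * (2 * (b * M + 1) + 2 ^ Suc k * (2 * b * C * M + 1)))"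
 have "norm (Z vs) <= C' * c * P vs" if sl: "split_linear (Suc k) M c X Y Z W" and k: "length vs <= Suc k" for X Y Z W c vs
 proof -
  have c: "0 <= c" and R: "norm (X []) <= R" "norm (Y []) <= R" and Z0: "norm (Z []) <= c"
   and XY: "\<forall>vs. length vs <= Suc k --> norm (X vs) <= M * P vs & norm (Y vs) <= M * P vs"
   and Z: "\<forall>vs. vs ~= [] --> length vs <= Suc k --> Z vs = split_sum (%p. B (Z (fst p)) (X (snd p)) + B (Y (fst p)) (Z (snd p)) + W p) vs &
    (\<forall>p\<in>set (splits vs). norm (W p) <= c * P vs)"
   using sl unfolding split_linear_def by blast+
  have "split_linear k M c X Y Z W" using sl unfolding split_linear_def by (meson le_SucI)
  note IH = C(2)[OF this]
  show ?thesis
  proof (cases "length vs <= k")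
   case True
   have "C * (c * P vs) <= C' * (c * P vs)" using c P_nonneg by (intro mult_right_mono) (auto simp: C'_def)
   then show ?thesis using IH[OF True] by (simp add: mult.assoc)
  next
   case False
   then have n: "vs ~= []" and lk: "length vs = Suc k" using k by auto
   let ?S = "c * P vs"
   let ?g = "%p. B (Z (fst p)) (X (snd p)) + B (Y (fst p)) (Z (snd p)) + W p"
   have S: "0 <= ?S" using c P_nonneg by simp
   have mem: "([], vs) \<in> set (splits vs)" "(vs, []) \<in> set (splits vs)" by (induction vs) (force simp: image_iff)+
   have W: "norm (W p) <= ?S" if "p \<in> set (splits vs)" for p using Z n k that by blast
   have X: "norm (X ws) <= M * P ws" and Y: "norm (Y ws) <= M * P ws" if "length ws <= Suc k" for ws using XY that by auto
   have w0: "norm (proper_sum ?g vs) <= 2 ^ length vs * ((2 * b * C * M + 1) * ?S)"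
   proof (rule norm_proper_sum_le)
    show "0 <= (2 * b * C * M + 1) * ?S" using b C M S by simp
    fix p assume p: "p \<in> set (splits vs)" "fst p ~= []" "snd p ~= []"
    note ln = proper_lengths[OF p]
    have "norm (B (Z (fst p)) (X (snd p))) <= b * (C * c) * M * P vs" "norm (B (Y (fst p)) (Z (snd p))) <= b * M * (C * c) * P vs"
     by (rule norm_B_le_prod[OF p(1)]; use ln lk C(1) M c IH X Y in auto)+
    from norm_triangle_mono[OF norm_triangle_mono[OF this] W[OF p(1)]] show "norm (?g p) <= (2 * b * C * M + 1) * ?S"
     by (simp add: algebra_simps)
   qed
   have w1: "norm (B (Z []) (X vs) + W ([], vs)) <= b * c * M * P vs + ?S"
    using norm_B_le_prod[OF mem(1), of "Z []" c "X vs" M] Z0 X[OF k] c M by (intro norm_triangle_mono W mem) auto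
   have w2: "norm (B (Y vs) (Z []) + W (vs, [])) <= b * M * c * P vs + ?S"
    using norm_B_le_prod[OF mem(2), of "Y vs" M "Z []" c] Z0 Y[OF k] c M by (intro norm_triangle_mono W mem) auto
   have w: "norm ((B (Z []) (X vs) + W ([], vs)) + (B (Y vs) (Z []) + W (vs, [])) + proper_sum ?g vs)
     <= (b * c * M * P vs + ?S) + (b * M * c * P vs + ?S) + 2 ^ Suc k * ((2 * b * C * M + 1) * ?S)"
    using norm_triangle_mono[OF norm_triangle_mono[OF w1 w2] w0] unfolding lk .
   have "Z vs = split_sum ?g vs" using Z n k by blast
   then have "Z vs = ?g ([], vs) + ?g (vs, []) + proper_sum ?g vs" using split_sum_proper[OF n, of ?g] by (rule trans)
   then have "Z vs = ((B (Z []) (X vs) + W ([], vs)) + (B (Y vs) (Z []) + W (vs, [])) + proper_sum ?g vs) + (B (Y []) (Z vs) + B (Z vs) (X []))"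
    by (simp add: add_ac)
   from linearized_bound[OF R(2,1) this] w
   have "norm (Z vs) <= 2 * (2 * (b * M + 1) + 2 ^ Suc k * (2 * b * C * M + 1)) * ?S" by (simp add: algebra_simps)
   also have "... <= C' * ?S" by (intro mult_right_mono S) (simp add: C'_def)
   finally show ?thesis by (simp add: mult.assoc)
  qed
 qed
 moreover have "0 <= C'" using C by (simp add: C'_def)
 ultimately show ?case by blast
qed

lemma D_lipschitz:
 "EX C>=0. \<forall>e v vs. norm e < r --> norm (e + v) < r --> length vs <= k --> norm (D (e + v) vs - D e vs) <= C * norm v * P vs"
proof -
 obtain M where M: "0 <= M" "!!e vs. norm e < r ==> length vs <= k ==> norm (D e vs) <= M * P vs" using D_bounded[of k] by blast
 obtain C where C: "0 <= C" "!!X Y Z W c vs. split_linear k M c X Y Z W ==> length vs <= k ==> norm (Z vs) <= C * c * P vs"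
  using split_linear_bound[OF M(1), of k] by blast
 have "norm (D (e + v) vs - D e vs) <= C * (2 * l * norm v) * P vs" if e: "norm e < r" "norm (e + v) < r" and k: "length vs <= k" for e v vs
 proof (rule C(2)[where X = "D (e + v)" and Y = "D e" and W = "%_. 0", OF _ k])
  have "D (e + v) vs - D e vs = split_sum (%p. B (D (e + v) (fst p) - D e (fst p)) (D (e + v) (snd p)) + B (D e (fst p)) (D (e + v) (snd p) - D e (snd p)) + 0) vs"
   if "vs ~= []" for vs
   using D_eq[OF e(1), of vs] D_eq[OF e(2), of vs] that by (simp add: sum_list_subtractf[symmetric] B.diff_left B.diff_right)
  then show "split_linear k M (2 * l * norm v) (D (e + v)) (D e) (%vs. D (e + v) vs - D e vs) (%_. 0)"
   unfolding split_linear_def using sol(1) e M(2) sol_lipschitz[OF e] l P_nonneg by simp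
 qed
 then show ?thesis using C(1) l by (intro exI[of _ "C * (2 * l)"]) (simp add: mult.assoc)
qed

lemma src_Cons: "src (v # vs) = (if vs = [] then L v else 0)" by (simp add: src_def)

text \<open>The remainder obeys the linearized recursion, forced by \<open>B\<close> applied to two
  increments of derivatives. Both are of size \<open>norm v\<close> by \<open>D_lipschitz\<close>,
  so the remainder is quadratic in \<open>v\<close>, uniformly in \<open>e\<close>.\<close>

lemma D_remainder:
 "EX C>=0. \<forall>e v vs. norm e < r --> norm (e + v) < r --> length vs <= k -->
   norm (D (e + v) vs - D e vs - D e (v # vs)) <= C * (norm v)^2 * P vs"
proof -
 obtain M where M: "0 <= M" "!!e vs. norm e < r ==> length vs <= k ==> norm (D e vs) <= M * P vs" using D_bounded[of k] by blast
 obtain C where C: "0 <= C" "!!X Y Z W c vs. split_linear k M c X Y Z W ==> length vs <= k ==> norm (Z vs) <= C * c * P vs"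
  using split_linear_bound[OF M(1), of k] by blast
 obtain K where K: "0 <= K" "!!e v vs. norm e < r ==> norm (e + v) < r ==> length vs <= k ==> norm (D (e + v) vs - D e vs) <= K * norm v * P vs"
  using D_lipschitz[of k] by blast
 have "norm (D (e + v) vs - D e vs - D e (v # vs)) <= C * (2 * (b * K * K) * (norm v)^2) * P vs"
  if e: "norm e < r" "norm (e + v) < r" and k: "length vs <= k" for e v vs
 proof -
  let ?Dl = "%ws. D (e + v) ws - D e ws"
  let ?rh = "%ws. ?Dl ws - D e (v # ws)"
  let ?W = "%p. B (?Dl (fst p)) (?Dl (snd p))"
  have rh: "?rh vs = split_sum (%p. B (?rh (fst p)) (D e (snd p)) + B (D e (fst p)) (?rh (snd p)) + ?W p) vs" for vs
  proof -
   have "D e (v # vs) = (if vs = [] then L v else 0) + split_sum (%p. B (D e (v # fst p)) (D e (snd p)) + B (D e (fst p)) (D e (v # snd p))) vs"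
    using D_eq[OF e(1), of "v # vs"] by (simp add: src_Cons comp_def sum_list_addf)
   moreover have "?Dl vs = (if vs = [] then L v else 0) + (split_sum (BD (e + v)) vs - split_sum (BD e) vs)"
    using D_eq[OF e(1), of vs] D_eq[OF e(2), of vs] by (simp add: L.add)
   ultimately have "?rh vs = split_sum (BD (e + v)) vs - split_sum (BD e) vs - split_sum (%p. B (D e (v # fst p)) (D e (snd p)) + B (D e (fst p)) (D e (v # snd p))) vs"
    by simp
   also have "... = split_sum (%p. B (?rh (fst p)) (D e (snd p)) + B (D e (fst p)) (?rh (snd p)) + ?W p) vs"
    unfolding sum_list_subtractf[symmetric]
    by (intro arg_cong[where f=sum_list] map_cong refl) (simp add: B.diff_left B.diff_right B.add_left B.add_right algebra_simps)
   finally show ?thesis .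
  qed
  have W: "norm (?W p) <= 1 * (b * K * K * (norm v)^2) * P vs" if "p \<in> set (splits vs)" "length vs <= k" for p vs
   using norm_B_le_prod[OF that(1) K(2)[OF e] K(2)[OF e]] splits_length[OF that(1)] that(2) K(1) by (simp add: power2_eq_square mult_ac)
  show ?thesis
  proof (rule C(2)[where X = "D e" and Y = "D e" and W = "?W", OF _ k])
   have "?rh [] = ?W ([], []) + (B (sol e) (?rh []) + B (?rh []) (sol e))" using rh[of "[]"] by (simp add: algebra_simps)
   from linearized_bound[OF sol(1)[OF e(1)] sol(1)[OF e(1)] this] W[of "([], [])" "[]"]
   have 1: "norm (?rh []) <= 2 * (b * K * K) * (norm v)^2" by simp
   have "norm (?W p) <= 2 * (b * K * K) * (norm v)^2 * P vs" if "p \<in> set (splits vs)" "length vs <= k" for p vs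
   proof -
    have "0 <= b * K * K * (norm v)^2 * P vs" using b(2) K(1) P_nonneg[of vs] by simp
    then show ?thesis using W[OF that] by (simp add: mult.assoc)
   qed
   with rh 1 sol(1)[OF e(1)] M(2)[OF e(1)] b K show "split_linear k M (2 * (b * K * K) * (norm v)^2) (D e) (D e) ?rh ?W"
    unfolding split_linear_def D_Nil by (intro conjI allI impI ballI) (assumption | simp | blast)+
  qed
 qed
 then show ?thesis using C(1) b K by (intro exI[of _ "C * (2 * (b * K * K))"]) (simp add: mult.assoc)
qed

text \<open>Induction on the number of the remaining slots: proper splittings only involve shorter
  lists, and the defect from linearity then solves the linearized equation with source 0.\<close>

lemma D_multilinear:
 assumes e: "norm e < r"
 shows "D e (xs @ (c *R v + d *R w) # ys) = c *R D e (xs @ v # ys) + d *R D e (xs @ w # ys)"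
proof (induction "length xs + length ys" arbitrary: xs ys rule: less_induct)
 case less
 let ?u = "c *R v + d *R w"
 let ?G = "%p. if fst p = [] \<or> snd p = [] then 0 else BD e p"
 have IH: "D e (fst p @ ?u # fst q) = c *R D e (fst p @ v # fst q) + d *R D e (fst p @ w # fst q)"
  if "p \<in> set (splits xs)" "q \<in> set (splits ys)" "snd p @ snd q ~= []" for p q
 proof (rule less)
  have "0 < length (snd p @ snd q)" using that(3) by (simp only: length_greater_0_conv not_False_eq_True)
  then show "length (fst p) + length (fst q) < length xs + length ys"
   using splits_length[OF that(1)] splits_length[OF that(2)] unfolding length_append by linarith
 qed
 have IH': "D e (snd p @ ?u # snd q) = c *R D e (snd p @ v # snd q) + d *R D e (snd p @ w # snd q)"
  if "p \<in> set (splits xs)" "q \<in> set (splits ys)" "fst p @ fst q ~= []" for p q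
 proof (rule less)
  have "0 < length (fst p @ fst q)" using that(3) by (simp only: length_greater_0_conv not_False_eq_True)
  then show "length (snd p) + length (snd q) < length xs + length ys"
   using splits_length[OF that(1)] splits_length[OF that(2)] unfolding length_append by linarith
 qed
 have proper: "proper_sum (BD e) (xs @ ?u # ys) = c *R proper_sum (BD e) (xs @ v # ys) + d *R proper_sum (BD e) (xs @ w # ys)"
  unfolding split_sum_middle sum_list_scaleR[symmetric] sum_list_addf[symmetric]
 proof (intro arg_cong[where f=sum_list] map_cong refl)
  fix p q assume pq: "p \<in> set (splits xs)" "q \<in> set (splits ys)"
  have 1: "?G (fst p @ ?u # fst q, snd p @ snd q) = c *R ?G (fst p @ v # fst q, snd p @ snd q) + d *R ?G (fst p @ w # fst q, snd p @ snd q)"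
   using IH[OF pq] by (auto simp: B.add_left B.scaleR_left)
  have 2: "?G (fst p @ fst q, snd p @ ?u # snd q) = c *R ?G (fst p @ fst q, snd p @ v # snd q) + d *R ?G (fst p @ fst q, snd p @ w # snd q)"
   using IH'[OF pq] by (auto simp: B.add_right B.scaleR_right)
  show "?G (fst p @ ?u # fst q, snd p @ snd q) + ?G (fst p @ fst q, snd p @ ?u # snd q)
   = c *R (?G (fst p @ v # fst q, snd p @ snd q) + ?G (fst p @ fst q, snd p @ v # snd q))
   + d *R (?G (fst p @ w # fst q, snd p @ snd q) + ?G (fst p @ fst q, snd p @ w # snd q))"
   unfolding 1 2 by (simp add: scaleR_add_right)
 qed
 have srcl: "src (xs @ ?u # ys) = c *R src (xs @ v # ys) + d *R src (xs @ w # ys)"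
  by (cases "xs = [] & ys = []") (auto simp: src_def L.add L.scaleR)
 let ?z = "D e (xs @ ?u # ys) - (c *R D e (xs @ v # ys) + d *R D e (xs @ w # ys))"
 have Dp: "D e (xs @ a # ys) - (B (sol e) (D e (xs @ a # ys)) + B (D e (xs @ a # ys)) (sol e)) = src (xs @ a # ys) + proper_sum (BD e) (xs @ a # ys)" for a
  using D_proper[OF e, of "xs @ a # ys"] by (simp add: algebra_simps)
 have "?z - (B (sol e) ?z + B ?z (sol e)) = 0"
 proof -
  have "?z - (B (sol e) ?z + B ?z (sol e))
   = (src (xs @ ?u # ys) + proper_sum (BD e) (xs @ ?u # ys)) - (c *R (src (xs @ v # ys) + proper_sum (BD e) (xs @ v # ys)) + d *R (src (xs @ w # ys) + proper_sum (BD e) (xs @ w # ys)))"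
   unfolding Dp[symmetric] by (simp add: B.diff_left B.diff_right B.add_left B.add_right B.scaleR_left B.scaleR_right algebra_simps)
  then show ?thesis unfolding proper srcl by (simp add: algebra_simps)
 qed
 then have "?z = 0 + (B (sol e) ?z + B ?z (sol e))" by simp
 from linearized_bound[OF sol(1)[OF e] sol(1)[OF e] this] show ?case by simp
qed

end

section \<open>The contracted Bianchi identity\<close>

lemma bounded_bilinear_matrix_mul: "bounded_bilinear ((**) :: real^'n^'m => real^'k^'n => real^'k^'m)"
 unfolding bilinear_conv_bounded_bilinear[symmetric] bilinear_def
 by (auto intro!: linearI simp: matrix_matrix_mult_def vec_eq_iff algebra_simps sum.distrib sum_distrib_left)

lemmas matrix_mul_simps = bounded_bilinear.add_left[OF bounded_bilinear_matrix_mul] bounded_bilinear.add_right[OF bounded_bilinear_matrix_mul]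
 bounded_bilinear.diff_left[OF bounded_bilinear_matrix_mul] bounded_bilinear.diff_right[OF bounded_bilinear_matrix_mul]
 bounded_bilinear.minus_left[OF bounded_bilinear_matrix_mul] bounded_bilinear.minus_right[OF bounded_bilinear_matrix_mul] matrix_mul_assoc

lemma bounded_linear_transpose: "bounded_linear (transpose :: real^'n^'m => real^'m^'n)"
 unfolding linear_conv_bounded_linear[symmetric] by (auto intro!: linearI simp: transpose_def vec_eq_iff)

lemmas transpose_simps = linear_add[OF bounded_linear.linear[OF bounded_linear_transpose]] linear_diff[OF bounded_linear.linear[OF bounded_linear_transpose]]
 linear_neg[OF bounded_linear.linear[OF bounded_linear_transpose]] matrix_transpose_mul

lemma pderivative_matrix_mul:
 assumes "f differentiable (at x)" "g differentiable (at x)"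
 shows "pd i (%x. (f x :: real^'b^'a) ** (g x :: real^'c^'b)) x = f x ** pd i g x + pd i f x ** g x"
  and "(%x. f x ** g x) differentiable (at x)"
proof -
 note * = bounded_bilinear.FDERIV[OF bounded_bilinear_matrix_mul has_derivative_pderivative[OF assms(1)] has_derivative_pderivative[OF assms(2)]]
 show "pd i (%x. f x ** g x) x = f x ** pd i g x + pd i f x ** g x" using pderivative_eqI[OF *, of i] by simp
 show "(%x. f x ** g x) differentiable (at x)" by (rule differentiableI[OF *])
qed

lemma pderivative_bounded_linear:
 assumes "bounded_linear T" "f differentiable (at x)"
 shows "pd i (%x. T (f x)) x = T (pd i f x)" and "(%x. T (f x)) differentiable (at x)"
proof -
 note * = bounded_linear.has_derivative[OF assms(1) has_derivative_pderivative[OF assms(2)]]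
 show "pd i (%x. T (f x)) x = T (pd i f x)" using pderivative_eqI[OF *, of i] by simp
 show "(%x. T (f x)) differentiable (at x)" by (rule differentiableI[OF *])
qed

lemma pderivative_diff:
 "f differentiable (at x) ==> g differentiable (at x) ==> pd i (%y. f y - g y) x = pd i f x - pd i g x"
 using pderivative_eqI[OF has_derivative_diff[OF has_derivative_pderivative has_derivative_pderivative], of f x g i] by simp

lemma pderivative_uminus:
 "f differentiable (at x) ==> pd i (%y. - f y) x = - pd i f x"
 using pderivative_bounded_linear(1)[OF bounded_linear_minus[OF bounded_linear_ident]] .

lemma pderivative_sum:
 assumes "!!a. a \<in> I ==> f a differentiable (at x)"
 shows "pd i (%y. \<Sum>a\<in>I. f a y) x = (\<Sum>a\<in>I. pd i (f a) x)"
 using pderivative_eqI[OF has_derivative_sum[of I f, OF has_derivative_pderivative[OF assms]], of i] by simp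

lemma pderivative_const: "pd i (%y. c) x = 0"
 by (rule pderivative_eqI) (rule has_derivative_const)

lemma pderivative_component:
 assumes "M differentiable (at x)"
 shows "pd i M x $ a $ b = pd i (%x. (M x :: real^'b^'a) $ a $ b) x" and "(%x. M x $ a $ b) differentiable (at x)"
 using pderivative_bounded_linear[OF bounded_linear_compose[OF bounded_linear_vec_nth bounded_linear_vec_nth, of a b] assms] by auto

lemma differentiable_matrixI:
 fixes M :: "'c::real_normed_vector => real^'b^'a"
 assumes "!!a b. (%x. M x $ a $ b) differentiable (at x)" shows "M differentiable (at x)"
 by (subst differentiable_componentwise_within) (auto simp: Basis_vec_def inner_axis intro!: assms)

text \<open>\<open>A i\<close> is the matrix with the Christoffel symbol Gamma^l_ij in row l and
  column j, and \<open>G\<close> is the inverse metric. In this form curvature identities are matrix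
  identities; only \<open>torsion\<close> mixes the index of the form with an index of the
  matrix.\<close>

locale levi_civita =
 fixes g G :: "real^'n => real^'n^'n" and A :: "'n => real^'n => real^'n^'n"
 assumes dg: "g differentiable (at x)" and dG: "G differentiable (at x)" and dA: "A i differentiable (at x)"
  and gG: "g x ** G x = mat 1" and sym: "transpose (g x) = g x"
  and torsion: "A i x $ l $ k = A k x $ l $ i"
  and compat: "pd i g x = g x ** A i x + transpose (A i x) ** g x"
  and comm: "pd i (pd j g) x = pd j (pd i g) x"
begin

text \<open>The curvature of the connection matrices. In \<open>Ph\<close> the second matrix index
  is raised, after which compatibility with the metric is plain antisymmetry of a matrix.\<close>

definition F where "F i j x = pd i (A j) x - pd j (A i) x + (A i x ** A j x - A j x ** A i x)"
definition Ph where "Ph i j x = F i j x ** G x"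
definition ric where "ric x = (\<chi> j k. \<Sum>l\<in>UNIV. F l k x $ l $ j)"

text \<open>\<open>P\<close> is the Ricci tensor with its first index raised.\<close>

definition P where "P i m x = (\<Sum>l\<in>UNIV. Ph l m x $ l $ i)"

lemma Gg: "G x ** g x = mat 1" using gG matrix_left_right_inverse by metis

lemma gg_cancel: "G x ** (g x ** M) = M" "M ** g x ** G x = M" "M ** G x ** g x = M"
 using gG[of x] Gg[of x] by (simp_all add: matrix_mul_assoc) (simp_all add: matrix_mul_assoc[symmetric])

lemma symG: "transpose (G x) = G x"
proof -
 have "transpose (G x) = G x ** (g x ** transpose (G x))" by (simp add: gg_cancel)
 also have "g x ** transpose (G x) = mat 1" using arg_cong[OF Gg[of x], of transpose] by (simp add: matrix_transpose_mul sym)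
 finally show ?thesis by simp
qed

lemma F_antisym: "F j i x = - F i j x" by (simp add: F_def)

lemma dAt: "(%x. transpose (A i x)) differentiable (at x)"
 by (rule pderivative_bounded_linear(2)[OF bounded_linear_transpose dA])

text \<open>The compatibility condition is differentiated once more and antisymmetrized: by
  \<open>comm\<close> the second derivatives of \<open>g\<close> cancel, which leaves the action of
  the curvature on \<open>g\<close>.\<close>

lemma gF: "g x ** F i j x + transpose (F i j x) ** g x = 0"
proof -
 have 2: "pd i (pd j g) x = (g x ** pd i (A j) x + (g x ** A i x + transpose (A i x) ** g x) ** A j x)
   + (transpose (A j x) ** (g x ** A i x + transpose (A i x) ** g x) + transpose (pd i (A j) x) ** g x)" for i j
  by (simp add: ext[OF compat[of j]] pderivative_add pderivative_matrix_mul dg dA dAt pderivative_bounded_linear(1)[OF bounded_linear_transpose dA] compat)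
 show ?thesis using comm[of i j x] unfolding 2 F_def
  by (simp add: matrix_mul_simps transpose_simps algebra_simps)
qed

lemma Ph_transpose: "transpose (Ph i j x) = - Ph i j x"
proof -
 have "0 = G x ** (g x ** F i j x + transpose (F i j x) ** g x) ** G x" by (simp add: gF)
 also have "... = Ph i j x + transpose (Ph i j x)"
  by (simp only: matrix_mul_simps Ph_def transpose_simps symG) (simp only: gg_cancel Gg matrix_mul_lid)
 finally show ?thesis by (simp add: eq_neg_iff_add_eq_0 add.commute)
qed

lemma Ph_antisym: "Ph j i x = - Ph i j x" "Ph i j x $ b $ a = - Ph i j x $ a $ b"
 using F_antisym[of j i x] arg_cong[OF Ph_transpose[of i j x], of "%M. M $ a $ b"]
 by (auto simp: Ph_def matrix_mul_simps transpose_def)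

text \<open>The trace pairs the antisymmetric \<open>Ph\<close> with the symmetric
  \<open>g\<close>.\<close>

lemma trace_F: "(\<Sum>l\<in>UNIV. F i j x $ l $ l) = 0"
proof -
 have "F i j x = Ph i j x ** g x" by (simp add: Ph_def gg_cancel)
 then have 1: "(\<Sum>l\<in>UNIV. F i j x $ l $ l) = (\<Sum>l\<in>UNIV. \<Sum>k\<in>UNIV. Ph i j x $ l $ k * g x $ k $ l)" by (simp add: matrix_matrix_mult_def)
 have "Ph i j x $ k $ l * g x $ l $ k = - (Ph i j x $ l $ k * g x $ k $ l)" for k l
  using Ph_antisym(2)[of i j x k l] arg_cong[OF sym[of x], of "%M. M $ k $ l"] by (simp add: transpose_def)
 then have "(\<Sum>l\<in>UNIV. \<Sum>k\<in>UNIV. Ph i j x $ l $ k * g x $ k $ l) = (\<Sum>l\<in>UNIV. \<Sum>k\<in>UNIV. - (Ph i j x $ l $ k * g x $ k $ l))"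
  by (subst sum.swap) (intro sum.cong refl)
 then show ?thesis unfolding 1 sum_negf by (rule equal_neg_zero[THEN iffD1])
qed

lemma dA_sym: "pd m (A i) x $ l $ k = pd m (A k) x $ l $ i"
 using torsion by (simp add: pderivative_component(1)[OF dA])

text \<open>Symmetry of the connection in its lower indices cancels the derivatives and the products
  separately in the cyclic sum.\<close>

lemma first_bianchi: "F i j x $ l $ k + F j k x $ l $ i + F k i x $ l $ j = 0"
proof -
 have 1: "(A i x ** A j x) $ l $ k = (A i x ** A k x) $ l $ j" for i j k
  using torsion[of _ x] by (simp add: matrix_matrix_mult_def)
 show ?thesis
  using dA_sym[of i j x l k] dA_sym[of j i x l k] dA_sym[of k j x l i] 1[of i j k] 1[of j i k] 1[of k j i] by (simp add: F_def)
qed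

text \<open>By the first Bianchi identity the antisymmetric part of \<open>ric\<close> is a trace of
  the curvature.\<close>

lemma ric_sym: "ric x $ j $ k = ric x $ k $ j"
proof -
 have "F l k x $ l $ j - F l j x $ l $ k = - F k j x $ l $ l" for l
  using first_bianchi[of l k x l j] F_antisym[of j l x] by simp
 then have "ric x $ j $ k - ric x $ k $ j = - (\<Sum>l\<in>UNIV. F k j x $ l $ l)"
  by (simp add: ric_def sum_subtractf[symmetric] sum_negf)
 then have "ric x $ j $ k - ric x $ k $ j = 0" by (simp only: trace_F minus_zero)
 then show ?thesis by (simp only: right_minus_eq)
qed

lemma P_ric: "P i m x = (G x ** ric x) $ i $ m"
proof -
 have "P i m x = (\<Sum>l\<in>UNIV. \<Sum>k\<in>UNIV. G x $ i $ k * F l m x $ l $ k)"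
  using arg_cong[OF symG[of x], of "%M. M $ _ $ _"] by (simp add: P_def Ph_def matrix_matrix_mult_def transpose_def mult.commute)
 also have "... = (G x ** ric x) $ i $ m"
  by (subst sum.swap) (simp add: ric_def matrix_matrix_mult_def sum_distrib_left)
 finally show ?thesis .
qed

end

locale levi_civita_twice = levi_civita +
 assumes dA2: "pd i (A j) differentiable (at x)"
  and comm2: "pd i (pd j (A k)) x = pd j (pd i (A k)) x"
begin

lemma dF: "F i j differentiable (at x)"
 unfolding F_def[abs_def] by (intro differentiable_add differentiable_diff dA2 pderivative_matrix_mul(2) dA)

lemma dPh: "Ph i j differentiable (at x)"
 unfolding Ph_def[abs_def] by (intro pderivative_matrix_mul(2) dF dG)

lemma pderivative_F: "pd m (F i j) x = pd m (pd i (A j)) x - pd m (pd j (A i)) x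
  + ((A i x ** pd m (A j) x + pd m (A i) x ** A j x) - (A j x ** pd m (A i) x + pd m (A j) x ** A i x))"
 by (simp add: F_def[abs_def] pderivative_add pderivative_diff pderivative_matrix_mul dA dA2)

text \<open>The second derivatives of \<open>A\<close> cancel by \<open>comm2\<close>, and the
  commutators cancel as in the Jacobi identity.\<close>

lemma second_bianchi_F:
 "(pd m (F i j) x + (A m x ** F i j x - F i j x ** A m x)) + (pd i (F j m) x + (A i x ** F j m x - F j m x ** A i x))
  + (pd j (F m i) x + (A j x ** F m i x - F m i x ** A j x)) = 0"
 unfolding pderivative_F using comm2[of m i j x] comm2[of m j i x] comm2[of i j m x]
 by (simp add: F_def matrix_mul_simps algebra_simps)

lemma pderivative_G: "pd m G x = - (A m x ** G x + G x ** transpose (A m x))"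
proof -
 have "0 = pd m (%x. g x ** G x) x" by (simp add: gG pderivative_const)
 also have "... = g x ** pd m G x + pd m g x ** G x" by (rule pderivative_matrix_mul(1)[OF dg dG])
 finally have "0 = G x ** (g x ** pd m G x + (g x ** A m x + transpose (A m x) ** g x) ** G x)" by (simp add: compat)
 also have "... = pd m G x + (A m x ** G x + G x ** transpose (A m x))"
  by (simp only: matrix_mul_simps) (simp only: gg_cancel Gg matrix_mul_lid)
 finally show ?thesis unfolding eq_neg_iff_add_eq_0 by (rule HOL.sym)
qed

text \<open>The inverse metric is parallel by \<open>pderivative_G\<close>, so raising an index
  commutes with covariant differentiation.\<close>

lemma pderivative_Ph: "pd m (Ph i j) x + (A m x ** Ph i j x + Ph i j x ** transpose (A m x))
  = (pd m (F i j) x + (A m x ** F i j x - F i j x ** A m x)) ** G x"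
 by (simp add: Ph_def[abs_def] pderivative_matrix_mul dF dG pderivative_G matrix_mul_simps algebra_simps)

lemma second_bianchi:
 "(pd m (Ph i j) x + (A m x ** Ph i j x + Ph i j x ** transpose (A m x)))
  + (pd i (Ph j m) x + (A i x ** Ph j m x + Ph j m x ** transpose (A i x)))
  + (pd j (Ph m i) x + (A j x ** Ph m i x + Ph m i x ** transpose (A j x))) = 0"
 unfolding pderivative_Ph matrix_mul_simps(1)[symmetric] by (simp add: second_bianchi_F)

lemma dP: "P i m differentiable (at x)"
 unfolding P_def[abs_def] by (intro differentiable_sum ballI pderivative_component(2) dPh finite)

lemma pderivative_P: "pd i (P a m) x = (\<Sum>l\<in>UNIV. pd i (Ph l m) x $ l $ a)"
 unfolding P_def[abs_def] by (subst pderivative_sum) (simp_all add: pderivative_component dPh)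

lemma dPh_antisym: "pd m (Ph j i) x = - pd m (Ph i j) x" "pd m (Ph i j) x $ b $ a = - pd m (Ph i j) x $ a $ b"
proof -
 show "pd m (Ph j i) x = - pd m (Ph i j) x" by (subst ext[OF Ph_antisym(1)[of j i]]) (rule pderivative_uminus[OF dPh])
 show "pd m (Ph i j) x $ b $ a = - pd m (Ph i j) x $ a $ b"
  unfolding pderivative_component(1)[OF dPh]
  by (subst ext[OF Ph_antisym(2)[of i j _ b a]]) (rule pderivative_uminus[OF pderivative_component(2)[OF dPh]])
qed

text \<open>In the second Bianchi identity the matrix indices are set to \<open>i\<close> and
  \<open>j\<close> and summed. The first cyclic term gives the derivative of the trace of
  \<open>P\<close>, the other two each give minus its divergence. Of the connection terms, some
  combine into those of the divergence and the others vanish by symmetry.\<close>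

theorem contracted_bianchi:
 "pd m (%x. \<Sum>i\<in>UNIV. P i i x) x
  = 2 * (\<Sum>i\<in>UNIV. pd i (P i m) x + (\<Sum>p\<in>UNIV. A i x $ i $ p * P p m x - A i x $ p $ m * P i p x))"
proof -
 let ?d = "%m i j a b. pd m (Ph i j) x $ a $ b" and ?f = "%i j a b. Ph i j x $ a $ b" and ?G = "%a m p. A m x $ a $ p"
 let ?X = "%m i j a b. ?d m i j a b + ((\<Sum>p\<in>UNIV. ?G a m p * ?f i j p b) + (\<Sum>p\<in>UNIV. ?f i j a p * ?G b m p))"
 note a1 = Ph_antisym(1)[of _ _ x] and a2 = Ph_antisym(2)[of _ _ x]
 have "?X m i j a b + ?X i j m a b + ?X j m i a b = 0" for i j a b
  using arg_cong[OF second_bianchi[of m i j x], of "%M. M $ a $ b"] by (simp add: matrix_matrix_mult_def transpose_def)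
 then have "(\<Sum>i\<in>UNIV. \<Sum>j\<in>UNIV. ?X m i j i j + ?X i j m i j + ?X j m i i j) = 0" by simp
 then have sum0: "(\<Sum>i\<in>UNIV. \<Sum>j\<in>UNIV. ?X m i j i j) + (\<Sum>i\<in>UNIV. \<Sum>j\<in>UNIV. ?X i j m i j) + (\<Sum>i\<in>UNIV. \<Sum>j\<in>UNIV. ?X j m i i j) = 0"
  by (simp only: sum.distrib)
 let ?Q = "\<Sum>i\<in>UNIV. \<Sum>p\<in>UNIV. ?G p i m * P i p x"
 let ?T = "\<Sum>i\<in>UNIV. \<Sum>p\<in>UNIV. ?G i i p * P p m x"
 let ?dP = "\<Sum>i\<in>UNIV. pd i (P i m) x"
 have f2: "?f i j p j = ?f j i j p" for i j p using arg_cong[OF a1[of i j], of "%M. M $ p $ j"] a2[of j i p j] by simp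
 \<comment> \<open>\<open>Ph\<close> is antisymmetric in its matrix indices and the connection is
   symmetric in its lower ones.\<close>
 have zero: "(\<Sum>i\<in>UNIV. \<Sum>p\<in>UNIV. ?f j k i p * ?G l i p) = 0" for j k l
 proof -
  have "?f j k p i * ?G l p i = - (?f j k i p * ?G l i p)" for i p using torsion[of p x l i] a2[of j k p i] by simp
  then have "(\<Sum>i\<in>UNIV. \<Sum>p\<in>UNIV. ?f j k i p * ?G l i p) = (\<Sum>i\<in>UNIV. \<Sum>p\<in>UNIV. - (?f j k i p * ?G l i p))"
   by (subst sum.swap) (intro sum.cong refl)
  then show ?thesis unfolding sum_negf by (rule equal_neg_zero[THEN iffD1])
 qed
 have "(\<Sum>i\<in>UNIV. \<Sum>j\<in>UNIV. ?X m i j i j) = pd m (%x. \<Sum>i\<in>UNIV. P i i x) x + 2 * ?Q"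
 proof -
  have d: "pd m (%x. \<Sum>i\<in>UNIV. P i i x) x = (\<Sum>i\<in>UNIV. \<Sum>j\<in>UNIV. ?d m i j i j)"
   by (subst pderivative_sum[OF dP], simp add: pderivative_P) (rule sum.swap)
  have e1: "(\<Sum>i\<in>UNIV. \<Sum>j\<in>UNIV. \<Sum>p\<in>UNIV. ?G i m p * ?f i j p j) = ?Q"
  proof -
   have "(\<Sum>j\<in>UNIV. \<Sum>p\<in>UNIV. ?G i m p * ?f i j p j) = (\<Sum>p\<in>UNIV. ?G i p m * P p i x)" for i
    by (subst sum.swap) (simp add: P_def sum_distrib_left f2 torsion[of m x i])
   then show ?thesis by simp (rule sum.swap)
  qed
  have e2: "(\<Sum>i\<in>UNIV. \<Sum>j\<in>UNIV. \<Sum>p\<in>UNIV. ?f i j i p * ?G j m p) = ?Q"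
  proof -
   have "(\<Sum>i\<in>UNIV. \<Sum>p\<in>UNIV. ?f i j i p * ?G j m p) = (\<Sum>p\<in>UNIV. ?G j p m * P p j x)" for j
    by (subst sum.swap) (simp add: P_def sum_distrib_left torsion[of m x j] mult.commute)
   then show ?thesis by (subst sum.swap) (simp, rule sum.swap)
  qed
  show ?thesis by (simp only: sum.distrib d e1 e2)
 qed
 moreover have "(\<Sum>i\<in>UNIV. \<Sum>j\<in>UNIV. ?X i j m i j) = - ?dP - ?T"
 proof -
  have e0: "(\<Sum>i\<in>UNIV. \<Sum>j\<in>UNIV. ?d i j m i j) = - ?dP"
  proof -
   have "?d i j m i j = - ?d i j m j i" for i j by (rule dPh_antisym(2))
   then show ?thesis by (simp only: pderivative_P sum_negf)
  qed
  have e1: "(\<Sum>i\<in>UNIV. \<Sum>j\<in>UNIV. \<Sum>p\<in>UNIV. ?G i i p * ?f j m p j) = - ?T"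
  proof -
   have "(\<Sum>j\<in>UNIV. \<Sum>p\<in>UNIV. ?G i i p * ?f j m p j) = - (\<Sum>p\<in>UNIV. ?G i i p * P p m x)" for i
   proof -
    have "?G i i p * ?f j m p j = - (?G i i p * ?f j m j p)" for j p using a2[of j m p j] by simp
    then have "(\<Sum>j\<in>UNIV. \<Sum>p\<in>UNIV. ?G i i p * ?f j m p j) = (\<Sum>j\<in>UNIV. \<Sum>p\<in>UNIV. - (?G i i p * ?f j m j p))" by simp
    also have "... = - (\<Sum>p\<in>UNIV. ?G i i p * P p m x)" by (subst sum.swap) (simp add: P_def sum_distrib_left sum_negf)
    finally show ?thesis .
   qed
   then show ?thesis by (simp add: sum_negf)
  qed
  have e2: "(\<Sum>i\<in>UNIV. \<Sum>j\<in>UNIV. \<Sum>p\<in>UNIV. ?f j m i p * ?G j i p) = 0"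
   by (subst sum.swap) (simp add: zero)
  show ?thesis by (simp only: sum.distrib e0 e1 e2)
 qed
 moreover have "(\<Sum>i\<in>UNIV. \<Sum>j\<in>UNIV. ?X j m i i j) = - ?dP - ?T"
 proof -
  have e0: "(\<Sum>i\<in>UNIV. \<Sum>j\<in>UNIV. ?d j m i i j) = - ?dP"
  proof -
   have "?d j m i i j = - ?d j i m i j" for i j using arg_cong[OF dPh_antisym(1)[of j m i x], of "%M. M $ i $ j"] by simp
   then show ?thesis by (subst sum.swap) (simp only: pderivative_P sum_negf)
  qed
  have e1: "(\<Sum>i\<in>UNIV. \<Sum>j\<in>UNIV. \<Sum>p\<in>UNIV. ?G i j p * ?f m i p j) = 0"
  proof -
   have "(\<Sum>j\<in>UNIV. \<Sum>p\<in>UNIV. ?G i j p * ?f m i p j) = 0" for i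
    using zero[of m i i] by (subst sum.swap) (simp add: torsion[of _ x i] mult.commute)
   then show ?thesis by simp
  qed
  have e2: "(\<Sum>i\<in>UNIV. \<Sum>j\<in>UNIV. \<Sum>p\<in>UNIV. ?f m i i p * ?G j j p) = - ?T"
  proof -
   have "(\<Sum>i\<in>UNIV. \<Sum>p\<in>UNIV. ?f m i i p * ?G j j p) = - (\<Sum>p\<in>UNIV. ?G j j p * P p m x)" for j
   proof -
    have "?f m i i p * ?G j j p = - (?G j j p * ?f i m i p)" for i p using arg_cong[OF a1[of m i], of "%M. M $ i $ p"] by simp
    then have "(\<Sum>i\<in>UNIV. \<Sum>p\<in>UNIV. ?f m i i p * ?G j j p) = (\<Sum>i\<in>UNIV. \<Sum>p\<in>UNIV. - (?G j j p * ?f i m i p))" by simp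
    also have "... = - (\<Sum>p\<in>UNIV. ?G j j p * P p m x)" by (subst sum.swap) (simp add: P_def sum_distrib_left sum_negf)
    finally show ?thesis .
   qed
   then show ?thesis by (subst sum.swap) (simp add: sum_negf)
  qed
  show ?thesis by (simp only: sum.distrib e0 e1 e2)
 qed
 ultimately show ?thesis using sum0 by (simp add: sum.distrib sum_subtractf algebra_simps)
qed

end

section \<open>Power series expansion of the solution\<close>

lemma sum_triangle_le_square:
 fixes a :: "nat => real" assumes "!!k. 0 <= a k"
 shows "(\<Sum>k\<le>N. \<Sum>i\<le>k. a i * a (k - i)) <= (\<Sum>k\<le>N. a k) * (\<Sum>k\<le>N. a k)"
proof -
 have "(\<Sum>k\<le>N. \<Sum>i\<le>k. a i * a (k - i)) = (\<Sum>(i,j)\<in>{(i,j). i + j <= N}. a i * a j)"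
  by (simp add: sum.triangle_reindex_eq)
 also have "... <= (\<Sum>(i,j)\<in>{..N} \<times> {..N}. a i * a j)"
  by (rule sum_mono2) (auto simp: assms)
 finally show ?thesis by (simp add: sum_product sum.cartesian_product)
qed

text \<open>Once the lower coefficients vanish, division by \<open>t ^ m\<close> leaves a series
  whose limit at 0 is the coefficient of index \<open>m\<close>.\<close>

lemma power_series_zero:
 fixes a :: "nat => real"
 assumes s: "0 < s" and z: "!!t. t ~= 0 ==> \<bar>t\<bar> < s ==> (%k. a k * t ^ k) sums 0"
 shows "a m = 0"
proof (induction m rule: less_induct)
 case (less m)
 have "(%k. a (k + m) * t ^ k) sums 0" if t: "t ~= 0" "norm t < s" for t
 proof -
  have "(%k. a (k + m) * t ^ (k + m)) sums 0"
   using sums_split_initial_segment[OF z[of t], of m] t less by simp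
  from sums_mult[OF this, of "1 / t ^ m"] show ?thesis using t by (simp add: power_add)
 qed
 from powser_limit_0_strong[of s "%k. a (k + m)" "%_. 0", OF s this]
 have "((%_::real. 0::real) \<longlongrightarrow> a (0 + m)) (at 0)" by blast
 then show ?case by (simp add: tendsto_const_iff)
qed

context quad
begin

text \<open>Homogeneous parts of the solution in \<open>e\<close>, of degree \<open>k + 1\<close> at
  index \<open>k\<close>; inserting the series into the equation gives this Catalan-type
  recursion.\<close>

fun coef :: "'e => nat => 'x" where
 "coef e 0 = L e"
| "coef e (Suc k) = (\<Sum>i\<le>k. B (coef e i) (coef e (k - i)))"

lemma coef_scaleR: "coef (t *R e) k = t ^ Suc k *R coef e k"
proof (induction k rule: less_induct)
 case (less k)
 show ?case
 proof (cases k)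
  case (Suc m)
  have "t ^ Suc (m - i) * t ^ Suc i = t ^ Suc (Suc m)" if "i <= m" for i
   using that by (simp add: power_add[symmetric] del: power_Suc)
  then show ?thesis using less Suc by (simp add: B.scaleR_left B.scaleR_right scaleR_sum_right del: power_Suc)
 qed (simp add: L.scaleR)
qed

text \<open>The induction closes because R/2 + b R^2 = R/2 + R/8 \<le> R, the triangular double sum
  being at most the square of the preceding partial sum.\<close>

lemma coef_sum_le: assumes e: "norm e < r" shows "(\<Sum>k\<le>N. norm (coef e k)) <= R"
proof (induction N)
 case 0
 show ?case using norm_L_le[OF e] R by simp
next
 case (Suc N)
 let ?a = "%k. norm (coef e k)"
 have "?a (Suc k) <= b * (\<Sum>i\<le>k. ?a i * ?a (k - i))" for k
  unfolding coef.simps sum_distrib_left by (rule sum_norm_le) (use b in "simp add: mult.assoc")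
 then have "(\<Sum>k\<le>N. ?a (Suc k)) <= b * (\<Sum>k\<le>N. \<Sum>i\<le>k. ?a i * ?a (k - i))"
  unfolding sum_distrib_left[of b] by (intro sum_mono)
 also have "... <= b * (R * R)"
 proof (intro mult_left_mono)
  have "(\<Sum>k\<le>N. ?a k) * (\<Sum>k\<le>N. ?a k) <= R * R" using Suc R by (intro mult_mono) (auto intro: sum_nonneg)
  then show "(\<Sum>k\<le>N. \<Sum>i\<le>k. ?a i * ?a (k - i)) <= R * R" using sum_triangle_le_square[of ?a N] by simp
 qed (use b in simp)
 also have "... = R / 8" using R by (simp add: mult.assoc[symmetric])
 finally have "(\<Sum>k\<le>N. ?a (Suc k)) <= R / 8" .
 moreover have "(\<Sum>k\<le>Suc N. ?a k) = ?a 0 + (\<Sum>k\<le>N. ?a (Suc k))" by (rule sum.atMost_Suc_shift)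
 ultimately show ?case using norm_L_le[OF e] R by simp
qed

lemma coef_sums: assumes e: "norm e < r" shows "coef e sums sol e"
proof -
 let ?a = "%k. norm (coef e k)"
 have sa: "summable ?a"
  by (rule bounded_imp_summable[of _ R]) (use coef_sum_le[OF e] in auto)
 define X where "X = suminf (coef e)"
 have X: "coef e sums X" unfolding X_def by (rule summable_sums[OF summable_norm_cancel[OF sa]])
 define S where "S N = (\<Sum>k\<le>N. coef e k)" for N
 have S: "S \<longlonglongrightarrow> X" unfolding S_def using X by (simp add: sums_def_le)
 define T where "T N = (\<Sum>k\<le>N. coef e (Suc k))" for N
 have "(%N. S (Suc N) - L e) \<longlonglongrightarrow> X - L e" by (intro tendsto_intros LIMSEQ_Suc S)
 then have T: "T \<longlonglongrightarrow> X - L e" by (simp add: T_def[abs_def] S_def sum.atMost_Suc_shift del: sum.atMost_Suc coef.simps(2))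
 \<comment> \<open>The gap between square and triangular partial sums of the norms. It tends to 0 by
   the Cauchy product and dominates the corresponding gap for \<open>B\<close>.\<close>
 define q where "q N = (\<Sum>k\<le>N. ?a k) * (\<Sum>k\<le>N. ?a k) - (\<Sum>k\<le>N. \<Sum>i\<le>k. ?a i * ?a (k - i))" for N
 have "q \<longlonglongrightarrow> suminf ?a * suminf ?a - suminf ?a * suminf ?a"
  unfolding q_def using summable_sums[OF sa] Cauchy_product_sums[of ?a ?a] sa by (intro tendsto_intros) (auto simp: sums_def_le)
 then have q: "q \<longlonglongrightarrow> 0" by simp
 have "norm (B (S N) (S N) - T N) <= b * q N" for N
 proof -
  let ?I = "{..N} \<times> {..N}" and ?J = "{(i,j). i + j <= N}"
  have J: "?J \<subseteq> ?I" "finite ?I" by auto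
  have "T N = (\<Sum>(i,j)\<in>?J. B (coef e i) (coef e j))" by (simp add: T_def sum.triangle_reindex_eq)
  moreover have "B (S N) (S N) = (\<Sum>(i,j)\<in>?I. B (coef e i) (coef e j))"
   unfolding S_def by (subst B.sum_left) (simp only: B.sum_right sum.cartesian_product)
  ultimately have 1: "B (S N) (S N) - T N = (\<Sum>(i,j)\<in>?I - ?J. B (coef e i) (coef e j))" using sum_diff[OF J(2,1)] by metis
  have "q N = (\<Sum>(i,j)\<in>?I - ?J. ?a i * ?a j)"
   unfolding q_def using sum_diff[OF J(2,1), of "%(i,j). ?a i * ?a j"]
   by (simp add: sum.triangle_reindex_eq[of "%i j. ?a i * ?a j", symmetric] sum_product sum.cartesian_product)
  then show ?thesis unfolding 1 using b(1)
   by (auto simp: sum_distrib_left mult.assoc intro!: sum_norm_le)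
 qed
 then have "(%N. B (S N) (S N) - T N) \<longlonglongrightarrow> 0"
  by (rule Lim_null_comparison[OF always_eventually[OF allI]]) (use tendsto_mult_right_zero[OF q, of b] in simp)
 moreover have "(%N. B (S N) (S N) - T N) \<longlonglongrightarrow> B X X - (X - L e)" by (intro tendsto_diff B.tendsto S T)
 ultimately have "B X X - (X - L e) = 0" using LIMSEQ_unique by blast
 then have 1: "X = L e + B X X" by (simp add: algebra_simps)
 have "norm (S N) <= R" for N unfolding S_def using norm_sum[of "coef e" "{..N}"] coef_sum_le[OF e, of N] by linarith
 then have 2: "norm X <= R" using Lim_bounded[OF tendsto_norm[OF S], of 0] by simp
 show ?thesis using sol_unique[OF 2 1 sol[OF e]] X by simp
qed

text \<open>The solution is analytic along rays.\<close>

lemma functional_zero: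
 fixes ph :: "'x => real"
 assumes e: "norm e < r" and ph: "bounded_linear ph" and s: "0 < s" and z: "!!t. \<bar>t\<bar> < s ==> ph (sol (t *R e)) = 0"
 shows "ph (sol e) = 0"
proof -
 define s' where "s' = min s 1"
 have sums: "(%k. ph (coef (t *R e) k)) sums ph (sol (t *R e))" if "\<bar>t\<bar> <= 1" for t
 proof -
  have "norm (t *R e) < r" using e that mult_left_le_one_le[of "norm e" "\<bar>t\<bar>"] by simp
  from bounded_linear.sums[OF ph coef_sums[OF this]] show ?thesis .
 qed
 have "ph (coef e k) = 0" for k
 proof (rule power_series_zero[of s'])
  show "0 < s'" using s by (simp add: s'_def)
  fix t :: real assume t0: "t ~= 0" and t: "\<bar>t\<bar> < s'"
  from sums[of t] z[of t] t have "(%k. t ^ Suc k * ph (coef e k)) sums 0"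
   by (simp add: s'_def coef_scaleR linear_cmul[OF bounded_linear.linear[OF ph]] del: power_Suc)
  from sums_mult[OF this, of "1 / t"] t0 show "(%k. ph (coef e k) * t ^ k) sums 0" by (simp add: mult.commute)
 qed
 with sums[of 1] have "(%k. 0) sums ph (sol e)" by simp
 then show ?thesis by (rule sums_unique2) (rule sums_zero)
qed

end

section \<open>Operators between weighted Sobolev spaces\<close>

lemma bounded_linear_vec_lambda:
 fixes f :: "'i::finite => 'a::real_normed_vector => 'b::real_normed_vector"
 assumes "!!i. bounded_linear (f i)" shows "bounded_linear (%x. \<chi> i. f i x)"
proof -
 obtain K where K: "!!i x. norm (f i x) <= norm x * K i" using bounded_linear.bounded[OF assms] by metis
 show ?thesis
 proof (rule bounded_linear_intro)
  fix x
  have "norm (\<chi> i. f i x) <= (\<Sum>i\<in>UNIV. norm (f i x))" unfolding norm_vec_def using L2_set_le_sum[of UNIV "%i. norm (f i x)"] by simp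
  also have "... <= (\<Sum>i\<in>UNIV. norm x * K i)" by (intro sum_mono K)
  finally show "norm (\<chi> i. f i x) <= norm x * (\<Sum>i\<in>UNIV. K i)" by (simp add: sum_distrib_left)
 qed (simp_all add: vec_eq_iff linear_add[OF bounded_linear.linear[OF assms]] linear_cmul[OF bounded_linear.linear[OF assms]])
qed

lemma bounded_linear_axis: "bounded_linear (axis i :: 'a::real_normed_vector => 'a^'i::finite)"
proof -
 have "bounded_linear (%x::'a. if j = i then x else 0)" for j by (cases "j = i") (simp_all add: bounded_linear_ident)
 from bounded_linear_vec_lambda[OF this] show ?thesis by (simp add: axis_def[abs_def])
qed

lemma bounded_bilinear_linear:
 assumes "bounded_linear T" "bounded_bilinear B" shows "bounded_bilinear (%x y. T (B x y))"
proof -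
 interpret T: bounded_linear T by fact
 interpret B: bounded_bilinear B by fact
 obtain K L where K: "0 < K" "!!x. norm (T x) <= norm x * K" and L: "0 < L" "!!x y. norm (B x y) <= norm x * norm y * L"
  using T.pos_bounded B.pos_bounded by blast
 have "norm (T (B x y)) <= norm x * norm y * (L * K)" for x y
  using order_trans[OF K(2) mult_right_mono[OF L(2)]] K(1) by (simp add: mult.assoc)
 then show ?thesis
  by unfold_locales (auto simp: B.add_left B.add_right B.scaleR_left B.scaleR_right T.add T.scaleR)
qed

lemma bounded_bilinear_plus:
 assumes "bounded_bilinear A" "bounded_bilinear B" shows "bounded_bilinear (%x y. A x y + B x y)"
proof -
 interpret A: bounded_bilinear A by fact
 interpret B: bounded_bilinear B by fact
 obtain K L where K: "!!x y. norm (A x y) <= norm x * norm y * K" and L: "!!x y. norm (B x y) <= norm x * norm y * L"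
  using A.bounded B.bounded by blast
 have "norm (A x y + B x y) <= norm x * norm y * (K + L)" for x y
  using norm_triangle_mono[OF K L] by (simp add: distrib_left)
 then show ?thesis
  by unfold_locales (auto simp: A.add_left A.add_right B.add_left B.add_right A.scaleR_left A.scaleR_right B.scaleR_left B.scaleR_right scaleR_add_right)
qed

lemma bounded_bilinear_zero: "bounded_bilinear (%x y. 0)"
 by unfold_locales (auto intro: exI[of _ 0])

lemma bounded_bilinear_sum: "(!!i. bounded_bilinear (f i)) ==> bounded_bilinear (%x y. \<Sum>i\<in>I. f i x y)"
 by (induction I rule: infinite_finite_induct) (simp_all add: bounded_bilinear_zero bounded_bilinear_plus)

lemma bounded_bilinear_vec_lambda:
 assumes "!!i. bounded_bilinear (f i)" shows "bounded_bilinear (%x y. \<chi> i. f i x y)"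
proof -
 have "(%x y. \<chi> i. f i x y) = (%x y. \<Sum>i\<in>UNIV. axis i (f i x y))"
  by (intro ext) (simp add: vec_eq_iff axis_def if_distrib cong: if_cong)
 then show ?thesis using bounded_bilinear_sum[OF bounded_bilinear_linear[OF bounded_linear_axis assms]] by simp
qed

lemma bounded_bilinear_Pair:
 assumes "bounded_bilinear A" "bounded_bilinear B" shows "bounded_bilinear (%x y. (A x y, B x y))"
proof -
 have "bounded_linear (%z. (z, 0))" "bounded_linear (%z. (0, z))" by (intro bounded_linear_Pair bounded_linear_ident bounded_linear_zero)+
 from bounded_bilinear_plus[OF bounded_bilinear_linear[OF this(1) assms(1)] bounded_bilinear_linear[OF this(2) assms(2)]]
 show ?thesis by simp
qed

lemma bounded_bilinear_minus: "bounded_bilinear B ==> bounded_bilinear (%x y. - B x y)"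
 by (rule bounded_bilinear_linear[OF bounded_linear_minus[OF bounded_linear_ident]])

lemma bounded_bilinear_diff: "bounded_bilinear A ==> bounded_bilinear B ==> bounded_bilinear (%x y. A x y - B x y)"
 using bounded_bilinear_plus[OF _ bounded_bilinear_minus, of A B] by simp

lemma lift_operator:
 fixes Op :: "(real^'n::finite => real) => real^'n => real"
 assumes sg: "sg > real CARD('n) / 2" and tu: "tu > real CARD('n) / 2"
  and bound: "!!u K. wsob sg t u K ==> wsob tu t' (Op u) (C * K)"
  and add: "!!u v K L. wsob sg t u K ==> wsob sg t v L ==> Op (%x. u x + v x) = (%x. Op u x + Op v x)"
  and cmult: "!!u K r. wsob sg t u K ==> Op (%x. r * u x) = (%x. r * Op u x)"
 shows "\<exists>T :: 'n l2 => 'n l2. bounded_linear T & (\<forall>F. fld tu t' (T F) = Op (fld sg t F))"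
proof -
 have fa: "fld sg t (F + G :: 'n l2) = (%x. fld sg t F x + fld sg t G x)" for F G by (rule ext) (rule fld_add[OF sg])
 have fs: "fld sg t (r *R F :: 'n l2) = (%x. r * fld sg t F x)" for F r by (rule ext) (rule fld_scaleR)
 have "\<exists>T :: 'n l2 => 'n l2. bounded_linear T & (\<forall>F. norm (T F) <= C * norm F & fld tu t' (T F) = Op (fld sg t F))"
 proof (rule lift_relation)
  fix F :: "'n l2"
  show "\<exists>G :: 'n l2. norm G <= C * norm F & fld tu t' G = Op (fld sg t F)"
   using wsob_fld_ex[OF bound[OF wsob_fld[OF sg]]] by metis
 next
  fix F G F' G' :: "'n l2"
  assume "fld tu t' G = Op (fld sg t F)" "fld tu t' G' = Op (fld sg t F')"
  then show "fld tu t' (G + G') = Op (fld sg t (F + F'))"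
   unfolding fa add[OF wsob_fld[OF sg] wsob_fld[OF sg]] by (simp add: fun_eq_iff fld_add[OF tu])
 next
  fix F G :: "'n l2" and r
  assume "fld tu t' G = Op (fld sg t F)"
  then show "fld tu t' (r *R G) = Op (fld sg t (r *R F))"
   unfolding fs cmult[OF wsob_fld[OF sg]] by (simp add: fun_eq_iff fld_scaleR)
 next
  fix F G G' :: "'n l2"
  assume "fld tu t' G = Op (fld sg t F)" "fld tu t' G' = Op (fld sg t F)"
  then show "G = G'" by (intro fld_inject[OF tu, of t']) simp
 qed
 then show ?thesis by blast
qed

text \<open>Operators on parameters are chosen by their effect on fields, which determines them by
  \<open>fld_inject\<close>. The side conditions stay in the lemmas, so the operators can be named
  before any order or weight is fixed.\<close>

definition incl :: "real => real => real => real => 'n::finite l2 => 'n l2" where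
 "incl sg t tu t' = (SOME T. bounded_linear T & (\<forall>F. fld tu t' (T F) = fld sg t F))"

lemma incl:
 assumes tu: "tu > real CARD('n::finite) / 2" and "tu <= sg" "0 <= t" "t' = t \<or> t' = 0"
 shows "bounded_linear (incl sg t tu t' :: 'n l2 => 'n l2)" and "fld tu t' (incl sg t tu t' (F :: 'n l2)) = fld sg t F"
proof -
 obtain A where A: "!!(u :: real^'n => real) K. wsob sg t u K ==> sob 1 sg u (A * K)" using wsob_unweighted[OF assms(3), of sg] by blast
 have "\<exists>C. \<forall>(u :: real^'n => real) K. wsob sg t u K --> wsob tu t' u (C * K)"
 proof (cases "t' = t")
  case True
  then show ?thesis by (intro exI[of _ 1]) (auto intro: wsob_order_mono assms(2))
 next
  case False
  then show ?thesis using assms(4) A by (intro exI[of _ A]) (auto intro: sob_order_mono assms(2))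
 qed
 then obtain C where C: "!!(u :: real^'n => real) K. wsob sg t u K ==> wsob tu t' u (C * K)" by blast
 have "\<exists>T :: 'n l2 => 'n l2. bounded_linear T & (\<forall>F. fld tu t' (T F) = (%u. u) (fld sg t F))"
  by (rule lift_operator[OF _ tu C]) (use assms in auto)
 from someI_ex[OF this] show "bounded_linear (incl sg t tu t' :: 'n l2 => 'n l2)" "fld tu t' (incl sg t tu t' F) = fld sg t F"
  unfolding incl_def by auto
qed

definition der :: "real => real => real => 'n::finite => 'n l2 => 'n l2" where
 "der sg tu t i = (SOME T. bounded_linear T & (\<forall>F. fld tu t (T F) = pd i (fld sg t F)))"

lemma der:
 assumes tu: "tu > real CARD('n::finite) / 2" and sg: "sg = tu + 1"
 shows "bounded_linear (der sg tu t i :: 'n l2 => 'n l2)" and "fld tu t (der sg tu t i F) = pd i (fld sg t (F :: 'n l2))"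
proof -
 obtain A where A: "!!(u :: real^'n => real) K. wsob (tu + 1) t u K ==> wsob tu t (pd i u) (A * K)" using wsob_deriv(2)[OF tu] by blast
 have "\<exists>T :: 'n l2 => 'n l2. bounded_linear T & (\<forall>F. fld tu t (T F) = pd i (fld sg t F))"
  unfolding sg by (rule lift_operator[OF _ tu A]) (use tu wsob_pderivative_add[OF tu] wsob_pderivative_cmult[OF tu] in auto)
 from someI_ex[OF this] show "bounded_linear (der sg tu t i :: 'n l2 => 'n l2)" "fld tu t (der sg tu t i F) = pd i (fld sg t F)"
  unfolding der_def by auto
qed

definition mul :: "real => real => 'n::finite l2 => 'n l2 => 'n l2" where
 "mul sg t = (SOME M. bounded_bilinear M & (\<forall>F G x. fld sg t (M F G) x = fld sg t F x * fld sg t G x))"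

lemma mul:
 assumes sg: "sg > real CARD('n::finite) / 2" and t: "0 <= t"
 shows "bounded_bilinear (mul sg t :: 'n l2 => 'n l2 => 'n l2)" and "fld sg t (mul sg t F G) x = fld sg t (F :: 'n l2) x * fld sg t G x"
proof -
 obtain A where A: "0 <= A" "!!(u :: real^'n => real) v K L. wsob sg t u K ==> wsob sg t v L ==> wsob sg t (%x. u x * v x) (A * K * L)"
  using wsob_product[OF sg t] by blast
 have "\<exists>H. norm H <= A * norm F * norm G & (%x. fld sg t F x * fld sg t G x) = fld sg t H" for F G :: "'n l2"
  by (rule wsob_fld_ex[OF A(2)[OF wsob_fld[OF sg] wsob_fld[OF sg]]])
 then obtain M where M: "!!F G :: 'n l2. norm (M F G :: 'n l2) <= A * norm F * norm G" "!!F G x. fld sg t (M F G) x = fld sg t F x * fld sg t G x"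
  by metis
 have "bounded_bilinear M"
 proof
  fix F F' G G' :: "'n l2" and r :: real
  show "M (F + F') G = M F G + M F' G" "M F (G + G') = M F G + M F G'" "M (r *R F) G = r *R M F G" "M F (r *R G) = r *R M F G"
   by (rule fld_inject[OF sg, of t]; simp add: M fld_add[OF sg] fld_scaleR algebra_simps)+
  show "\<exists>K. \<forall>F G. norm (M F G) <= norm F * norm G * K" using M(1) by (intro exI[of _ A]) (simp add: mult_ac)
 qed
 then have "\<exists>M :: 'n l2 => 'n l2 => 'n l2. bounded_bilinear M & (\<forall>F G x. fld sg t (M F G) x = fld sg t F x * fld sg t G x)" using M(2) by blast
 from someI_ex[OF this] show "bounded_bilinear (mul sg t :: 'n l2 => 'n l2 => 'n l2)" "fld sg t (mul sg t F G) x = fld sg t F x * fld sg t G x"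
  unfolding mul_def by auto
qed

text \<open>The equivalence serves both directions: it solves the equation and recognizes a given
  solution as a value of the operator.\<close>

definition res :: "real => real => real => real => 'n::finite l2 => 'n l2" where
 "res sg tu t \<mu> = (SOME T. bounded_linear T & (\<forall>F G. G = T F \<longleftrightarrow> (\<forall>x. \<mu> * fld sg t G x - lap (fld sg t G) x = fld tu t F x)))"

lemma res:
 assumes tu: "tu > real CARD('n::finite) / 2" and sg: "sg = tu + 2" and t: "0 <= t" and \<mu>: "0 < \<mu>"
 shows "bounded_linear (res sg tu t \<mu> :: 'n l2 => 'n l2)"
  and "G = res sg tu t \<mu> F \<longleftrightarrow> (\<forall>x. \<mu> * fld sg t G x - lap (fld sg t (G :: 'n l2)) x = fld tu t F x)"
proof -
 have sg2: "sg > real CARD('n) / 2" using tu sg by simp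
 have w: "wsob (tu + 2) t (fld sg t (F :: 'n l2)) (norm F)" for F using wsob_fld[OF sg2, of t F] sg by simp
 obtain A where A: "0 <= A" "!!(f :: real^'n => real) K. wsob tu t f K ==> \<exists>u. wsob (tu + 2) t u (A * K) & (\<forall>x. \<mu> * u x - lap u x = f x)"
  using wsob_resolvent[OF tu \<mu>, of t] by blast
 let ?P = "%f u. \<forall>x. \<mu> * u x - lap u x = f x"
 have fa: "fld sg t (F + G :: 'n l2) = (%x. fld sg t F x + fld sg t G x)" for F G by (rule ext) (rule fld_add[OF sg2])
 have fs: "fld sg t (r *R F :: 'n l2) = (%x. r * fld sg t F x)" for F r by (rule ext) (rule fld_scaleR)
 have uniq: "G = G'" if "?P (fld tu t F) (fld sg t G)" "?P (fld tu t F) (fld sg t G')" for F G G' :: "'n l2"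
  by (rule fld_inject[OF sg2, of t], rule wsob_resolvent_unique[OF tu t \<mu> w w]) (use that in auto)
 have "\<exists>T :: 'n l2 => 'n l2. bounded_linear T & (\<forall>F. norm (T F) <= A * norm F & ?P (fld tu t F) (fld sg t (T F)))"
 proof (rule lift_relation)
  fix F :: "'n l2"
  obtain u where u: "wsob (tu + 2) t u (A * norm F)" "?P (fld tu t F) u" using A(2)[OF wsob_fld[OF tu]] by blast
  from wsob_fld_ex[OF u(1)] u(2) show "\<exists>G :: 'n l2. norm G <= A * norm F & ?P (fld tu t F) (fld sg t G)" using sg by auto
 next
  fix F G F' G' :: "'n l2"
  assume "?P (fld tu t F) (fld sg t G)" "?P (fld tu t F') (fld sg t G')"
  then show "?P (fld tu t (F + F')) (fld sg t (G + G'))"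
   unfolding fa lap_add[OF tu w w] fld_add[OF tu] by (simp add: algebra_simps)
 next
  fix F G :: "'n l2" and r
  assume "?P (fld tu t F) (fld sg t G)"
  then show "?P (fld tu t (r *R F)) (fld sg t (r *R G))"
   unfolding fs lap_cmult[OF tu w] fld_scaleR by (metis mult.left_commute right_diff_distrib)
 qed (rule uniq)
 then obtain T :: "'n l2 => 'n l2" where T: "bounded_linear T" "!!F. ?P (fld tu t F) (fld sg t (T F))" by blast
 have "G = T F \<longleftrightarrow> ?P (fld tu t F) (fld sg t G)" for F G using T(2) uniq by blast
 with T(1) have "\<exists>T :: 'n l2 => 'n l2. bounded_linear T & (\<forall>F G. G = T F \<longleftrightarrow> ?P (fld tu t F) (fld sg t G))" by blast
 from someI_ex[OF this] show "bounded_linear (res sg tu t \<mu> :: 'n l2 => 'n l2)" "G = res sg tu t \<mu> F \<longleftrightarrow> ?P (fld tu t F) (fld sg t G)"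
  unfolding res_def by auto
qed

section \<open>The gauged Einstein system\<close>

text \<open>With \<open>c = \<kappa> / (1 + n\<kappa>)\<close>, \<open>Ein(\<delta> + h) = \<Lambda>\<delta> + e\<close> amounts to \<open>Ric + \<Lambda>h + c tr(p) (\<delta> + h) = e\<close>, where
 \<open>\<delta> + k\<close> is the inverse metric and \<open>p = (\<delta> + k)(\<Lambda>\<delta> + e) - \<Lambda>\<delta>\<close>. The system below adds the Lie derivative along
 the one-form \<open>w\<close>, which makes the equation elliptic. The field \<open>w\<close> is what the Bianchi identity applied to
 \<open>p\<close> requires to vanish. All equations are quadratic in the unknowns.\<close>

definition lower_christoffel :: "('n::finite => 'n => real^'n => real) => 'n => 'n => 'n => real^'n => real" where
 "lower_christoffel h m j k x = (1/2) * (pd j (h k m) x + pd k (h j m) x - pd m (h j k) x)"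

definition ricci_of :: "('n::finite => 'n => 'n => real^'n => real) => 'n => 'n => real^'n => real" where
 "ricci_of y j k x = (\<Sum>l\<in>UNIV. pd l (y l j k) x - pd k (y l j l) x
   + (\<Sum>p\<in>UNIV. y p j k x * y l p l x - y p j l x * y l p k x))"

definition gauge_system where
 "gauge_system c \<Lambda> a h k p e y w \<longleftrightarrow>
   (\<forall>i j x. h i j x = h j i x) &
   (\<forall>i j x. k i j x = - h i j x - (\<Sum>l\<in>UNIV. h i l x * k l j x)) &
   (\<forall>i j x. p i j x = \<Lambda> * k i j x + e i j x + (\<Sum>l\<in>UNIV. k i l x * e l j x)) &
   (\<forall>l i j x. y l i j x = lower_christoffel h l i j x + (\<Sum>m\<in>UNIV. k l m x * lower_christoffel h m i j x)) &
   (\<forall>m x. w m x = (\<Sum>i\<in>UNIV. pd i (p i m) x) - a * pd m (%x. \<Sum>i\<in>UNIV. p i i x) x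
    + (\<Sum>i\<in>UNIV. \<Sum>q\<in>UNIV. y i i q x * p q m x - y q i m x * p i q x)) &
   (\<forall>i j x. (1/2) * (ricci_of y i j x + ricci_of y j i x) + \<Lambda> * h i j x
    + ((if i = j then c * (\<Sum>l\<in>UNIV. p l l x) else 0) + c * (\<Sum>l\<in>UNIV. p l l x) * h i j x)
    - e i j x + 1 / (2 * \<Lambda>) * (pd i (w j) x + pd j (w i) x) = (0 :: real))"

section \<open>The linear solution operator and the quadratic terms of the gauged system\<close>

type_synonym 'n tensor2 = "'n l2^'n^'n"
type_synonym 'n tensor3 = "'n l2^'n^'n^'n"
text \<open>In order \<open>h\<close>, \<open>k\<close>, \<open>p\<close>, \<open>e\<close>,
  \<open>y\<close>, \<open>w\<close>. The source is repeated among the unknowns so that the product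
  of \<open>k\<close> and \<open>e\<close> is quadratic in them.\<close>

type_synonym 'n unknowns = "'n tensor2 \<times> 'n tensor2 \<times> 'n tensor2 \<times> 'n tensor2 \<times> 'n tensor3 \<times> ('n l2^'n)"
text \<open>The source \<open>e\<close>, followed by the values of the quadratic terms in the
  equations for \<open>k\<close>, \<open>p\<close>, \<open>y\<close>, \<open>w\<close> and in the
  main equation.\<close>

type_synonym 'n sources = "'n tensor2 \<times> 'n tensor2 \<times> 'n tensor2 \<times> 'n tensor3 \<times> ('n l2^'n) \<times> 'n tensor2"

lemma bounded_linear_if: "bounded_linear f ==> bounded_linear (%x. if P then f x else 0)"
 by (cases P) simp_all

lemma scaleR_halves:
 fixes x y :: "'a::real_vector"
 shows "(1/4) *R x + (1/4) *R x = (1/2) *R x" "(1/4) *R x + ((1/4) *R x + y) = (1/2) *R x + y"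
  "(r/2) *R x + (r/2) *R x = r *R x" "(r/2) *R x + ((r/2) *R x + y) = r *R x + y"
 by (simp_all add: scaleR_add_left[symmetric] add.assoc[symmetric])

lemma fld_eq_iff: "sg > real CARD('n::finite) / 2 ==> F = G \<longleftrightarrow> (\<forall>x. fld sg t F x = fld sg t (G :: 'n l2) x)"
 using fld_inject by blast

locale einstein =
 fixes ty :: "'n::finite itself" and n s t \<kappa> \<Lambda> :: real
 assumes n: "n = real CARD('n)" and n2: "CARD('n) >= 2" and s: "s > real CARD('n) / 2" and t: "0 <= t"
  and \<kappa>: "\<kappa> > - 1 / (2 * (real CARD('n) - 1))" and \<Lambda>: "\<Lambda> > 0"
begin

text \<open>Tracing \<open>Ein\<close> with the inverse metric gives (1 + n \<kappa>) R(g) = tr p,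
  so \<kappa> R(g) = c tr p. The coefficient \<open>a\<close> adds the 1/2 of the contracted Bianchi
  identity to the contribution c (1 - n/2) of the term c tr p. The numbers \<open>\<beta>\<close>
  and \<open>\<mu>\<close> are read off from the trace of \<open>Pop\<close>.\<close>

definition "c = \<kappa> / (1 + n * \<kappa>)"
definition "b = c * (1 - n / 2)"
definition "a = 1/2 + b"
definition "\<beta> = 1/2 - b"
definition "\<mu> = \<Lambda> * (1 - n * c) / \<beta>"

text \<open>The bound on \<kappa> says 1 + 2 (n - 1) \<kappa> > 0, and \<open>\<beta>\<close> is
  this number divided by 2 (1 + n \<kappa>).\<close>

lemma constants: "0 < 1 + n * \<kappa>" "0 < \<beta>" "0 < \<mu>" "\<beta> * \<mu> = \<Lambda> * (1 - n * c)" "\<kappa> = c * (1 + n * \<kappa>)"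
proof -
 have n2: "n >= 2" using n2 n by simp
 then have k: "- 1 < 2 * (n - 1) * \<kappa>" using \<kappa> n by (simp add: field_simps)
 show 1: "0 < 1 + n * \<kappa>"
 \<comment> \<open>For negative \<kappa> the inequality n \<le> 2 (n - 1) turns the bound on
   \<kappa> into positivity of 1 + n \<kappa>.\<close>
 proof (cases "0 <= \<kappa>")
  case False
  then have "(n - 2) * \<kappa> <= 0" using n2 by (simp add: mult_nonneg_nonpos)
  then have "2 * (n - 1) * \<kappa> <= n * \<kappa>" by (simp add: algebra_simps)
  then show ?thesis using k by linarith
 qed (use n2 in "simp add: add_pos_nonneg")
 have "\<beta> = (1 + 2 * (n - 1) * \<kappa>) / (2 * (1 + n * \<kappa>))" using 1 by (simp add: \<beta>_def b_def c_def field_simps)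
 then show 2: "0 < \<beta>" using k 1 by simp
 have "1 - n * c = 1 / (1 + n * \<kappa>)" using 1 by (simp add: c_def field_simps)
 then show "0 < \<mu>" using 1 2 \<Lambda> by (simp add: \<mu>_def)
 show "\<beta> * \<mu> = \<Lambda> * (1 - n * c)" using 2 by (simp add: \<mu>_def)
 show "\<kappa> = c * (1 + n * \<kappa>)" using 1 by (simp add: c_def)
qed

lemma orders: "s > real CARD('n) / 2" "s + 1 > real CARD('n) / 2" "s + 2 > real CARD('n) / 2" using s n by auto

text \<open>The unknowns \<open>h\<close>, \<open>k\<close>, \<open>p\<close>, \<open>e\<close> live
  in order s + 2, \<open>y\<close> and \<open>w\<close> in order s + 1, and the main equation in
  order s. The operators that follow act on or between these three levels.\<close>

abbreviation J2 :: "'n l2 => 'n l2" where "J2 == incl (s + 2) t (s + 1) t"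
abbreviation J1 :: "'n l2 => 'n l2" where "J1 == incl (s + 1) t s t"
abbreviation J0 :: "'n l2 => 'n l2" where "J0 == incl (s + 2) t s t"
abbreviation D1 :: "'n => 'n l2 => 'n l2" where "D1 == der (s + 2) (s + 1) t"
abbreviation D0 :: "'n => 'n l2 => 'n l2" where "D0 == der (s + 1) s t"
abbreviation M2 :: "'n l2 => 'n l2 => 'n l2" where "M2 == mul (s + 2) t"
abbreviation M1 :: "'n l2 => 'n l2 => 'n l2" where "M1 == mul (s + 1) t"
abbreviation M0 :: "'n l2 => 'n l2 => 'n l2" where "M0 == mul s t"
abbreviation R :: "real => 'n l2 => 'n l2" where "R == res (s + 2) s t"
abbreviation f2 :: "'n l2 => real^'n => real" where "f2 == fld (s + 2) t"
abbreviation f1 :: "'n l2 => real^'n => real" where "f1 == fld (s + 1) t"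
abbreviation f0 :: "'n l2 => real^'n => real" where "f0 == fld s t"

lemma op_bl: "bounded_linear J2" "bounded_linear J1" "bounded_linear J0" "bounded_linear (D1 i)" "bounded_linear (D0 i)"
 using orders t by (auto intro!: incl(1) der(1))

lemma R_bl: "0 < m ==> bounded_linear (R m)"
 using orders t by (auto intro!: res(1))

lemma M_bb: "bounded_bilinear M2" "bounded_bilinear M1" "bounded_bilinear M0"
 using orders t by (auto intro!: mul(1))

lemma fld_op: "f1 (J2 F) = f2 F" "f0 (J1 F) = f1 F" "f0 (J0 F) = f2 F" "f1 (D1 i F) = pd i (f2 F)" "f0 (D0 i F) = pd i (f1 F)"
 "f2 (M2 F G) = (%x. f2 F x * f2 G x)" "f1 (M1 F G) = (%x. f1 F x * f1 G x)" "f0 (M0 F G) = (%x. f0 F x * f0 G x)"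
 using orders t by (auto simp: incl(2) der(2) mul(2))

lemma fld_bl: "bounded_linear (%F. f2 F x)" "bounded_linear (%F. f1 F x)" "bounded_linear (%F. f0 F x)"
 using orders by (auto intro!: fld_linear)

lemmas linears = op_bl[THEN bounded_linear.linear] fld_bl[THEN bounded_linear.linear]

lemmas op_lin = linears[THEN linear_add] linears[THEN linear_diff] linears[THEN linear_cmul] linears[THEN linear_sum] linears[THEN linear_neg] linears[THEN linear_0]

lemmas fld_lin = fld_bl[THEN bounded_linear.linear, THEN linear_add, THEN ext] fld_bl[THEN bounded_linear.linear, THEN linear_diff, THEN ext]
 fld_bl[THEN bounded_linear.linear, THEN linear_cmul, THEN ext] fld_bl[THEN bounded_linear.linear, THEN linear_sum, THEN ext] fld_bl[THEN bounded_linear.linear, THEN linear_neg, THEN ext]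
 fld_bl[THEN bounded_linear.linear, THEN linear_0, THEN ext]

lemma D_commute: "D0 i (D1 j F) = D0 j (D1 i F)"
proof -
 obtain A where "!!(u :: real^'n => real) K. wsob (s + 2) t u K ==> sob 1 (s + 2) u (A * K)" using wsob_unweighted[OF t, of "s + 2"] by blast
 from sob_second_deriv_commute[OF orders(1) this[OF wsob_fld[OF orders(3)]]] show ?thesis
  by (simp add: fld_eq_iff[OF orders(1), of _ _ t] fld_op)
qed

definition Lp :: "'n l2 => 'n l2" where "Lp F = (\<Sum>i\<in>UNIV. D0 i (D1 i F))"

lemma Lp_bl: "bounded_linear Lp"
 unfolding Lp_def[abs_def] by (intro bounded_linear_sum bounded_linear_compose[OF op_bl(5)] op_bl)

lemmas Lp_lin = Lp_bl[THEN bounded_linear.linear, THEN linear_add] Lp_bl[THEN bounded_linear.linear, THEN linear_sum] Lp_bl[THEN bounded_linear.linear, THEN linear_cmul]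

lemma R_eq: assumes "0 < m" shows "G = R m F \<longleftrightarrow> m *R J0 G - Lp G = F"
 using res(2)[OF orders(1) refl t assms, of G F]
 by (simp add: fld_eq_iff[OF orders(1), of _ _ t] op_lin fld_op Lp_def lap_def)

abbreviation tr :: "'n tensor2 => 'n l2" where "tr H == \<Sum>i\<in>UNIV. H $ i $ i"

text \<open>The part of the main equation linear in \<open>h\<close> once the linear parts of
  \<open>y\<close>, \<open>p\<close> and \<open>w\<close> are inserted. The divergences in the
  linearized Ricci tensor cancel against those in \<open>w\<close>; of the Hessian of the trace the
  multiple \<open>b = a - 1/2\<close> survives.\<close>

definition Pop :: "'n tensor2 => 'n tensor2" where
 "Pop H = (\<chi> j k. (-1/2) *R Lp (H $ j $ k) + b *R D0 j (D1 k (tr H)) + \<Lambda> *R J0 (H $ j $ k) - (if j = k then (c * \<Lambda>) *R J0 (tr H) else 0))"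

definition pinv_trace :: "'n tensor2 => 'n l2" where "pinv_trace F = R \<mu> ((1 / \<beta>) *R tr F)"

definition pinv :: "'n tensor2 => 'n tensor2" where
 "pinv F = (\<chi> j k. R (2 * \<Lambda>) (2 *R (F $ j $ k - b *R D0 j (D1 k (pinv_trace F)) + (if j = k then (c * \<Lambda>) *R J0 (pinv_trace F) else 0))))"

text \<open>The trace of \<open>Pop H = F\<close> is a scalar equation for \<open>tr H\<close>; once it is solved, the components decouple.\<close>

lemma pinv_eq: "H = pinv F \<longleftrightarrow> Pop H = F"
proof -
 have L2: "0 < 2 * \<Lambda>" using \<Lambda> by simp
 \<comment> \<open>With the trace terms \<open>d\<close> and \<open>e\<close> known, each component
   solves a resolvent equation of its own.\<close>
 have comp: "G = R (2 * \<Lambda>) (2 *R (f - b *R d + e)) \<longleftrightarrow> (-1/2) *R Lp G + b *R d + \<Lambda> *R J0 G - e = f" for G f d e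
 proof -
  have "(2 * \<Lambda>) *R J0 G - Lp G - 2 *R (f - b *R d + e) = 2 *R ((-1/2) *R Lp G + b *R d + \<Lambda> *R J0 G - e - f)"
   by (simp add: scaleR_add_right scaleR_diff_right algebra_simps)
  then show ?thesis unfolding R_eq[OF L2] by (metis (no_types, lifting) eq_iff_diff_eq_0 scaleR_eq_0_iff zero_neq_numeral)
 qed
 have trace: "T = R \<mu> ((1 / \<beta>) *R f) \<longleftrightarrow> (-1/2) *R Lp T + b *R Lp T + \<Lambda> *R J0 T - (n * (c * \<Lambda>)) *R J0 T = f" for T f
 proof -
  have "\<beta> *R (\<mu> *R J0 T - Lp T - (1 / \<beta>) *R f) = (\<Lambda> * (1 - n * c)) *R J0 T - \<beta> *R Lp T - f"
   using constants(2,4) by (simp add: scaleR_diff_right)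
  also have "... = (-1/2) *R Lp T + b *R Lp T + \<Lambda> *R J0 T - (n * (c * \<Lambda>)) *R J0 T - f"
   by (simp add: \<beta>_def algebra_simps)
  finally show ?thesis unfolding R_eq[OF constants(3)] using constants(2) by (metis (no_types, lifting) eq_iff_diff_eq_0 less_irrefl scaleR_eq_0_iff)
 qed
 have sumd: "(\<Sum>i\<in>UNIV. (-1/2) *R Lp (H $ i $ i) + b *R D0 i (D1 i T) + \<Lambda> *R J0 (H $ i $ i) - (c * \<Lambda>) *R J0 T)
   = (-1/2) *R Lp (tr H) + b *R Lp T + \<Lambda> *R J0 (tr H) - (n * (c * \<Lambda>)) *R J0 T" for T
  by (simp add: sum.distrib sum_subtractf Lp_lin op_lin scaleR_sum_right[symmetric] Lp_def[of T] sum_constant_scaleR n)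
 \<comment> \<open>Summing the components shows that \<open>tr H\<close> solves an equation with
   \<open>pinv_trace F\<close> in the trace terms; \<open>pinv_trace F\<close> solves the same
   equation, and the resolvent for \<open>2 * \<Lambda>\<close> is unique.\<close>
 have "tr H = pinv_trace F" if H: "H = pinv F"
 proof -
  let ?u = "pinv_trace F"
  have "(-1/2) *R Lp (H $ i $ i) + b *R D0 i (D1 i ?u) + \<Lambda> *R J0 (H $ i $ i) - (c * \<Lambda>) *R J0 ?u = F $ i $ i" for i
   using comp[of "H $ i $ i" "F $ i $ i" "D0 i (D1 i ?u)" "(c * \<Lambda>) *R J0 ?u"] H by (simp add: pinv_def)
  then have 1: "(-1/2) *R Lp (tr H) + b *R Lp ?u + \<Lambda> *R J0 (tr H) - (n * (c * \<Lambda>)) *R J0 ?u = tr F"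
   using sumd[of ?u] by simp
  have "(-1/2) *R Lp ?u + b *R Lp ?u + \<Lambda> *R J0 ?u - (n * (c * \<Lambda>)) *R J0 ?u = tr F"
   using trace[of ?u "tr F"] by (simp add: pinv_trace_def)
  with 1 comp[of "tr H" "tr F" "Lp ?u" "(n * (c * \<Lambda>)) *R J0 ?u"] comp[of ?u "tr F" "Lp ?u" "(n * (c * \<Lambda>)) *R J0 ?u"]
  show ?thesis by simp
 qed
 moreover have "tr H = pinv_trace F" if H: "Pop H = F"
 proof -
  have "tr F = (-1/2) *R Lp (tr H) + b *R Lp (tr H) + \<Lambda> *R J0 (tr H) - (n * (c * \<Lambda>)) *R J0 (tr H)"
   using sumd[of "tr H"] H by (auto simp: Pop_def)
  then show ?thesis unfolding pinv_trace_def using trace[of "tr H" "tr F"] by simp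
 qed
 moreover have "H = pinv F \<longleftrightarrow> Pop H = F" if u: "tr H = pinv_trace F"
  unfolding vec_eq_iff pinv_def Pop_def u by (simp only: vec_lambda_beta comp)
 ultimately show ?thesis by blast
qed

lemma R_compose: "0 < m ==> bounded_linear f ==> bounded_linear (%x. R m (f x))"
 by (rule bounded_linear_compose[OF R_bl])

lemmas bl_intros = bounded_linear_vec_lambda bounded_linear_add bounded_linear_sub bounded_linear_minus bounded_linear_sum bounded_linear_if bounded_linear_ident
 bounded_linear_compose[OF op_bl(1)] bounded_linear_compose[OF op_bl(2)] bounded_linear_compose[OF op_bl(3)] bounded_linear_compose[OF op_bl(4)] bounded_linear_compose[OF op_bl(5)]
 bounded_linear_compose[OF Lp_bl] bounded_linear_compose[OF bounded_linear_vec_nth] bounded_linear_compose[OF bounded_linear_fst] bounded_linear_compose[OF bounded_linear_snd]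
 bounded_linear_compose[OF bounded_linear_scaleR_right] bounded_linear_Pair

lemma pinv_bl: "bounded_linear pinv"
proof -
 have "bounded_linear (%F. R \<mu> ((1 / \<beta>) *R tr F))" by (intro bl_intros R_compose constants)
 note u = bounded_linear_compose[OF this[folded pinv_trace_def]]
 show ?thesis unfolding pinv_def[abs_def] by (intro bl_intros R_compose u) (use \<Lambda> in simp)
qed

definition Gam :: "'n tensor2 => 'n tensor3" where
 "Gam H = (\<chi> m j k. (1/2) *R (D1 j (H $ k $ m) + D1 k (H $ j $ m) - D1 m (H $ j $ k)))"

definition dvg :: "'n tensor2 => 'n l2^'n" where
 "dvg H = (\<chi> m. (\<Sum>i\<in>UNIV. D1 i (H $ i $ m)) - a *R D1 m (tr H))"

definition lin_ric :: "'n tensor3 => 'n tensor2" where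
 "lin_ric Y = (\<chi> j k. \<Sum>l\<in>UNIV. D0 l (Y $ l $ j $ k) - D0 k (Y $ l $ j $ l))"

text \<open>The inhomogeneity in the equation for \<open>h\<close>. Its symmetrization forces the
  solution of the linear equation to be symmetric, by uniqueness.\<close>

definition main_part :: "'n tensor2 => 'n tensor2 => 'n tensor3 => 'n tensor2 => 'n l2^'n => 'n tensor2" where
 "main_part E P Y Qm W = (\<chi> j k. (1/2) *R ((lin_ric Y $ j $ k + Qm $ j $ k - J0 (E $ j $ k) + (1 / \<Lambda>) *R D0 j (W $ k))
   + (lin_ric Y $ k $ j + Qm $ k $ j - J0 (E $ k $ j) + (1 / \<Lambda>) *R D0 k (W $ j))) + (if j = k then c *R J0 (tr P) else 0))"

text \<open>What remains of p = \<Lambda> k + e + Qp after k = - h + Qk is inserted and the term -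
  \<Lambda> h is set aside.\<close>

definition p0 :: "'n sources => 'n tensor2" where
 "p0 = (%(E, Qk, Qp, Qy, Qw, Qm). E + \<Lambda> *R Qk + Qp)"

definition solve_h :: "'n sources => 'n tensor2" where
 "solve_h z = (case z of (E, Qk, Qp, Qy, Qw, Qm) => - pinv (main_part E (p0 z) Qy Qm (dvg (p0 z) + Qw)))"

text \<open>Solves the linear system with prescribed quadratic terms: \<open>h\<close> comes from
  \<open>pinv\<close>, the other unknowns by substitution. Feeding in \<open>quadratic x x\<close>
  gives the fixed point equation.\<close>

definition reconstruct :: "'n sources => 'n unknowns" where
 "reconstruct z = (case z of (E, Qk, Qp, Qy, Qw, Qm) => (solve_h z, - solve_h z + Qk, - \<Lambda> *R solve_h z + p0 z, E,
   Gam (solve_h z) + Qy, dvg (- \<Lambda> *R solve_h z + p0 z) + Qw))"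

definition quadratic :: "'n unknowns => 'n unknowns => 'n tensor2 \<times> 'n tensor2 \<times> 'n tensor3 \<times> ('n l2^'n) \<times> 'n tensor2" where
 "quadratic x x' = (case x of (H, K, P, E, Y, W) => case x' of (H', K', P', E', Y', W') =>
  (\<chi> i j. - (\<Sum>l\<in>UNIV. M2 (H $ i $ l) (K' $ l $ j)),
   \<chi> i j. \<Sum>l\<in>UNIV. M2 (K $ i $ l) (E' $ l $ j),
   \<chi> l j k. \<Sum>m\<in>UNIV. M1 (J2 (K $ l $ m)) (Gam H' $ m $ j $ k),
   \<chi> m. \<Sum>i\<in>UNIV. \<Sum>q\<in>UNIV. M1 (Y $ i $ i $ q) (J2 (P' $ q $ m)) - M1 (Y $ q $ i $ m) (J2 (P' $ i $ q)),
   \<chi> j k. (\<Sum>l\<in>UNIV. \<Sum>q\<in>UNIV. M0 (J1 (Y $ q $ j $ k)) (J1 (Y' $ l $ q $ l)) - M0 (J1 (Y $ q $ j $ l)) (J1 (Y' $ l $ q $ k)))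
    + c *R M0 (J0 (tr P)) (J0 (H' $ j $ k))))"

lemma Gam_bl: "bounded_linear Gam" unfolding Gam_def[abs_def] by (intro bl_intros)
lemma dvg_bl: "bounded_linear dvg" unfolding dvg_def[abs_def] by (intro bl_intros)
lemma lin_ric_bl: "bounded_linear lin_ric" unfolding lin_ric_def[abs_def] by (intro bl_intros)

lemmas bl_intros' = bl_intros bounded_linear_compose[OF Gam_bl] bounded_linear_compose[OF dvg_bl] bounded_linear_compose[OF lin_ric_bl] bounded_linear_compose[OF pinv_bl]

lemma p0_bl: "bounded_linear p0"
 unfolding p0_def case_prod_beta by (intro bl_intros')

lemma solve_h_bl: "bounded_linear solve_h"
 unfolding solve_h_def[abs_def] main_part_def case_prod_beta by (intro bl_intros' bounded_linear_compose[OF p0_bl])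

lemma reconstruct_bl: "bounded_linear reconstruct"
 unfolding reconstruct_def[abs_def] case_prod_beta by (intro bl_intros' bounded_linear_compose[OF p0_bl] bounded_linear_compose[OF solve_h_bl] p0_bl solve_h_bl)

lemma quadratic_bb: "bounded_bilinear quadratic"
 unfolding quadratic_def[abs_def] case_prod_beta
 by (intro bounded_bilinear_Pair bounded_bilinear_vec_lambda bounded_bilinear_sum bounded_bilinear_minus bounded_bilinear_diff bounded_bilinear_plus
   bounded_bilinear_linear[OF bounded_linear_scaleR_right] bounded_bilinear.comp[OF M_bb(1)] bounded_bilinear.comp[OF M_bb(2)] bounded_bilinear.comp[OF M_bb(3)] bl_intros')

definition "L e = reconstruct (e, 0)"
definition "B x y = reconstruct (0, quadratic x y)"

lemma L_bl: "bounded_linear L"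
 unfolding L_def[abs_def] by (intro bounded_linear_compose[OF reconstruct_bl] bl_intros bounded_linear_zero)

lemma B_bb: "bounded_bilinear B"
 unfolding B_def[abs_def]
 by (intro bounded_bilinear_linear[OF reconstruct_bl] bounded_bilinear_Pair quadratic_bb bounded_bilinear_zero)

lemma fixpoint_reconstruct: "L e + B x x = reconstruct (e, quadratic x x)"
 unfolding L_def B_def linear_add[OF bounded_linear.linear[OF reconstruct_bl], symmetric] by simp

definition "B_bound = (SOME C. 0 < C & (\<forall>x y. norm (B x y) <= norm x * norm y * C))"

lemma B_bound: "0 < B_bound" "norm (B x y) <= B_bound * norm x * norm y"
proof -
 have *: "0 < B_bound & (\<forall>x y. norm (B x y) <= norm x * norm y * B_bound)"
  unfolding B_bound_def by (rule someI_ex[OF bounded_bilinear.pos_bounded[OF B_bb]])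
 from * show "0 < B_bound" by (rule conjunct1)
 show "norm (B x y) <= B_bound * norm x * norm y" using *[THEN conjunct2, THEN spec, THEN spec, of x y] by (simp only: mult.commute mult.left_commute)
qed

sublocale q: quad L B "onorm L" B_bound
 by (rule quad.intro) (rule L_bl B_bb B_bound onorm[OF L_bl] onorm_pos_le[OF L_bl])+

abbreviation symmetric2 :: "'n tensor2 => bool" where "symmetric2 H == \<forall>i j. H $ i $ j = H $ j $ i"

text \<open>Commuting derivatives writes the linearized Ricci tensor as divergence terms minus half
  the Laplacian and half the Hessian of the trace. Expressing the divergences by \<open>dvg\<close>
  changes the coefficient of that Hessian from -1/2 to a - 1/2 = b.\<close>

lemma Pop_main: assumes H: "symmetric2 H"
 shows "Pop H = (\<chi> j k. (1/2) *R (lin_ric (Gam H) $ j $ k + lin_ric (Gam H) $ k $ j) + \<Lambda> *R J0 (H $ j $ k)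
   - (1/2) *R (D0 j (dvg H $ k) + D0 k (dvg H $ j)) - (if j = k then (c * \<Lambda>) *R J0 (tr H) else 0))"
proof -
 have 1: "lin_ric (Gam H) $ j $ k = (1/2) *R (\<Sum>l\<in>UNIV. D0 j (D1 l (H $ l $ k)) + D0 k (D1 l (H $ l $ j))) - (1/2) *R Lp (H $ j $ k) - (1/2) *R D0 j (D1 k (tr H))" for j k
 proof -
  have "D0 l (Gam H $ l $ j $ k) - D0 k (Gam H $ l $ j $ l) = (1/2) *R (D0 j (D1 l (H $ l $ k)) + D0 k (D1 l (H $ l $ j))) - (1/2) *R D0 l (D1 l (H $ j $ k)) - (1/2) *R D0 j (D1 k (H $ l $ l))" for l
   using H D_commute[of l j "H $ k $ l"] D_commute[of l k "H $ j $ l"] D_commute[of k j "H $ l $ l"]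
   by (simp add: Gam_def op_lin scaleR_diff_right scaleR_add_right)
  then have "lin_ric (Gam H) $ j $ k = (\<Sum>l\<in>UNIV. (1/2) *R (D0 j (D1 l (H $ l $ k)) + D0 k (D1 l (H $ l $ j))) - (1/2) *R D0 l (D1 l (H $ j $ k)) - (1/2) *R D0 j (D1 k (H $ l $ l)))"
   unfolding lin_ric_def by simp
  then show ?thesis by (simp add: Lp_def op_lin sum.distrib sum_subtractf scaleR_sum_right[symmetric] scaleR_add_right)
 qed
 have 2: "D0 j (dvg H $ k) = (\<Sum>l\<in>UNIV. D0 j (D1 l (H $ l $ k))) - a *R D0 j (D1 k (tr H))" for j k
  by (simp add: dvg_def op_lin)
 have "Pop H $ j $ k = (1/2) *R (lin_ric (Gam H) $ j $ k + lin_ric (Gam H) $ k $ j) + \<Lambda> *R J0 (H $ j $ k)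
   - (1/2) *R (D0 j (dvg H $ k) + D0 k (dvg H $ j)) - (if j = k then (c * \<Lambda>) *R J0 (tr H) else 0)" for j k
  unfolding Pop_def vec_lambda_beta 1 2 D_commute[of k j "tr H"] H[rule_format, of k j] sum.distrib a_def
  by (simp add: algebra_simps) (simp add: scaleR_halves add_ac)
 then show ?thesis by (simp add: vec_eq_iff)
qed

definition main_eq :: "'n tensor2 => 'n tensor2 => 'n tensor2 => 'n tensor3 => 'n tensor2 => 'n l2^'n => 'n tensor2" where
 "main_eq H E P Y Qm W = (\<chi> j k. (1/2) *R ((lin_ric Y $ j $ k + Qm $ j $ k) + (lin_ric Y $ k $ j + Qm $ k $ j)) + \<Lambda> *R J0 (H $ j $ k)
   + (if j = k then c *R J0 (tr P) else 0) - (1/2) *R (J0 (E $ j $ k) + J0 (E $ k $ j)) + (1 / (2 * \<Lambda>)) *R (D0 j (W $ k) + D0 k (W $ j)))"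

text \<open>The parts of \<open>p\<close>, \<open>y\<close> and \<open>w\<close> linear in
  \<open>h\<close> are - \<Lambda> h, \<open>Gam H\<close> and - \<Lambda> times
  \<open>dvg H\<close>. Removing them leaves the arguments of \<open>main_part\<close>, and together
  they contribute \<open>Pop H\<close>.\<close>

lemma main_identity:
 assumes "symmetric2 H"
 shows "Pop H + main_part E (P + \<Lambda> *R H) (Y - Gam H) Qm (dvg (P + \<Lambda> *R H) + (W - dvg P)) = main_eq H E P Y Qm W"
proof -
 note lin = linear_add[OF bounded_linear.linear[OF dvg_bl]] linear_diff[OF bounded_linear.linear[OF lin_ric_bl]] linear_cmul[OF bounded_linear.linear[OF dvg_bl]]
 have *: "dvg (P + \<Lambda> *R H) + (W - dvg P) = W + \<Lambda> *R dvg H" by (simp add: lin)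
 have h: "(1 / \<Lambda>) *R x = (1 / (\<Lambda> * 2)) *R x + (1 / (\<Lambda> * 2)) *R x" for x :: "'n l2"
  by (simp add: scaleR_add_left[symmetric])
 show ?thesis
  unfolding Pop_main[OF assms] main_part_def main_eq_def * vec_eq_iff
  using \<Lambda> by (simp add: op_lin lin sum.distrib scaleR_sum_right[symmetric]) (auto simp: algebra_simps intro: h)
qed

lemma reconstruct_eq:
 "(H, K, P, E', Y, W) = reconstruct (E, Qk, Qp, Qy, Qw, Qm) \<longleftrightarrow> symmetric2 H & E' = E & K = - H + Qk & P = \<Lambda> *R K + E + Qp &
   Y = Gam H + Qy & W = dvg P + Qw & main_eq H E P Y Qm W = 0"
proof -
 let ?z = "(E, Qk, Qp, Qy, Qw, Qm)"
 let ?M = "main_part E (p0 ?z) Qy Qm (dvg (p0 ?z) + Qw)"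
 have "(H, K, P, E', Y, W) = reconstruct ?z \<longleftrightarrow> H = solve_h ?z & E' = E & K = - H + Qk & P = - \<Lambda> *R H + p0 ?z & Y = Gam H + Qy & W = dvg P + Qw"
  unfolding reconstruct_def by auto
 moreover have "P = - \<Lambda> *R H + p0 ?z \<longleftrightarrow> P = \<Lambda> *R K + E + Qp" if "K = - H + Qk"
  unfolding that by (simp add: p0_def algebra_simps)
 moreover have "H = solve_h ?z \<longleftrightarrow> symmetric2 H & main_eq H E P Y Qm W = 0" if P: "P = - \<Lambda> *R H + p0 ?z" and Y: "Y = Gam H + Qy" and W: "W = dvg P + Qw"
 proof -
  have "H = solve_h ?z \<longleftrightarrow> Pop H = - ?M"
   unfolding pinv_eq[symmetric] solve_h_def by (simp add: linear_neg[OF bounded_linear.linear[OF pinv_bl]])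
  \<comment> \<open>\<open>Pop\<close> commutes with transposition and the right-hand side is
    symmetric, so the transpose of \<open>H\<close> is also a solution and uniqueness
    applies.\<close>
  moreover have "symmetric2 H" if e: "Pop H = - ?M"
  proof -
   have "Pop (\<chi> i j. H $ j $ i) $ j $ k = Pop H $ k $ j" for j k
    using D_commute[of k j "tr H"] by (simp add: Pop_def)
   also have "Pop H $ k $ j = Pop H $ j $ k" for j k
    unfolding e main_part_def by (simp add: add.commute)
   finally have "Pop (\<chi> i j. H $ j $ i) = - ?M" unfolding e[symmetric] by (simp add: vec_eq_iff)
   with e have "(\<chi> i j. H $ j $ i) = H" unfolding pinv_eq[symmetric] by simp
   then have "(\<chi> i j. H $ j $ i) $ i $ j = H $ i $ j" for i j by simp
   then show ?thesis by simp
  qed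
  moreover have "Pop H + ?M = main_eq H E P Y Qm W" if "symmetric2 H"
   using main_identity[OF that, of E P Y Qm W] P Y W by simp
  ultimately show ?thesis by (metis eq_neg_iff_add_eq_0)
 qed
 ultimately show ?thesis by metis
qed

abbreviation "fields2 H == (%i j. f2 (H $ i $ j))"
abbreviation "fields3 Y == (%l i j. f1 (Y $ l $ i $ j))"
abbreviation "fields1 W == (%m. f1 (W $ m))"

lemma f1_Gam: "f1 (Gam H $ m $ i $ j) = lower_christoffel (fields2 H) m i j"
 by (rule ext) (simp add: Gam_def lower_christoffel_def fld_lin fld_op)

text \<open>The abstract equation becomes a system for the fields alone, in which order and weight
  no longer occur. This is what makes solutions in different spaces comparable.\<close>

lemma fixpoint_iff:
 assumes E: "symmetric2 E"
 shows "(H, K, P, E', Y, W) = L E + B (H, K, P, E', Y, W) (H, K, P, E', Y, W) \<longleftrightarrow>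
   E' = E & gauge_system c \<Lambda> a (fields2 H) (fields2 K) (fields2 P) (fields2 E') (fields3 Y) (fields1 W)"
proof -
 let ?x = "(H, K, P, E', Y, W)"
 obtain Qk Qp Qy Qw Qm where Q: "quadratic ?x ?x = (Qk, Qp, Qy, Qw, Qm)" by (metis prod_cases5)
 note Qd = Q[symmetric, unfolded quadratic_def prod.case prod.inject]
 have sym: "symmetric2 H \<longleftrightarrow> (\<forall>i j x. fields2 H i j x = fields2 H j i x)"
  by (simp add: fld_eq_iff[OF orders(3), of _ _ t])
 have K': "f2 ((- H + Qk) $ i $ j) x = - fields2 H i j x - (\<Sum>l\<in>UNIV. fields2 H i l x * fields2 K l j x)" for i j x
  by (simp add: Qd fld_lin fld_op)
 have K: "K = - H + Qk \<longleftrightarrow> (\<forall>i j x. fields2 K i j x = - fields2 H i j x - (\<Sum>l\<in>UNIV. fields2 H i l x * fields2 K l j x))"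
  by (simp only: vec_eq_iff fld_eq_iff[OF orders(3), of _ _ t] K')
 have P: "P = \<Lambda> *R K + E + Qp \<longleftrightarrow> (\<forall>i j x. fields2 P i j x = \<Lambda> * fields2 K i j x + fields2 E i j x + (\<Sum>l\<in>UNIV. fields2 K i l x * fields2 E' l j x))"
  by (simp add: vec_eq_iff fld_eq_iff[OF orders(3), of _ _ t] Qd fld_lin fld_op)
 have Y: "Y = Gam H + Qy \<longleftrightarrow> (\<forall>l i j x. fields3 Y l i j x = lower_christoffel (fields2 H) l i j x + (\<Sum>m\<in>UNIV. fields2 K l m x * lower_christoffel (fields2 H) m i j x))"
  by (simp add: vec_eq_iff fld_eq_iff[OF orders(2), of _ _ t] Qd fld_lin fld_op f1_Gam)
 have W: "W = dvg P + Qw \<longleftrightarrow> (\<forall>m x. fields1 W m x = (\<Sum>i\<in>UNIV. pd i (fields2 P i m) x) - a * pd m (%x. \<Sum>i\<in>UNIV. fields2 P i i x) x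
    + (\<Sum>i\<in>UNIV. \<Sum>q\<in>UNIV. fields3 Y i i q x * fields2 P q m x - fields3 Y q i m x * fields2 P i q x))"
  by (simp add: vec_eq_iff fld_eq_iff[OF orders(2), of _ _ t] Qd fld_lin fld_op dvg_def)
 have ric: "f0 (lin_ric Y $ i $ j + Qm $ i $ j) x = ricci_of (fields3 Y) i j x + c * (\<Sum>l\<in>UNIV. fields2 P l l x) * fields2 H i j x" for i j x
  by (simp add: lin_ric_def Qd ricci_of_def fld_lin fld_op sum.distrib sum_subtractf)
 have M: "main_eq H E P Y Qm W = 0 \<longleftrightarrow> (\<forall>i j x. (1/2) * (ricci_of (fields3 Y) i j x + ricci_of (fields3 Y) j i x) + \<Lambda> * fields2 H i j x
    + ((if i = j then c * (\<Sum>l\<in>UNIV. fields2 P l l x) else 0) + c * (\<Sum>l\<in>UNIV. fields2 P l l x) * fields2 H i j x)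
    - fields2 E i j x + 1 / (2 * \<Lambda>) * (pd i (fields1 W j) x + pd j (fields1 W i) x) = 0)"
  if "symmetric2 H"
 proof -
  have e: "f0 (main_eq H E P Y Qm W $ i $ j) x = (1/2) * (f0 (lin_ric Y $ i $ j + Qm $ i $ j) x + f0 (lin_ric Y $ j $ i + Qm $ j $ i) x) + \<Lambda> * fields2 H i j x
    + (if i = j then c * (\<Sum>l\<in>UNIV. fields2 P l l x) else 0) - fields2 E i j x + 1 / (2 * \<Lambda>) * (pd i (fields1 W j) x + pd j (fields1 W i) x)" for i j x
   using E[rule_format, of j i] by (simp add: main_eq_def fld_lin fld_op)
  have "f0 (main_eq H E P Y Qm W $ i $ j) x = (1/2) * (ricci_of (fields3 Y) i j x + ricci_of (fields3 Y) j i x) + \<Lambda> * fields2 H i j x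
    + ((if i = j then c * (\<Sum>l\<in>UNIV. fields2 P l l x) else 0) + c * (\<Sum>l\<in>UNIV. fields2 P l l x) * fields2 H i j x)
    - fields2 E i j x + 1 / (2 * \<Lambda>) * (pd i (fields1 W j) x + pd j (fields1 W i) x)" for i j x
  proof -
   have "fields2 H j i x = fields2 H i j x" using that by simp
   then show ?thesis unfolding e ric by (simp add: algebra_simps)
  qed
  then show ?thesis by (simp only: vec_eq_iff zero_index fld_eq_iff[OF orders(1), of _ _ t] fld_lin)
 qed
 have conj: "(S ==> A = B) ==> (S & True & c1 & c2 & c3 & c4 & A) = (True & S & c1 & c2 & c3 & c4 & B)" for S A B c1 c2 c3 c4 by blast
 show ?thesis
 proof (cases "E' = E")
  case False then show ?thesis unfolding fixpoint_reconstruct Q reconstruct_eq by simp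
 next
  case True
  show ?thesis
   unfolding fixpoint_reconstruct Q reconstruct_eq gauge_system_def sym K P Y W unfolding True refl[of E, THEN eqTrueI]
   by (rule conj, rule M, unfold sym)
 qed
qed

end

section \<open>Geometry of solutions of the gauged system\<close>

lemma pderivative_mat_component:
 "pd j (%x. (mat 1 + M x :: real^'n^'n) $ i $ k) x = pd j (%x. M x $ i $ k) x" if "(%x. M x $ i $ k) differentiable (at x)"
 using pderivative_add[where f = "%_. (mat 1 :: real^'n^'n) $ i $ k", OF differentiable_const that, of j] by (simp add: pderivative_const)

text \<open>Assumes only the regularity available at order s + 2: two derivatives of
  \<open>h\<close> and one of the other unknowns. The further derivative for the Bianchi identity is
  added in \<open>gauge_solution_twice\<close>.\<close>

locale gauge_solution =
 fixes c \<Lambda> a :: real and h k p e :: "'n::finite => 'n => real^'n => real" and y :: "'n => 'n => 'n => real^'n => real" and w :: "'n => real^'n => real"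
 assumes sys: "gauge_system c \<Lambda> a h k p e y w" and e_sym: "e i j x = e j i x" and \<Lambda>: "0 < \<Lambda>"
  and dh: "h i j differentiable (at x)" and dk: "k i j differentiable (at x)" and dp: "p i j differentiable (at x)"
  and dy: "y l i j differentiable (at x)" and dw: "w i differentiable (at x)" 
  and dh2: "pd l (h i j) differentiable (at x)" 
  and h_comm: "pd i (pd j (h l m)) x = pd j (pd i (h l m)) x"
begin

lemma h_sym: "h i j x = h j i x"
 and k_eq: "k i j x = - h i j x - (\<Sum>l\<in>UNIV. h i l x * k l j x)"
 and p_eq: "p i j x = \<Lambda> * k i j x + e i j x + (\<Sum>l\<in>UNIV. k i l x * e l j x)"
 and y_eq: "y l i j x = lower_christoffel h l i j x + (\<Sum>m\<in>UNIV. k l m x * lower_christoffel h m i j x)"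
 and w_eq: "w m x = (\<Sum>i\<in>UNIV. pd i (p i m) x) - a * pd m (%x. \<Sum>i\<in>UNIV. p i i x) x
    + (\<Sum>i\<in>UNIV. \<Sum>q\<in>UNIV. y i i q x * p q m x - y q i m x * p i q x)"
 and main: "(1/2) * (ricci_of y i j x + ricci_of y j i x) + \<Lambda> * h i j x
    + ((if i = j then c * (\<Sum>l\<in>UNIV. p l l x) else 0) + c * (\<Sum>l\<in>UNIV. p l l x) * h i j x)
    - e i j x + 1 / (2 * \<Lambda>) * (pd i (w j) x + pd j (w i) x) = 0"
 using sys unfolding gauge_system_def by blast+

definition h_mat :: "real^'n => real^'n^'n" where "h_mat x = (\<chi> i j. h i j x)"
definition k_mat :: "real^'n => real^'n^'n" where "k_mat x = (\<chi> i j. k i j x)"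
definition g where "g x = mat 1 + h_mat x"
definition G where "G x = mat 1 + k_mat x"
definition A :: "'n => real^'n => real^'n^'n" where "A i x = (\<chi> l j. y l i j x)"

lemma h_sym_fun: "h i j = h j i" using h_sym by blast

lemma lower_christoffel_sym: "lower_christoffel h m i j x = lower_christoffel h m j i x"
 using h_sym_fun[of i j] by (simp add: lower_christoffel_def)

lemma y_sym: "y l i j x = y l j i x" unfolding y_eq by (simp add: lower_christoffel_sym[of _ i j])

lemma mat_mul: "(\<Sum>l\<in>UNIV. (mat 1 :: real^'n^'n) $ i $ l * f l) = f i"
 by (simp add: mat_def if_distrib[of "%z. z * _"] cong: if_cong)

text \<open>The quadratic equation for \<open>k\<close> expands (1 + h)(1 + k) = 1.\<close>

lemma gG: "g x ** G x = mat 1"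
proof -
 have "k_mat x = - h_mat x - h_mat x ** k_mat x" by (simp add: vec_eq_iff h_mat_def k_mat_def matrix_matrix_mult_def) (intro allI k_eq)
 then have "k_mat x + h_mat x ** k_mat x = - h_mat x" unfolding eq_diff_eq[symmetric] .
 then show ?thesis by (simp add: g_def G_def matrix_mul_simps)
qed

lemma Gg: "G x ** g x = mat 1" using gG matrix_left_right_inverse by metis

lemma G_y: "y l i j x = (\<Sum>m\<in>UNIV. G x $ l $ m * lower_christoffel h m i j x)"
 by (simp add: y_eq G_def k_mat_def distrib_right sum.distrib mat_mul)

lemma g_y: "(\<Sum>l\<in>UNIV. g x $ b $ l * y l i j x) = lower_christoffel h b i j x"
proof -
 have "(\<Sum>l\<in>UNIV. g x $ b $ l * y l i j x) = (\<Sum>m\<in>UNIV. (g x ** G x) $ b $ m * lower_christoffel h m i j x)"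
  by (simp add: G_y sum_distrib_left sum_distrib_right matrix_matrix_mult_def mult.assoc) (rule sum.swap)
 then show ?thesis by (simp add: gG mat_mul)
qed

lemma dg: "g differentiable (at x)" and dG: "G differentiable (at x)" and dA: "A i differentiable (at x)"
 unfolding g_def[abs_def] G_def[abs_def] A_def[abs_def] h_mat_def k_mat_def
 by (rule differentiable_matrixI; simp add: dh dk dy)+

lemma pderivative_g: "pd i g x = (\<chi> j l. pd i (h j l) x)"
 using pderivative_component(1)[OF dg[of x], of i] pderivative_mat_component[of h_mat _ _ x i] dh
 by (simp add: vec_eq_iff g_def[abs_def] h_mat_def)

sublocale levi_civita g G A
proof
 fix x i l j
 show "g differentiable (at x)" "G differentiable (at x)" "A i differentiable (at x)" by (rule dg dG dA)+
 show "g x ** G x = mat 1" by (rule gG)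
 show "transpose (g x) = g x" by (simp add: g_def h_mat_def transpose_def vec_eq_iff h_sym mat_def)
 show "A i x $ l $ j = A j x $ l $ i" by (simp add: A_def y_sym)
 have 1: "(g x ** A i x) $ b $ j = lower_christoffel h b i j x" for b j by (simp add: matrix_matrix_mult_def A_def g_y)
 have g_sym: "g x $ l $ b = g x $ b $ l" for l b by (simp add: g_def h_mat_def h_sym[of l b] mat_def)
 have 2: "(transpose (A i x) ** g x) $ b $ j = lower_christoffel h j i b x" for b j
  using g_y[of x j i b] by (simp add: matrix_matrix_mult_def A_def transpose_def mult.commute g_sym[of _ j])
 show "pd i g x = g x ** A i x + transpose (A i x) ** g x"
  unfolding pderivative_g vec_eq_iff
 proof (intro allI)
  fix b j
  show "(\<chi> j l. pd i (h j l) x) $ b $ j = (g x ** A i x + transpose (A i x) ** g x) $ b $ j"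
   unfolding vector_add_component 1 2 lower_christoffel_def using h_sym_fun[of b j] h_sym_fun[of i b] h_sym_fun[of i j] by (simp add: field_simps)
 qed
next
 fix x i j
 have "pd i (pd j g) x = (\<chi> b l. pd i (pd j (h b l)) x)" for i j
 proof -
  have "pd j g differentiable (at x)" unfolding pderivative_g[abs_def] by (rule differentiable_matrixI) (simp add: dh2)
  from pderivative_component(1)[OF this, of i] show ?thesis by (simp add: vec_eq_iff pderivative_g[abs_def])
 qed
 then show "pd i (pd j g) x = pd j (pd i g) x" by (simp add: h_comm)
qed

lemma ric_ricci_of: "ric x $ i $ j = ricci_of y i j x"
proof -
 have "F l j x $ l $ i = pd l (y l i j) x - pd j (y l i l) x + (\<Sum>q\<in>UNIV. y q i j x * y l q l x - y q i l x * y l q j x)" for l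
 proof -
  have "(%x. A j x $ l $ i) = y l i j" for j by (simp add: fun_eq_iff A_def y_sym)
  then have "pd m (A j) x $ l $ i = pd m (y l i j) x" for m j by (simp add: pderivative_component(1)[OF dA])
  then show ?thesis
   by (simp add: F_def matrix_matrix_mult_def A_def sum_subtractf y_sym[of _ l] y_sym[of _ j] mult.commute)
 qed
 then show ?thesis by (simp add: ric_def ricci_of_def)
qed

abbreviation T where "T == %x. \<Sum>l\<in>UNIV. p l l x"
abbreviation S where "S == %i j x. (1/2) * (pd i (w j) x + pd j (w i) x)"

lemma ric_eq: "ric x $ i $ j = e i j x - \<Lambda> * h i j x - c * T x * g x $ i $ j - 1 / \<Lambda> * S i j x"
 using main[of i j x] ric_sym[of x i j] by (cases "i = j") (simp_all add: ric_ricci_of g_def h_mat_def mat_def algebra_simps)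

text \<open>Since G h = - k, raising an index of e - \<Lambda> h gives exactly \<open>p\<close>;
  this is the reason for the definition of \<open>p\<close>.\<close>

lemma G_ric: "(G x ** ric x) $ i $ m = p i m x - (if i = m then c * T x else 0) - 1 / \<Lambda> * (\<Sum>l\<in>UNIV. G x $ i $ l * S l m x)"
proof -
 have "(\<Sum>l\<in>UNIV. G x $ i $ l * h l m x) = - k i m x"
 proof -
  have "(\<Sum>l\<in>UNIV. G x $ i $ l * h l m x) = (G x ** (g x - mat 1)) $ i $ m" by (simp add: matrix_matrix_mult_def g_def h_mat_def)
  also have "... = - k i m x" unfolding matrix_mul_simps Gg by (simp add: G_def k_mat_def)
  finally show ?thesis .
 qed
 moreover have "(\<Sum>l\<in>UNIV. G x $ i $ l * e l m x) = e i m x + (\<Sum>l\<in>UNIV. k i l x * e l m x)"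
  by (simp add: G_def k_mat_def distrib_right sum.distrib mat_mul)
 moreover have "(\<Sum>l\<in>UNIV. G x $ i $ l * g x $ l $ m) = (if i = m then 1 else 0)"
  using arg_cong[OF Gg[of x], of "%M. M $ i $ m"] by (simp add: matrix_matrix_mult_def mat_def)
 moreover have "(G x ** ric x) $ i $ m = (\<Sum>l\<in>UNIV. G x $ i $ l * e l m x) - \<Lambda> * (\<Sum>l\<in>UNIV. G x $ i $ l * h l m x)
   - c * T x * (\<Sum>l\<in>UNIV. G x $ i $ l * g x $ l $ m) - 1 / \<Lambda> * (\<Sum>l\<in>UNIV. G x $ i $ l * S l m x)"
  unfolding matrix_matrix_mult_def vec_lambda_beta ric_eq sum_distrib_left sum_subtractf[symmetric]
  by (rule sum.cong[OF refl]) (simp add: algebra_simps)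
 ultimately show ?thesis by (simp add: p_eq)
qed

text \<open>For \<open>w = 0\<close> the main equation reads Ric = e - \<Lambda> h - c T g. Its
  trace is the scalar curvature (1 - n c) T, and \<kappa> (1 - n c) = c restores the scalar
  curvature term of \<open>Ein\<close>.\<close>

lemma Ein_eq:
 assumes w0: "!!m. w m = (%x. 0)" and c: "\<kappa> = c * (1 + real CARD('n) * \<kappa>)"
 shows "Ein \<kappa> \<Lambda> (%x. flat_metric x + h_mat x) x = Ein \<kappa> \<Lambda> flat_metric x + (\<chi> i j. e i j x)"
proof -
 have gd: "(%x. flat_metric x + h_mat x) = g" by (simp add: fun_eq_iff flat_metric_def g_def)
 have inv: "matrix_inv (g x) = G x" for x
 proof -
  have "g x ** matrix_inv (g x) = mat 1" using someI_ex[of "%B. g x ** B = mat 1 & B ** g x = mat 1"] gG Gg unfolding matrix_inv_def by blast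
  then have "G x ** (g x ** matrix_inv (g x)) = G x" by simp
  then show ?thesis by (simp only: gg_cancel)
 qed
 have "pd j (%x. g x $ l $ m) x = pd j (h l m) x" for j l m x
  using pderivative_component(1)[OF dg[of x], of j l m] by (simp add: pderivative_g)
 then have "christoffel g l i j = y l i j" for l i j
  by (simp add: fun_eq_iff christoffel_def G_y lower_christoffel_def inv sum_distrib_left mult_ac)
 then have ric: "ricci g x = ric x" by (simp add: vec_eq_iff ricci_def ric_ricci_of ricci_of_def)
 have S0: "S i j x = 0" for i j by (simp add: w0 pderivative_const)
 have G_sym: "G x $ i $ j = G x $ j $ i" for i j using arg_cong[OF symG[of x], of "%M. M $ j $ i"] by (simp add: transpose_def)
 have "scalar_curvature g x = (\<Sum>j\<in>UNIV. (G x ** ric x) $ j $ j)"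
  unfolding scalar_curvature_def inv ric matrix_matrix_mult_def vec_lambda_beta
  by (intro sum.cong refl) (simp add: ric_sym)
 also have "... = (1 - real CARD('n) * c) * T x" by (simp only: G_ric S0) (simp add: sum_subtractf algebra_simps)
 finally have sc: "scalar_curvature g x = (1 - real CARD('n) * c) * T x" .
 have "\<kappa> * (1 - real CARD('n) * c) = c"
  using arg_cong[OF c, of "%z. z * (1 - real CARD('n) * c)"] c by (simp add: algebra_simps)
 then have "\<kappa> * ((1 - real CARD('n) * c) * T x) = c * T x" by (metis mult.assoc)
 then have "Ein \<kappa> \<Lambda> g x $ i $ j = e i j x + \<Lambda> * (mat 1 :: real^'n^'n) $ i $ j" for i j
  by (simp only: Ein_def ric sc vector_add_component vector_scaleR_component ric_eq S0) (simp add: g_def h_mat_def algebra_simps)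
 moreover have "Ein \<kappa> \<Lambda> flat_metric x = \<Lambda> *R mat 1"
 proof -
  have "christoffel flat_metric l i j = (%x. 0)" for l i j :: 'n by (simp add: fun_eq_iff christoffel_def flat_metric_def pderivative_const)
  then have "ricci flat_metric x = 0" by (simp add: ricci_def vec_eq_iff pderivative_const)
  then show ?thesis by (simp add: Ein_def scalar_curvature_def flat_metric_def)
 qed
 ultimately show ?thesis unfolding gd by (simp add: vec_eq_iff)
qed

end

locale gauge_solution_twice = gauge_solution c \<Lambda> a h k p e y w
 for c \<Lambda> a and h k p e :: "'n::finite => 'n => real^'n => real" and y w +
 assumes dy2: "pd i (y l j m) differentiable (at x)" and dw2: "pd i (w j) differentiable (at x)"
  and y_comm: "pd i (pd j (y l m q)) x = pd j (pd i (y l m q)) x"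
  and w_comm: "pd i (pd j (w l)) x = pd j (pd i (w l)) x"
  and a_eq: "a = 1/2 + c * (1 - real CARD('n) / 2)"
begin

lemma pderivative_A: "pd i (A j) x = (\<chi> l m. pd i (y l j m) x)"
 using pderivative_component(1)[OF dA[of j x], of i] by (simp add: vec_eq_iff A_def)

sublocale levi_civita_twice g G A
proof
 fix x i j
 show d: "pd i (A j) differentiable (at x)" for i j
  unfolding pderivative_A[abs_def] by (rule differentiable_matrixI) (simp add: dy2)
 fix m
 have "pd i (pd j (A m)) x = (\<chi> b l. pd i (pd j (y b m l)) x)" for i j
  using pderivative_component(1)[OF d[of j m], of i] by (simp add: vec_eq_iff pderivative_A)
 then show "pd i (pd j (A m)) x = pd j (pd i (A m)) x" by (simp add: y_comm)
qed

text \<open>Covariant divergence of a tensor with raised first index, minus half the differential of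
  its trace: the operator that kills the raised Ricci tensor by the contracted Bianchi
  identity.\<close>

definition dvg where
 "dvg f m x = (\<Sum>i\<in>UNIV. pd i (f i m) x) + (\<Sum>i\<in>UNIV. \<Sum>q\<in>UNIV. y i i q x * f q m x - y q i m x * f i q x) - (1/2) * pd m (%x. \<Sum>i\<in>UNIV. f i i x) x"

lemma dvg_add:
 assumes "!!i m. f i m differentiable (at x)" "!!i m. f' i m differentiable (at x)"
 shows "dvg (%i m x. f i m x + f' i m x) m x = dvg f m x + dvg f' m x"
 using assms by (simp add: dvg_def sum.distrib pderivative_add algebra_simps sum_subtractf)

lemma dvg_cmult:
 assumes "!!i m. f i m differentiable (at x)"
 shows "dvg (%i m x. r * f i m x) m x = r * dvg f m x"
 using assms by (simp add: dvg_def pderivative_cmult sum_distrib_left[symmetric] algebra_simps sum_subtractf)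

lemma dvg_trace:
 assumes "f differentiable (at x)"
 shows "dvg (%i m x. if i = m then f x else 0) m x = (1 - real CARD('n) / 2) * pd m f x"
proof -
 have "pd i (%x. if i = m then f x else 0) x = (if i = m then pd m f x else 0)" for i
  by (cases "i = m") (simp_all add: pderivative_const)
 moreover have "(\<Sum>q\<in>UNIV. y i i q x * (if q = m then f x else 0) - y q i m x * (if i = q then f x else 0)) = 0" for i
  by (simp add: sum_subtractf if_distrib[of "%z. _ * z"] cong: if_cong)
 moreover have "pd m (%x. f x * real CARD('n)) x = real CARD('n) * pd m f x"
  using pderivative_cmult[OF assms, of m "real CARD('n)"] by (simp add: mult.commute)
 ultimately show ?thesis by (simp add: dvg_def algebra_simps)
qed

lemma dvg_P: "dvg P m x = 0"
 using contracted_bianchi[of m x] by (simp add: dvg_def A_def sum.distrib)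

lemma dT: "T differentiable (at x)" by (simp add: dp)

lemma dS: "S i j differentiable (at x)" by (intro differentiable_mult differentiable_add dw2 differentiable_const)

text \<open>The correction when an index of \<open>S\<close> is raised by G = 1 + k instead of the
  flat metric.\<close>

definition V where "V i m x = (\<Sum>l\<in>UNIV. k i l x * S l m x)"

lemma dV: "V i m differentiable (at x)"
 unfolding V_def[abs_def] by (intro differentiable_sum finite ballI differentiable_mult dk dS)

lemma dvg_S: "dvg S m x = (1/2) * lap (w m) x + (\<Sum>i\<in>UNIV. \<Sum>q\<in>UNIV. y i i q x * S q m x - y q i m x * S i q x)"
proof -
 have S': "pd l (S i j) x = (1/2) * (pd l (pd i (w j)) x + pd l (pd j (w i)) x)" for i j l
  unfolding pderivative_cmult[OF differentiable_add[OF dw2 dw2]] pderivative_add[OF dw2 dw2] ..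
 have "pd m (%x. \<Sum>i\<in>UNIV. S i i x) x = (\<Sum>i\<in>UNIV. pd m (pd i (w i)) x)"
  by (subst pderivative_sum[OF dS]) (simp add: S')
 then show ?thesis unfolding dvg_def S' lap_def
  by (simp add: sum.distrib w_comm[of _ m] sum_divide_distrib[symmetric] add_divide_distrib)
qed

text \<open>\<open>dvg\<close> is applied to the raised main equation. The Ricci part vanishes,
  \<open>p\<close> and \<open>c * T\<close> combine to \<open>w\<close> by the choice of
  \<open>a\<close>, and the flat part of \<open>dvg S\<close> is half the Laplacian, because the
  gradient of the divergence cancels against the trace. Every other term contains \<open>k\<close>
  or \<open>y\<close> and is small.\<close>

lemma gauge_equation:
 "2 * \<Lambda> * w m x - lap (w m) x = 2 * (dvg V m x + (\<Sum>i\<in>UNIV. \<Sum>q\<in>UNIV. y i i q x * S q m x - y q i m x * S i q x))"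
proof -
 have "P i m x = p i m x + ((- c) * (if i = m then T x else 0) + (- (1 / \<Lambda>)) * (S i m x + V i m x))" for i m x
 proof -
  have "(\<Sum>l\<in>UNIV. G x $ i $ l * S l m x) = S i m x + V i m x"
   unfolding G_def k_mat_def V_def by (simp only: vector_add_component vec_lambda_beta distrib_right[of _ _ "S _ _ _"] sum.distrib mat_mul)
  then show ?thesis unfolding P_ric G_ric by simp
 qed
 then have P: "P = (%i m x. p i m x + ((- c) * (if i = m then T x else 0) + (- (1 / \<Lambda>)) * (S i m x + V i m x)))" by (intro ext)
 have d1: "(%x. if i = m then T x else 0) differentiable (at x)" for i m by (cases "i = m") (simp_all add: dT)
 have d2: "(%x. S i m x + V i m x) differentiable (at x)" for i m by (intro differentiable_add dS dV)
 have d3: "(%x. (- c) * (if i = m then T x else 0)) differentiable (at x)" "(%x. (- (1 / \<Lambda>)) * (S i m x + V i m x)) differentiable (at x)" for i m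
  by (intro differentiable_mult differentiable_const d1 d2)+
 have "dvg P m x = dvg p m x + ((- c) * ((1 - real CARD('n) / 2) * pd m T x) + (- (1 / \<Lambda>)) * (dvg S m x + dvg V m x))"
  unfolding P by (simp only: dvg_add[OF dp differentiable_add[OF d3]] dvg_add[OF d3] dvg_cmult[OF d1] dvg_cmult[OF d2] dvg_trace[OF dT] dvg_add[OF dS dV])
 then have "0 = dvg p m x + ((- c) * ((1 - real CARD('n) / 2) * pd m T x) + (- (1 / \<Lambda>)) * (dvg S m x + dvg V m x))" by (simp only: dvg_P)
 moreover have "dvg p m x = w m x + c * (1 - real CARD('n) / 2) * pd m T x"
  by (simp add: w_eq dvg_def a_eq algebra_simps)
 ultimately have "\<Lambda> * w m x = dvg S m x + dvg V m x" using \<Lambda> by (simp add: field_simps)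
 then show ?thesis unfolding dvg_S by (simp add: algebra_simps)
qed

end

section \<open>The gauge term vanishes\<close>

text \<open>Cutting off high frequencies changes \<open>F\<close> arbitrarily little, and on bounded
  frequencies one more power of the bracket is harmless, so the truncated field gains a
  derivative.\<close>

lemma band_limited_dense:
 fixes F :: "'n::finite l2"
 assumes ep: "0 < ep"
 shows "\<exists>F' F''. norm (F' - F) < ep & ev (sg + 1) F'' = ev sg F'"
proof -
 define X where "X N xi = (if norm xi <= real N then rp F xi else 0)" for N xi
 have X: "X N \<in> L2H" for N
  unfolding L2H_def
 proof (intro CollectI conjI allI)
  show [measurable]: "X N \<in> borel_measurable borel" unfolding X_def by measurable
  show "integrable lborel (%x. (norm (X N x))^2)"
   by (rule Bochner_Integration.integrable_bound[OF rp_sq[of F]]) (auto simp: X_def)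
  show "X N (- xi) = cnj (X N xi)" for xi by (simp add: X_def rp_herm)
 qed
 have X': "(%xi. cor (bracket xi) * X N xi) \<in> L2H" for N
  unfolding L2H_def
 proof (intro CollectI conjI allI)
  have [measurable]: "X N \<in> borel_measurable borel" using X by (simp add: L2H_def)
  show "(%xi. cor (bracket xi) * X N xi) \<in> borel_measurable borel" by measurable
  show "integrable lborel (%xi. (norm (cor (bracket xi) * X N xi))^2)"
  proof (rule Bochner_Integration.integrable_bound[OF integrable_mult_right[OF rp_sq[of F], of "1 + (real N)^2"]])
   have "(norm (cor (bracket xi) * X N xi))^2 <= (1 + (real N)^2) * (norm (rp F xi))^2" for xi
    by (auto simp: X_def norm_mult power_mult_distrib bracket_def intro!: mult_right_mono power_mono)
   then show "AE xi in lborel. norm ((norm (cor (bracket xi) * X N xi))^2) <= norm ((1 + (real N)^2) * (norm (rp F xi))^2)" by simp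
  qed simp
  show "cor (bracket (- xi)) * X N (- xi) = cnj (cor (bracket xi) * X N xi)" for xi
   by (simp add: X_def rp_herm)
 qed
 have "(%N. LINT xi|lborel. (norm (rp F xi - X N xi))^2) \<longlonglongrightarrow> (LINT xi::real^'n|lborel. 0)"
 proof (rule integral_dominated_convergence[where w = "%xi. (norm (rp F xi))^2"])
  show "(%xi. (norm (rp F xi - X N xi))^2) \<in> borel_measurable lborel" for N unfolding X_def by measurable
  have "(%N. (norm (rp F xi - X N xi))^2) \<longlonglongrightarrow> 0" for xi
  proof (rule tendsto_eventually)
   show "\<forall>\<^sub>F N in sequentially. (norm (rp F xi - X N xi))^2 = 0"
    using eventually_ge_at_top[of "nat \<lceil>norm xi\<rceil>"] by eventually_elim (simp add: X_def nat_ceiling_le_eq)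
  qed
  then show "AE xi in lborel. (%N. (norm (rp F xi - X N xi))^2) \<longlonglongrightarrow> 0" by simp
 qed (auto simp: X_def rp_sq)
 then have "\<forall>\<^sub>F N in sequentially. (LINT xi|lborel. (norm (rp F xi - X N xi))^2) < ep^2"
  using ep by (intro order_tendstoD(2)) auto
 then obtain N where N: "(LINT xi|lborel. (norm (rp F xi - X N xi))^2) < ep^2" by (auto simp: eventually_sequentially)
 have "(norm (mk (X N) - F))^2 = (LINT xi|lborel. (norm (rp F xi - X N xi))^2)"
  unfolding norm_minus_commute[of "mk (X N)"] norm_l2_sq
  by (rule integral_cong_AE) (use rp_diff[of F "mk (X N)"] rp_mk[OF X[of N]] in "auto simp: X_def elim!: AE_mp")
 then have "norm (mk (X N) - F) < ep" using N ep by (metis less_imp_le power_less_imp_less_base)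
 moreover have "ev (sg + 1) (mk (%xi. cor (bracket xi) * X N xi)) = ev sg (mk (X N))"
 proof
  fix x
  have b: "bracket xi powr (- (sg + 1)) * bracket xi = bracket xi powr (- sg)" for xi :: "real^'n"
  proof -
   have "bracket xi powr (- (sg + 1)) * bracket xi powr 1 = bracket xi powr (- sg)" by (subst powr_add[symmetric]) simp
   then show ?thesis using bracket_pos[of xi] by simp
  qed
  show "ev (sg + 1) (mk (%xi. cor (bracket xi) * X N xi)) x = ev sg (mk (X N)) x"
   unfolding ev_def
  proof (intro arg_cong[of _ _ Re] osc_cong_AE)
   show "AE xi in lborel. cor (bracket xi powr (- (sg + 1))) * rp (mk (%xi. cor (bracket xi) * X N xi)) xi
     = cor (bracket xi powr (- sg)) * rp (mk (X N)) xi"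
    using rp_mk[OF X[of N]] rp_mk[OF X'[of N]]
    by eventually_elim (simp add: b[symmetric] mult.assoc del: minus_add_distrib)
  qed (auto simp: X_def)
 qed
 ultimately show ?thesis by blast
qed

section \<open>The linear elliptic equation for the gauge term\<close>

context einstein
begin

lemma differentiable_f: "f1 F differentiable (at x)" "f2 F differentiable (at x)" "pd i (f2 F) differentiable (at x)"
proof -
 show 1: "f1 F differentiable (at x)" for F by (rule wsob_deriv(1)[OF orders(1) wsob_fld[OF orders(2)]])
 have "wsob (s + 1 + 1) t (f2 F) (norm F)" using wsob_fld[OF orders(3), of t F] by (simp add: add.assoc)
 then show "f2 F differentiable (at x)" by (rule wsob_deriv(1)[OF orders(2)])
 show "pd i (f2 F) differentiable (at x)" using 1[of "D1 i F"] by (simp add: fld_op)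
qed

lemma pderivative_f2_commute: "pd i (pd j (f2 F)) x = pd j (pd i (f2 F)) x"
 using arg_cong[OF D_commute[of i j F], of "%F. f0 F x"] by (simp add: fld_op)

lemma gauge_solution:
 assumes "(H, K, P, E', Y, W) = L E + B (H, K, P, E', Y, W) (H, K, P, E', Y, W)" and E: "symmetric2 E"
 shows "E' = E" "gauge_solution c \<Lambda> a (fields2 H) (fields2 K) (fields2 P) (fields2 E) (fields3 Y) (fields1 W)"
proof -
 show E': "E' = E" using assms fixpoint_iff[OF E] by blast
 have "gauge_system c \<Lambda> a (fields2 H) (fields2 K) (fields2 P) (fields2 E) (fields3 Y) (fields1 W)"
  using assms fixpoint_iff[OF E] E' by blast
 then show "gauge_solution c \<Lambda> a (fields2 H) (fields2 K) (fields2 P) (fields2 E) (fields3 Y) (fields1 W)"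
  using E \<Lambda> by (unfold_locales) (auto simp: differentiable_f pderivative_f2_commute)
qed

definition Sop :: "'n l2^'n => 'n tensor2" where "Sop W = (\<chi> i j. (1/2) *R (D1 i (W $ j) + D1 j (W $ i)))"

definition Vop :: "'n unknowns => 'n l2^'n => 'n tensor2" where
 "Vop x W = (\<chi> i m. \<Sum>l\<in>UNIV. M1 (J2 (fst (snd x) $ i $ l)) (Sop W $ l $ m))"

definition Cop :: "'n unknowns => 'n tensor2 => 'n l2^'n" where
 "Cop x Z = (let Y = fst (snd (snd (snd (snd x)))) in
   \<chi> m. \<Sum>i\<in>UNIV. \<Sum>q\<in>UNIV. M0 (J1 (Y $ i $ i $ q)) (J1 (Z $ q $ m)) - M0 (J1 (Y $ q $ i $ m)) (J1 (Z $ i $ q)))"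

definition dvgV :: "'n tensor2 => 'n l2^'n" where
 "dvgV Z = (\<chi> m. (\<Sum>i\<in>UNIV. D0 i (Z $ i $ m)) - (1/2) *R D0 m (tr Z))"

text \<open>The resolvent applied to the right-hand side of \<open>gauge_equation\<close>, linear in
  \<open>W\<close> for fixed \<open>x\<close>. Each term has an entry \<open>k\<close> or
  \<open>y\<close> of \<open>x\<close> as a factor, so the operator is small for small
  \<open>x\<close>.\<close>

definition Gop :: "'n unknowns => 'n l2^'n => 'n l2^'n" where
 "Gop x W = (\<chi> m. R (2 * \<Lambda>) ((2 *R (dvgV (Vop x W) + Cop x (Vop x W) + Cop x (Sop W))) $ m))"

text \<open>The term \<open>Cop x (Vop x W)\<close> is quadratic in \<open>x\<close> and is reduced
  to first order by \<open>norm x <= 1\<close>.\<close>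

lemma Gop_bound: "\<exists>C>0. \<forall>x W. norm x <= 1 --> norm (Gop x W) <= C * norm x * norm W"
proof -
 have S: "bounded_linear Sop" unfolding Sop_def[abs_def] by (intro bl_intros)
 have "bounded_bilinear Vop" unfolding Vop_def[abs_def]
  by (intro bounded_bilinear_vec_lambda bounded_bilinear_sum bounded_bilinear.comp[OF M_bb(2)] bl_intros bounded_linear_compose[OF S])
 then obtain CV where CV: "0 < CV" "!!x W. norm (Vop x W) <= norm x * norm W * CV" using bounded_bilinear.pos_bounded by blast
 have "bounded_bilinear Cop" unfolding Cop_def[abs_def] Let_def
  by (intro bounded_bilinear_vec_lambda bounded_bilinear_sum bounded_bilinear_diff bounded_bilinear.comp[OF M_bb(3)] bl_intros)
 then obtain CC where CC: "0 < CC" "!!x Z. norm (Cop x Z) <= norm x * norm Z * CC" using bounded_bilinear.pos_bounded by blast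
 have "bounded_linear dvgV" unfolding dvgV_def[abs_def] by (intro bl_intros)
 then obtain CD where CD: "0 < CD" "!!Z. norm (dvgV Z) <= norm Z * CD" using bounded_linear.pos_bounded by blast
 obtain CS where CS: "0 < CS" "!!W. norm (Sop W) <= norm W * CS" using bounded_linear.pos_bounded[OF S] by blast
 have "bounded_linear (%Z. \<chi> m. R (2 * \<Lambda>) ((2 *R Z :: 'n l2^'n) $ m))" using \<Lambda> by (intro bl_intros R_compose) simp
 then obtain CR where CR: "0 < CR" "!!Z. norm (\<chi> m. R (2 * \<Lambda>) ((2 *R Z :: 'n l2^'n) $ m)) <= norm Z * CR" using bounded_linear.pos_bounded by blast
 have "norm (Gop x W) <= ((CV * CD + CV * CC + CS * CC) * CR) * norm x * norm W" if x: "norm x <= 1" for x W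
 proof -
  have "norm (dvgV (Vop x W)) <= (norm x * norm W * CV) * CD"
   using order_trans[OF CD(2) mult_right_mono[OF CV(2)]] CD(1) by simp
  moreover have "norm (Cop x (Vop x W)) <= norm x * norm W * CV * CC"
  proof -
   have "norm x * norm (Vop x W) <= 1 * (norm x * norm W * CV)" by (rule mult_mono[OF x CV(2)]) auto
   from mult_right_mono[OF this, of CC] CC show ?thesis using order_trans[OF CC(2)] by simp
  qed
  moreover have "norm (Cop x (Sop W)) <= norm x * (norm W * CS) * CC"
   using order_trans[OF CC(2) mult_right_mono[OF mult_left_mono[OF CS(2)]]] CC(1) by simp
  ultimately have "norm (dvgV (Vop x W) + Cop x (Vop x W) + Cop x (Sop W)) <= norm x * norm W * CV * CD + norm x * norm W * CV * CC + norm x * (norm W * CS) * CC"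
   by (intro norm_triangle_mono)
  then have "norm (Gop x W) <= (norm x * norm W * CV * CD + norm x * norm W * CV * CC + norm x * (norm W * CS) * CC) * CR"
   unfolding Gop_def by (rule order_trans[OF CR(2) mult_right_mono]) (use CR(1) in simp)
  then show ?thesis by (simp add: algebra_simps)
 qed
 moreover have "0 < (CV * CD + CV * CC + CS * CC) * CR" using CV CC CD CS CR by (simp add: add_pos_pos)
 ultimately show ?thesis by blast
qed

text \<open>For a solution with one more derivative the gauge term solves a homogeneous elliptic equation.\<close>

lemma gauge_term_fixpoint:
 assumes fp: "(H, K, P, E', Y, W) = L E + B (H, K, P, E', Y, W) (H, K, P, E', Y, W)" and E: "symmetric2 E"
  and Y': "!!l i j. f2 (Y' l i j) = f1 (Y $ l $ i $ j)" and W': "!!m. f2 (W' $ m) = f1 (W $ m)"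
 shows "W' = Gop (H, K, P, E', Y, W) W'"
proof -
 interpret gs: gauge_solution c \<Lambda> a "fields2 H" "fields2 K" "fields2 P" "fields2 E" "fields3 Y" "fields1 W"
  by (rule gauge_solution[OF fp E])
 interpret gt: gauge_solution_twice c \<Lambda> a "fields2 H" "fields2 K" "fields2 P" "fields2 E" "fields3 Y" "fields1 W"
 proof
  fix i l j m q x
  show "pd i (fields3 Y l j m) differentiable (at x)" "pd i (fields1 W j) differentiable (at x)"
   unfolding Y'[symmetric] W'[symmetric] by (rule differentiable_f)+
  show "pd i (pd j (fields3 Y l m q)) x = pd j (pd i (fields3 Y l m q)) x"
   "pd i (pd j (fields1 W l)) x = pd j (pd i (fields1 W l)) x"
   unfolding Y'[symmetric] W'[symmetric] by (rule pderivative_f2_commute)+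
  show "a = 1/2 + c * (1 - real CARD('n) / 2)" by (simp add: a_def b_def n[symmetric])
 qed
 let ?x = "(H, K, P, E', Y, W)"
 have S: "f1 (Sop W' $ i $ j) = (%x. 1/2 * (pd i (fields1 W j) x + pd j (fields1 W i) x))" for i j
  by (rule ext) (simp add: Sop_def fld_lin fld_op W')
 have V: "f1 (Vop ?x W' $ i $ m) = gt.V i m" for i m
  by (rule ext) (simp only: Vop_def fst_conv snd_conv vec_lambda_beta fld_lin fld_op S gt.V_def)
 have C: "f0 (Cop ?x Z $ m) x = (\<Sum>i\<in>UNIV. \<Sum>q\<in>UNIV. fields3 Y i i q x * f1 (Z $ q $ m) x - fields3 Y q i m x * f1 (Z $ i $ q) x)" for Z m x
  by (simp add: Cop_def Let_def fld_lin fld_op)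
 have "2 * \<Lambda> * f2 (W' $ m) x - lap (f2 (W' $ m)) x = f0 ((2 *R (dvgV (Vop ?x W') + Cop ?x (Vop ?x W') + Cop ?x (Sop W'))) $ m) x" for m x
  unfolding W' gt.gauge_equation vector_scaleR_component vector_add_component fld_lin C V S gt.dvg_def
  by (simp add: dvgV_def fld_lin fld_op V)
 then have "W' $ m = R (2 * \<Lambda>) ((2 *R (dvgV (Vop ?x W') + Cop ?x (Vop ?x W') + Cop ?x (Sop W'))) $ m)" for m
  by (intro res(2)[OF orders(1) refl t, THEN iffD2] allI) (use \<Lambda> in auto)
 then show ?thesis unfolding Gop_def by (simp only: vec_eq_iff vec_lambda_beta) simp
qed

end

section \<open>Comparison of solutions in spaces of different order and weight\<close>

declare fld_zero_weight [simp del]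

definition down2 :: "('n l2 => 'n l2) => 'n::finite tensor2 => 'n tensor2" where
 "down2 I H = (\<chi> i j. I (H $ i $ j))"

definition down :: "('n l2 => 'n l2) => ('n l2 => 'n l2) => 'n::finite unknowns => 'n unknowns" where
 "down I J x = (case x of (H, K, P, E, Y, W) => (down2 I H, down2 I K, down2 I P, down2 I E, \<chi> l i j. J (Y $ l $ i $ j), \<chi> m. J (W $ m)))"

lemma norm_tensor2_le: "norm (H :: 'n::finite tensor2) <= (\<Sum>i\<in>UNIV. \<Sum>j\<in>UNIV. norm (H $ i $ j))"
proof -
 have "norm H <= (\<Sum>i\<in>UNIV. norm (H $ i))" unfolding norm_vec_def[of H] by (rule L2_set_le_sum) simp
 also have "... <= (\<Sum>i\<in>UNIV. \<Sum>j\<in>UNIV. norm (H $ i $ j))"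
  by (rule sum_mono, subst norm_vec_def) (rule L2_set_le_sum, simp)
 finally show ?thesis .
qed

text \<open>Used twice: with one more derivative above and no weights, for regularity, and with
  equal orders and weight \<open>t\<close> above, to remove the weight.\<close>

locale einstein_pair = hi: einstein ty n s' t' \<kappa> \<Lambda> + lo: einstein ty n s 0 \<kappa> \<Lambda> for ty :: "'n::finite itself" and n s' t' s \<kappa> \<Lambda> +
 assumes le: "s <= s'"
begin

abbreviation I2 :: "'n l2 => 'n l2" where "I2 == incl (s' + 2) t' (s + 2) 0"
abbreviation I1 :: "'n l2 => 'n l2" where "I1 == incl (s' + 1) t' (s + 1) 0"

lemma I: "bounded_linear I2" "bounded_linear I1" "lo.f2 (I2 F) = hi.f2 F" "lo.f1 (I1 F) = hi.f1 F"
 using lo.orders hi.t le by (auto intro!: incl)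

lemma down2_bl: "bounded_linear (down2 I2)"
 unfolding down2_def[abs_def] by (intro lo.bl_intros bounded_linear_compose[OF I(1)])

lemma down_bl: "bounded_linear (down I2 I1)"
 unfolding down_def[abs_def] case_prod_beta
 by (intro lo.bl_intros bounded_linear_compose[OF I(2)] bounded_linear_compose[OF down2_bl])

text \<open>The system speaks about fields only, and inclusions leave the fields unchanged.\<close>

lemma down_fixpoint:
 assumes fp: "x = hi.L E + hi.B x x" and E: "hi.symmetric2 E"
 shows "down I2 I1 x = lo.L (down2 I2 E) + lo.B (down I2 I1 x) (down I2 I1 x)"
proof -
 obtain H K P E' Y W where x: "x = (H, K, P, E', Y, W)" by (metis prod_cases6)
 have sym: "lo.symmetric2 (down2 I2 E)" using E by (simp add: down2_def)
 show ?thesis using fp unfolding x hi.fixpoint_iff[OF E] down_def prod.case lo.fixpoint_iff[OF sym] by (auto simp: down2_def I)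
qed

text \<open>The upper and the lower problem have different radii. For \<open>E\<close> small in the
  upper space the upper solution is carried into the lower \<open>R\<close>-ball, where uniqueness
  identifies it; the three terms in \<open>et\<close> are these conditions.\<close>

lemma down_sol:
 "\<exists>et>0. \<forall>E. hi.symmetric2 E --> norm E < et --> norm E < hi.q.r & norm (down2 I2 E) < lo.q.r & down I2 I1 (hi.q.sol E) = lo.q.sol (down2 I2 E)"
proof -
 obtain C where C: "0 < C" "!!x. norm (down I2 I1 x) <= norm x * C" using bounded_linear.pos_bounded[OF down_bl] by blast
 obtain C2 where C2: "0 < C2" "!!x. norm (down2 I2 x) <= norm x * C2" using bounded_linear.pos_bounded[OF down2_bl] by blast
 let ?l = "onorm hi.L"
 define et where "et = min hi.q.r (min (lo.q.r / C2) (lo.q.R / ((2 * ?l + 1) * C)))"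
 have l: "0 <= ?l" by (rule onorm_pos_le[OF hi.L_bl])
 have "0 < et" using hi.q.r lo.q.r lo.q.R C C2 l by (simp add: et_def)
 moreover have "norm E < hi.q.r & norm (down2 I2 E) < lo.q.r & down I2 I1 (hi.q.sol E) = lo.q.sol (down2 I2 E)"
  if E: "hi.symmetric2 E" "norm E < et" for E
 proof (intro conjI)
  show 1: "norm E < hi.q.r" using E by (simp add: et_def)
  have "norm E * C2 < lo.q.r" using E C2 by (simp add: et_def pos_less_divide_eq)
  then show 2: "norm (down2 I2 E) < lo.q.r" using C2(2)[of E] by linarith
  have "norm (down I2 I1 (hi.q.sol E)) <= norm (hi.q.sol E) * C" by (rule C)
  also have "... <= (2 * ?l * norm E) * C" using hi.q.sol_bound[OF 1] C by (intro mult_right_mono) auto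
  also have "... <= norm E * ((2 * ?l + 1) * C)" using C by (simp add: algebra_simps)
  also have "... <= lo.q.R" using E C l by (simp add: et_def pos_less_divide_eq)
  finally show "down I2 I1 (hi.q.sol E) = lo.q.sol (down2 I2 E)"
   by (rule lo.q.sol_unique[OF _ down_fixpoint[OF hi.q.sol(2)[OF 1] E(1)] lo.q.sol[OF 2]])
 qed
 ultimately show ?thesis by blast
qed

end

abbreviation gauge_part :: "'n::finite unknowns => 'n l2^'n" where "gauge_part x == snd (snd (snd (snd (snd x))))"

context einstein
begin

text \<open>A small enough multiple of a source with one more derivative has a solution with one
  more derivative, so \<open>gauge_term_fixpoint\<close> applies and the bound by half of
  \<open>norm W\<close> forces \<open>W = 0\<close>. How small it must be depends on the norm of
  \<open>E\<close> in the higher space.\<close>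

lemma gauge_part_zero_regular:
 assumes t0: "t = 0" and E: "symmetric2 E"
 defines "I == incl (s + 1 + 2) 0 (s + 2) 0"
 shows "\<exists>et>0. \<forall>tu. \<bar>tu\<bar> < et --> gauge_part (q.sol (tu *R down2 I E)) = 0"
proof -
 interpret pair: einstein_pair ty n "s + 1" 0 s \<kappa> \<Lambda>
  by unfold_locales (use n n2 s \<kappa> \<Lambda> in auto)
 have I: "I = pair.I2" by (simp add: I_def)
 obtain et where et: "0 < et" "!!E. pair.hi.symmetric2 E ==> norm E < et ==> norm E < pair.hi.q.r & norm (down2 I E) < pair.lo.q.r & down I pair.I1 (pair.hi.q.sol E) = pair.lo.q.sol (down2 I E)"
  using pair.down_sol unfolding I by blast
 obtain C where C: "0 < C" "!!x W. norm x <= 1 ==> norm (pair.lo.Gop x W) <= C * norm x * norm W" using pair.lo.Gop_bound by blast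
 define dl where "dl = min 1 (1 / (2 * C))"
 have dl: "0 < dl" "dl <= 1" "C * dl <= 1/2" using C by (auto simp: dl_def min_def field_simps)
 let ?l = "onorm pair.lo.L"
 have l: "0 <= ?l" by (rule onorm_pos_le[OF pair.lo.L_bl])
 have dbl: "bounded_linear (down2 I)" unfolding I by (rule pair.down2_bl)
 have dscale: "down2 I (tu *R E) = tu *R down2 I E" for tu by (rule linear_cmul[OF bounded_linear.linear[OF dbl]])
 define et' where "et' = min (et / (norm E + 1)) (dl / ((2 * ?l + 1) * (norm (down2 I E) + 1)))"
 have "0 < et'" using et dl l by (simp add: et'_def add_nonneg_pos)
 moreover have "gauge_part (pair.lo.q.sol (tu *R down2 I E)) = 0" if tu: "\<bar>tu\<bar> < et'" for tu
 proof -
  let ?E = "tu *R E"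
  have sym: "pair.hi.symmetric2 ?E" "pair.lo.symmetric2 (down2 I ?E)" using E by (auto simp: down2_def)
  have "\<bar>tu\<bar> * (norm E + 1) < et" using tu by (simp add: et'_def pos_less_divide_eq add_nonneg_pos)
  then have "norm ?E < et" by (simp add: algebra_simps)
  note * = et(2)[OF sym(1) this]
  then have h1: "norm ?E < pair.hi.q.r" and h2: "norm (down2 I ?E) < pair.lo.q.r" and h3: "pair.lo.q.sol (down2 I ?E) = down I pair.I1 (pair.hi.q.sol ?E)" by auto
  obtain H K P E' Y W where x': "pair.hi.q.sol ?E = (H, K, P, E', Y, W)" by (metis prod_cases6)
  obtain H1 K1 P1 E1 Y1 W1 where x: "pair.lo.q.sol (down2 I ?E) = (H1, K1, P1, E1, Y1, W1)" by (metis prod_cases6)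
  have YW: "Y1 = (\<chi> l i j. pair.I1 (Y $ l $ i $ j))" "W1 = (\<chi> m. pair.I1 (W $ m))" using h3 unfolding x x' by (auto simp: down_def)
  have f: "fld (s + 1 + 1) 0 = fld (s + 2) 0" by (simp add: add.assoc)
  have "norm (H1, K1, P1, E1, Y1, W1) <= 2 * ?l * norm (down2 I ?E)" using pair.lo.q.sol_bound[OF h2] x by simp
  also have "... <= \<bar>tu\<bar> * ((2 * ?l + 1) * (norm (down2 I E) + 1))" unfolding dscale using l by (simp add: algebra_simps)
  also have "... <= dl" using tu l by (simp add: et'_def pos_less_divide_eq add_nonneg_pos less_imp_le)
  finally have xn: "norm (H1, K1, P1, E1, Y1, W1) <= dl" .
  have "W = pair.lo.Gop (H1, K1, P1, E1, Y1, W1) W"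
  proof (rule pair.lo.gauge_term_fixpoint[OF _ sym(2)])
   show "(H1, K1, P1, E1, Y1, W1) = pair.lo.L (down2 I ?E) + pair.lo.B (H1, K1, P1, E1, Y1, W1) (H1, K1, P1, E1, Y1, W1)"
    using pair.lo.q.sol(2)[OF h2] unfolding x .
   show "pair.lo.f2 (Y $ l $ i $ j) = pair.lo.f1 (Y1 $ l $ i $ j)" for l i j using pair.I(4)[of "Y $ l $ i $ j"] unfolding f YW by simp
   show "pair.lo.f2 (W $ m) = pair.lo.f1 (W1 $ m)" for m using pair.I(4)[of "W $ m"] unfolding f YW by simp
  qed
  then have "norm W <= C * norm (H1, K1, P1, E1, Y1, W1) * norm W" using C(2)[OF order_trans[OF xn dl(2)], of W] by simp
  also have "... <= (C * dl) * norm W" using xn C by (intro mult_right_mono mult_left_mono) auto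
  also have "... <= 1/2 * norm W" by (intro mult_right_mono dl) simp
  finally have W: "W = 0" by simp
  have "pair.I1 0 = 0" by (rule linear_0[OF bounded_linear.linear[OF pair.I(2)]])
  then have "W1 = 0" unfolding YW W vec_eq_iff by (simp only: vec_lambda_beta zero_index) simp
  then show ?thesis using x by (simp add: dscale)
 qed
 ultimately show ?thesis unfolding t0 by blast
qed

text \<open>Suppose a component of \<open>w\<close> is nonzero at some point. For a nearby
  band-limited source it vanishes on tiny multiples, hence by \<open>functional_zero\<close> for
  that source itself, and the Lipschitz bound for the solution contradicts the assumed
  value.\<close>

lemma gauge_part_zero_unweighted:
 assumes t0: "t = 0" and E: "symmetric2 E" "norm E < q.r"
 shows "gauge_part (q.sol E) = 0"
proof -
 let ?n = "real CARD('n)"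
 let ?ph = "%m z x. f1 (gauge_part x $ m) z"
 have ph: "bounded_linear (?ph m z)" for m z by (intro bounded_linear_compose[OF fld_bl(2)] bl_intros)
 interpret pair: einstein_pair ty n "s + 1" 0 s \<kappa> \<Lambda>
  by unfold_locales (use n n2 s \<kappa> \<Lambda> in auto)
 let ?I = "incl (s + 1 + 2) 0 (s + 2) 0 :: 'n l2 => 'n l2"
 have z: "f1 (gauge_part (q.sol E) $ m) z = 0" for m z
 proof (rule ccontr)
  assume nz: "f1 (gauge_part (q.sol E) $ m) z ~= 0"
  obtain C where C: "0 < C" "!!x. norm (?ph m z x) <= norm x * C" using bounded_linear.pos_bounded[OF ph] by blast
  let ?l = "onorm L"
  have l: "0 <= ?l" by (rule onorm_pos_le[OF L_bl])
  \<comment> \<open>The first bound keeps the approximation inside the radius \<open>q.r\<close>,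
    the second keeps the change of the evaluated component below its value at
    \<open>E\<close>.\<close>
  define d where "d = min (q.r - norm E) (\<bar>?ph m z (q.sol E)\<bar> / ((2 * ?l + 1) * C))"
  have d: "0 < d" using E nz C l by (simp add: d_def)
  have "0 < d / (?n * ?n)" using d by simp
  from band_limited_dense[OF this, of _ "s + 2"]
  have "\<exists>F' F''. norm (F' - F) < d / (?n * ?n) & ev (s + 2 + 1) F'' = ev (s + 2) F'" for F :: "'n l2" by blast
  then obtain b b' where b: "!!F :: 'n l2. norm (b F - F) < d / (?n * ?n)" "!!F. ev (s + 2 + 1) (b' F :: 'n l2) = ev (s + 2) (b F :: 'n l2)" by metis
  define E' where "E' = (\<chi> i j. b (E $ i $ j))"
  define E'' where "E'' = (\<chi> i j. b' (E $ i $ j))"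
  have "?I (b' F) = b F" for F
   by (rule fld_inject[OF orders(3), of 0]) (use pair.I(3)[of "b' F"] b(2)[of F] in "simp add: fld_zero_weight add.assoc")
  then have E': "E' = down2 ?I E''" by (simp add: E'_def E''_def down2_def)
  have "norm (E' - E) <= (\<Sum>i\<in>UNIV. \<Sum>j\<in>UNIV. norm ((E' - E) $ i $ j))" by (rule norm_tensor2_le)
  also have "... < (\<Sum>i\<in>(UNIV::'n set). \<Sum>j\<in>(UNIV::'n set). d / (?n * ?n))"
   by (intro sum_strict_mono) (auto simp: E'_def b)
  finally have diff: "norm (E' - E) < d" by simp
  have E'r: "norm E' < q.r" using diff norm_triangle_ineq[of "E' - E" E] by (simp add: d_def)
  have "symmetric2 E''" using E by (simp add: E''_def)
  from gauge_part_zero_regular[OF t0 this] obtain et where et: "0 < et" "!!tu. \<bar>tu\<bar> < et ==> gauge_part (q.sol (tu *R E')) = 0"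
   unfolding E' by blast
  have "?ph m z (q.sol E') = 0"
   by (rule q.functional_zero[OF E'r ph et(1)]) (simp add: et(2) linear_0[OF bounded_linear.linear[OF fld_bl(2)]])
  then have "\<bar>?ph m z (q.sol E)\<bar> = norm (?ph m z (q.sol E - q.sol E'))"
   by (simp add: linear_diff[OF bounded_linear.linear[OF fld_bl(2)]])
  also have "... <= norm (q.sol E - q.sol E') * C" by (rule C)
  also have "... <= (2 * ?l * norm (E' - E)) * C"
   using q.sol_lipschitz[OF E'r E(2)] C by (intro mult_right_mono) (auto simp: norm_minus_commute)
  also have "... <= norm (E' - E) * ((2 * ?l + 1) * C)" using C by (simp add: algebra_simps)
  also have "... < \<bar>?ph m z (q.sol E)\<bar>" using diff C l by (simp add: d_def pos_less_divide_eq)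
  finally show False by simp
 qed
 have "gauge_part (q.sol E) $ m = 0" for m
  by (rule fld_inject[OF orders(2), of t]) (simp add: z linear_0[OF bounded_linear.linear[OF fld_bl(2)]])
 then show ?thesis by (simp add: vec_eq_iff)
qed

text \<open>As a field, the gauge term of the weighted solution is that of the unweighted solution
  for the same source, which vanishes.\<close>

theorem Einstein_solution:
 "\<exists>et>0. \<forall>E. symmetric2 E --> norm E < et --> norm E < q.r & symmetric2 (fst (q.sol E)) &
   (\<forall>x. Ein \<kappa> \<Lambda> (%x. flat_metric x + (\<chi> i j. f2 (fst (q.sol E) $ i $ j) x)) x = Ein \<kappa> \<Lambda> flat_metric x + (\<chi> i j. f2 (E $ i $ j) x))"
proof -
 interpret pair: einstein_pair ty n s t s \<kappa> \<Lambda>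
  by unfold_locales (use n n2 s \<kappa> \<Lambda> in auto)
 obtain et where et: "0 < et" "!!E. symmetric2 E ==> norm E < et ==> norm E < q.r & norm (down2 pair.I2 E) < pair.lo.q.r & down pair.I2 pair.I1 (q.sol E) = pair.lo.q.sol (down2 pair.I2 E)"
  using pair.down_sol by blast
 have "norm E < q.r & symmetric2 (fst (q.sol E)) &
   (\<forall>x. Ein \<kappa> \<Lambda> (%x. flat_metric x + (\<chi> i j. f2 (fst (q.sol E) $ i $ j) x)) x = Ein \<kappa> \<Lambda> flat_metric x + (\<chi> i j. f2 (E $ i $ j) x))"
  if E: "symmetric2 E" "norm E < et" for E
 proof -
  note * = et(2)[OF E]
  obtain H K P E' Y W where x: "q.sol E = (H, K, P, E', Y, W)" by (metis prod_cases6)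
  have fp: "(H, K, P, E', Y, W) = L E + B (H, K, P, E', Y, W) (H, K, P, E', Y, W)" using q.sol(2)[of E] * x by simp
  interpret gs: gauge_solution c \<Lambda> a "fields2 H" "fields2 K" "fields2 P" "fields2 E" "fields3 Y" "fields1 W"
   by (rule gauge_solution(2)[OF fp E(1)])
  have "gauge_part (pair.lo.q.sol (down2 pair.I2 E)) = 0"
   by (rule pair.lo.gauge_part_zero_unweighted) (use * E in "auto simp: down2_def")
  then have "gauge_part (down pair.I2 pair.I1 (q.sol E)) = 0" using * by (simp only:)
  then have "pair.I1 (W $ m) = 0" for m by (simp add: down_def x vec_eq_iff)
  then have w0: "fields1 W m = (%x. 0)" for m
   using pair.I(4)[of "W $ m"] linear_0[OF bounded_linear.linear[OF pair.lo.fld_bl(2)]] by auto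
  have "Ein \<kappa> \<Lambda> (%x. flat_metric x + gs.h_mat x) x = Ein \<kappa> \<Lambda> flat_metric x + (\<chi> i j. fields2 E i j x)" for x
   by (rule gs.Ein_eq[OF w0]) (use constants(5) n in simp)
  moreover have "symmetric2 H" using gs.h_sym by (auto simp: fld_eq_iff[OF orders(3), of _ _ t])
  ultimately show ?thesis using * by (simp add: x gs.h_mat_def)
 qed
 with et(1) show ?thesis by blast
qed

end

section \<open>Weighted Sobolev distributions as functions\<close>

lemma schwartz_cnj:
 assumes "schwartz (ph :: real^'n::finite => complex)" shows "schwartz (%x. cnj (ph x))"
proof (rule schwartz_coinduct[of _ "{%x. cnj (ph x) |ph. schwartz ph}"])
 show "(%x. cnj (ph x)) \<in> {%x. cnj (ph x) |ph. schwartz ph}" using assms by blast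
 fix g :: "real^'n => complex" assume "g \<in> {%x. cnj (ph x) |ph. schwartz ph}"
 then obtain ph where g: "g = (%x. cnj (ph x))" and S: "schwartz ph" by blast
 note d = pderivative_bounded_linear[OF bounded_linear_cnj schwartz_differentiable[OF S]]
 have "pd i g = (%x. cnj (pd i ph x))" for i unfolding g by (rule ext) (rule d)
 then have "pd i g \<in> {%x. cnj (ph x) |ph. schwartz ph}" for i using schwartz_pderivative[OF S] by blast
 moreover have "g differentiable (at x)" for x unfolding g by (rule d)
 moreover have "\<exists>C. \<forall>x. (1 + norm x) ^ N * norm (g x) <= C" for N
  using schwartz_bounded[OF S, of N] by (auto simp: g)
 ultimately show "(\<forall>x. g differentiable (at x)) & (\<forall>i. pd i g \<in> {%x. cnj (ph x) |ph. schwartz ph}) & (\<forall>N. \<exists>C. \<forall>x. (1 + norm x) ^ N * norm (g x) <= C)"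
  by blast
qed

lemma bracket_powr_cancel_complex:
 "cor (bracket x powr p) * (cor (bracket x powr (- p)) * z) = z"
 "cor (bracket x powr (- p)) * (cor (bracket x powr p) * z) = z"
proof -
 have "bracket x powr p * bracket x powr (- p) = 1" using bracket_powr_cancel[of x p 1] by simp
 then have *: "cor (bracket x powr p) * cor (bracket x powr (- p)) = 1" by (metis of_real_1 of_real_mult)
 then show "cor (bracket x powr p) * (cor (bracket x powr (- p)) * z) = z"
  unfolding mult.assoc[symmetric] by simp
 show "cor (bracket x powr (- p)) * (cor (bracket x powr p) * z) = z"
  unfolding mult.assoc[symmetric] mult.commute[of "cor (bracket x powr (- p))"] * by simp
qed

lemma schwartz_re_im:
 assumes "schwartz (ph :: real^'n::finite => complex)"
 shows "schwartz (%x. cor (Re (ph x)))" "schwartz (%x. cor (Im (ph x)))"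
proof -
 have e: "(%x. cor (Re (ph x))) = (%x. (1/2) * (ph x + cnj (ph x)))"
  "(%x. cor (Im (ph x))) = (%x. (- \<i> / 2) * (ph x + (-1) * cnj (ph x)))"
  by (auto simp: fun_eq_iff complex_eq_iff)
 show "schwartz (%x. cor (Re (ph x)))" "schwartz (%x. cor (Im (ph x)))"
  unfolding e by (intro schwartz_cmult schwartz_add schwartz_cnj assms)+
qed

text \<open>The value 0 outside the Schwartz space follows the convention for
  \<open>tempered\<close>.\<close>

definition int_functional :: "(real^'n::finite => real) => (real^'n => complex) => complex" where
 "int_functional u ph = (if schwartz ph then (LINT x|lborel. cor (u x) * ph x) else 0)"

definition nice :: "(real^'n::finite => real) => bool" where
 "nice u \<longleftrightarrow> continuous_on UNIV u & (\<exists>B. \<forall>x. \<bar>u x\<bar> <= B)"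

lemma nice_integrable:
 assumes u: "nice u" and S: "schwartz ph" shows "integrable lborel (%x. cor (u x) * ph x)"
proof -
 obtain B where B: "!!x. \<bar>u x\<bar> <= B" using u by (auto simp: nice_def)
 have [measurable]: "u \<in> borel_measurable borel" using u by (auto simp: nice_def intro: borel_measurable_continuous_onI)
 have [measurable]: "ph \<in> borel_measurable borel" by (rule schwartz_measurable[OF S])
 show ?thesis
 proof (rule Bochner_Integration.integrable_bound[OF integrable_mult_right[OF schwartz_integrable[OF S], of "cor B"]])
  show "AE x in lborel. norm (cor (u x) * ph x) <= norm (cor B * ph x)"
   unfolding norm_mult using B by (intro always_eventually allI mult_right_mono) (auto intro: order_trans[OF _ abs_ge_self])
 qed measurable
qed

lemma tempered_int_functional:
 assumes u: "nice u" shows "tempered (int_functional (u :: real^'n::finite => real))"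
proof -
 obtain B where B: "!!x. \<bar>u x\<bar> <= B" using u by (auto simp: nice_def)
 have B0: "0 <= B" using B[of 0] by simp
 let ?I = "LINT x::real^'n|lborel. inverse ((1 + norm x) ^ Suc CARD('n))"
 have "norm (int_functional u ph) <= (B * ?I) * schwartz_seminorm (Suc CARD('n)) ph" if S: "schwartz ph" for ph
 proof -
  have "norm (int_functional u ph) <= (LINT x|lborel. norm (cor (u x) * ph x))"
   using S by (simp only: int_functional_def if_True integral_norm_bound)
  also have "... <= (LINT x|lborel. B * norm (ph x))"
   using B by (intro integral_mono integrable_mult_right integrable_norm nice_integrable[OF u S] schwartz_integrable[OF S])
    (auto simp: norm_mult intro!: mult_right_mono)
  also have "... = B * (LINT x|lborel. norm (ph x))" by simp
  also have "... <= B * (schwartz_seminorm (Suc CARD('n)) ph * ?I)"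
   by (intro mult_left_mono integrable_decay(2) schwartz_measurable[OF S] schwartz_seminorm_upper[OF S] B0)
  finally show ?thesis by (simp add: mult_ac)
 qed
 then have "\<exists>C N. \<forall>ph. schwartz ph --> norm (int_functional u ph) <= C * schwartz_seminorm N ph" by blast
 moreover have "int_functional u (%x. ph x + psi x) = int_functional u ph + int_functional u psi" if "schwartz ph" "schwartz psi" for ph psi
  using that schwartz_add[OF that] nice_integrable[OF u] by (simp add: int_functional_def distrib_left)
 moreover have "int_functional u (%x. c * ph x) = c * int_functional u ph" if "schwartz ph" for c ph
  using that schwartz_cmult[OF that, of c] by (simp add: int_functional_def mult.left_commute[of _ c])
 ultimately show ?thesis unfolding tempered_def by (auto simp: int_functional_def)
qed

definition dist_of :: "real => real => 'n::finite l2 => 'n tdist" where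
 "dist_of sg t F = Abs_tdist (int_functional (fld sg t F))"

lemma L2_representative_unique:
 assumes "L2_representative g T" "L2_representative (g' :: real^'n::finite => complex) T"
 shows "AE x in lborel. g x = g' x"
proof -
 have "AE x in lborel. g x - g' x = 0"
  by (rule schwartz_annihilator_AE_zero)
    (use assms in "auto simp: L2_representative_def square_integrable_def represents_def left_diff_distrib")
 then show ?thesis by simp
qed

context
 fixes sg t :: real and ty :: "'n::finite itself"
 assumes sg: "sg > real CARD('n) / 2" and t: "0 <= t"
begin

lemma nice_ev: "nice (ev sg (F :: 'n l2))"
 unfolding nice_def using sob_continuous[OF sob_ev[OF sg]] sob_bound[OF sg sob_ev[OF sg]] by blast

lemma nice_fld: "nice (fld sg t (F :: 'n l2))"
proof -
 obtain B where B: "!!x. \<bar>ev sg F x\<bar> <= B" using nice_ev[of F] by (auto simp: nice_def)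
 have "\<bar>fld sg t F x\<bar> <= B" for x
 proof -
  have "bracket x powr (- t) <= bracket x powr 0" by (rule powr_mono) (use t bracket_ge1 in auto)
  then have "\<bar>fld sg t F x\<bar> <= 1 * \<bar>ev sg F x\<bar>" unfolding fld_def abs_mult using bracket_pos[of x] by (intro mult_right_mono) auto
  then show ?thesis using B[of x] by simp
 qed
 moreover have "bracket x ~= 0" for x :: "real^'n" using bracket_pos[of x] by simp
 then have "continuous_on UNIV (fld sg t F)" unfolding fld_def using nice_ev[of F] by (intro continuous_intros) (auto simp: nice_def)
 ultimately show ?thesis unfolding nice_def by blast
qed

lemma pairing_dist_of: "pairing (dist_of sg t (F :: 'n l2)) = int_functional (fld sg t F)"
 unfolding dist_of_def by (rule Abs_tdist_inverse) (simp add: tempered_int_functional nice_fld)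

lemma represents_dist_of: "represents (%x. cor (fld sg t (F :: 'n l2) x)) (pairing (dist_of sg t F))"
 unfolding represents_def pairing_dist_of by (auto simp: int_functional_def nice_integrable[OF nice_fld])

lemma dist_weight_dist_of: "dist_weight t (pairing (dist_of sg t (F :: 'n l2))) = int_functional (ev sg F)"
proof
 fix ph :: "real^'n => complex"
 have e: "cor (fld sg t F x) * (cor (bracket x powr t) * ph x) = cor (ev sg F x) * ph x" for x
  using bracket_powr_cancel_complex(2)[of x t "cor (ev sg F x) * ph x"] unfolding fld_def of_real_mult by (simp only: mult_ac)
 show "dist_weight t (pairing (dist_of sg t F)) ph = int_functional (ev sg F) ph"
  by (simp add: dist_weight_def pairing_dist_of int_functional_def schwartz_bracket_powr e)
qed

text \<open>\<open>osc_swap\<close> moves the transform from the field to the test function, and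
  inversion returns the density. The constant is that of the inversion formula, since
  \<open>fourier\<close> carries no normalizing factor.\<close>

lemma dist_of_representative:
 "L2_representative (%xi. cor ((gauss_int TYPE('n))^2) * rp (F :: 'n l2) xi) (dist_weight sg (dist_fourier (dist_weight t (pairing (dist_of sg t F)))))"
proof -
 let ?c = "cor ((gauss_int TYPE('n))^2)"
 let ?f = "%xi. cor (bracket xi powr (- sg)) * rp F xi"
 have "dist_weight sg (dist_fourier (dist_weight t (pairing (dist_of sg t F)))) ph = (LINT xi|lborel. (?c * rp F xi) * ph xi)" if S: "schwartz ph" for ph
 proof -
  let ?psi = "%xi. cor (bracket xi powr sg) * ph xi"
  have S': "schwartz ?psi" by (rule schwartz_bracket_powr[OF S])
  have "dist_weight sg (dist_fourier (dist_weight t (pairing (dist_of sg t F)))) ph = (LINT x|lborel. osc ?f x * osc ?psi (- x))"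
   unfolding dist_weight_dist_of using S S' schwartz_fourier[OF S']
   by (simp add: dist_weight_def dist_fourier_def int_functional_def ev_density(5)[OF sg] fourier_osc)
  also have "... = (LINT x|lborel. osc (%xi. ?f (- xi)) x * osc ?psi x)"
   unfolding osc_uminus[of ?f] by (subst lborel_integral_reflect[symmetric]) simp
  also have "... = (LINT xi|lborel. ?f (- xi) * osc (osc ?psi) xi)"
   using ev_density(2)[OF sg, of F] by (intro osc_swap schwartz_integrable[OF schwartz_osc[OF S']]) (subst lborel_integrable_reflect_iff)
  also have "... = (LINT xi|lborel. ?f xi * (?c * ?psi xi))"
   unfolding osc_osc[OF S'] by (subst lborel_integral_reflect[symmetric]) simp
  also have "... = (LINT xi|lborel. (?c * rp F xi) * ph xi)"
  proof (intro Bochner_Integration.integral_cong refl)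
   fix xi :: "real^'n"
   show "?f xi * (?c * ?psi xi) = (?c * rp F xi) * ph xi"
    using bracket_powr_cancel_complex(2)[of xi sg "?c * rp F xi * ph xi"] by (simp only: mult_ac)
  qed
  finally show ?thesis .
 qed
 moreover have "integrable lborel (%xi. (?c * rp F xi) * ph xi)" if S: "schwartz ph" for ph
 proof (rule sq_integrable_product)
  obtain C where C: "!!x. (1 + norm x) ^ Suc CARD('n) * norm (ph x * ph x) <= C"
   using schwartz_bounded[OF schwartz_mult[OF S S]] by blast
  have [measurable]: "ph \<in> borel_measurable borel" by (rule schwartz_measurable[OF S])
  have "integrable lborel (%x. norm (ph x * ph x))" by (intro integrable_norm integrable_decay(1)[OF _ C]) measurable
  then show "integrable lborel (%x. (norm (ph x))^2)" by (simp add: norm_mult power2_eq_square)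
  show "ph \<in> borel_measurable lborel" by simp
 qed (auto simp: norm_mult power_mult_distrib rp_sq)
 ultimately show ?thesis
  by (auto simp: L2_representative_def square_integrable_def represents_def norm_mult power_mult_distrib rp_sq)
qed

lemma wsobolev_dist_of: "dist_of sg t (F :: 'n l2) \<in> wsobolev sg t"
 unfolding wsobolev_def sobolev_def using dist_of_representative[of F] tempered_int_functional[OF nice_ev, of F]
 by (auto simp: dist_weight_dist_of)

lemma wsobolev_norm_dist_of: "wsobolev_norm sg t (dist_of sg t (F :: 'n l2)) = (gauss_int TYPE('n))^2 * norm F"
proof -
 let ?T = "dist_weight sg (dist_fourier (dist_weight t (pairing (dist_of sg t F))))"
 let ?c = "(gauss_int TYPE('n))^2"
 define g where "g = (SOME g. L2_representative g ?T)"
 have g: "L2_representative g ?T" unfolding g_def by (rule someI[where P = "%g. L2_representative g ?T", OF dist_of_representative])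
 have [measurable]: "g \<in> borel_measurable borel" using g by (auto simp: L2_representative_def square_integrable_def)
 have "(LINT xi|lborel. (norm (g xi))^2) = (LINT xi|lborel. ?c^2 * (norm (rp F xi))^2)"
  by (rule integral_cong_AE)
    (use L2_representative_unique[OF g dist_of_representative] in "auto simp: norm_mult power_mult_distrib simp del: of_real_power elim!: AE_mp")
 also have "... = (?c * norm F)^2" by (simp add: norm_l2_sq power_mult_distrib)
 finally show ?thesis
  by (simp add: wsobolev_norm_def sobolev_norm_def Let_def g_def[symmetric] del: fourier_def)
qed

lemma real_dist_of: "real_distribution (pairing (dist_of sg t (F :: 'n l2)))"
 unfolding real_distribution_def pairing_dist_of
proof (intro allI impI)
 fix ph :: "real^'n => complex" assume S: "schwartz ph" and "range ph \<subseteq> \<real>"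
 then have "ph x = cor (Re (ph x))" for x by (metis Reals_cases Re_complex_of_real rangeI subsetD)
 then obtain r where r: "ph = (%x. cor (r x))" using that[of "%x. Re (ph x)"] ext by blast
 have "int_functional (fld sg t F) ph = cor (LINT x|lborel. fld sg t F x * r x)"
  using S unfolding int_functional_def r by (simp flip: integral_complex_of_real)
 then show "int_functional (fld sg t F) ph \<in> \<real>" by simp
qed

text \<open>Every Schwartz function is \<open>bracket x powr t\<close> times the Fourier transform of \<open>bracket xi powr sg * ph xi\<close> for a
 Schwartz function \<open>ph\<close>, so the \<open>L\<^sup>2\<close> representative determines the distribution.\<close>

lemma dist_of_surj:
 assumes T: "T \<in> wsobolev sg t" and re: "real_distribution (pairing T)"
 shows "\<exists>F :: 'n l2. T = dist_of sg t F"
proof -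
 let ?c = "cor ((gauss_int TYPE('n))^2)"
 have c: "?c ~= 0" using gauss_int_pos[where 'n='n] by simp
 obtain g where g: "L2_representative g (dist_weight sg (dist_fourier (dist_weight t (pairing T))))"
  using T unfolding wsobolev_def sobolev_def by blast
 have [measurable]: "g \<in> borel_measurable borel" and gi: "integrable lborel (%xi. (norm (g xi))^2)"
  using g by (auto simp: L2_representative_def square_integrable_def)
 define f where "f xi = cor (bracket xi powr (- sg)) * (g xi / ?c)" for xi
 have [measurable]: "f \<in> borel_measurable borel" unfolding f_def by measurable
 have fi: "integrable lborel f" unfolding f_def
 proof (rule sq_integrable_product)
  show "integrable lborel (%xi::real^'n. (norm (cor (bracket xi powr (- sg))))^2)"
   using bracket_powr_integrable[OF sg] bracket_pos by (simp add: powr_power power2_eq_square flip: powr_add)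
  show "integrable lborel (%xi. (norm (g xi / ?c))^2)" using gi by (simp add: norm_divide power_divide)
 qed auto
 \<comment> \<open>The Hermitian part of the recovered density, which lies in \<open>L2H\<close>.
   That nothing is lost is seen below on real test functions, where the pairing is real.\<close>
 define G where "G xi = (1/2) *R (g xi / ?c + cnj (g (- xi)) / ?c)" for xi
 have gr: "integrable lborel (%xi. (norm (cnj (g (- xi)) / ?c))^2)"
  using gi lborel_integrable_reflect_iff[of "%xi. (norm (g xi))^2"] by (simp add: norm_divide power_divide)
 have [measurable]: "(%xi. cnj (g (- xi)) / ?c) \<in> borel_measurable borel" by measurable
 have "integrable lborel (%xi. (norm (g xi / ?c + cnj (g (- xi)) / ?c))^2)"
  by (rule square_integrable_add[OF _ _ _ gr]) (use gi in "auto simp: norm_divide power_divide")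
 then have G: "G \<in> L2H" by (auto simp: L2H_def G_def[abs_def] norm_divide power_divide add.commute)
 have fr: "integrable lborel (%xi. cnj (f (- xi)))"
  using fi lborel_integrable_reflect_iff[of f] by (simp add: Bochner_Integration.integrable_bound)
 have fld: "fld sg t (mk G) x = bracket x powr (- t) * Re (osc f x)" for x
 proof -
  have "osc (%xi. cor (bracket xi powr (- sg)) * rp (mk G) xi) x = osc (%xi. (1/2) * (f xi + cnj (f (- xi)))) x"
  proof (rule osc_cong_AE)
   show "AE xi in lborel. cor (bracket xi powr (- sg)) * rp (mk G) xi = (1/2) * (f xi + cnj (f (- xi)))"
    using rp_mk[OF G] by eventually_elim (simp add: G_def f_def scaleR_conv_of_real algebra_simps)
  qed measurable
  also have "... = (1/2) * (osc f x + cnj (osc f x))"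
   unfolding osc_cmult osc_add[OF fi fr] osc_cnj osc_uminus by simp
  also have "... = cor (Re (osc f x))" by (simp add: complex_eq_iff)
  finally show ?thesis by (simp add: fld_def ev_def)
 qed
 have main: "pairing T psi = (LINT x|lborel. osc f x * (cor (bracket x powr (- t)) * psi x))" if S: "schwartz psi" for psi
 proof -
  define \<omega> where "\<omega> x = cor (bracket x powr (- t)) * psi x" for x
  define \<theta> where "\<theta> xi = (1 / ?c) * osc \<omega> xi" for xi
  define ph where "ph xi = cor (bracket xi powr (- sg)) * \<theta> xi" for xi
  have S\<omega>: "schwartz \<omega>" unfolding \<omega>_def by (rule schwartz_bracket_powr[OF S])
  have S\<theta>: "schwartz \<theta>" unfolding \<theta>_def by (rule schwartz_cmult[OF schwartz_osc[OF S\<omega>]])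
  have Sph: "schwartz ph" unfolding ph_def by (rule schwartz_bracket_powr[OF S\<theta>])
  have "(%xi. cor (bracket xi powr sg) * ph xi) = \<theta>"
   unfolding ph_def bracket_powr_cancel_complex ..
  moreover have "fourier \<theta> = \<omega>"
   unfolding \<theta>_def fourier_osc[abs_def] osc_cmult osc_osc[OF S\<omega>] using c by simp
  moreover have "(%x. cor (bracket x powr t) * \<omega> x) = psi"
   unfolding \<omega>_def bracket_powr_cancel_complex ..
  ultimately have "dist_weight sg (dist_fourier (dist_weight t (pairing T))) ph = pairing T psi"
   using Sph S\<theta> S\<omega> by (simp add: dist_weight_def dist_fourier_def)
  then have "pairing T psi = (LINT xi|lborel. g xi * ph xi)"
   using g Sph by (simp add: L2_representative_def represents_def)
  also have "... = (LINT xi|lborel. f xi * osc \<omega> xi)" by (simp add: ph_def \<theta>_def f_def mult_ac)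
  also have "... = (LINT x|lborel. osc f x * \<omega> x)"
   by (rule osc_swap[OF fi schwartz_integrable[OF S\<omega>], symmetric])
  finally show ?thesis unfolding \<omega>_def .
 qed
 have tT: "tempered (pairing T)" using pairing[of T] by simp
 \<comment> \<open>On real test functions the pairing equals its real part, to which only the
   Hermitian part of the density contributes; complex test functions follow by linearity.\<close>
 have real: "pairing T psi = int_functional (fld sg t (mk G)) psi" if S: "schwartz psi" and r: "!!x. psi x = cor (r x)" for psi r
 proof -
  have "range psi \<subseteq> \<real>" using r by auto
  then have "pairing T psi \<in> \<real>" using re S by (simp add: real_distribution_def)
  then have "pairing T psi = cor (Re (pairing T psi))" by (metis Reals_cases Re_complex_of_real)
  also have "Re (pairing T psi) = (LINT x|lborel. fld sg t (mk G) x * r x)"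
  proof -
   have m: "osc f \<in> borel_measurable borel" by (rule borel_measurable_continuous_onI[OF osc_continuous[OF fi]])
   have "integrable lborel (%x. osc f x * (cor (bracket x powr (- t)) * psi x))"
   proof (rule Bochner_Integration.integrable_bound[OF integrable_mult_right[OF schwartz_integrable[OF schwartz_bracket_powr[OF S]], of "cor (LINT xi|lborel. norm (f xi))" "- t"]])
    show "(%x. osc f x * (cor (bracket x powr (- t)) * psi x)) \<in> borel_measurable lborel" using m schwartz_measurable[OF S] by simp
    show "AE x in lborel. norm (osc f x * (cor (bracket x powr (- t)) * psi x)) <= norm (cor (LINT xi|lborel. norm (f xi)) * (cor (bracket x powr (- t)) * psi x))"
     unfolding norm_mult using osc_bound[OF fi] by (intro always_eventually allI mult_right_mono) (auto intro: order_trans[OF _ abs_ge_self])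
   qed
   from integral_Re[OF this] show ?thesis unfolding main[OF S] fld by (simp add: r mult_ac)
  qed
  also have "cor ... = int_functional (fld sg t (mk G)) psi"
   using S by (simp add: int_functional_def r flip: integral_complex_of_real)
  finally show ?thesis .
 qed
 have "pairing T psi = int_functional (fld sg t (mk G)) psi" for psi
 proof (cases "schwartz psi")
  case True
  note S = schwartz_re_im[OF True]
  let ?I = "int_functional (fld sg t (mk G))"
  have d: "psi = (%x. cor (Re (psi x)) + \<i> * cor (Im (psi x)))" by (simp add: fun_eq_iff complex_eq_iff)
  have lin: "P psi = P (%x. cor (Re (psi x))) + \<i> * P (%x. cor (Im (psi x)))" if "tempered P" for P
   using that S schwartz_cmult[OF S(2), of \<i>] unfolding tempered_def by (subst d) simp
  show ?thesis unfolding lin[OF tT] lin[OF tempered_int_functional[OF nice_fld]] using real[OF S(1)] real[OF S(2)] by simp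
 next
  case False
  then show ?thesis using tT by (simp add: int_functional_def tempered_def)
 qed
 then have "T = dist_of sg t (mk G)" by (simp add: pairing_inject[symmetric] pairing_dist_of fun_eq_iff)
 then show ?thesis by blast
qed

lemma dist_of_linear:
 "dist_of sg t (F + G) = dist_of sg t F + dist_of sg t (G :: 'n l2)" "dist_of sg t (r *R F) = r *R dist_of sg t F"
proof -
 have "int_functional (fld sg t (F + G)) ph = int_functional (fld sg t F) ph + int_functional (fld sg t G) ph" for ph
  by (auto simp: int_functional_def fld_add[OF sg] distrib_right nice_integrable[OF nice_fld])
 then show "dist_of sg t (F + G) = dist_of sg t F + dist_of sg t G"
  by (simp add: pairing_inject[symmetric] plus_tdist.rep_eq pairing_dist_of fun_eq_iff)
 have "int_functional (fld sg t (r *R F)) ph = r *R int_functional (fld sg t F) ph" for ph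
  by (auto simp: int_functional_def fld_scaleR scaleR_conv_of_real mult.assoc)
 then show "dist_of sg t (r *R F) = r *R dist_of sg t F"
  by (simp add: pairing_inject[symmetric] scaleR_tdist.rep_eq pairing_dist_of fun_eq_iff)
qed

end

section \<open>The theorem\<close>

lemma pderivative_matrix:
 fixes f :: "'n::finite => 'n => real^'n => real"
 assumes "!!i j x. f i j differentiable (at x)"
 shows "pd l (%x. C + (\<chi> i j. f i j x)) = (%x. 0 + (\<chi> i j. pd l (f i j) x))" and "(%x. C + (\<chi> i j. f i j x)) differentiable (at x)"
proof -
 show d: "(%x. C + (\<chi> i j. f i j x)) differentiable (at x)" for x
  by (rule differentiable_matrixI) (simp add: assms)
 have "pd l (%x. C $ i $ j + f i j x) x = pd l (f i j) x" for i j x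
  using pderivative_add[where f = "%_. C $ i $ j", OF differentiable_const assms, of l i j] by (simp add: pderivative_const)
 then show "pd l (%x. C + (\<chi> i j. f i j x)) = (%x. 0 + (\<chi> i j. pd l (f i j) x))"
  using pderivative_component(1)[OF d, of l] by (simp add: fun_eq_iff vec_eq_iff)
qed

context einstein
begin

lemma continuous_f: "continuous_on UNIV (f2 F)" "continuous_on UNIV (f1 F)" "continuous_on UNIV (f0 F)"
 using nice_fld[OF orders(3) t] nice_fld[OF orders(2) t] nice_fld[OF orders(1) t] unfolding nice_def by blast+

text \<open>Two derivatives of a field of order s + 2 form a field of order s, which is continuous
  because s > n/2.\<close>

lemma class_C2_metric:
 fixes H :: "'n tensor2"
 shows "class_C 2 (%x. mat 1 + (\<chi> i j. f2 (H $ i $ j) x))"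
proof -
 note p = pderivative_matrix[where f = "fields2 H", OF differentiable_f(2)]
 have p': "pd m (%x. C + (\<chi> i j. pd l (fields2 H i j) x)) = (%x. 0 + (\<chi> i j. pd m (pd l (fields2 H i j)) x))"
  "(%x. C + (\<chi> i j. pd l (fields2 H i j) x)) differentiable (at x)" for C l m x
  by (rule pderivative_matrix, rule differentiable_f(3))+
 have "pd l (f2 F) = f1 (D1 l F)" "pd m (f1 (D1 l F)) = f0 (D0 m (D1 l F))" for l m F by (simp_all add: fld_op)
 then have c: "continuous_on UNIV (f2 F)" "continuous_on UNIV (pd l (f2 F))" "continuous_on UNIV (pd m (pd l (f2 F)))" for l m F
  using continuous_f by auto
 show ?thesis
  unfolding class_C_def
 proof (intro conjI allI impI)
  fix ls :: "'n list" assume "length ls <= 2"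
  then consider "ls = []" | l where "ls = [l]" | m l where "ls = [m, l]"
   by (cases ls; cases "tl ls"; cases "tl (tl ls)") auto
  then show "continuous_on UNIV (pderivatives ls (%x. mat 1 + (\<chi> i j. f2 (H $ i $ j) x)))"
   by cases (simp_all only: pderivatives_Cons pderivatives_Nil p p', auto intro!: continuous_intros c)
 next
  fix ls :: "'n list" and x assume "length ls < 2"
  then consider "ls = []" | l where "ls = [l]" by (cases ls; cases "tl ls") auto
  then show "pderivatives ls (%x. mat 1 + (\<chi> i j. f2 (H $ i $ j) x)) differentiable (at x)"
   by cases (simp_all only: pderivatives_Cons pderivatives_Nil p p')
 qed
qed

lemma f2_bound: "\<bar>f2 F x\<bar> <= sob_const TYPE('n) (s + 2) * norm F"
proof -
 have "bracket x powr (- t) <= bracket x powr 0" by (rule powr_mono) (use t bracket_ge1 in auto)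
 then have "\<bar>f2 F x\<bar> <= 1 * \<bar>ev (s + 2) F x\<bar>" unfolding fld_def abs_mult using bracket_pos[of x] by (intro mult_right_mono) auto
 then show ?thesis using sob_bound[OF orders(3) sob_ev[OF orders(3)], of F x] by linarith
qed

text \<open>The entries of the perturbation are bounded by \<open>sob_const\<close> times the norm
  of \<open>H\<close>, so its quadratic form is at most n^2 times this bound, hence less than that
  of the flat metric.\<close>

lemma riemannian_metric_small:
 assumes H: "symmetric2 H" and small: "n * n * (sob_const TYPE('n) (s + 2) * norm H) < 1"
 shows "riemannian_metric (%x. flat_metric x + (\<chi> i j. f2 (H $ i $ j) x))"
proof -
 let ?M = "sob_const TYPE('n) (s + 2) * norm H"
 let ?h = "%x. (\<chi> i j. f2 (H $ i $ j) x) :: real^'n^'n"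
 have M: "\<bar>f2 (H $ i $ j) x\<bar> <= ?M" for i j x
  using f2_bound[of "H $ i $ j" x] Finite_Cartesian_Product.norm_nth_le[of "H $ i" j] Finite_Cartesian_Product.norm_nth_le[of H i]
  by (meson mult_left_mono order_trans sob_const_nonneg)
 have "0 < v \<bullet> ((mat 1 + ?h x) *v v)" if v: "v ~= 0" for x v
 proof -
  have "\<bar>v \<bullet> (?h x *v v)\<bar> <= (\<Sum>i\<in>(UNIV::'n set). \<Sum>j\<in>(UNIV::'n set). ?M * (norm v)^2)"
   unfolding inner_vec_def matrix_vector_mult_def inner_real_def sum_distrib_left vec_lambda_beta
  proof (intro order_trans[OF sum_abs] sum_mono)
   fix i j
   have "\<bar>v $ i * (f2 (H $ i $ j) x * v $ j)\<bar> = \<bar>f2 (H $ i $ j) x\<bar> * (\<bar>v $ i\<bar> * \<bar>v $ j\<bar>)" by (simp add: abs_mult)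
   also have "... <= ?M * (norm v * norm v)"
    by (intro mult_mono M component_le_norm_cart mult_nonneg_nonneg sob_const_nonneg) auto
   finally show "\<bar>v $ i * (f2 (H $ i $ j) x * v $ j)\<bar> <= ?M * (norm v)^2" by (simp add: power2_eq_square)
  qed
  also have "... = (n * n * ?M) * (norm v)^2" by (simp add: n)
  also have "... < 1 * (norm v)^2" using small v by (intro mult_strict_right_mono) auto
  finally show ?thesis by (simp add: matrix_vector_mult_add_rdistrib inner_add_right power2_norm_eq_inner)
 qed
 moreover have "transpose (mat 1 + ?h x) = mat 1 + ?h x" for x
  using H by (simp add: transpose_def vec_eq_iff mat_def)
 ultimately show ?thesis unfolding riemannian_metric_def flat_metric_def using class_C2_metric[of H] by blast
qed

section \<open>Transport of the solution map to spaces of distributions\<close>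

abbreviation "E_space == wsobolev_sym2 (s + 2) t :: 'n dist_tensor set"
abbreviation "N == wsobolev_sym2_norm (s + 2) t :: 'n dist_tensor => real"
definition "c0 = (gauss_int ty)^2"

text \<open>\<open>J\<close> carries the symmetric parameters bijectively onto
  \<open>E_space\<close> and multiplies norms by \<open>c0\<close>; \<open>K\<close> is its inverse
  there. Smoothness is transported through this pair.\<close>

definition J :: "'n tensor2 => 'n dist_tensor" where "J E = (\<chi> i j. dist_of (s + 2) t (E $ i $ j))"
definition K :: "'n dist_tensor => 'n tensor2" where "K u = (SOME E. symmetric2 E & J E = u)"

lemma linear_J: "linear J"
 by (rule linearI) (simp_all add: J_def vec_eq_iff dist_of_linear[OF orders(3) t])

lemma c0: "0 < c0" and c0_eq: "(gauss_int TYPE('n))^2 = c0"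
 using gauss_int_pos[where 'n='n] by (simp_all add: c0_def gauss_int_def)

lemma N_J: "N (J E) = c0 * norm E"
proof -
 have "(norm E)^2 = (\<Sum>i\<in>UNIV. \<Sum>j\<in>UNIV. (norm (E $ i $ j))^2)"
  by (simp add: norm_vec_def L2_set_def sum_nonneg)
 then have "(\<Sum>i\<in>UNIV. \<Sum>j\<in>UNIV. (c0 * norm (E $ i $ j))^2) = (c0 * norm E)^2"
  by (simp add: power_mult_distrib sum_distrib_left)
 then show ?thesis unfolding wsobolev_sym2_norm_def J_def using c0
  by (simp add: wsobolev_norm_dist_of[OF orders(3) t, unfolded c0_eq])
qed

lemma J_mem: "symmetric2 E ==> J E \<in> E_space"
 unfolding wsobolev_sym2_def J_def
 by (simp add: wsobolev_dist_of[OF orders(3) t] real_dist_of[OF orders(3) t])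

lemma J_inject: assumes "J E = J F" shows "E = F"
proof -
 have "c0 * norm (E - F) = N (J (E - F))" by (simp add: N_J)
 also have "J (E - F) = J 0" by (simp add: linear_diff[OF linear_J] linear_0[OF linear_J] assms)
 finally show ?thesis using c0 by (simp add: N_J)
qed

lemma K: assumes "u \<in> E_space" shows "symmetric2 (K u)" "J (K u) = u"
proof -
 have "\<exists>F. u $ i $ j = dist_of (s + 2) t F" for i j
  using assms unfolding wsobolev_sym2_def by (intro dist_of_surj[OF orders(3) t]) auto
 then obtain f where f: "!!i j. u $ i $ j = dist_of (s + 2) t (f i j)" by metis
 have JE: "J (\<chi> i j. f i j) = u" by (simp add: J_def vec_eq_iff f)
 have "J (\<chi> i j. f j i) = J (\<chi> i j. f i j)"
  using assms unfolding JE wsobolev_sym2_def by (simp add: J_def vec_eq_iff f[symmetric])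
 then have "(\<chi> i j. f j i) = (\<chi> i j. f i j)" by (rule J_inject)
 then have "symmetric2 (\<chi> i j. f i j)" by (simp add: vec_eq_iff)
 then have "\<exists>E. symmetric2 E & J E = u" using JE by blast
 from someI_ex[OF this] show "symmetric2 (K u)" "J (K u) = u" unfolding K_def by auto
qed

lemma E_space_closed: "u \<in> E_space ==> v \<in> E_space ==> x *R u + y *R v \<in> E_space & K (x *R u + y *R v) = x *R K u + y *R K v"
proof -
 assume u: "u \<in> E_space" and v: "v \<in> E_space"
 have e: "x *R u + y *R v = J (x *R K u + y *R K v)" by (simp add: linear_add[OF linear_J] linear_cmul[OF linear_J] K u v)
 have m: "J (x *R K u + y *R K v) \<in> E_space" by (rule J_mem) (use K(1)[OF u] K(1)[OF v] in simp)
 show ?thesis unfolding e using m J_inject[OF K(2)[OF m]] by blast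
qed

lemma N_K: "u \<in> E_space ==> N u = c0 * norm (K u)" using N_J[of "K u"] K(2) by simp

lemma K_zero: "(0 :: 'n dist_tensor) \<in> E_space" "K 0 = 0"
proof -
 have z: "J 0 = 0" by (rule linear_0[OF linear_J])
 show m: "(0 :: 'n dist_tensor) \<in> E_space" using J_mem[of 0] z by simp
 show "K 0 = 0" by (rule J_inject) (simp add: K(2)[OF m] z)
qed

lemma K_diff: assumes "u \<in> E_space" "v \<in> E_space" shows "u - v \<in> E_space" "K (u - v) = K u - K v"
 using E_space_closed[OF assms, of 1 "-1"] by simp_all

lemma K_add: assumes "u \<in> E_space" "v \<in> E_space" shows "u + v \<in> E_space" "K (u + v) = K u + K v"
 using E_space_closed[OF assms, of 1 1] by simp_all

text \<open>The derivatives of the solution map must take values in \<open>E_space\<close>, which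
  contains symmetric tensors only. Composition with this linear projection gives that for all
  \<open>q.D\<close> at once and leaves a symmetric \<open>h\<close> unchanged by
  \<open>symm_eq\<close>.\<close>

definition symm :: "'n unknowns => 'n tensor2" where "symm x = (\<chi> i j. (1/2) *R (fst x $ i $ j + fst x $ j $ i))"

lemma symm_bl: "bounded_linear symm" unfolding symm_def[abs_def] by (intro bl_intros)

lemma symm_sym: "symmetric2 (symm x)" by (simp add: symm_def add.commute)

lemma symm_eq: "symmetric2 (fst x) ==> symm x = fst x"
 by (simp add: symm_def vec_eq_iff scaleR_2[symmetric])

definition "Dmap u vs = J (symm (q.D (K u) (map K vs)))"

lemma prod_norm_K: "vs \<in> lists E_space ==> prod_list (map norm (map K vs)) * c0 ^ length vs = prod_list (map N vs)"
 by (induction vs) (auto simp: N_K mult_ac)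

text \<open>The power of \<open>c0\<close> accounts for the rescaling of each direction between
  \<open>l2\<close> and \<open>E_space\<close>.\<close>

lemma N_Dmap_le:
 assumes "norm x <= C * prod_list (map norm (map K vs))" "vs \<in> lists E_space" "0 <= C"
 shows "N (J (symm x)) <= (c0 * (onorm symm * C) / c0 ^ length vs) * prod_list (map N vs)"
proof -
 have "N (J (symm x)) <= c0 * (onorm symm * (C * prod_list (map norm (map K vs))))"
  unfolding N_J using c0 onorm_pos_le[OF symm_bl] assms(1)
  by (intro mult_left_mono order_trans[OF onorm[OF symm_bl]]) auto
 also have "... = (c0 * (onorm symm * C) / c0 ^ length vs) * prod_list (map N vs)"
  using c0 unfolding prod_norm_K[OF assms(2), symmetric] by (simp add: mult_ac)
 finally show ?thesis .
qed

lemma smooth_Dmap: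
 assumes U: "U \<subseteq> E_space" "!!u. u \<in> U ==> norm (K u) < q.r"
 shows "smooth_map_on E_space N E_space N U (%u. J (symm (q.sol (K u))))"
 unfolding smooth_map_on_def
proof (intro exI[of _ Dmap] conjI ballI allI impI)
 fix u assume u: "u \<in> U"
 note r = U(2)[OF u]
 show "Dmap u [] = J (symm (q.sol (K u)))" by (simp add: Dmap_def)
 fix k
 show "bounded_multilinear_on E_space N E_space N k (Dmap u)"
  unfolding bounded_multilinear_on_def
 proof (intro conjI ballI allI impI)
  show "Dmap u vs \<in> E_space" for vs unfolding Dmap_def by (rule J_mem[OF symm_sym])
  fix xs ys v w x y assume "v \<in> E_space" "w \<in> E_space"
  then show "Dmap u (xs @ (x *R v + y *R w) # ys) = x *R Dmap u (xs @ v # ys) + y *R Dmap u (xs @ w # ys)"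
   by (simp add: Dmap_def E_space_closed q.D_multilinear[OF r] linear_add[OF bounded_linear.linear[OF symm_bl]] linear_cmul[OF bounded_linear.linear[OF symm_bl]]
     linear_add[OF linear_J] linear_cmul[OF linear_J])
 next
  obtain C where C: "0 <= C" "!!vs. length vs <= k ==> norm (q.D (K u) vs) <= C * prod_list (map norm vs)"
   using q.D_bounded[of k] r by blast
  have "N (Dmap u vs) <= (c0 * (onorm symm * C) / c0 ^ k) * prod_list (map N vs)" if "vs \<in> lists E_space" "length vs = k" for vs
   unfolding Dmap_def using N_Dmap_le[OF C(2) that(1) C(1)] that(2) by simp
  then show "\<exists>C. \<forall>vs\<in>lists E_space. length vs = k --> N (Dmap u vs) <= C * prod_list (map N vs)" by blast
 qed
 fix ep :: real assume ep: "0 < ep"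
 obtain C where C: "0 <= C" "!!e v vs. norm e < q.r ==> norm (e + v) < q.r ==> length vs <= k ==>
   norm (q.D (e + v) vs - q.D e vs - q.D e (v # vs)) <= C * (norm v)^2 * prod_list (map norm vs)"
  using q.D_remainder[of k] by blast
 \<comment> \<open>The remainder is at most \<open>A * N v * N v\<close> times the norms of the
   directions; the factor \<open>c0^2\<close> belongs to the two powers of \<open>N v\<close>. The
   radius \<open>ep / (A + 1)\<close> avoids division by 0.\<close>
 define A where "A = c0 * (onorm symm * C) / c0 ^ k / c0^2"
 have A: "0 <= A" using C c0 onorm_pos_le[OF symm_bl] by (simp add: A_def)
 show "\<exists>d>0. \<forall>v\<in>E_space. N v < d & u + v \<in> U --> (\<forall>vs\<in>lists E_space. length vs = k -->
   N (Dmap (u + v) vs - Dmap u vs - Dmap u (v # vs)) <= ep * N v * prod_list (map N vs))"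
 proof (intro exI[of _ "ep / (A + 1)"] conjI ballI impI)
  show "0 < ep / (A + 1)" using ep A by simp
  fix v vs assume v: "v \<in> E_space" and small: "N v < ep / (A + 1) & u + v \<in> U" and vs: "vs \<in> lists E_space" "length vs = k"
  have uE: "u \<in> E_space" using u U by blast
  let ?rh = "q.D (K u + K v) (map K vs) - q.D (K u) (map K vs) - q.D (K u) (K v # map K vs)"
  have "norm (K u + K v) < q.r" using U(2)[of "u + v"] small K_add(2)[OF uE v] by simp
  then have "norm ?rh <= (C * (norm (K v))^2) * prod_list (map norm (map K vs))" using C(2)[OF r, of "K v" "map K vs"] vs by simp
  then have "N (J (symm ?rh)) <= (c0 * (onorm symm * (C * (norm (K v))^2)) / c0 ^ k) * prod_list (map N vs)"
   using N_Dmap_le[OF _ vs(1), of ?rh] vs(2) C(1) by simp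
  also have "... = (A * N v) * N v * prod_list (map N vs)"
   using c0 by (simp add: A_def N_K[OF v] power2_eq_square field_simps)
  also have "... <= ep * N v * prod_list (map N vs)"
  proof -
   have nn: "0 <= N w" if "w \<in> E_space" for w using N_K[OF that] c0 by simp
   have p: "0 <= prod_list (map N vs)" using vs(1) nn by (induction vs) auto
   have "A * N v <= (A + 1) * N v" using nn[OF v] by (intro mult_right_mono) auto
   also have "... <= ep" using small A by (simp add: pos_less_divide_eq mult.commute less_imp_le)
   finally show ?thesis using p nn[OF v] by (intro mult_right_mono) auto
  qed
  finally show "N (Dmap (u + v) vs - Dmap u vs - Dmap u (v # vs)) <= ep * N v * prod_list (map N vs)"
   by (simp add: Dmap_def K_add[OF uE v] linear_diff[OF bounded_linear.linear[OF symm_bl]] linear_diff[OF linear_J])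
 qed
qed

theorem Einstein_perturbation:
 assumes V: "nhd_on E_space N 0 V"
 shows "\<exists>U h. open_on E_space N U & 0 \<in> U & h \<in> U \<rightarrow> V & smooth_map_on E_space N E_space N U h &
   (\<forall>e\<in>U. \<exists>hf ef :: real^'n => real^'n^'n. tensor_represents hf (h e) & continuous_on UNIV ef & tensor_represents ef e &
     riemannian_metric (%x. flat_metric x + hf x) &
     (\<forall>x. Ein \<kappa> \<Lambda> (%x. flat_metric x + hf x) x = Ein \<kappa> \<Lambda> flat_metric x + ef x))"
proof -
 obtain rV where rV: "0 < rV" "!!y. y \<in> E_space ==> N y < rV ==> y \<in> V" using V unfolding nhd_on_def by auto
 obtain et where et: "0 < et" "!!E. symmetric2 E ==> norm E < et ==> norm E < q.r & symmetric2 (fst (q.sol E)) &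
   (\<forall>x. Ein \<kappa> \<Lambda> (%x. flat_metric x + (\<chi> i j. f2 (fst (q.sol E) $ i $ j) x)) x = Ein \<kappa> \<Lambda> flat_metric x + (\<chi> i j. f2 (E $ i $ j) x))"
  using Einstein_solution by blast
 let ?l = "2 * onorm L + 1"
 have l: "0 < ?l" using onorm_pos_le[OF L_bl] by simp
 let ?S = "n * n * sob_const TYPE('n) (s + 2) + 1"
 have S: "0 < ?S" using sob_const_nonneg[where 'n='n] n by (simp add: add_nonneg_pos)
 \<comment> \<open>The three bounds secure, in turn, a solution with vanishing gauge term, values in
   \<open>V\<close>, and positivity of the metric. The number \<open>?l\<close> bounds the solution
   by a multiple of the source and is made positive by the added 1.\<close>
 define rh where "rh = min et (min (rV / (c0 * ?l)) (1 / (?S * ?l)))"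
 have rh: "0 < rh" using et rV c0 l S by (simp add: rh_def)
 define U where "U = {u \<in> E_space. norm (K u) < rh}"
 let ?h = "%u. J (symm (q.sol (K u)))"
 have props: "norm E < q.r" "symm (q.sol E) = fst (q.sol E)" "symmetric2 (fst (q.sol E))" "c0 * norm (fst (q.sol E)) < rV" "n * n * (sob_const TYPE('n) (s + 2) * norm (fst (q.sol E))) < 1"
  if E: "symmetric2 E" "norm E < rh" for E
 proof -
  have "norm E < et" using E by (simp add: rh_def)
  note * = et(2)[OF E(1) this]
  show r: "norm E < q.r" and sy: "symmetric2 (fst (q.sol E))" using * by auto
  show "symm (q.sol E) = fst (q.sol E)" by (rule symm_eq[OF sy])
  have "norm (fst (q.sol E)) <= norm (q.sol E)" by (metis norm_fst_le prod.collapse)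
  also have "... <= 2 * onorm L * norm E" by (rule q.sol_bound[OF r])
  also have "... <= ?l * norm E" by (intro mult_right_mono) auto
  finally have b: "norm (fst (q.sol E)) <= ?l * norm E" .
  have "c0 * norm (fst (q.sol E)) <= c0 * (?l * norm E)" using b c0 by (intro mult_left_mono) auto
  also have "... < rV" using E c0 l by (simp add: rh_def pos_less_divide_eq mult_ac)
  finally show "c0 * norm (fst (q.sol E)) < rV" .
  have "n * n * (sob_const TYPE('n) (s + 2) * norm (fst (q.sol E))) <= ?S * norm (fst (q.sol E))" by (simp add: algebra_simps)
  also have "... <= ?S * (?l * norm E)" using b S by (intro mult_left_mono) auto
  also have "... < 1" using E S l by (simp add: rh_def pos_less_divide_eq mult_ac)
  finally show "n * n * (sob_const TYPE('n) (s + 2) * norm (fst (q.sol E))) < 1" .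
 qed
 have "open_on E_space N U"
  unfolding open_on_def nhd_on_def
 proof (intro ballI conjI)
  fix u assume u: "u \<in> U"
  then show "u \<in> U" "U \<subseteq> E_space" by (auto simp: U_def)
  have uE: "u \<in> E_space" using u by (simp add: U_def)
  show "\<exists>r>0. \<forall>y\<in>E_space. N (y - u) < r --> y \<in> U"
  proof (intro exI[of _ "c0 * (rh - norm (K u))"] conjI ballI impI)
   show "0 < c0 * (rh - norm (K u))" using u c0 by (simp add: U_def)
   fix y assume y: "y \<in> E_space" "N (y - u) < c0 * (rh - norm (K u))"
   then have "norm (K y - K u) < rh - norm (K u)" using N_K[OF K_diff(1)[OF y(1) uE]] K_diff(2)[OF y(1) uE] c0 by simp
   then show "y \<in> U" using y(1) norm_triangle_ineq[of "K y - K u" "K u"] by (simp add: U_def)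
  qed
 qed
 moreover have "0 \<in> U" using rh by (simp add: U_def K_zero)
 moreover have "?h \<in> U \<rightarrow> V"
  using props(2-4) K(1) by (auto simp: U_def N_J intro!: rV(2) J_mem)
 moreover have "smooth_map_on E_space N E_space N U ?h"
  by (rule smooth_Dmap) (use props(1) K(1) in "auto simp: U_def")
 moreover have "\<exists>hf ef :: real^'n => real^'n^'n. tensor_represents hf (?h e) & continuous_on UNIV ef & tensor_represents ef e &
     riemannian_metric (%x. flat_metric x + hf x) & (\<forall>x. Ein \<kappa> \<Lambda> (%x. flat_metric x + hf x) x = Ein \<kappa> \<Lambda> flat_metric x + ef x)"
  if e: "e \<in> U" for e
 proof -
  have eE: "e \<in> E_space" and En: "norm (K e) < rh" using e by (auto simp: U_def)
  have E: "symmetric2 (K e)" by (rule K(1)[OF eE])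
  note p = props[OF E En]
  let ?field = "%E x. (\<chi> i j. f2 (E $ i $ j) x) :: real^'n^'n"
  have rep: "tensor_represents (?field E) (J E)" for E
   unfolding tensor_represents_def J_def by (simp add: represents_dist_of[OF orders(3) t])
  have "tensor_represents (?field (fst (q.sol (K e)))) (?h e)" unfolding p(2) by (rule rep)
  moreover have "tensor_represents (?field (K e)) e" using rep[of "K e"] K(2)[OF eE] by simp
  moreover have "continuous_on UNIV (?field (K e))" by (intro continuous_intros continuous_f)
  moreover have "riemannian_metric (%x. flat_metric x + ?field (fst (q.sol (K e))) x)" by (rule riemannian_metric_small[OF p(3,5)])
  moreover have "norm (K e) < et" using En by (simp add: rh_def)
  ultimately show ?thesis using et(2)[OF E] by blast
 qed
 ultimately show ?thesis by (intro exI[of _ U] exI[of _ ?h]) blast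
qed

end

theorem mainTheorem1:
  fixes s t \<kappa> \<Lambda> :: real
    and V :: "('n::finite) dist_tensor set"
  assumes "CARD('n) \<ge> 2"
    and "s > real CARD('n) / 2"
    and "t \<ge> 0"
    and "\<kappa> > - 1 / (2 * (real CARD('n) - 1))"
    and "\<Lambda> > 0"
    and "nhd_on (wsobolev_sym2 (s + 2) t) (wsobolev_sym2_norm (s + 2) t) 0 V"
  shows "\<exists>(U :: 'n dist_tensor set) (h :: 'n dist_tensor \<Rightarrow> 'n dist_tensor).
      open_on (wsobolev_sym2 (s + 2) t) (wsobolev_sym2_norm (s + 2) t) U \<and> 0 \<in> U \<and>
      h \<in> U \<rightarrow> V \<and>
      smooth_map_on (wsobolev_sym2 (s + 2) t) (wsobolev_sym2_norm (s + 2) t)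
        (wsobolev_sym2 (s + 2) t) (wsobolev_sym2_norm (s + 2) t) U h \<and>
      (\<forall>e\<in>U. \<exists>hf ef :: real^'n \<Rightarrow> real^'n^'n.
         tensor_represents hf (h e) \<and>
         continuous_on UNIV ef \<and> tensor_represents ef e \<and>
         riemannian_metric (\<lambda>x. flat_metric x + hf x) \<and>
         (\<forall>x. Ein \<kappa> \<Lambda> (\<lambda>x. flat_metric x + hf x) x = Ein \<kappa> \<Lambda> flat_metric x + ef x))"
proof -
 interpret einstein "TYPE('n)" "real CARD('n)" s t \<kappa> \<Lambda>
  by unfold_locales (use assms in auto)
 show ?thesis by (rule Einstein_perturbation[OF assms(6)])
qed

end
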